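(* Let $(X,V)$ be a directed projective manifold, and let $Z_1,\dots,Z_q$ be closed subschemes of $X$. Let $f\colon(\mathbb{C},T_{\mathbb{C}})\to(X,V)$ be a non-constant holomorphic curve such that $f(\mathbb{C})\not\subset\operatorname{Supp}(Z_1+\dots+Z_q)$. For any linear system $\mathfrak{S}\subset|L|$ on $X$ such that $\mathfrak{S}$ separates $1$-jets at every point of $X$ and $\mathcal{I}_{Z_i}=\mathfrak{s}_{\supset Z_i}$ for each $1\le i\le q$, there exists a constant $c>0$ such that the inequality $$\varepsilon\,\mathcal{N}\Big(\exp\big(2(1-\varepsilon)\max_{1\le i\le q}\lambda_{Z_i}\circ f-2\max_{1\le i\le q}\lambda_{Z_i^{(1)}}\circ f_{[1]}\big)\,f^{*}dd^c\varphi_{\mathfrak S},\,r\Big)\le c\,T_f(r,L)+O(1)$$ holds for any $0<\varepsilon<1$.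
   Context: A directed projective manifold $(X,V)$ is a connected complex projective manifold $X$ with a holomorphic subbundle $V\subset T_X$. A holomorphic curve $f\colon(\mathbb{C},T_{\mathbb{C}})\to(X,V)$ is a holomorphic map $f\colon\mathbb{C}\to X$ with $f'(z)\in V_{f(z)}$ for all $z$. $X_1=\mathrm{P}(V)$ is the bundle of lines in $V$, with projection $\pi_1\colon X_1\to X$. The lift $f_{[1]}\colon\mathbb{C}\to X_1$ of a non-constant $f$ is $f_{[1]}(z)=(f(z),[u(z)])$, where near each $z_0$ one writes $f'(z)=(z-z_0)^m u(z)$ with $u(z_0)\ne0$. Subschemes: $Z_1+Z_2$ is the closed subscheme with ideal sheaf $\mathcal{I}_{Z_1}\cdot\mathcal{I}_{Z_2}$. For a closed subscheme $Z\subset X$, the closed subscheme $Z^{(1)}\subset X_1=\mathrm{P}(V)$ is defined, over each affine open $U\subset X$ with $\mathcal{I}_Z(U)=(\zeta_1,\dots,\zeta_s)$, by the homogeneous ideal $(\zeta_1,\dots,\zeta_s,d\zeta_1,\dots,d\zeta_s)$, where $d\zeta_i$ is restricted to $V$ and viewed as a function linear on the fibres of $V$; these glue. Weil functions: for a closed subscheme $Y$ of a projective manifold $M$, a Weil function $\lambda_Y\colon M\setminus\operatorname{Supp}Y\to\mathbb{R}$ is a continuous function for which there are an affine Zariski open covering $\{U_\epsilon\}$ of $M$ and generators $g_1,\dots,g_{r_\epsilon}$ of $\mathcal{I}_Y(U_\epsilon)$ such that $|\lambda_Y+\log\max_i|g_i||$ is bounded on $U_\epsilon\setminus\operatorname{Supp}Y$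 by a continuous function on $U_\epsilon$. It is unique up to a bounded function. In the claim, $\lambda_{Z_i}$ and $\lambda_{Z_i^{(1)}}$ are chosen Weil functions for $Z_i\subset X$ and $Z_i^{(1)}\subset X_1$. Linear systems: $L$ is a holomorphic line bundle on $X$; a linear system $\mathfrak{S}\subset|L|$ corresponds to a linear subspace $\mathbb{S}\subset H^0(X,L)$. $\mathfrak{S}$ separates $1$-jets at $x$ if $\mathbb{S}\to L\otimes\mathcal{O}_{X,x}/\mathfrak{m}_{X,x}^2$ is surjective. $\mathfrak{S}_{\supset Z}=\{D\in\mathfrak{S}\mid Z\subset D\}$, and $\mathfrak{s}_{\supset Z}\subset\mathcal{O}_X$ is its base ideal, i.e. the image of the evaluation map of the corresponding space of sections, tensored with $L^{-1}$. With a basis $\varsigma_0,\dots,\varsigma_N$ of $\mathbb{S}$, $\varphi_{\mathfrak S}=\log\sum_i|\varsigma_i|^2$ (computed in local trivializations of $L$); $dd^c\varphi_{\mathfrak S}$ is a globally defined $(1,1)$-form. Nevanlinna notation: $dd^c=\frac{i}{2\pi}\partial\bar\partial$; $\mathcal{N}(\Phi,r)=\int_0^r\frac{dt}{t}\int_{\{|z|<t\}}\Phi$; $T_f(r,L)=\mathcal{N}(f^*dd^c\varphi,r)$ modulo bounded functions, where $\varphi$ is the local weight of a continuous Hermitian metric $\|\xi\|_h^2=|\xi|^2e^{-\varphi}$ on $L$. $O(1)$ denotes a bounded real-valued function of $r\in\mathbb{R}_{\ge0}$. *)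

theory Defs
  imports "HOL-Complex_Analysis.Complex_Analysis"
begin

section \<open>Spaces with functions\<close>

text \<open>Complex algebraic varieties are treated as sets of closed points with a Zariski topology and
  a sheaf of complex-valued regular functions. Functions are total; the members of
  \<open>regs S W\<close> are constrained on \<open>W\<close> only, so two of them that agree on \<open>W\<close> are the same section.\<close>

record 'a fspace =
  zopens :: "'a set set"
  regs :: "'a set \<Rightarrow> ('a \<Rightarrow> complex) set"

inductive_set alg_gen :: "('x \<Rightarrow> complex) set \<Rightarrow> ('x \<Rightarrow> complex) set"
  for G :: "('x \<Rightarrow> complex) set" where
  const: "(\<lambda>_. c) \<in> alg_gen G"
| gen: "g \<in> G \<Longrightarrow> g \<in> alg_gen G"
| add: "g \<in> alg_gen G \<Longrightarrow> h \<in> alg_gen G \<Longrightarrow> (\<lambda>x. g x + h x) \<in> alg_gen G"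
| mult: "g \<in> alg_gen G \<Longrightarrow> h \<in> alg_gen G \<Longrightarrow> (\<lambda>x. g x * h x) \<in> alg_gen G"

text \<open>Affine space of dimension \<open>m\<close> is modelled by the sequences that vanish from index \<open>m\<close> on, so
  that \<open>m\<close> can be quantified over.\<close>

definition affine_polys :: "nat \<Rightarrow> ((nat \<Rightarrow> complex) \<Rightarrow> complex) set" where
  "affine_polys m = alg_gen {(\<lambda>y. y i) |i. i < m}"

text \<open>\<open>H\<close> is an isomorphism of spaces with functions from the open subspace \<open>U\<close> onto a Zariski
  closed subset of affine space of dimension \<open>m\<close>: it is a bijection onto a closed set, it identifies
  the open subsets, and it identifies the regular functions.\<close>

definition affine_chart ::
    "'a fspace \<Rightarrow> 'a set \<Rightarrow> nat \<Rightarrow> ('a \<Rightarrow> nat \<Rightarrow> complex) \<Rightarrow> bool" where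
  "affine_chart S U m H \<longleftrightarrow>
     inj_on H U \<and>
     (\<exists>T \<subseteq> affine_polys m. H ` U = {y. (\<forall>i\<ge>m. y i = 0) \<and> (\<forall>p\<in>T. p y = 0)}) \<and>
     (\<forall>W \<subseteq> U. W \<in> zopens S \<longleftrightarrow>
        (\<exists>T \<subseteq> affine_polys m. W = {u \<in> U. \<exists>p\<in>T. p (H u) \<noteq> 0})) \<and>
     (\<forall>W \<subseteq> U. W \<in> zopens S \<longrightarrow>
        regs S W = {g. \<forall>w\<in>W. \<exists>p\<in>affine_polys m. \<exists>q\<in>affine_polys m.
          q (H w) \<noteq> 0 \<and> (\<forall>u\<in>W. q (H u) \<noteq> 0 \<longrightarrow> g u = p (H u) / q (H u))})"

definition affine_open :: "'a fspace \<Rightarrow> 'a set \<Rightarrow> bool" where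
  "affine_open S U \<longleftrightarrow> U \<in> zopens S \<and> (\<exists>m H. affine_chart S U m H)"

text \<open>The complex (Euclidean) topology of a variety: the coarsest one in which Zariski open sets are
  open and regular functions are continuous.\<close>

definition complex_topology :: "'a fspace \<Rightarrow> 'a topology" where
  "complex_topology S =
     topology_generated_by {{w \<in> W. g w \<in> B} |W g B. W \<in> zopens S \<and> g \<in> regs S W \<and> open B}"


section \<open>Closed subschemes and Weil functions\<close>

text \<open>A closed subscheme is given by its ideal sheaf \<open>I\<close>, a quasi-coherent sheaf of ideals of the
  sheaf of regular functions. Quasi-coherence says that \<open>I (D a)\<close> is the localization of \<open>I U\<close> at
  \<open>a\<close> for the basic open subset \<open>D a\<close> of an affine open \<open>U\<close>. Only the values of \<open>I\<close> at Zariski open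
  sets are meaningful.\<close>

definition ideal_sheaf :: "'a fspace \<Rightarrow> ('a set \<Rightarrow> ('a \<Rightarrow> complex) set) \<Rightarrow> bool" where
  "ideal_sheaf S I \<longleftrightarrow>
     (\<forall>W\<in>zopens S. I W \<subseteq> regs S W \<and> (\<lambda>_. 0) \<in> I W \<and>
        (\<forall>g\<in>I W. \<forall>h\<in>I W. (\<lambda>x. g x + h x) \<in> I W) \<and>
        (\<forall>a\<in>regs S W. \<forall>g\<in>I W. (\<lambda>x. a x * g x) \<in> I W)) \<and>
     (\<forall>W\<in>zopens S. \<forall>W'\<in>zopens S. W' \<subseteq> W \<longrightarrow> I W \<subseteq> I W') \<and>
     (\<forall>W\<in>zopens S. \<forall>g\<in>regs S W.
        (\<forall>w\<in>W. \<exists>W'\<in>zopens S. w \<in> W' \<and> W' \<subseteq> W \<and> (\<exists>g'\<in>I W'. \<forall>u\<in>W'. g u = g' u)) \<longrightarrow> g \<in> I W)"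

definition closed_subscheme :: "'a fspace \<Rightarrow> ('a set \<Rightarrow> ('a \<Rightarrow> complex) set) \<Rightarrow> bool" where
  "closed_subscheme S I \<longleftrightarrow> ideal_sheaf S I \<and>
     (\<forall>U a. affine_open S U \<and> a \<in> regs S U \<longrightarrow>
        I {u \<in> U. a u \<noteq> 0} =
          {g \<in> regs S {u \<in> U. a u \<noteq> 0}.
             \<exists>b\<in>I U. \<exists>n::nat. \<forall>u\<in>U. a u \<noteq> 0 \<longrightarrow> g u = b u / a u ^ n})"

definition Supp :: "'a fspace \<Rightarrow> ('a set \<Rightarrow> ('a \<Rightarrow> complex) set) \<Rightarrow> 'a set" where
  "Supp S I = {x \<in> \<Union>(zopens S). \<forall>W\<in>zopens S. x \<in> W \<longrightarrow> (\<forall>g\<in>I W. g x = 0)}"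

text \<open>\<open>I \<cdot> J\<close> as a sheaf: the sections that are locally finite sums of products.\<close>

definition ideal_product ::
    "'a fspace \<Rightarrow> ('a set \<Rightarrow> ('a \<Rightarrow> complex) set) \<Rightarrow> ('a set \<Rightarrow> ('a \<Rightarrow> complex) set)
      \<Rightarrow> 'a set \<Rightarrow> ('a \<Rightarrow> complex) set" where
  "ideal_product S I J W = {s \<in> regs S W. \<forall>w\<in>W. \<exists>W'\<in>zopens S. w \<in> W' \<and> W' \<subseteq> W \<and>
     (\<exists>(n::nat) a b. (\<forall>k<n. a k \<in> I W' \<and> b k \<in> J W') \<and>
        (\<forall>u\<in>W'. s u = (\<Sum>k<n. a k u * b k u)))}"

text \<open>The subscheme \<open>Z 1 + \<dots> + Z q\<close>; the empty sum is the empty subscheme (unit ideal).\<close>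

primrec subscheme_sum ::
    "'a fspace \<Rightarrow> (nat \<Rightarrow> 'a set \<Rightarrow> ('a \<Rightarrow> complex) set) \<Rightarrow> nat \<Rightarrow> 'a set \<Rightarrow> ('a \<Rightarrow> complex) set" where
  "subscheme_sum S Z 0 = regs S"
| "subscheme_sum S Z (Suc k) = ideal_product S (subscheme_sum S Z k) (Z (Suc k))"

definition generates ::
    "'a fspace \<Rightarrow> ('a set \<Rightarrow> ('a \<Rightarrow> complex) set) \<Rightarrow> 'a set \<Rightarrow> nat \<Rightarrow> (nat \<Rightarrow> 'a \<Rightarrow> complex) \<Rightarrow> bool" where
  "generates S I U r g \<longleftrightarrow> (\<forall>i<r. g i \<in> I U) \<and>
     (\<forall>s\<in>I U. \<exists>a. (\<forall>i<r. a i \<in> regs S U) \<and> (\<forall>u\<in>U. s u = (\<Sum>i<r. a i u * g i u)))"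

text \<open>The values of a Weil function on the support are irrelevant.\<close>

definition weil_function ::
    "'a fspace \<Rightarrow> ('a set \<Rightarrow> ('a \<Rightarrow> complex) set) \<Rightarrow> ('a \<Rightarrow> real) \<Rightarrow> bool" where
  "weil_function S I lam \<longleftrightarrow>
     continuous_map
       (subtopology (complex_topology S) (topspace (complex_topology S) - Supp S I)) euclideanreal lam \<and>
     (\<exists>\<U>. (\<forall>U\<in>\<U>. affine_open S U) \<and> \<Union>\<U> = \<Union>(zopens S) \<and>
        (\<forall>U\<in>\<U>. \<exists>r g C. 0 < r \<and> generates S I U r g \<and>
           continuous_map (subtopology (complex_topology S) U) euclideanreal C \<and>
           (\<forall>u \<in> U - Supp S I. \<bar>lam u + ln (Max ((\<lambda>i. cmod (g i u)) ` {..<r}))\<bar> \<le> C u)))"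


section \<open>Projective manifolds\<close>

text \<open>A point of projective space is a complex line through the origin of \<open>complex ^ 'n\<close>, that is, a
  set of vectors; hence for a set \<open>X\<close> of points, \<open>\<Union>X\<close> is the affine cone over \<open>X\<close>.\<close>

type_synonym 'n pt = "(complex ^ 'n) set"

definition cline :: "complex ^ ('n::finite) \<Rightarrow> 'n pt" where
  "cline v = range (\<lambda>c. c *s v)"

definition proj_space :: "('n::finite) pt set" where
  "proj_space = {cline v |v. v \<noteq> 0}"

definition homogeneous_poly :: "nat \<Rightarrow> (complex ^ ('n::finite) \<Rightarrow> complex) \<Rightarrow> bool" where
  "homogeneous_poly d p \<longleftrightarrow> p \<in> alg_gen {(\<lambda>v. v $ i) |i. True} \<and> (\<forall>c v. p (c *s v) = c ^ d * p v)"

definition variety_of :: "'n pt set \<Rightarrow> ('n::finite) pt fspace" where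
  "variety_of X =
    \<lparr> zopens = {W. \<exists>T. (\<forall>p\<in>T. \<exists>d. homogeneous_poly d p) \<and> W = {x \<in> X. \<exists>p\<in>T. \<exists>v\<in>x. p v \<noteq> 0}},
      regs = (\<lambda>W. {g. \<forall>x\<in>W. \<exists>d p q. homogeneous_poly d p \<and> homogeneous_poly d q \<and>
                (\<forall>v\<in>x - {0}. q v \<noteq> 0) \<and>
                (\<forall>y\<in>W. \<forall>v\<in>y - {0}. q v \<noteq> 0 \<longrightarrow> g y = p v / q v)}) \<rparr>"

definition mholomorphic_on :: "(complex ^ 'n) set \<Rightarrow> (complex ^ ('n::finite) \<Rightarrow> complex) \<Rightarrow> bool" where
  "mholomorphic_on A G \<longleftrightarrow> open A \<and>
     (\<forall>w\<in>A. \<exists>G'. (G has_derivative G') (at w) \<and> (\<forall>c v. G' (c *s v) = c * G' v))"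

text \<open>Closed complex submanifolds of projective space, by way of the cone: the projection of the
  nonzero vectors onto projective space is a holomorphic submersion, so \<open>X\<close> is a submanifold iff its
  cone is one away from the origin. By Chow's theorem these are the nonsingular projective
  varieties.\<close>

definition projective_manifold :: "('n::finite) pt set \<Rightarrow> bool" where
  "projective_manifold X \<longleftrightarrow>
     X \<subseteq> proj_space \<and> closed (insert 0 (\<Union>X)) \<and>
     connected_space (complex_topology (variety_of X)) \<and>
     (\<forall>v \<in> \<Union>X - {0}. \<exists>A A' (\<Phi> :: complex ^ 'n \<Rightarrow> complex ^ 'n) \<Psi> E.
        v \<in> A \<and> open A \<and> open A' \<and>
        (\<forall>i. mholomorphic_on A (\<lambda>w. \<Phi> w $ i)) \<and> (\<forall>i. mholomorphic_on A' (\<lambda>w. \<Psi> w $ i)) \<and>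
        \<Phi> ` A = A' \<and> (\<forall>w\<in>A. \<Psi> (\<Phi> w) = w) \<and> (\<forall>w\<in>A'. \<Phi> (\<Psi> w) = w) \<and>
        vec.subspace E \<and> \<Phi> ` (A \<inter> \<Union>X) = A' \<inter> E)"

abbreviation open_in_manifold :: "('n::finite) pt set \<Rightarrow> 'n pt set \<Rightarrow> bool" where
  "open_in_manifold X \<Omega> \<equiv> openin (complex_topology (variety_of X)) \<Omega>"

text \<open>\<open>g\<close> is holomorphic on a neighbourhood of \<open>x\<close> in \<open>X\<close>: near some vector over \<open>x\<close>, the pullback
  of \<open>g\<close> to the cone is the restriction of a holomorphic function of the ambient vector space.\<close>

definition holo_at :: "('n::finite) pt set \<Rightarrow> 'n pt \<Rightarrow> ('n pt \<Rightarrow> complex) \<Rightarrow> bool" where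
  "holo_at X x g \<longleftrightarrow>
     (\<exists>v \<in> x - {0}. \<exists>A G. v \<in> A \<and> mholomorphic_on A G \<and>
        (\<forall>w \<in> A - {0}. cline w \<in> X \<longrightarrow> g (cline w) = G w))"

definition germ_eq :: "('n::finite) pt set \<Rightarrow> 'n pt \<Rightarrow> ('n pt \<Rightarrow> complex) \<Rightarrow> ('n pt \<Rightarrow> complex) \<Rightarrow> bool" where
  "germ_eq X x g h \<longleftrightarrow> (\<exists>\<Omega>. open_in_manifold X \<Omega> \<and> x \<in> \<Omega> \<and> (\<forall>y\<in>\<Omega>. g y = h y))"

text \<open>The ideal generated by \<open>G\<close> in the local ring of germs of holomorphic functions at \<open>x\<close>, as the
  set of all representatives of its elements.\<close>

definition germ_ideal ::
    "('n::finite) pt set \<Rightarrow> 'n pt \<Rightarrow> ('n pt \<Rightarrow> complex) set \<Rightarrow> ('n pt \<Rightarrow> complex) set" where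
  "germ_ideal X x G = {h. \<exists>(n::nat) a b. (\<forall>k<n. holo_at X x (a k) \<and> b k \<in> G) \<and>
     germ_eq X x h (\<lambda>y. \<Sum>k<n. a k y * b k y)}"

definition max_ideal :: "('n::finite) pt set \<Rightarrow> 'n pt \<Rightarrow> ('n pt \<Rightarrow> complex) set" where
  "max_ideal X x = {g. holo_at X x g \<and> g x = 0}"

definition max_ideal_sq :: "('n::finite) pt set \<Rightarrow> 'n pt \<Rightarrow> ('n pt \<Rightarrow> complex) set" where
  "max_ideal_sq X x = germ_ideal X x {(\<lambda>y. a y * b y) |a b. a \<in> max_ideal X x \<and> b \<in> max_ideal X x}"

text \<open>The extension of the stalk of an algebraic ideal sheaf to the ring of holomorphic germs.\<close>

definition an_stalk ::
    "('n::finite) pt set \<Rightarrow> ('n pt set \<Rightarrow> ('n pt \<Rightarrow> complex) set) \<Rightarrow> 'n pt \<Rightarrow> ('n pt \<Rightarrow> complex) set" where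
  "an_stalk X I x = germ_ideal X x (\<Union>{I W |W. W \<in> zopens (variety_of X) \<and> x \<in> W})"


section \<open>Tangent vectors, directed manifolds and curves\<close>

text \<open>A tangent vector at \<open>x\<close> is a derivation of the local ring of holomorphic germs at \<open>x\<close>. It is
  extended by 0 to functions that are not holomorphic near \<open>x\<close>, so that equality of tangent vectors
  is equality of functions.\<close>

type_synonym 'n tv = "('n pt \<Rightarrow> complex) \<Rightarrow> complex"

definition tangent_space :: "('n::finite) pt set \<Rightarrow> 'n pt \<Rightarrow> 'n tv set" where
  "tangent_space X x = {D.
     (\<forall>g. \<not> holo_at X x g \<longrightarrow> D g = 0) \<and>
     (\<forall>g h. holo_at X x g \<and> holo_at X x h \<and> germ_eq X x g h \<longrightarrow> D g = D h) \<and>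
     (\<forall>g h a b. holo_at X x g \<and> holo_at X x h \<longrightarrow>
        D (\<lambda>y. a * g y + b * h y) = a * D g + b * D h) \<and>
     (\<forall>g h. holo_at X x g \<and> holo_at X x h \<longrightarrow> D (\<lambda>y. g y * h y) = g x * D h + h x * D g)}"

text \<open>A holomorphic subbundle has, locally, a holomorphic frame \<open>v 0, \<dots>, v (k - 1)\<close>; a vector field is
  holomorphic if it maps holomorphic functions to holomorphic functions.\<close>

definition holomorphic_subbundle :: "('n::finite) pt set \<Rightarrow> ('n pt \<Rightarrow> 'n tv set) \<Rightarrow> bool" where
  "holomorphic_subbundle X V \<longleftrightarrow> (\<forall>x\<in>X. V x \<subseteq> tangent_space X x) \<and>
     (\<forall>x\<in>X. \<exists>\<Omega> (k::nat) v. open_in_manifold X \<Omega> \<and> x \<in> \<Omega> \<and>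
        (\<forall>y\<in>\<Omega>. V y = {(\<lambda>g. \<Sum>i<k. c i * v i y g) |c. True} \<and>
           (\<forall>c. (\<forall>g. (\<Sum>i<k. c i * v i y g) = 0) \<longrightarrow> (\<forall>i<k. c i = 0)) \<and>
           (\<forall>i<k. \<forall>g. holo_at X y g \<longrightarrow> holo_at X y (\<lambda>y'. v i y' g))))"

definition directed_projective_manifold :: "('n::finite) pt set \<Rightarrow> ('n pt \<Rightarrow> 'n tv set) \<Rightarrow> bool" where
  "directed_projective_manifold X V \<longleftrightarrow> projective_manifold X \<and> holomorphic_subbundle X V"

definition holomorphic_map_to :: "('n::finite) pt set \<Rightarrow> (complex \<Rightarrow> 'n pt) \<Rightarrow> bool" where
  "holomorphic_map_to X f \<longleftrightarrow> (\<forall>z. f z \<in> X) \<and>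
     (\<forall>\<Omega>. open_in_manifold X \<Omega> \<longrightarrow> open (f -` \<Omega>)) \<and>
     (\<forall>z g. holo_at X (f z) g \<longrightarrow> (\<lambda>w. g (f w)) analytic_on {z})"

definition velocity :: "('n::finite) pt set \<Rightarrow> (complex \<Rightarrow> 'n pt) \<Rightarrow> complex \<Rightarrow> 'n tv" where
  "velocity X f z = (\<lambda>g. if holo_at X (f z) g then deriv (\<lambda>w. g (f w)) z else 0)"

definition directed_curve ::
    "('n::finite) pt set \<Rightarrow> ('n pt \<Rightarrow> 'n tv set) \<Rightarrow> (complex \<Rightarrow> 'n pt) \<Rightarrow> bool" where
  "directed_curve X V f \<longleftrightarrow> holomorphic_map_to X f \<and> (\<forall>z. velocity X f z \<in> V (f z))"


section \<open>The bundle of lines, lifts and first-order prolongation of subschemes\<close>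

definition tline :: "('n::finite) tv \<Rightarrow> 'n tv set" where
  "tline D = {(\<lambda>g. c * D g) |c. True}"

definition lines_in ::
    "('n::finite) pt set \<Rightarrow> ('n pt \<Rightarrow> 'n tv set) \<Rightarrow> ('n pt \<times> 'n tv set) set" where
  "lines_in X V = {(x, tline D) |x D. x \<in> X \<and> D \<in> V x \<and> D \<noteq> (\<lambda>_. 0)}"

text \<open>Over an affine open \<open>U\<close>, the algebra of regular functions on the total space of \<open>V\<close> that are
  polynomial on the fibres is generated by the regular functions on \<open>U\<close> and their differentials
  (the regular 1-forms on \<open>U\<close> surject onto the sections of the dual of \<open>V\<close>).
  The following is its part of fibre degree \<open>m\<close>; it is the homogeneous coordinate ring of \<open>P(V)\<close>
  over \<open>U\<close>.\<close>

inductive fibre_poly ::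
    "('n::finite) pt set \<Rightarrow> 'n pt set \<Rightarrow> nat \<Rightarrow> ('n pt \<times> 'n tv \<Rightarrow> complex) \<Rightarrow> bool"
  for X U where
  base: "a \<in> regs (variety_of X) U \<Longrightarrow> fibre_poly X U 0 (\<lambda>(x, D). a x)"
| diff: "a \<in> regs (variety_of X) U \<Longrightarrow> fibre_poly X U 1 (\<lambda>(x, D). D a)"
| add: "fibre_poly X U m P \<Longrightarrow> fibre_poly X U m Q \<Longrightarrow> fibre_poly X U m (\<lambda>p. P p + Q p)"
| mult: "fibre_poly X U m P \<Longrightarrow> fibre_poly X U n Q \<Longrightarrow> fibre_poly X U (m + n) (\<lambda>p. P p * Q p)"

definition basic_open ::
    "('n::finite) pt set \<Rightarrow> ('n pt \<Rightarrow> 'n tv set) \<Rightarrow> 'n pt set \<Rightarrow> ('n pt \<times> 'n tv \<Rightarrow> complex)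
      \<Rightarrow> ('n pt \<times> 'n tv set) set" where
  "basic_open X V U Q =
     {(x, l) \<in> lines_in X V. x \<in> U \<and> (\<forall>D \<in> l - {\<lambda>_. 0}. Q (x, D) \<noteq> 0)}"

definition is_fraction_on ::
    "(('n::finite) pt \<times> 'n tv set) set \<Rightarrow> ('n pt \<times> 'n tv set \<Rightarrow> complex)
      \<Rightarrow> ('n pt \<times> 'n tv \<Rightarrow> complex) \<Rightarrow> ('n pt \<times> 'n tv \<Rightarrow> complex) \<Rightarrow> bool" where
  "is_fraction_on W g P Q \<longleftrightarrow>
     (\<forall>(x, l) \<in> W. \<forall>D \<in> l - {\<lambda>_. 0}. g (x, l) = P (x, D) / Q (x, D))"

text \<open>\<open>P(V)\<close> as a variety: over each affine open \<open>U\<close> it is the Proj of the graded ring above.\<close>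

definition projectivization ::
    "('n::finite) pt set \<Rightarrow> ('n pt \<Rightarrow> 'n tv set) \<Rightarrow> ('n pt \<times> 'n tv set) fspace" where
  "projectivization X V =
    \<lparr> zopens = {W. W \<subseteq> lines_in X V \<and>
        (\<forall>w\<in>W. \<exists>U m Q. affine_open (variety_of X) U \<and> fibre_poly X U m Q \<and>
           w \<in> basic_open X V U Q \<and> basic_open X V U Q \<subseteq> W)},
      regs = (\<lambda>W. {g. \<forall>w\<in>W. \<exists>U m P Q. affine_open (variety_of X) U \<and>
           fibre_poly X U m P \<and> fibre_poly X U m Q \<and>
           w \<in> basic_open X V U Q \<and> is_fraction_on (W \<inter> basic_open X V U Q) g P Q}) \<rparr>"

text \<open>The degree \<open>m\<close> part of the homogeneous ideal generated by \<open>\<zeta> i\<close> (degree 0) and their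
  differentials (degree 1), \<open>i < s\<close>.\<close>

definition jet_ideal ::
    "('n::finite) pt set \<Rightarrow> 'n pt set \<Rightarrow> nat \<Rightarrow> (nat \<Rightarrow> 'n pt \<Rightarrow> complex) \<Rightarrow> nat
      \<Rightarrow> ('n pt \<times> 'n tv \<Rightarrow> complex) set" where
  "jet_ideal X U s \<zeta> m = {P. \<exists>A B. (\<forall>i<s. fibre_poly X U m (A i)) \<and>
     (\<forall>i<s. if m = 0 then B i = (\<lambda>_. 0) else fibre_poly X U (m - 1) (B i)) \<and>
     P = (\<lambda>(x, D). (\<Sum>i<s. A i (x, D) * \<zeta> i x) + (\<Sum>i<s. B i (x, D) * D (\<zeta> i)))}"

text \<open>The ideal sheaf of the first-order prolongation of the subscheme with ideal sheaf \<open>I\<close>.\<close>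

definition prolongation ::
    "('n::finite) pt set \<Rightarrow> ('n pt \<Rightarrow> 'n tv set) \<Rightarrow> ('n pt set \<Rightarrow> ('n pt \<Rightarrow> complex) set)
      \<Rightarrow> ('n pt \<times> 'n tv set) set \<Rightarrow> ('n pt \<times> 'n tv set \<Rightarrow> complex) set" where
  "prolongation X V I W = {g \<in> regs (projectivization X V) W.
     \<forall>w\<in>W. \<exists>U s \<zeta> m P Q. affine_open (variety_of X) U \<and> generates (variety_of X) I U s \<zeta> \<and>
        P \<in> jet_ideal X U s \<zeta> m \<and> fibre_poly X U m Q \<and>
        w \<in> basic_open X V U Q \<and> is_fraction_on (W \<inter> basic_open X V U Q) g P Q}"

text \<open>\<open>f1\<close> is the lift of \<open>f\<close>; for non-constant \<open>f\<close> these conditions determine \<open>f1\<close>. The local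
  factor \<open>u\<close> is a holomorphic section of the pullback of \<open>V\<close>.\<close>

definition is_lift ::
    "('n::finite) pt set \<Rightarrow> ('n pt \<Rightarrow> 'n tv set) \<Rightarrow> (complex \<Rightarrow> 'n pt)
      \<Rightarrow> (complex \<Rightarrow> 'n pt \<times> 'n tv set) \<Rightarrow> bool" where
  "is_lift X V f f1 \<longleftrightarrow> (\<forall>z0. \<exists>(m::nat) u. u z0 \<noteq> (\<lambda>_. 0) \<and>
     (\<exists>e>0. \<forall>z\<in>ball z0 e. u z \<in> V (f z) \<and> velocity X f z = (\<lambda>g. (z - z0) ^ m * u z g)) \<and>
     (\<forall>g. holo_at X (f z0) g \<longrightarrow> (\<lambda>z. u z g) analytic_on {z0}) \<and>
     f1 z0 = (f z0, tline (u z0)))"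


section \<open>Line bundles and linear systems\<close>

text \<open>A line bundle is given by trivializations over the open sets \<open>triv_dom L i\<close> and a cocycle;
  a section is a family of local functions with \<open>s i = transition L i j * s j\<close>, extended by 0.\<close>

record ('i, 'n) line_bundle =
  triv_dom :: "'i \<Rightarrow> 'n pt set"
  transition :: "'i \<Rightarrow> 'i \<Rightarrow> 'n pt \<Rightarrow> complex"

type_synonym ('i, 'n) sect = "'i \<Rightarrow> 'n pt \<Rightarrow> complex"

definition holomorphic_line_bundle :: "('n::finite) pt set \<Rightarrow> ('i, 'n) line_bundle \<Rightarrow> bool" where
  "holomorphic_line_bundle X L \<longleftrightarrow>
     (\<forall>i. open_in_manifold X (triv_dom L i)) \<and> (\<Union>i. triv_dom L i) = X \<and>
     (\<forall>i j. \<forall>x \<in> triv_dom L i \<inter> triv_dom L j.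
        holo_at X x (transition L i j) \<and> transition L i j x \<noteq> 0) \<and>
     (\<forall>i j k. \<forall>x \<in> triv_dom L i \<inter> triv_dom L j \<inter> triv_dom L k.
        transition L i j x * transition L j k x = transition L i k x)"

definition sections :: "('n::finite) pt set \<Rightarrow> ('i, 'n) line_bundle \<Rightarrow> ('i, 'n) sect set" where
  "sections X L = {s.
     (\<forall>i. \<forall>x \<in> triv_dom L i. holo_at X x (s i)) \<and>
     (\<forall>i x. x \<notin> triv_dom L i \<longrightarrow> s i x = 0) \<and>
     (\<forall>i j. \<forall>x \<in> triv_dom L i \<inter> triv_dom L j.
        s i x = transition L i j x * s j x)}"

text \<open>A linear system is represented by the corresponding linear subspace of the space of sections.\<close>

definition linear_system ::
    "('n::finite) pt set \<Rightarrow> ('i, 'n) line_bundle \<Rightarrow> ('i, 'n) sect set \<Rightarrow> bool" where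
  "linear_system X L S \<longleftrightarrow> S \<subseteq> sections X L \<and> (\<lambda>i x. 0) \<in> S \<and>
     (\<forall>s\<in>S. \<forall>t\<in>S. \<forall>a b. (\<lambda>i x. a * s i x + b * t i x) \<in> S)"

definition is_basis :: "('i, ('n::finite)) sect set \<Rightarrow> nat \<Rightarrow> (nat \<Rightarrow> ('i, 'n) sect) \<Rightarrow> bool" where
  "is_basis S M \<sigma> \<longleftrightarrow> (\<forall>k<M. \<sigma> k \<in> S) \<and>
     (\<forall>s\<in>S. \<exists>c. s = (\<lambda>i x. \<Sum>k<M. c k * \<sigma> k i x)) \<and>
     (\<forall>c. (\<forall>i x. (\<Sum>k<M. c k * \<sigma> k i x) = 0) \<longrightarrow> (\<forall>k<M. c k = 0))"

definition separates_1jets ::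
    "('n::finite) pt set \<Rightarrow> ('i, 'n) line_bundle \<Rightarrow> ('i, 'n) sect set \<Rightarrow> 'n pt \<Rightarrow> bool" where
  "separates_1jets X L S x \<longleftrightarrow> (\<forall>i. x \<in> triv_dom L i \<longrightarrow>
     (\<forall>g. holo_at X x g \<longrightarrow> (\<exists>s\<in>S. (\<lambda>y. s i y - g y) \<in> max_ideal_sq X x)))"

text \<open>The sections in \<open>S\<close> that vanish on the subscheme with ideal sheaf \<open>I\<close> (for a nonzero section
  this says that its divisor contains the subscheme).\<close>

definition sections_through ::
    "('n::finite) pt set \<Rightarrow> ('i, 'n) line_bundle \<Rightarrow> ('i, 'n) sect set
      \<Rightarrow> ('n pt set \<Rightarrow> ('n pt \<Rightarrow> complex) set) \<Rightarrow> ('i, 'n) sect set" where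
  "sections_through X L S I =
     {s \<in> S. \<forall>i. \<forall>x \<in> triv_dom L i. s i \<in> an_stalk X I x}"

text \<open>The stalk at \<open>x\<close> of the base ideal of \<open>S\<close>, computed in the trivialization \<open>i\<close>.\<close>

definition base_ideal ::
    "('n::finite) pt set \<Rightarrow> ('i, 'n) sect set \<Rightarrow> 'i \<Rightarrow> 'n pt \<Rightarrow> ('n pt \<Rightarrow> complex) set" where
  "base_ideal X S i x = germ_ideal X x {s i |s. s \<in> S}"

definition is_base_ideal_through ::
    "('n::finite) pt set \<Rightarrow> ('i, 'n) line_bundle \<Rightarrow> ('i, 'n) sect set
      \<Rightarrow> ('n pt set \<Rightarrow> ('n pt \<Rightarrow> complex) set) \<Rightarrow> bool" where
  "is_base_ideal_through X L S I \<longleftrightarrow>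
     (\<forall>i. \<forall>x \<in> triv_dom L i. an_stalk X I x = base_ideal X (sections_through X L S I) i x)"

definition system_weight :: "nat \<Rightarrow> (nat \<Rightarrow> ('i, ('n::finite)) sect) \<Rightarrow> 'i \<Rightarrow> 'n pt \<Rightarrow> real" where
  "system_weight M \<sigma> i x = ln (\<Sum>k<M. (cmod (\<sigma> k i x))\<^sup>2)"

text \<open>Local weights \<open>\<phi> i\<close> of a continuous Hermitian metric \<open>|\<xi>|^2 exp (- \<phi>)\<close>: the transformation
  rule expresses that these local formulas define one metric.\<close>

definition hermitian_weight ::
    "('n::finite) pt set \<Rightarrow> ('i, 'n) line_bundle \<Rightarrow> ('i \<Rightarrow> 'n pt \<Rightarrow> real) \<Rightarrow> bool" where
  "hermitian_weight X L \<phi> \<longleftrightarrow>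
     (\<forall>i. continuous_map (subtopology (complex_topology (variety_of X)) (triv_dom L i))
            euclideanreal (\<phi> i)) \<and>
     (\<forall>i j. \<forall>x \<in> triv_dom L i \<inter> triv_dom L j.
        \<phi> i x = \<phi> j x + ln ((cmod (transition L i j x))\<^sup>2))"


section \<open>Nevanlinna theory\<close>

text \<open>A 2-form on the complex plane is given by its density with respect to \<open>dx \<and> dy\<close>. For the form
  \<open>dd\<^sup>c u = (\<i> / 2\<pi>) u\<^sub>z\<^sub>z\<^sub>' dz \<and> dz'\<close> (\<open>z'\<close> the conjugate) the density is \<open>(u\<^sub>x\<^sub>x + u\<^sub>y\<^sub>y) / 4\<pi>\<close>, because
  \<open>(\<i> / 2) dz \<and> dz' = dx \<and> dy\<close> and \<open>4 u\<^sub>z\<^sub>z\<^sub>' = u\<^sub>x\<^sub>x + u\<^sub>y\<^sub>y\<close>.\<close>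

definition ddc :: "(complex \<Rightarrow> real) \<Rightarrow> complex \<Rightarrow> real" where
  "ddc u z =
     ((deriv ^^ 2) (\<lambda>s. u (z + of_real s)) 0 + (deriv ^^ 2) (\<lambda>s. u (z + \<i> * of_real s)) 0) / (4 * pi)"

definition C2_on :: "complex set \<Rightarrow> (complex \<Rightarrow> real) \<Rightarrow> bool" where
  "C2_on A u \<longleftrightarrow> (\<exists>p q pp pq qp qq. \<forall>z\<in>A.
     (u has_derivative (\<lambda>h. p z * Re h + q z * Im h)) (at z) \<and>
     (p has_derivative (\<lambda>h. pp z * Re h + pq z * Im h)) (at z) \<and>
     (q has_derivative (\<lambda>h. qp z * Re h + qq z * Im h)) (at z) \<and>
     isCont pp z \<and> isCont pq z \<and> isCont qp z \<and> isCont qq z)"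

text \<open>The pullback by \<open>f\<close> of the form \<open>dd\<^sup>c \<phi>\<close>, for local weights \<open>\<phi> i\<close>; since \<open>f\<close> is holomorphic it
  is \<open>dd\<^sup>c (\<phi> i \<circ> f)\<close>. The choice of the trivialization around \<open>f z\<close> does not matter because
  the weights differ by pluriharmonic functions.\<close>

definition pullback_ddc ::
    "('i, ('n::finite)) line_bundle \<Rightarrow> (complex \<Rightarrow> 'n pt) \<Rightarrow> ('i \<Rightarrow> 'n pt \<Rightarrow> real) \<Rightarrow> complex \<Rightarrow> real" where
  "pullback_ddc L f \<phi> z = ddc (\<lambda>w. \<phi> (SOME i. f z \<in> triv_dom L i) (f w)) z"

text \<open>Positive and negative parts are integrated separately with values in the extended reals, so an
  estimate of \<open>nevanlinna\<close> includes the convergence of the integral.\<close>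

definition nevanlinna_nn :: "(complex \<Rightarrow> real) \<Rightarrow> real \<Rightarrow> ennreal" where
  "nevanlinna_nn \<rho> r =
     (\<integral>\<^sup>+ t\<in>{0<..<r}. ennreal (1 / t) * (\<integral>\<^sup>+ z\<in>ball 0 t. ennreal (\<rho> z) \<partial>lborel) \<partial>lborel)"

definition nevanlinna :: "(complex \<Rightarrow> real) \<Rightarrow> real \<Rightarrow> ereal" where
  "nevanlinna \<rho> r =
     enn2ereal (nevanlinna_nn \<rho> r) - enn2ereal (nevanlinna_nn (\<lambda>z. - \<rho> z) r)"

text \<open>\<open>T\<close> represents the characteristic function of \<open>f\<close> with respect to \<open>L\<close>, a class modulo bounded
  functions that does not depend on the metric. The metric is continuous, with \<open>f\<close>-pullback of class
  \<open>C\<^sup>2\<close> so that the pullback of \<open>dd\<^sup>c \<phi>\<close> is a continuous form rather than a current; every metric of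
  class \<open>C\<^sup>2\<close> qualifies.\<close>

definition characteristic_function ::
    "('n::finite) pt set \<Rightarrow> ('i, 'n) line_bundle \<Rightarrow> (complex \<Rightarrow> 'n pt) \<Rightarrow> (real \<Rightarrow> real) \<Rightarrow> bool" where
  "characteristic_function X L f T \<longleftrightarrow>
     (\<exists>\<phi>. hermitian_weight X L \<phi> \<and> (\<forall>i. C2_on (f -` triv_dom L i) (\<lambda>z. \<phi> i (f z))) \<and>
        (\<exists>K. \<forall>r\<ge>0. \<bar>nevanlinna (pullback_ddc L f \<phi>) r - ereal (T r)\<bar> \<le> ereal K))"

end

theory Submission
  imports Defs
begin

text \<open>Choose generators \<open>\<tau>\<^sub>k\<close> of the sections of the linear system that vanish on \<open>Z\<close>, put
  \<open>h = \<Sum>\<bar>\<tau>\<^sub>k\<bar>\<^sup>2 / \<Sum>\<bar>\<sigma>\<^sub>k\<bar>\<^sup>2\<close>, and let \<open>\<rho>\<close> be the squared norm of the derivatives of the \<open>\<tau>\<^sub>k\<close>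
  along the curve, taken with respect to the Chern connection of the metric \<open>1 / \<Sum>\<bar>\<sigma>\<^sub>k\<bar>\<^sup>2\<close>. Since the
  \<open>\<tau>\<^sub>k\<close> generate the ideal of \<open>Z\<close>, \<open>exp (2 \<lambda>)\<close> is \<open>O(1 / h)\<close>; since they generate the ideal together
  with their differentials on the prolongation, \<open>exp (- 2 \<lambda>\<^sup>1) \<omega>\<close> is \<open>O(h \<omega> + \<rho>)\<close>, where \<open>\<omega>\<close> is the
  pullback of \<open>dd\<^sup>c \<phi>\<close>, positive by separation of 1-jets. So the integrand is dominated by
  \<open>\<omega> + h\<^bsup>\<epsilon>-1\<^esup> \<rho>\<close>. The curvature of \<open>(h + \<delta>)\<^bsup>\<epsilon>\<^esup>\<close> satisfies
  \<open>\<epsilon> (h + \<delta>)\<^bsup>\<epsilon>-1\<^esup> \<rho> \<le> (h + \<delta>)\<^bsup>\<epsilon>\<^esup> \<omega> + (1 / \<epsilon>) dd\<^sup>c (h + \<delta>)\<^bsup>\<epsilon>\<^esup>\<close>, up to constants; by Jensen's formula the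
  last term contributes \<open>O(1)\<close> to the Nevanlinna functional because \<open>(h + \<delta>)\<^bsup>\<epsilon>\<^esup>\<close> is bounded. Fatou's lemma
  for \<open>\<delta> \<rightarrow> 0\<close> gives the claim, and the maximum over several subschemes is estimated by the sum.\<close>

subsection \<open>The Nevanlinna functional\<close>

text \<open>The shift by \<open>\<delta>\<close> is forced by the points where the curve meets the
  support: \<open>h\<close> vanishes there, \<open>h powr \<epsilon>\<close> need not be C2, and
  Jensen's formula does not apply to it. \<open>h + \<delta>\<close> is again a quotient of sums of
  squared moduli of holomorphic functions, and its bounds do not depend on \<open>\<delta>\<close>.
  Since \<open>c\<close> is fixed before \<open>\<epsilon>\<close>, powers of
  \<open>1 / \<epsilon>\<close> must be watched. The curvature inequality costs
  \<open>1 / \<epsilon>\<close>, which the factor \<open>\<epsilon>\<close> of the claim repays; the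
  Jensen term costs \<open>1 / \<epsilon>^2\<close> and leaves a bounded summand. The geometric
  obstacle lies on \<open>P(V)\<close>. A Weil estimate there lives on affine sets unrelated to
  those of \<open>X\<close>, and it is informative only where some generator is nonzero. So a
  section of the prolongation over such a set is needed that does not vanish at a given point over
  the complement of the support. It is built from a section of the ideal sheaf twisted by
  \<open>O(e)\<close>, multiplied with the \<open>e\<close>-th power of a section of
  \<open>O(-1)\<close>.\<close>

lemma ball_measurable [measurable]: "ball (x::'a::euclidean_space) t \<in> sets borel"
  by simp

lemma nn_integral_lborel_translate:
  fixes g :: "'a::euclidean_space \<Rightarrow> ennreal"
  assumes "g \<in> borel_measurable borel"
  shows "(\<integral>\<^sup>+ x. g (t + x) \<partial>lborel) = (\<integral>\<^sup>+ x. g x \<partial>lborel)"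
proof -
  have "(\<integral>\<^sup>+ x. g x \<partial>lborel) = (\<integral>\<^sup>+ x. g x \<partial>distr lborel borel ((+) t))"
    by (simp add: lborel_distr_plus)
  also have "\<dots> = (\<integral>\<^sup>+ x. g (t + x) \<partial>lborel)"
    by (rule nn_integral_distr) (use assms in auto)
  finally show ?thesis by simp
qed

lemma nn_integral_lborel_reflect:
  fixes g :: "'a::euclidean_space \<Rightarrow> ennreal"
  assumes "g \<in> borel_measurable borel"
  shows "(\<integral>\<^sup>+ x. g (t - x) \<partial>lborel) = (\<integral>\<^sup>+ x. g x \<partial>lborel)"
proof -
  have "(lborel :: 'a measure) = distr lborel borel (\<lambda>x. t - x)"
    using lborel_affine[of "-1" t] by (simp add: density_1)
  then have "(\<integral>\<^sup>+ x. g x \<partial>lborel) = (\<integral>\<^sup>+ x. g x \<partial>distr lborel borel (\<lambda>x. t - x))"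
    by simp
  also have "\<dots> = (\<integral>\<^sup>+ x. g (t - x) \<partial>lborel)"
    by (rule nn_integral_distr) (use assms in auto)
  finally show ?thesis by simp
qed

text \<open>The image of Lebesgue measure is translation invariant, hence a multiple of Lebesgue
  measure, and the factor is 1 because the unit ball is preserved. The proof inlines the uniqueness
  of invariant measures: for each Borel set \<open>A\<close>, both sides times the volume of
  \<open>?B\<close> are double integrals that agree by Fubini and translation.\<close>

lemma lborel_distr_linear_isometry:
  fixes T :: "'a::euclidean_space \<Rightarrow> 'a"
  assumes T: "linear T" "\<And>x. norm (T x) = norm x"
  shows "distr lborel borel T = lborel"
proof (rule measure_eqI)
  fix A assume "A \<in> sets (distr lborel borel T)"
  then have A: "A \<in> sets borel" by simp
  have contT: "continuous_on UNIV T"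
    using T(1) by (simp add: linear_continuous_on linear_linear)
  then have mT [measurable]: "T \<in> borel_measurable borel"
    by (rule borel_measurable_continuous_onI)
  have "inj T"
    using T by (metis linear_injective_0 norm_eq_zero)
  then have "surj T"
    using T(1) linear_injective_imp_surjective by blast
  let ?B = "ball (0::'a) 1"
  have TB: "T x \<in> ?B \<longleftrightarrow> x \<in> ?B" for x using T(2) by simp
  note [measurable] = A
  have shift: "(\<integral>\<^sup>+x. indicator A (T x) * indicator ?B (y + T x) \<partial>lborel)
             = (\<integral>\<^sup>+x. indicator A (T x - y) * indicator ?B (T x) \<partial>lborel)" for y
  proof -
    obtain y' where y': "T y' = y" using \<open>surj T\<close> by (metis surj_def)
    have "(\<integral>\<^sup>+x. indicator A (T x - y) * indicator ?B (T x) \<partial>lborel)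
       = (\<integral>\<^sup>+x. indicator A (T (y' + x) - y) * indicator ?B (T (y' + x)) \<partial>lborel)"
      by (rule nn_integral_lborel_translate[symmetric]) measurable
    then show ?thesis by (simp add: linear_add[OF T(1)] y')
  qed
  have "(\<integral>\<^sup>+x. indicator A (T x) \<partial>lborel) * emeasure lborel ?B
      = (\<integral>\<^sup>+x. indicator A (T x) * emeasure lborel ?B \<partial>lborel)"
    by (simp add: nn_integral_multc)
  also have "\<dots> = (\<integral>\<^sup>+x. \<integral>\<^sup>+y. indicator A (T x) * indicator ?B (T x + y) \<partial>lborel \<partial>lborel)"
  proof (intro nn_integral_cong)
    fix x
    have "(\<integral>\<^sup>+y. indicator A (T x) * indicator ?B (T x + y) \<partial>lborel)
        = indicator A (T x) * (\<integral>\<^sup>+y. indicator ?B (T x + y) \<partial>lborel)"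
      by (rule nn_integral_cmult) measurable
    also have "(\<integral>\<^sup>+y. indicator ?B (T x + y) \<partial>lborel) = (\<integral>\<^sup>+y. indicator ?B y \<partial>lborel)"
      by (rule nn_integral_lborel_translate) measurable
    finally show "indicator A (T x) * emeasure lborel ?B
        = (\<integral>\<^sup>+y. indicator A (T x) * indicator ?B (T x + y) \<partial>lborel)" by simp
  qed
  also have "\<dots> = (\<integral>\<^sup>+y. \<integral>\<^sup>+x. indicator A (T x) * indicator ?B (y + T x) \<partial>lborel \<partial>lborel)"
    by (subst lborel_pair.Fubini') (simp_all add: add.commute)
  also have "\<dots> = (\<integral>\<^sup>+y. \<integral>\<^sup>+x. indicator A (T x - y) * indicator ?B (T x) \<partial>lborel \<partial>lborel)"
    by (simp only: shift)
  also have "\<dots> = (\<integral>\<^sup>+x. \<integral>\<^sup>+y. indicator A (T x - y) * indicator ?B (T x) \<partial>lborel \<partial>lborel)"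
    by (subst lborel_pair.Fubini') simp_all
  also have "\<dots> = (\<integral>\<^sup>+x. emeasure lborel A * indicator ?B x \<partial>lborel)"
  proof (intro nn_integral_cong)
    fix x
    have "(\<integral>\<^sup>+y. indicator A (T x - y) * indicator ?B (T x) \<partial>lborel)
        = (\<integral>\<^sup>+y. indicator A (T x - y) \<partial>lborel) * indicator ?B (T x)"
      by (rule nn_integral_multc) measurable
    also have "(\<integral>\<^sup>+y. indicator A (T x - y) \<partial>lborel) = (\<integral>\<^sup>+y. indicator A y \<partial>lborel)"
      by (rule nn_integral_lborel_reflect) measurable
    finally show "(\<integral>\<^sup>+y. indicator A (T x - y) * indicator ?B (T x) \<partial>lborel)
        = emeasure lborel A * indicator ?B x" using TB[of x] by (cases "x \<in> ?B") simp_all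
  qed
  also have "\<dots> = emeasure lborel A * emeasure lborel ?B"
    by (simp add: nn_integral_cmult)
  finally have "(\<integral>\<^sup>+x. indicator A (T x) \<partial>lborel) * emeasure lborel ?B = emeasure lborel A * emeasure lborel ?B" .
  moreover have "emeasure lborel ?B \<noteq> 0"
    using open_not_negligible[of ?B] by (simp add: negligible_iff_emeasure0)
  moreover have "emeasure lborel ?B \<noteq> \<infinity>"
    using emeasure_bounded_finite[of ?B] by simp
  ultimately have "(\<integral>\<^sup>+x. indicator A (T x) \<partial>lborel) = emeasure lborel A"
    by (metis ennreal_mult_cancel_left infinity_ennreal_def mult.commute)
  moreover have "(\<integral>\<^sup>+x. indicator A (T x) \<partial>lborel) = (\<integral>\<^sup>+x. indicator A x \<partial>distr lborel borel T)"
    by (rule nn_integral_distr[symmetric]) auto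
  ultimately show "emeasure (distr lborel borel T) A = emeasure lborel A"
    by simp
qed simp

lemma nn_integral_ball_rotate:
  fixes g :: "complex \<Rightarrow> ennreal"
  assumes [measurable]: "g \<in> borel_measurable borel" and c: "cmod c = 1"
  shows "(\<integral>\<^sup>+ z\<in>ball 0 t. g (c * z) \<partial>lborel) = (\<integral>\<^sup>+ z\<in>ball 0 t. g z \<partial>lborel)"
proof -
  have d: "distr lborel borel ((*) c) = (lborel :: complex measure)"
    using c by (intro lborel_distr_linear_isometry) (auto simp: norm_mult intro!: linearI simp: algebra_simps)
  have "(\<integral>\<^sup>+ z\<in>ball 0 t. g z \<partial>lborel) = (\<integral>\<^sup>+ z. g z * indicator (ball 0 t) z \<partial>distr lborel borel ((*) c))"
    by (simp add: d)
  also have "\<dots> = (\<integral>\<^sup>+ z. g (c * z) * indicator (ball 0 t) (c * z) \<partial>lborel)"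
    by (rule nn_integral_distr) measurable
  also have "\<dots> = (\<integral>\<^sup>+ z\<in>ball 0 t. g (c * z) \<partial>lborel)"
    using c by (simp add: norm_mult indicator_def)
  finally show ?thesis by simp
qed

lemma emeasure_ball_complex: "t \<ge> 0 \<Longrightarrow> emeasure lborel (ball (0::complex) t) = ennreal (pi * t\<^sup>2)"
  using emeasure_ball[of t "0::complex"] by (simp add: unit_ball_vol_2)

lemma has_integral_two_pi:
  assumes "x \<le> (t::real)" 
  shows "((\<lambda>s. 2 * pi * s) has_integral pi * (t\<^sup>2 - x\<^sup>2)) {x..t}"
proof -
  have "((\<lambda>s. pi * s\<^sup>2) has_vector_derivative 2 * pi * s) (at s within {x..t})" for s
    by (auto intro!: derivative_eq_intros simp: has_real_derivative_iff_has_vector_derivative[symmetric])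
  from fundamental_theorem_of_calculus[OF assms this] show ?thesis
    by (simp add: algebra_simps)
qed

text \<open>This is the radial half of polar coordinates. The two measures on the line are compared
  on the rays \<open>{x<..}\<close>, where the left side is the area of an annulus.\<close>

lemma distr_norm_ball:
  assumes t: "t \<ge> 0"
  shows "distr (density lborel (indicator (ball (0::complex) t))) borel norm
       = density lborel (\<lambda>s. ennreal (2 * pi * s) * indicator {0..t} s)" (is "?L = ?R")
proof (rule measure_eqI_lessThan)
  have L: "emeasure ?L {x<..} = emeasure lborel (ball (0::complex) t - {z. norm z \<le> x})" for x
  proof -
    have "emeasure ?L {x<..} = emeasure (density lborel (indicator (ball (0::complex) t))) (norm -` {x<..})"
      by (subst emeasure_distr) auto
    also have "\<dots> = emeasure lborel (ball (0::complex) t \<inter> norm -` {x<..})"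
    proof -
      have "norm -` {x<..} \<in> sets (borel :: complex measure)"
        using measurable_sets[of norm borel borel "{x<..}"] by simp
      then show ?thesis
        by (subst emeasure_density) (auto simp: indicator_inter_arith[symmetric])
    qed
    also have "ball (0::complex) t \<inter> norm -` {x<..} = ball (0::complex) t - {z. norm z \<le> x}" by auto
    finally show ?thesis .
  qed
  show "emeasure ?L {x<..} < \<infinity>" for x
  proof -
    have "emeasure ?L {x<..} \<le> emeasure lborel (ball (0::complex) t)"
      unfolding L by (rule emeasure_mono) auto
    then show ?thesis using t by (auto simp: emeasure_ball_complex intro: order.strict_trans1)
  qed
  show "emeasure ?L {x<..} = emeasure ?R {x<..}" for x
  proof -
    \<comment> \<open>Norms are nonnegative, so every ray that starts below \<open>0\<close> carries
      the whole disc; clamping treats these rays together with the others.\<close>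
    define x' where "x' = max 0 x"
    have R: "emeasure ?R {x<..} = (\<integral>\<^sup>+ s. ennreal (2 * pi * s) * indicator {x'..t} s \<partial>lborel)"
    proof -
      have "emeasure ?R {x<..} = (\<integral>\<^sup>+ s. ennreal (2 * pi * s) * indicator {0..t} s * indicator {x<..} s \<partial>lborel)"
        by (subst emeasure_density) auto
      also have "\<dots> = (\<integral>\<^sup>+ s. ennreal (2 * pi * s) * indicator {x'..t} s \<partial>lborel)"
      proof (rule nn_integral_cong_AE)
        have "AE s in lborel. s \<noteq> x" using AE_lborel_singleton by auto
        then show "AE s in lborel. ennreal (2 * pi * s) * indicator {0..t} s * indicator {x<..} s =
             ennreal (2 * pi * s) * indicator {x'..t} s"
          by eventually_elim (auto simp: indicator_def x'_def)
      qed
      finally show ?thesis .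
    qed
    show ?thesis
    proof (cases "x' \<le> t")
      case True
      have "emeasure ?R {x<..} = ennreal (pi * (t\<^sup>2 - x'\<^sup>2))"
        unfolding R
      proof (rule nn_integral_has_integral_lebesgue[OF _ has_integral_two_pi[OF True], THEN trans[rotated]])
        show "0 \<le> 2 * pi * s" if "s \<in> {x'..t}" for s using that by (auto simp: x'_def)
        show "(\<integral>\<^sup>+ s. ennreal (2 * pi * s) * indicator {x'..t} s \<partial>lborel) =
          (\<integral>\<^sup>+ s. ennreal (indicator {x'..t} s * (2 * pi * s)) \<partial>lborel)"
          by (intro nn_integral_cong) (auto simp: indicator_def)
      qed
      moreover have "emeasure ?L {x<..} = ennreal (pi * (t\<^sup>2 - x'\<^sup>2))"
      proof (cases "x < 0")
        case True
        then have "{z::complex. norm z \<le> x} = {}"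
          by (metis (mono_tags, lifting) Collect_empty_eq linorder_not_less norm_ge_zero order.strict_trans1)
        then show ?thesis unfolding L using t True by (simp add: x'_def emeasure_ball_complex)
      next
        case False
        then have [simp]: "x' = x" by (auto simp: x'_def)
        have [simp]: "{z::complex. norm z \<le> x} = cball 0 x" by auto
        have "emeasure lborel (ball (0::complex) t - cball 0 x) 
            = emeasure lborel (ball (0::complex) t - ball 0 x)"
        proof (rule emeasure_eq_AE)
          have "negligible (sphere (0::complex) x)" by (rule negligible_sphere)
          then have "AE z in lborel. z \<notin> sphere (0::complex) x"
            by (metis AE_not_in null_sets_completion_iff negligible_iff_null_sets borel_closed closed_sphere sets_lborel)
          then show "AE z in lborel. (z \<in> ball (0::complex) t - cball 0 x) = (z \<in> ball 0 t - ball 0 x)"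
            by eventually_elim auto
        qed auto
        also have "\<dots> = emeasure lborel (ball (0::complex) t) - emeasure lborel (ball (0::complex) x)"
          using False \<open>x' \<le> t\<close> by (intro emeasure_Diff) (auto simp: emeasure_ball_complex)
        also have "\<dots> = ennreal (pi * (t\<^sup>2 - x\<^sup>2))"
          using False t by (simp add: emeasure_ball_complex ennreal_minus algebra_simps)
        finally show ?thesis unfolding L by simp
      qed
      ultimately show ?thesis by simp
    next
      case False
      then have "ball (0::complex) t - {z. norm z \<le> x} = {}" using t by (auto simp: x'_def max_def split: if_splits)
      then have "emeasure lborel (ball (0::complex) t - {z. norm z \<le> x}) = 0"
        by (simp only: emeasure_empty)
      then show ?thesis unfolding L R using False by simp
    qed
  qed
qed auto

lemma nn_integral_ball_radial:
  assumes [measurable]: "g \<in> borel_measurable borel" and t: "t \<ge> 0"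
  shows "(\<integral>\<^sup>+ z\<in>ball (0::complex) t. g (norm z) \<partial>lborel)
       = (\<integral>\<^sup>+ s. ennreal (2 * pi * s) * g s * indicator {0..t} s \<partial>lborel)"
proof -
  have "(\<integral>\<^sup>+ z\<in>ball (0::complex) t. g (norm z) \<partial>lborel)
     = (\<integral>\<^sup>+ z. g (norm z) \<partial>density lborel (indicator (ball (0::complex) t)))"
    by (subst nn_integral_density) (measurable, simp add: mult.commute)
  also have "\<dots> = (\<integral>\<^sup>+ s. g s \<partial>distr (density lborel (indicator (ball (0::complex) t))) borel norm)"
    by (subst nn_integral_distr) auto
  also have "\<dots> = (\<integral>\<^sup>+ s. ennreal (2 * pi * s) * indicator {0..t} s * g s \<partial>lborel)"
    unfolding distr_norm_ball[OF t] by (subst nn_integral_density) auto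
  finally show ?thesis by (simp add: mult_ac)
qed

text \<open>An integral over the circle and not a mean: its value at radius \<open>0\<close> is
  \<open>2 * pi\<close> times the value at the centre. For a continuous density the iterated
  integral \<open>nev\<close> is a real number and linear in the density, whereas
  \<open>nevanlinna\<close> is a difference of extended reals.\<close>

definition circ_int :: "(complex \<Rightarrow> real) \<Rightarrow> real \<Rightarrow> real" where
  "circ_int \<rho> s = integral {0..2*pi} (\<lambda>\<theta>. \<rho> (of_real s * cis \<theta>))"

definition nev :: "(complex \<Rightarrow> real) \<Rightarrow> real \<Rightarrow> real" where
  "nev \<rho> r = integral {0..r} (\<lambda>t. integral {0..t} (\<lambda>s. s * circ_int \<rho> s) / t)"

lemma circ_int_continuous:
  assumes "continuous_on UNIV \<rho>"
  shows "continuous_on S (circ_int \<rho>)"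
proof -
  have "continuous_on (S \<times> cbox 0 (2*pi)) (\<lambda>(s, \<theta>). \<rho> (of_real s * cis \<theta>))"
    unfolding split_beta
    by (rule continuous_on_compose2[OF assms]) (auto intro!: continuous_intros)
  from integral_continuous_on_param[OF this] show ?thesis
    unfolding circ_int_def cbox_interval .
qed

lemma circ_int_integrand:
  fixes \<rho> :: "complex \<Rightarrow> real"
  assumes "continuous_on UNIV \<rho>"
  shows "(\<lambda>\<theta>. \<rho> (z * cis \<theta>)) integrable_on {a..b}"
  by (rule integrable_continuous_interval, rule continuous_on_compose2[OF assms])
    (auto intro!: continuous_intros)

lemma integral_periodic_shift:
  fixes g :: "real \<Rightarrow> real"
  assumes cont: "continuous_on UNIV g" and per: "\<And>x. g (x + p) = g x" and "0 \<le> c" "c \<le> p"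
  shows "integral {0..p} (\<lambda>x. g (x + c)) = integral {0..p} g"
proof -
  have i: "g integrable_on {a..b}" for a b
    by (rule integrable_continuous_interval) (rule continuous_on_subset[OF cont], simp)
  have "integral {0..p} (\<lambda>x. g (x + c)) = integral {c..p+c} g"
    using integral_shift_real_ivl[of c c "p + c" g] by simp
  also have "\<dots> = integral {c..p} g + integral {p..p+c} g"
    by (rule Henstock_Kurzweil_Integration.integral_combine[symmetric]) (use assms i in auto)
  also have "integral {p..p+c} g = integral {0..c} (\<lambda>x. g (x + p))"
    using integral_shift_real_ivl[of p p "p + c" g] by simp
  also have "\<dots> = integral {0..c} g" by (simp add: per)
  also have "integral {c..p} g + integral {0..c} g = integral {0..p} g"
    using Henstock_Kurzweil_Integration.integral_combine[of 0 c p g] assms i by simp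
  finally show ?thesis .
qed

text \<open>The argument of \<open>z\<close> only shifts the angle, and the integrand is
  periodic.\<close>

lemma circ_int_norm:
  assumes "continuous_on UNIV \<rho>"
  shows "integral {0..2*pi} (\<lambda>\<theta>. \<rho> (z * cis \<theta>)) = circ_int \<rho> (norm z)"
proof -
  obtain \<phi> where \<phi>: "0 \<le> \<phi>" "\<phi> \<le> 2 * pi" "z = of_real (norm z) * cis \<phi>"
    using Arg2pi_ge_0[of z] Arg2pi_lt_2pi[of z] Arg2pi_eq[of z]
    by (metis cis_conv_exp less_eq_real_def)
  define g where "g = (\<lambda>\<theta>. \<rho> (of_real (norm z) * cis \<theta>))"
  have "integral {0..2*pi} (\<lambda>x. g (x + \<phi>)) = integral {0..2*pi} g"
  proof (rule integral_periodic_shift)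
    show "continuous_on UNIV g"
      unfolding g_def by (intro continuous_on_compose2[OF assms] continuous_intros) auto
    show "g (x + 2 * pi) = g x" for x by (simp add: g_def cis.ctr)
  qed (use \<phi> in auto)
  moreover have "g (x + \<phi>) = \<rho> (z * cis x)" for x
    unfolding g_def by (subst (2) \<phi>(3)) (simp add: cis_mult[symmetric] mult_ac)
  ultimately show ?thesis by (simp add: g_def circ_int_def)
qed

lemma nn_integral_Icc:
  fixes g :: "real \<Rightarrow> real"
  assumes "continuous_on {a..b} g" "\<And>x. x \<in> {a..b} \<Longrightarrow> 0 \<le> g x"
  shows "(\<integral>\<^sup>+ x. ennreal (g x) * indicator {a..b} x \<partial>lborel) = ennreal (integral {a..b} g)"
proof -
  have "(g has_integral integral {a..b} g) {a..b}"
    by (intro integrable_integral integrable_continuous_interval assms)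
  from nn_integral_has_integral_lebesgue[OF assms(2) this]
  have "(\<integral>\<^sup>+ x. ennreal (indicator {a..b} x * g x) \<partial>lborel) = ennreal (integral {a..b} g)" by simp
  moreover have "(\<integral>\<^sup>+ x. ennreal (indicator {a..b} x * g x) \<partial>lborel) = (\<integral>\<^sup>+ x. ennreal (g x) * indicator {a..b} x \<partial>lborel)"
    by (intro nn_integral_cong) (auto simp: indicator_def)
  ultimately show ?thesis by simp
qed

text \<open>Polar coordinates without a change of variables: the disc integral is invariant under
  rotations, so it equals its average over all angles; after Fubini the inner integral is
  \<open>circ_int \<rho> (norm z)\<close>, and a radial integral remains.\<close>

lemma nn_integral_ball_polar:
  assumes \<rho>: "continuous_on UNIV \<rho>" and pos: "\<And>z. 0 \<le> \<rho> z" and t: "t \<ge> 0"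
  shows "(\<integral>\<^sup>+ z\<in>ball 0 t. ennreal (\<rho> z) \<partial>lborel) = ennreal (integral {0..t} (\<lambda>s. s * circ_int \<rho> s))"
proof -
  have [measurable]: "\<rho> \<in> borel_measurable borel" by (rule borel_measurable_continuous_onI[OF \<rho>])
  have [measurable]: "cis \<in> borel_measurable borel"
    by (intro borel_measurable_continuous_onI continuous_intros)
  have c0: "0 \<le> circ_int \<rho> s" for s
    unfolding circ_int_def by (intro integral_nonneg circ_int_integrand \<rho> pos)
  let ?I = "\<integral>\<^sup>+ z\<in>ball 0 t. ennreal (\<rho> z) \<partial>lborel"
  have "?I * ennreal (2 * pi) = (\<integral>\<^sup>+ \<theta>. ?I * indicator {0..2*pi} \<theta> \<partial>lborel)"
    by (subst nn_integral_cmult_indicator) auto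
  also have "\<dots> = (\<integral>\<^sup>+ \<theta>. (\<integral>\<^sup>+ z. ennreal (\<rho> (cis \<theta> * z)) * indicator (ball 0 t) z * indicator {0..2*pi} \<theta> \<partial>lborel) \<partial>lborel)"
  proof (intro nn_integral_cong)
    fix \<theta>
    have "?I = (\<integral>\<^sup>+ z\<in>ball 0 t. ennreal (\<rho> (cis \<theta> * z)) \<partial>lborel)"
      by (rule nn_integral_ball_rotate[symmetric]) auto
    then have "?I * indicator {0..2*pi} \<theta> = (\<integral>\<^sup>+ z\<in>ball 0 t. ennreal (\<rho> (cis \<theta> * z)) \<partial>lborel) * indicator {0..2*pi} \<theta>"
      by (rule arg_cong)
    also have "\<dots> = (\<integral>\<^sup>+ z. ennreal (\<rho> (cis \<theta> * z)) * indicator (ball 0 t) z * indicator {0..2*pi} \<theta> \<partial>lborel)"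
      by (rule nn_integral_multc[symmetric]) measurable
    finally show "?I * indicator {0..2*pi} \<theta> = \<dots>" .
  qed
  also have "\<dots> = (\<integral>\<^sup>+ z. (\<integral>\<^sup>+ \<theta>. ennreal (\<rho> (cis \<theta> * z)) * indicator (ball 0 t) z * indicator {0..2*pi} \<theta> \<partial>lborel) \<partial>lborel)"
    by (rule lborel_pair.Fubini') measurable
  also have "\<dots> = (\<integral>\<^sup>+ z\<in>ball (0::complex) t. ennreal (circ_int \<rho> (norm z)) \<partial>lborel)"
  proof (rule nn_integral_cong)
    fix z :: complex
    have "(\<integral>\<^sup>+ \<theta>. ennreal (\<rho> (cis \<theta> * z)) * indicator (ball 0 t) z * indicator {0..2*pi} \<theta> \<partial>lborel)
       = (\<integral>\<^sup>+ \<theta>. (ennreal (\<rho> (z * cis \<theta>)) * indicator {0..2*pi} \<theta>) * indicator (ball 0 t) z \<partial>lborel)"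
      by (simp add: mult_ac)
    also have "\<dots> = (\<integral>\<^sup>+ \<theta>. ennreal (\<rho> (z * cis \<theta>)) * indicator {0..2*pi} \<theta> \<partial>lborel) * indicator (ball 0 t) z"
      by (rule nn_integral_multc) measurable
    also have "(\<integral>\<^sup>+ \<theta>. ennreal (\<rho> (z * cis \<theta>)) * indicator {0..2*pi} \<theta> \<partial>lborel) = ennreal (circ_int \<rho> (norm z))"
      unfolding circ_int_norm[OF \<rho>, symmetric]
      by (intro nn_integral_Icc pos continuous_on_compose2[OF \<rho>] continuous_intros) auto
    finally show "(\<integral>\<^sup>+ \<theta>. ennreal (\<rho> (cis \<theta> * z)) * indicator (ball 0 t) z * indicator {0..2*pi} \<theta> \<partial>lborel)
       = ennreal (circ_int \<rho> (norm z)) * indicator (ball 0 t) z" .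
  qed
  also have "\<dots> = (\<integral>\<^sup>+ s. ennreal (2 * pi * s) * ennreal (circ_int \<rho> s) * indicator {0..t} s \<partial>lborel)"
  proof (rule nn_integral_ball_radial[OF _ t])
    have [measurable]: "circ_int \<rho> \<in> borel_measurable borel"
      by (intro borel_measurable_continuous_onI circ_int_continuous \<rho>)
    show "(\<lambda>s. ennreal (circ_int \<rho> s)) \<in> borel_measurable borel" by measurable
  qed
  also have "\<dots> = (\<integral>\<^sup>+ s. ennreal (2 * pi * (s * circ_int \<rho> s)) * indicator {0..t} s \<partial>lborel)"
    by (intro nn_integral_cong) (auto simp: indicator_def ennreal_mult[symmetric] c0 mult_ac)
  also have "\<dots> = ennreal (integral {0..t} (\<lambda>s. 2 * pi * (s * circ_int \<rho> s)))"
    by (intro nn_integral_Icc continuous_intros circ_int_continuous \<rho>) (auto intro!: mult_nonneg_nonneg c0)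
  also have "\<dots> = ennreal (integral {0..t} (\<lambda>s. s * circ_int \<rho> s)) * ennreal (2 * pi)"
  proof -
    have "0 \<le> integral {0..t} (\<lambda>s. s * circ_int \<rho> s)"
      by (intro integral_nonneg integrable_continuous_interval continuous_intros circ_int_continuous \<rho>)
        (auto intro!: mult_nonneg_nonneg c0)
    moreover have "integral {0..t} (\<lambda>s. 2 * pi * (s * circ_int \<rho> s)) = 2 * pi * integral {0..t} (\<lambda>s. s * circ_int \<rho> s)"
      by (rule integral_mult_right)
    ultimately show ?thesis by (simp add: ennreal_mult[symmetric] mult.commute)
  qed
  finally have "?I * ennreal (2 * pi) = ennreal (integral {0..t} (\<lambda>s. s * circ_int \<rho> s)) * ennreal (2 * pi)" .
  then have "ennreal (2 * pi) * ?I = ennreal (2 * pi) * ennreal (integral {0..t} (\<lambda>s. s * circ_int \<rho> s))"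
    by (simp only: mult.commute)
  then show ?thesis
    unfolding ennreal_mult_cancel_left by simp
qed

text \<open>Only \<open>t = 0\<close> is critical. Division by zero gives the value \<open>0\<close>
  there, and the quotient tends to the derivative at \<open>0\<close> of the primitive of
  \<open>s * circ_int \<rho> s\<close>, which is also \<open>0\<close>.\<close>

lemma nev_integrand_continuous:
  assumes \<rho>: "continuous_on UNIV \<rho>"
  shows "continuous_on {0..r} (\<lambda>t. integral {0..t} (\<lambda>s. s * circ_int \<rho> s) / t)"
proof (cases "r \<ge> 0")
  case True
  have cont: "continuous_on {0..r} (\<lambda>s. s * circ_int \<rho> s)" 
    by (intro continuous_intros circ_int_continuous \<rho>)
  have c1: "continuous_on {0..r} (\<lambda>t. integral {0..t} (\<lambda>s. s * circ_int \<rho> s))"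
    by (rule indefinite_integral_continuous_1[OF integrable_continuous_interval[OF cont]])
  have "((\<lambda>t. integral {0..t} (\<lambda>s. s * circ_int \<rho> s)) has_real_derivative 0 * circ_int \<rho> 0) (at 0 within {0..r})"
    by (rule integral_has_real_derivative[OF cont]) (use True in auto)
  then have d0: "((\<lambda>t. integral {0..t} (\<lambda>s. s * circ_int \<rho> s) / t) \<longlongrightarrow> 0) (at 0 within {0..r})"
    unfolding has_field_derivative_iff by simp
  show ?thesis
    unfolding continuous_on_def
  proof
    fix x assume x: "x \<in> {0..r}"
    show "((\<lambda>t. integral {0..t} (\<lambda>s. s * circ_int \<rho> s) / t) \<longlongrightarrow> integral {0..x} (\<lambda>s. s * circ_int \<rho> s) / x)
         (at x within {0..r})"
    proof (cases "x = 0")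
      case True then show ?thesis using d0 by simp
    next
      case False then show ?thesis
        using c1 x by (intro tendsto_divide tendsto_ident_at) (auto simp: continuous_on_def)
    qed
  qed
qed simp

lemma nevanlinna_nn_eq_nev:
  assumes \<rho>: "continuous_on UNIV \<rho>" and pos: "\<And>z. 0 \<le> \<rho> z"
  shows "nevanlinna_nn \<rho> r = ennreal (nev \<rho> r)"
proof -
  have c0: "0 \<le> circ_int \<rho> s" for s
    unfolding circ_int_def by (intro integral_nonneg circ_int_integrand \<rho> pos)
  have i0: "0 \<le> integral {0..t} (\<lambda>s. s * circ_int \<rho> s)" for t
    by (intro integral_nonneg integrable_continuous_interval continuous_intros circ_int_continuous \<rho>)
        (auto intro!: mult_nonneg_nonneg c0)
  have "nevanlinna_nn \<rho> r = (\<integral>\<^sup>+ t. ennreal (integral {0..t} (\<lambda>s. s * circ_int \<rho> s) / t) * indicator {0..r} t \<partial>lborel)"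
    unfolding nevanlinna_nn_def
  proof (rule nn_integral_cong_AE)
    have "AE t in lborel. t \<noteq> (0::real)" "AE t in lborel. t \<noteq> r" using AE_lborel_singleton by auto
    then show "AE t in lborel. ennreal (1 / t) * (\<integral>\<^sup>+ z\<in>ball 0 t. ennreal (\<rho> z) \<partial>lborel) * indicator {0<..<r} t
       = ennreal (integral {0..t} (\<lambda>s. s * circ_int \<rho> s) / t) * indicator {0..r} t"
    proof eventually_elim
      case (elim t)
      show ?case
      proof (cases "t \<in> {0<..<r}")
        case True
        then show ?thesis 
          by (simp add: nn_integral_ball_polar[OF \<rho> pos] ennreal_mult[symmetric] i0)
      next
        case False
        then show ?thesis using elim by (auto simp: indicator_def)
      qed
    qed
  qed
  also have "\<dots> = ennreal (nev \<rho> r)"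
    unfolding nev_def
    by (intro nn_integral_Icc nev_integrand_continuous \<rho>) (auto intro!: divide_nonneg_nonneg i0)
  finally show ?thesis .
qed

lemma nev_nonneg:
  assumes \<rho>: "continuous_on UNIV \<rho>" and pos: "\<And>z. 0 \<le> \<rho> z"
  shows "0 \<le> nev \<rho> r"
proof -
  have c0: "0 \<le> circ_int \<rho> s" for s
    unfolding circ_int_def by (intro integral_nonneg circ_int_integrand \<rho> pos)
  have i0: "0 \<le> integral {0..t} (\<lambda>s. s * circ_int \<rho> s)" for t
    by (intro integral_nonneg integrable_continuous_interval continuous_intros circ_int_continuous \<rho>)
        (auto intro!: mult_nonneg_nonneg c0)
  show ?thesis unfolding nev_def
    by (intro integral_nonneg integrable_continuous_interval nev_integrand_continuous \<rho>) 
       (auto intro!: divide_nonneg_nonneg i0)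
qed

lemma circ_int_add:
  assumes "continuous_on UNIV \<rho>" "continuous_on UNIV \<tau>"
  shows "circ_int (\<lambda>z. \<rho> z + \<tau> z) s = circ_int \<rho> s + circ_int \<tau> s"
  unfolding circ_int_def by (intro integral_add circ_int_integrand assms)

lemma circ_int_cmult: "circ_int (\<lambda>z. c * \<rho> z) s = c * circ_int \<rho> s"
  unfolding circ_int_def by simp

lemma nev_add:
  assumes "continuous_on UNIV \<rho>" "continuous_on UNIV \<tau>"
  shows "nev (\<lambda>z. \<rho> z + \<tau> z) r = nev \<rho> r + nev \<tau> r"
proof -
  have "integral {0..t} (\<lambda>s. s * circ_int (\<lambda>z. \<rho> z + \<tau> z) s) 
    = integral {0..t} (\<lambda>s. s * circ_int \<rho> s) + integral {0..t} (\<lambda>s. s * circ_int \<tau> s)" for t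
    unfolding circ_int_add[OF assms] distrib_left
    by (intro integral_add integrable_continuous_interval continuous_intros circ_int_continuous assms)
  then show ?thesis unfolding nev_def
    by (simp add: add_divide_distrib)
       (intro integral_add integrable_continuous_interval nev_integrand_continuous assms)
qed

lemma nev_cmult: "nev (\<lambda>z. c * \<rho> z) r = c * nev \<rho> r"
proof -
  have "integral {0..t} (\<lambda>s. s * circ_int (\<lambda>z. c * \<rho> z) s) / t = c * (integral {0..t} (\<lambda>s. s * circ_int \<rho> s) / t)" for t
    unfolding circ_int_cmult by (simp add: mult.left_commute[of _ c])
  then show ?thesis unfolding nev_def by (simp only: integral_mult_right)
qed

lemma nev_sum:
  assumes "finite I" "\<And>i. i \<in> I \<Longrightarrow> continuous_on UNIV (\<rho> i)"
  shows "nev (\<lambda>z. \<Sum>i\<in>I. \<rho> i z) r = (\<Sum>i\<in>I. nev (\<rho> i) r)"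
  using assms
proof (induction I rule: finite_induct)
  case empty
  show ?case using nev_cmult[of 0 "\<lambda>_. 0" r] by simp
next
  case (insert i I)
  then have "continuous_on UNIV (\<lambda>z. \<Sum>i\<in>I. \<rho> i z)" by (intro continuous_on_sum) auto
  then show ?case using insert by (simp add: nev_add)
qed

text \<open>Positive and negative part are continuous, so both have a finite functional and the
  difference of extended reals is one of real numbers.\<close>

lemma nevanlinna_eq_nev:
  assumes \<rho>: "continuous_on UNIV \<rho>"
  shows "nevanlinna \<rho> r = ereal (nev \<rho> r)"
proof -
  define p n where "p = (\<lambda>z. max 0 (\<rho> z))" and "n = (\<lambda>z. max 0 (- \<rho> z))"
  have pn: "continuous_on UNIV p" "continuous_on UNIV n" "\<And>z. 0 \<le> p z" "\<And>z. 0 \<le> n z"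
    unfolding p_def n_def by (auto intro!: continuous_intros \<rho>)
  have "nevanlinna_nn \<rho> r = nevanlinna_nn p r" "nevanlinna_nn (\<lambda>z. - \<rho> z) r = nevanlinna_nn n r"
  proof -
    have "ennreal (p z) = ennreal (\<rho> z)" "ennreal (n z) = ennreal (- \<rho> z)" for z
      by (auto simp: p_def n_def max_def ennreal_neg)
    then show "nevanlinna_nn \<rho> r = nevanlinna_nn p r" "nevanlinna_nn (\<lambda>z. - \<rho> z) r = nevanlinna_nn n r"
      unfolding nevanlinna_nn_def by simp_all
  qed
  then have "nevanlinna \<rho> r = ereal (nev p r) - ereal (nev n r)"
    using pn by (simp add: nevanlinna_def nevanlinna_nn_eq_nev nev_nonneg enn2ereal_ennreal)
  also have "\<dots> = ereal (nev (\<lambda>z. p z + (-1) * n z) r)"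
    using pn nev_cmult[of "-1" n r] by (subst nev_add) (auto intro!: continuous_intros)
  also have "(\<lambda>z. p z + (-1) * n z) = \<rho>" by (auto simp: p_def n_def max_def)
  finally show ?thesis .
qed

subsection \<open>The curvature inequality\<close>

text \<open>Names the partial derivatives that \<open>C2_on\<close> only asserts to exist, so that
  they can be computed with.\<close>

definition C2d :: "complex set \<Rightarrow> (complex \<Rightarrow> real) \<Rightarrow> (complex \<Rightarrow> real) \<Rightarrow> (complex \<Rightarrow> real) \<Rightarrow> (complex \<Rightarrow> real)
    \<Rightarrow> (complex \<Rightarrow> real) \<Rightarrow> (complex \<Rightarrow> real) \<Rightarrow> (complex \<Rightarrow> real) \<Rightarrow> bool" where
  "C2d A u p q pp pq qp qq \<longleftrightarrow> (\<forall>z\<in>A.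
     (u has_derivative (\<lambda>h. p z * Re h + q z * Im h)) (at z) \<and>
     (p has_derivative (\<lambda>h. pp z * Re h + pq z * Im h)) (at z) \<and>
     (q has_derivative (\<lambda>h. qp z * Re h + qq z * Im h)) (at z) \<and>
     isCont pp z \<and> isCont pq z \<and> isCont qp z \<and> isCont qq z)"

lemma C2_on_iff: "C2_on A u \<longleftrightarrow> (\<exists>p q pp pq qp qq. C2d A u p q pp pq qp qq)"
  unfolding C2_on_def C2d_def ..

lemma C2_on_cong:
  assumes "C2_on S u" "\<And>z. z \<in> S \<Longrightarrow> u z = v z" "open S"
  shows "C2_on S v"
proof -
  obtain p q pp pq qp qq where C: "C2d S u p q pp pq qp qq" using assms(1) by (auto simp: C2_on_iff)
  have "(v has_derivative D) (at z)" if "z \<in> S" "(u has_derivative D) (at z)" for z D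
    using has_derivative_transform_within_open[OF that(2) assms(3) that(1)] assms(2) by simp
  then have "C2d S v p q pp pq qp qq" using C unfolding C2d_def by auto
  then show ?thesis unfolding C2_on_iff by (intro exI)
qed

lemma derivative_along_curve:
  assumes u: "(u has_derivative (\<lambda>h. a * Re h + b * Im h)) (at (\<gamma> s))"
    and \<gamma>: "(\<gamma> has_vector_derivative d) (at s)"
  shows "((\<lambda>s. u (\<gamma> s)) has_real_derivative a * Re d + b * Im d) (at s)"
proof -
  have "((\<lambda>s. u (\<gamma> s)) has_derivative (\<lambda>h. a * Re (h *\<^sub>R d) + b * Im (h *\<^sub>R d))) (at s)"
    using \<gamma> unfolding has_vector_derivative_def by (rule has_derivative_compose) (rule u)
  then show ?thesis
    by (rule has_derivative_imp_has_field_derivative) (simp add: algebra_simps)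
qed

lemma cis_has_vector_derivative: "(cis has_vector_derivative \<i> * cis \<theta>) (at \<theta>)"
proof -
  have "((\<lambda>t. \<i> * of_real t) has_vector_derivative \<i>) (at \<theta>)"
    by (auto intro!: derivative_eq_intros simp: has_vector_derivative_def scaleR_conv_of_real mult.commute)
  from field_vector_diff_chain_at[OF this DERIV_exp] show ?thesis
    by (simp add: o_def cis_conv_exp[abs_def])
qed

lemma C2d_isCont:
  assumes "C2d A u p q pp pq qp qq" "z \<in> A"
  shows "isCont u z" "isCont p z" "isCont q z" "isCont pp z" "isCont pq z" "isCont qp z" "isCont qq z"
  using assms unfolding C2d_def by (auto dest: has_derivative_continuous)

text \<open>Jensen's formula, with \<open>pp + qq\<close> as the Laplacian. In polar coordinates
  \<open>s^2\<close> times the Laplacian consists of \<open>s^2\<close> times the second radial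
  derivative, \<open>s\<close> times the first, and the second angular derivative, which integrates
  to zero over a circle. So \<open>s * circ_int\<close> of the Laplacian is the derivative of
  \<open>s * M1 s\<close>, where \<open>M1\<close> is the derivative of \<open>circ_int u\<close>.
  Integrating, dividing by \<open>t\<close> and integrating again gives the claim.\<close>

lemma nev_laplacian:
  assumes C: "C2d UNIV u p q pp pq qp qq" and r: "0 \<le> r"
  shows "nev (\<lambda>z. pp z + qq z) r = circ_int u r - circ_int u 0"
proof -
  have cont: "continuous_on UNIV u" "continuous_on UNIV p" "continuous_on UNIV q" "continuous_on UNIV pp"
    "continuous_on UNIV pq" "continuous_on UNIV qp" "continuous_on UNIV qq"
    using C2d_isCont[OF C] by (simp_all add: continuous_on_eq_continuous_at)
  note [continuous_intros] = cont[THEN continuous_on_compose2, OF _ subset_UNIV]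
  have du: "(u has_derivative (\<lambda>h. p z * Re h + q z * Im h)) (at z)"
    and dp: "(p has_derivative (\<lambda>h. pp z * Re h + pq z * Im h)) (at z)"
    and dq: "(q has_derivative (\<lambda>h. qp z * Re h + qq z * Im h)) (at z)" for z
    using C by (auto simp: C2d_def)
  have line: "((\<lambda>s. of_real s * cis \<theta>) has_vector_derivative cis \<theta>) (at s)" for s \<theta>
    by (auto intro!: derivative_eq_intros simp: has_vector_derivative_def scaleR_conv_of_real)
  have circle: "((\<lambda>\<theta>. of_real s * cis \<theta>) has_vector_derivative of_real s * (\<i> * cis \<theta>)) (at \<theta>)" for s \<theta>
    by (intro has_vector_derivative_mult_right cis_has_vector_derivative)
  define M1 where "M1 = (\<lambda>s. integral {0..2*pi} (\<lambda>\<theta>. p (of_real s * cis \<theta>) * cos \<theta> + q (of_real s * cis \<theta>) * sin \<theta>))"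
  define W where "W = (\<lambda>s \<theta>. (pp (of_real s * cis \<theta>) * cos \<theta> + pq (of_real s * cis \<theta>) * sin \<theta>) * cos \<theta>
     + (qp (of_real s * cis \<theta>) * cos \<theta> + qq (of_real s * cis \<theta>) * sin \<theta>) * sin \<theta>)"
  define M2 where "M2 = (\<lambda>s. integral {0..2*pi} (W s))"
  have M: "(circ_int u has_real_derivative M1 s) (at s)" for s
  proof -
    have "((\<lambda>s. integral (cbox 0 (2*pi)) (\<lambda>\<theta>. u (of_real s * cis \<theta>))) has_real_derivative
       integral (cbox 0 (2*pi)) (\<lambda>\<theta>. p (of_real s * cis \<theta>) * cos \<theta> + q (of_real s * cis \<theta>) * sin \<theta>)) (at s within UNIV)"
    proof (rule leibniz_rule_field_derivative)
      show "((\<lambda>s. u (of_real s * cis \<theta>)) has_real_derivative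
         p (of_real s * cis \<theta>) * cos \<theta> + q (of_real s * cis \<theta>) * sin \<theta>) (at s within UNIV)" for s \<theta>
        using derivative_along_curve[OF du line] by simp
      show "(\<lambda>\<theta>. u (of_real s * cis \<theta>)) integrable_on cbox 0 (2 * pi)" for s
        by (auto intro!: integrable_continuous_interval continuous_intros)
      show "continuous_on (UNIV \<times> cbox 0 (2 * pi)) (\<lambda>(s, \<theta>). p (of_real s * cis \<theta>) * cos \<theta> + q (of_real s * cis \<theta>) * sin \<theta>)"
        unfolding split_beta by (auto intro!: continuous_intros)
    qed auto
    then show ?thesis by (simp add: circ_int_def[abs_def] M1_def)
  qed
  have M1: "(M1 has_real_derivative M2 s) (at s)" for s
  proof -
    have "((\<lambda>s. integral (cbox 0 (2*pi)) (\<lambda>\<theta>. p (of_real s * cis \<theta>) * cos \<theta> + q (of_real s * cis \<theta>) * sin \<theta>)) has_real_derivative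
       integral (cbox 0 (2*pi)) (W s)) (at s within UNIV)"
    proof (rule leibniz_rule_field_derivative)
      show "((\<lambda>s. p (of_real s * cis \<theta>) * cos \<theta> + q (of_real s * cis \<theta>) * sin \<theta>) has_real_derivative W s \<theta>) (at s within UNIV)" for s \<theta>
        unfolding W_def
        using derivative_along_curve[OF dp line] derivative_along_curve[OF dq line]
        by (intro DERIV_add DERIV_cmult_right) simp_all
      show "(\<lambda>\<theta>. p (of_real s * cis \<theta>) * cos \<theta> + q (of_real s * cis \<theta>) * sin \<theta>) integrable_on cbox 0 (2 * pi)" for s
        by (auto intro!: integrable_continuous_interval continuous_intros)
      show "continuous_on (UNIV \<times> cbox 0 (2 * pi)) (\<lambda>(s, \<theta>). W s \<theta>)"
        unfolding split_beta W_def by (auto intro!: continuous_intros)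
    qed auto
    then show ?thesis by (simp add: M1_def M2_def)
  qed
  have key: "s * circ_int (\<lambda>z. pp z + qq z) s = M1 s + s * M2 s" if "s \<noteq> 0" for s
  proof -
    define P where "P = (\<lambda>\<theta>. of_real s * (\<i> * cis \<theta>))"
    \<comment> \<open>\<open>w1\<close> is the derivative of \<open>u\<close> with respect to the
      angle on the circle of radius \<open>s\<close>, and \<open>w2\<close> is the derivative of
      \<open>w1\<close>. Periodicity of \<open>w1\<close> makes the integral of \<open>w2\<close>
      zero.\<close>
    define w1 where "w1 = (\<lambda>\<theta>. p (of_real s * cis \<theta>) * (- s * sin \<theta>) + q (of_real s * cis \<theta>) * (s * cos \<theta>))"
    define w2 where "w2 = (\<lambda>\<theta>. (pp (of_real s * cis \<theta>) * (- s * sin \<theta>) + pq (of_real s * cis \<theta>) * (s * cos \<theta>)) * (- s * sin \<theta>)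
       + (- s * cos \<theta>) * p (of_real s * cis \<theta>)
       + ((qp (of_real s * cis \<theta>) * (- s * sin \<theta>) + qq (of_real s * cis \<theta>) * (s * cos \<theta>)) * (s * cos \<theta>)
       + (- s * sin \<theta>) * q (of_real s * cis \<theta>)))"
    have "(w1 has_real_derivative w2 \<theta>) (at \<theta>)" for \<theta>
    proof -
      have a: "((\<lambda>\<theta>. p (of_real s * cis \<theta>)) has_real_derivative
          pp (of_real s * cis \<theta>) * (- s * sin \<theta>) + pq (of_real s * cis \<theta>) * (s * cos \<theta>)) (at \<theta>)"
        using derivative_along_curve[OF dp circle] by simp
      have b: "((\<lambda>\<theta>. q (of_real s * cis \<theta>)) has_real_derivative
          qp (of_real s * cis \<theta>) * (- s * sin \<theta>) + qq (of_real s * cis \<theta>) * (s * cos \<theta>)) (at \<theta>)"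
        using derivative_along_curve[OF dq circle] by simp
      have c: "((\<lambda>\<theta>. - s * sin \<theta>) has_real_derivative - s * cos \<theta>) (at \<theta>)"
        "((\<lambda>\<theta>. s * cos \<theta>) has_real_derivative - s * sin \<theta>) (at \<theta>)"
        by (auto intro!: derivative_eq_intros)
      show ?thesis unfolding w1_def w2_def
        by (intro DERIV_add DERIV_mult a b c)
    qed
    then have "(w2 has_integral (w1 (2*pi) - w1 0)) {0..2*pi}"
      by (intro fundamental_theorem_of_calculus)
        (auto simp: has_real_derivative_iff_has_vector_derivative[symmetric] intro: has_field_derivative_at_within)
    moreover have "w1 (2 * pi) = w1 0" by (simp add: w1_def cis.ctr)
    ultimately have w2: "integral {0..2*pi} w2 = 0" "w2 integrable_on {0..2*pi}" by (auto simp: integral_unique has_integral_integrable)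
    have sum: "s\<^sup>2 * (pp (of_real s * cis \<theta>) + qq (of_real s * cis \<theta>)) = s\<^sup>2 * W s \<theta> + 
        (s * (p (of_real s * cis \<theta>) * cos \<theta> + q (of_real s * cis \<theta>) * sin \<theta>) + w2 \<theta>)" for \<theta>
    proof -
      have aux: "s\<^sup>2 * (A + B) = s\<^sup>2 * ((A * c + C * d) * c + (D * c + B * d) * d) + (s * (E * c + F * d) +
          ((A * (- s * d) + C * (s * c)) * (- s * d) + (- s * c) * E + ((D * (- s * d) + B * (s * c)) * (s * c) + (- s * d) * F)))"
        if "c\<^sup>2 + d\<^sup>2 = 1" for A B C D E F c d :: real
      proof -
        have "s\<^sup>2 * ((A * c + C * d) * c + (D * c + B * d) * d) + (s * (E * c + F * d) +
          ((A * (- s * d) + C * (s * c)) * (- s * d) + (- s * c) * E + ((D * (- s * d) + B * (s * c)) * (s * c) + (- s * d) * F)))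
          = s\<^sup>2 * (A + B) * (c\<^sup>2 + d\<^sup>2)" by (simp add: algebra_simps power2_eq_square)
        then show ?thesis using that by simp
      qed
      show ?thesis unfolding W_def w2_def by (rule aux) simp
    qed
    have iW: "W s integrable_on {0..2*pi}"
      unfolding W_def by (auto intro!: integrable_continuous_interval continuous_intros)
    have i1: "(\<lambda>\<theta>. p (of_real s * cis \<theta>) * cos \<theta> + q (of_real s * cis \<theta>) * sin \<theta>) integrable_on {0..2*pi}"
      by (auto intro!: integrable_continuous_interval continuous_intros)
    have "s\<^sup>2 * circ_int (\<lambda>z. pp z + qq z) s 
       = integral {0..2*pi} (\<lambda>\<theta>. s\<^sup>2 * W s \<theta> + (s * (p (of_real s * cis \<theta>) * cos \<theta> + q (of_real s * cis \<theta>) * sin \<theta>) + w2 \<theta>))"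
      unfolding circ_int_def by (simp flip: sum)
    also have "\<dots> = s\<^sup>2 * M2 s + (s * M1 s + integral {0..2*pi} w2)"
      unfolding M1_def M2_def
      by (intro integral_unique has_integral_add has_integral_mult_right integrable_integral w2(2) iW i1)
    finally have "s * (s * circ_int (\<lambda>z. pp z + qq z) s) = s * (M1 s + s * M2 s)"
      using w2(1) by (simp add: algebra_simps power2_eq_square)
    then show ?thesis using that by simp
  qed
  have inner: "integral {0..t} (\<lambda>s. s * circ_int (\<lambda>z. pp z + qq z) s) = t * M1 t" if "0 \<le> t" for t
  proof -
    have "((\<lambda>s. s * circ_int (\<lambda>z. pp z + qq z) s) has_integral (t * M1 t - 0 * M1 0)) {0..t}"
    proof (rule fundamental_theorem_of_calculus_interior[OF that])
      show "continuous_on {0..t} (\<lambda>s. s * M1 s)"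
        by (intro continuous_intros continuous_at_imp_continuous_on ballI DERIV_isCont[OF M1])
      show "((\<lambda>s. s * M1 s) has_vector_derivative s * circ_int (\<lambda>z. pp z + qq z) s) (at s)" if "s \<in> {0<..<t}" for s
        using that unfolding has_real_derivative_iff_has_vector_derivative[symmetric]
        by (subst key) (auto intro!: derivative_eq_intros M1)
    qed
    then show ?thesis by (simp add: integral_unique)
  qed
  have "((\<lambda>t. integral {0..t} (\<lambda>s. s * circ_int (\<lambda>z. pp z + qq z) s) / t) has_integral (circ_int u r - circ_int u 0)) {0..r}"
  proof (rule fundamental_theorem_of_calculus_interior[OF r])
    show "continuous_on {0..r} (circ_int u)" by (rule circ_int_continuous) (rule cont)
    show "(circ_int u has_vector_derivative integral {0..t} (\<lambda>s. s * circ_int (\<lambda>z. pp z + qq z) s) / t) (at t)"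
      if "t \<in> {0<..<r}" for t
      using that M[of t] unfolding has_real_derivative_iff_has_vector_derivative[symmetric] by (subst inner) auto
  qed
  then show ?thesis unfolding nev_def by (rule integral_unique)
qed

text \<open>\<open>ddc\<close> iterates \<open>deriv\<close> along lines parallel to the axes; the
  inner derivative has to be known near the point, which is why \<open>A\<close> is open.\<close>

lemma ddc_C2d:
  assumes C: "C2d A u p q pp pq qp qq" and A: "open A" "z \<in> A"
  shows "ddc u z = (pp z + qq z) / (4 * pi)"
proof -
  have along: "(deriv ^^ 2) (\<lambda>s. u (z + e * of_real s)) 0 
      = (pp z * Re e + pq z * Im e) * Re e + (qp z * Re e + qq z * Im e) * Im e" for e
  proof -
    define \<gamma> where "\<gamma> = (\<lambda>s::real. z + e * of_real s)"
    have \<gamma>: "(\<gamma> has_vector_derivative e) (at s)" for s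
      unfolding \<gamma>_def has_vector_derivative_def
      by (auto intro!: derivative_eq_intros simp: scaleR_conv_of_real mult.commute)
    have \<gamma>0: "\<gamma> 0 = z" by (simp add: \<gamma>_def)
    have "continuous_on UNIV \<gamma>" unfolding \<gamma>_def by (intro continuous_intros)
    then have "open (\<gamma> -` A)" using A(1) by (simp add: open_vimage)
    then have ev: "eventually (\<lambda>s. \<gamma> s \<in> A) (nhds 0)"
      using A(2) \<gamma>0 by (intro eventually_nhds[THEN iffD2]) (auto intro!: exI[of _ "\<gamma> -` A"])
    have "eventually (\<lambda>s. deriv (\<lambda>s. u (\<gamma> s)) s = p (\<gamma> s) * Re e + q (\<gamma> s) * Im e) (nhds 0)"
      using ev
    proof eventually_elim
      case (elim s)
      show ?case
        by (intro DERIV_imp_deriv derivative_along_curve[OF _ \<gamma>]) (use C elim in \<open>auto simp: C2d_def\<close>)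
    qed
    then have "deriv (deriv (\<lambda>s. u (\<gamma> s))) 0 = deriv (\<lambda>s. p (\<gamma> s) * Re e + q (\<gamma> s) * Im e) 0"
      by (rule deriv_cong_ev) simp
    also have "\<dots> = (pp z * Re e + pq z * Im e) * Re e + (qp z * Re e + qq z * Im e) * Im e"
      using C A(2) \<gamma>0
      by (intro DERIV_imp_deriv DERIV_add DERIV_cmult_right derivative_along_curve[OF _ \<gamma>]) (auto simp: C2d_def)
    finally show ?thesis by (simp add: \<gamma>_def numeral_2_eq_2)
  qed
  show ?thesis using along[of 1] along[of \<i>] by (simp add: ddc_def)
qed

lemma ddc_cong:
  assumes "eventually (\<lambda>w. u w = v w) (nhds z)"
  shows "ddc u z = ddc v z"
proof -
  have along: "(deriv ^^ 2) (\<lambda>s. u (z + e * of_real s)) 0 = (deriv ^^ 2) (\<lambda>s. v (z + e * of_real s)) 0" for e :: complex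
  proof -
    have "((\<lambda>s::real. z + e * of_real s) \<longlongrightarrow> z + e * of_real 0) (nhds 0)"
      by (intro tendsto_intros filterlim_ident)
    then have "filterlim (\<lambda>s::real. z + e * of_real s) (nhds z) (nhds 0)" by simp
    then have ev: "eventually (\<lambda>s. u (z + e * of_real s) = v (z + e * of_real s)) (nhds 0)"
      by (rule eventually_compose_filterlim[OF assms])
    have "eventually (\<lambda>s. deriv (\<lambda>s. u (z + e * of_real s)) s = deriv (\<lambda>s. v (z + e * of_real s)) s) (nhds 0)"
      using eventually_eventually[THEN iffD2, OF ev]
    proof eventually_elim
      case (elim s)
      then show ?case by (rule deriv_cong_ev) simp
    qed
    then have "deriv (deriv (\<lambda>s. u (z + e * of_real s))) 0 = deriv (deriv (\<lambda>s. v (z + e * of_real s))) 0"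
      by (rule deriv_cong_ev) simp
    then show ?thesis by (simp add: numeral_2_eq_2)
  qed
  show ?thesis using along[of 1] along[of \<i>] by (simp add: ddc_def)
qed

text \<open>By Jensen's formula the functional of \<open>ddc u\<close> is a difference of two circle
  integrals divided by \<open>4 * pi\<close>. Each of them is at most \<open>2 * pi * B\<close> in
  absolute value, so the bound is \<open>B\<close> itself.\<close>

lemma nev_ddc_bound:
  assumes C: "C2_on UNIV u" and B: "\<And>z. \<bar>u z\<bar> \<le> B"
  shows "continuous_on UNIV (ddc u)" "r \<ge> 0 \<Longrightarrow> \<bar>nev (ddc u) r\<bar> \<le> B"
proof -
  obtain p q pp pq qp qq where C: "C2d UNIV u p q pp pq qp qq" using C by (auto simp: C2_on_iff)
  have eq: "ddc u = (\<lambda>z. (1 / (4 * pi)) * (pp z + qq z))" using ddc_C2d[OF C] by auto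
  note cc = C2d_isCont[OF C]
  show "continuous_on UNIV (ddc u)"
    unfolding eq using cc by (auto intro!: continuous_at_imp_continuous_on continuous_intros)
  have bd: "\<bar>circ_int u s\<bar> \<le> 2 * pi * B" for s
  proof -
    have cu: "continuous_on UNIV u" using cc by (auto intro!: continuous_at_imp_continuous_on)
    have "norm (integral (cbox 0 (2*pi)) (\<lambda>\<theta>. u (of_real s * cis \<theta>))) \<le> B * measure lborel (cbox 0 (2*pi))"
      using B order_trans[OF abs_ge_zero B[of 0]] by (intro has_integral_bound[OF _ integrable_integral]) 
         (use circ_int_integrand[OF cu, of "of_real s" 0 "2*pi"] in auto)
    then show ?thesis by (simp add: circ_int_def mult.commute)
  qed
  assume r: "r \<ge> 0"
  have "nev (ddc u) r = (1 / (4 * pi)) * (circ_int u r - circ_int u 0)"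
    unfolding eq nev_cmult nev_laplacian[OF C r] ..
  also have "\<bar>\<dots>\<bar> = (1 / (4 * pi)) * \<bar>circ_int u r - circ_int u 0\<bar>" by (simp add: abs_mult)
  also have "\<dots> \<le> (1 / (4 * pi)) * (4 * pi * B)"
    using bd[of r] bd[of 0] by (intro mult_left_mono) auto
  finally show "\<bar>nev (ddc u) r\<bar> \<le> B" by simp
qed

text \<open>The gradient is stored as one complex number. Gradient and Laplacian together are closed
  under composition with functions of one variable, because that chain rule involves only the
  Laplacian and the squared length of the gradient.\<close>

definition C2_grad_lap :: "complex set \<Rightarrow> (complex \<Rightarrow> real) \<Rightarrow> (complex \<Rightarrow> complex) \<Rightarrow> (complex \<Rightarrow> real) \<Rightarrow> bool" where
  "C2_grad_lap A u g l \<longleftrightarrow> (\<exists>p q pp pq qp qq. C2d A u p q pp pq qp qq \<and>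
     (\<forall>z\<in>A. g z = Complex (p z) (q z) \<and> l z = pp z + qq z))"

lemma C2_grad_lap_imp_C2_on: "C2_grad_lap A u g l \<Longrightarrow> C2_on A u"
  unfolding C2_grad_lap_def C2_on_iff by blast

lemma C2_grad_lap_ddc: "C2_grad_lap A u g l \<Longrightarrow> open A \<Longrightarrow> z \<in> A \<Longrightarrow> ddc u z = l z / (4 * pi)"
  unfolding C2_grad_lap_def by (auto simp: ddc_C2d)

lemma C2_grad_lap_add:
  assumes "C2_grad_lap A u g l" "C2_grad_lap A v h m"
  shows "C2_grad_lap A (\<lambda>z. u z + v z) (\<lambda>z. g z + h z) (\<lambda>z. l z + m z)"
proof -
  obtain p q pp pq qp qq where 1: "C2d A u p q pp pq qp qq" "\<And>z. z \<in> A \<Longrightarrow> g z = Complex (p z) (q z) \<and> l z = pp z + qq z"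
    using assms(1) unfolding C2_grad_lap_def by blast
  obtain p' q' pp' pq' qp' qq' where 2: "C2d A v p' q' pp' pq' qp' qq'" "\<And>z. z \<in> A \<Longrightarrow> h z = Complex (p' z) (q' z) \<and> m z = pp' z + qq' z"
    using assms(2) unfolding C2_grad_lap_def by blast
  have "C2d A (\<lambda>z. u z + v z) (\<lambda>z. p z + p' z) (\<lambda>z. q z + q' z) (\<lambda>z. pp z + pp' z) (\<lambda>z. pq z + pq' z)
     (\<lambda>z. qp z + qp' z) (\<lambda>z. qq z + qq' z)"
    using 1(1) 2(1) unfolding C2d_def
    by (auto intro!: derivative_eq_intros continuous_intros simp: algebra_simps)
  then show ?thesis unfolding C2_grad_lap_def using 1(2) 2(2)
    by (intro exI conjI) (assumption, auto simp: complex_eq_iff)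
qed

lemma C2_grad_lap_const: "C2_grad_lap A (\<lambda>z. c) (\<lambda>z. 0) (\<lambda>z. 0)"
  unfolding C2_grad_lap_def C2d_def
  by (rule exI[of _ "\<lambda>_. 0"])+ (auto simp: complex_eq_iff)

lemma C2_grad_lap_sum:
  assumes "finite I" "\<And>i. i \<in> I \<Longrightarrow> C2_grad_lap A (u i) (g i) (l i)"
  shows "C2_grad_lap A (\<lambda>z. \<Sum>i\<in>I. u i z) (\<lambda>z. \<Sum>i\<in>I. g i z) (\<lambda>z. \<Sum>i\<in>I. l i z)"
  using assms by (induction I rule: finite_induct) (auto intro: C2_grad_lap_const C2_grad_lap_add)

lemma C2_grad_lap_compose:
  assumes "C2_grad_lap A u g l"
    and \<psi>: "\<And>z. z \<in> A \<Longrightarrow> (\<psi> has_real_derivative \<psi>1 (u z)) (at (u z))"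
    and \<psi>1: "\<And>z. z \<in> A \<Longrightarrow> (\<psi>1 has_real_derivative \<psi>2 (u z)) (at (u z))"
    and \<psi>2: "\<And>z. z \<in> A \<Longrightarrow> isCont \<psi>2 (u z)"
  shows "C2_grad_lap A (\<lambda>z. \<psi> (u z)) (\<lambda>z. \<psi>1 (u z) *\<^sub>R g z) (\<lambda>z. \<psi>2 (u z) * (cmod (g z))\<^sup>2 + \<psi>1 (u z) * l z)"
proof -
  obtain p q pp pq qp qq where 1: "C2d A u p q pp pq qp qq" "\<And>z. z \<in> A \<Longrightarrow> g z = Complex (p z) (q z) \<and> l z = pp z + qq z"
    using assms(1) unfolding C2_grad_lap_def by blast
  have "C2d A (\<lambda>z. \<psi> (u z)) (\<lambda>z. \<psi>1 (u z) * p z) (\<lambda>z. \<psi>1 (u z) * q z)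
     (\<lambda>z. \<psi>2 (u z) * p z * p z + \<psi>1 (u z) * pp z) (\<lambda>z. \<psi>2 (u z) * q z * p z + \<psi>1 (u z) * pq z)
     (\<lambda>z. \<psi>2 (u z) * p z * q z + \<psi>1 (u z) * qp z) (\<lambda>z. \<psi>2 (u z) * q z * q z + \<psi>1 (u z) * qq z)"
    unfolding C2d_def
  proof (intro ballI)
    fix z assume z: "z \<in> A"
    note c = C2d_isCont[OF 1(1) z]
    have du: "(u has_derivative (\<lambda>h. p z * Re h + q z * Im h)) (at z)"
      and dp: "(p has_derivative (\<lambda>h. pp z * Re h + pq z * Im h)) (at z)"
      and dq: "(q has_derivative (\<lambda>h. qp z * Re h + qq z * Im h)) (at z)"
      using 1(1) z by (auto simp: C2d_def)
    have d0: "((\<lambda>z. \<psi> (u z)) has_derivative (\<lambda>h. \<psi>1 (u z) * (p z * Re h + q z * Im h))) (at z)"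
      using has_derivative_compose[OF du \<psi>[OF z, unfolded has_field_derivative_def]] .
    have d1: "((\<lambda>z. \<psi>1 (u z)) has_derivative (\<lambda>h. \<psi>2 (u z) * (p z * Re h + q z * Im h))) (at z)"
      using has_derivative_compose[OF du \<psi>1[OF z, unfolded has_field_derivative_def]] .
    have c1: "isCont (\<lambda>z. \<psi>1 (u z)) z" using d1 by (rule has_derivative_continuous)
    have c2: "isCont (\<lambda>z. \<psi>2 (u z)) z" using isCont_o2[OF c(1) \<psi>2[OF z]] .
    show "((\<lambda>z. \<psi> (u z)) has_derivative (\<lambda>h. \<psi>1 (u z) * p z * Re h + \<psi>1 (u z) * q z * Im h)) (at z) \<and>
       ((\<lambda>z. \<psi>1 (u z) * p z) has_derivative (\<lambda>h. (\<psi>2 (u z) * p z * p z + \<psi>1 (u z) * pp z) * Re h + (\<psi>2 (u z) * q z * p z + \<psi>1 (u z) * pq z) * Im h)) (at z) \<and>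
       ((\<lambda>z. \<psi>1 (u z) * q z) has_derivative (\<lambda>h. (\<psi>2 (u z) * p z * q z + \<psi>1 (u z) * qp z) * Re h + (\<psi>2 (u z) * q z * q z + \<psi>1 (u z) * qq z) * Im h)) (at z) \<and>
       isCont (\<lambda>z. \<psi>2 (u z) * p z * p z + \<psi>1 (u z) * pp z) z \<and> isCont (\<lambda>z. \<psi>2 (u z) * q z * p z + \<psi>1 (u z) * pq z) z \<and>
       isCont (\<lambda>z. \<psi>2 (u z) * p z * q z + \<psi>1 (u z) * qp z) z \<and> isCont (\<lambda>z. \<psi>2 (u z) * q z * q z + \<psi>1 (u z) * qq z) z"
      using c c1 c2
      by (intro conjI continuous_intros has_derivative_eq_rhs[OF d0] has_derivative_eq_rhs[OF has_derivative_mult[OF d1 dp]]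
          has_derivative_eq_rhs[OF has_derivative_mult[OF d1 dq]]) (auto simp: algebra_simps)
  qed
  moreover have "\<psi>1 (u z) *\<^sub>R g z = Complex (\<psi>1 (u z) * p z) (\<psi>1 (u z) * q z) \<and>
      \<psi>2 (u z) * (cmod (g z))\<^sup>2 + \<psi>1 (u z) * l z
       = (\<psi>2 (u z) * p z * p z + \<psi>1 (u z) * pp z) + (\<psi>2 (u z) * q z * q z + \<psi>1 (u z) * qq z)" if "z \<in> A" for z
  proof -
    have "g z = Complex (p z) (q z)" "l z = pp z + qq z" using 1(2)[OF that] by auto
    then show ?thesis by (simp only: complex_norm complex_scaleR) (simp add: power2_eq_square algebra_simps)
  qed
  ultimately show ?thesis unfolding C2_grad_lap_def by blast
qed

lemma C2_grad_lap_cmult: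
  assumes "C2_grad_lap A u g l"
  shows "C2_grad_lap A (\<lambda>z. c * u z) (\<lambda>z. c *\<^sub>R g z) (\<lambda>z. c * l z)"
  using C2_grad_lap_compose[OF assms, of "\<lambda>x. c * x" "\<lambda>_. c" "\<lambda>_. 0"]
  by (simp add: DERIV_cmult_Id)

lemma C2_grad_lap_diff:
  assumes "C2_grad_lap A u g l" "C2_grad_lap A v h m"
  shows "C2_grad_lap A (\<lambda>z. u z - v z) (\<lambda>z. g z - h z) (\<lambda>z. l z - m z)"
  using C2_grad_lap_add[OF assms(1) C2_grad_lap_cmult[OF assms(2), of "-1"]] by simp

lemma C2_grad_lap_ln:
  assumes "C2_grad_lap A u g l" "\<And>z. z \<in> A \<Longrightarrow> 0 < u z"
  shows "C2_grad_lap A (\<lambda>z. ln (u z)) (\<lambda>z. inverse (u z) *\<^sub>R g z) (\<lambda>z. - (inverse (u z) ^ 2) * (cmod (g z))\<^sup>2 + inverse (u z) * l z)"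
proof (rule C2_grad_lap_compose[OF assms(1)])
  fix z assume "z \<in> A"
  then have pos: "0 < u z" by (rule assms(2))
  show "(ln has_real_derivative inverse (u z)) (at (u z))" using pos by (simp add: DERIV_ln)
  show "(inverse has_real_derivative - (inverse (u z) ^ 2)) (at (u z))"
    using pos DERIV_inverse[of "u z" UNIV] by (simp add: numeral_2_eq_2)
  show "isCont (\<lambda>x. - (inverse x ^ 2)) (u z)" using pos by (auto intro!: continuous_intros)
qed

lemma C2_grad_lap_exp:
  assumes "C2_grad_lap A u g l"
  shows "C2_grad_lap A (\<lambda>z. exp (u z)) (\<lambda>z. exp (u z) *\<^sub>R g z) (\<lambda>z. exp (u z) * (cmod (g z))\<^sup>2 + exp (u z) * l z)"
  by (rule C2_grad_lap_compose[OF assms]) auto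

text \<open>By the Cauchy-Riemann equations the gradient is twice the conjugate of
  \<open>cnj a\<close> times the derivative of \<open>a\<close>. In the two pure second derivatives
  the terms with the second derivative of \<open>a\<close> have opposite signs, so they cancel in
  the Laplacian.\<close>

lemma C2_grad_lap_cmod_sq:
  assumes a: "a holomorphic_on A" "open A"
  shows "C2_grad_lap A (\<lambda>z. (cmod (a z))\<^sup>2) (\<lambda>z. 2 * cnj (cnj (a z) * deriv a z)) (\<lambda>z. 4 * (cmod (deriv a z))\<^sup>2)"
proof -
  let ?c = "\<lambda>z. cnj (a z) * deriv (deriv a) z"
  have "C2d A (\<lambda>z. (cmod (a z))\<^sup>2) (\<lambda>z. 2 * Re (cnj (a z) * deriv a z)) (\<lambda>z. -2 * Im (cnj (a z) * deriv a z))
     (\<lambda>z. 2 * (cmod (deriv a z))\<^sup>2 + 2 * Re (?c z)) (\<lambda>z. - 2 * Im (?c z)) (\<lambda>z. - 2 * Im (?c z))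
     (\<lambda>z. 2 * (cmod (deriv a z))\<^sup>2 - 2 * Re (?c z))"
    unfolding C2d_def
  proof (intro ballI)
    fix z assume z: "z \<in> A"
    have h1: "deriv a holomorphic_on A" and h2: "deriv (deriv a) holomorphic_on A"
      using a by (auto intro!: holomorphic_deriv)
    have c: "isCont a z" "isCont (deriv a) z" "isCont (deriv (deriv a)) z"
      using a h1 h2 z by (auto dest!: holomorphic_on_imp_continuous_on simp: continuous_on_eq_continuous_at)
    have da: "(a has_derivative (\<lambda>h. deriv a z * h)) (at z)"
      using holomorphic_derivI[OF a z] by (simp add: has_field_derivative_def)
    have da': "(deriv a has_derivative (\<lambda>h. deriv (deriv a) z * h)) (at z)"
      using holomorphic_derivI[OF h1 a(2) z] by (simp add: has_field_derivative_def)
    have ca: "((\<lambda>z. cnj (a z)) has_derivative (\<lambda>h. cnj (deriv a z * h))) (at z)"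
      by (rule has_derivative_cnj[OF da])
    have cc: "isCont (\<lambda>z. Re (?c z)) z" "isCont (\<lambda>z. Im (?c z)) z"
      by (intro isCont_Re isCont_Im continuous_mult isCont_cnj c)+
    have cm: "(cmod (deriv a z))\<^sup>2 = Re (deriv a z) * Re (deriv a z) + Im (deriv a z) * Im (deriv a z)"
      by (simp add: cmod_power2) (simp add: power2_eq_square)
    have sq: "(\<lambda>z. (cmod (a z))\<^sup>2) = (\<lambda>z. Re (cnj (a z) * a z))"
      by (rule ext) (simp add: cmod_power2, simp add: power2_eq_square)
    show "((\<lambda>z. (cmod (a z))\<^sup>2) has_derivative (\<lambda>h. 2 * Re (cnj (a z) * deriv a z) * Re h + -2 * Im (cnj (a z) * deriv a z) * Im h)) (at z) \<and>
      ((\<lambda>z. 2 * Re (cnj (a z) * deriv a z)) has_derivative (\<lambda>h. (2 * (cmod (deriv a z))\<^sup>2 + 2 * Re (?c z)) * Re h + - 2 * Im (?c z) * Im h)) (at z) \<and>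
      ((\<lambda>z. -2 * Im (cnj (a z) * deriv a z)) has_derivative (\<lambda>h. - 2 * Im (?c z) * Re h + (2 * (cmod (deriv a z))\<^sup>2 - 2 * Re (?c z)) * Im h)) (at z) \<and>
      isCont (\<lambda>z. 2 * (cmod (deriv a z))\<^sup>2 + 2 * Re (?c z)) z \<and> isCont (\<lambda>z. - 2 * Im (?c z)) z \<and> isCont (\<lambda>z. - 2 * Im (?c z)) z \<and>
      isCont (\<lambda>z. 2 * (cmod (deriv a z))\<^sup>2 - 2 * Re (?c z)) z"
      unfolding sq
      by (intro conjI continuous_add continuous_diff continuous_mult continuous_const continuous_power continuous_norm c(2) cc
          has_derivative_eq_rhs[OF has_derivative_Re[OF has_derivative_mult[OF ca da]]]
          has_derivative_eq_rhs[OF has_derivative_mult_right[OF has_derivative_Re[OF has_derivative_mult[OF ca da']]]]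
          has_derivative_eq_rhs[OF has_derivative_mult_right[OF has_derivative_Im[OF has_derivative_mult[OF ca da']]]])
        (auto simp: cm algebra_simps fun_eq_iff)
  qed
  then show ?thesis unfolding C2_grad_lap_def
    by (intro exI conjI) (assumption, auto simp: complex_eq_iff)
qed

lemma sum_cmod_diff_sq:
  fixes x y :: "'a \<Rightarrow> complex"
  shows "(\<Sum>k\<in>I. (cmod (x k - \<kappa> * y k))\<^sup>2) = (\<Sum>k\<in>I. (cmod (x k))\<^sup>2)
     - 2 * Re (cnj \<kappa> * (\<Sum>k\<in>I. cnj (y k) * x k)) + (cmod \<kappa>)\<^sup>2 * (\<Sum>k\<in>I. (cmod (y k))\<^sup>2)"
proof -
  have "(cmod (x k - \<kappa> * y k))\<^sup>2 = (cmod (x k))\<^sup>2 - 2 * Re (cnj \<kappa> * (cnj (y k) * x k)) + (cmod \<kappa>)\<^sup>2 * (cmod (y k))\<^sup>2" for k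
    unfolding cmod_power2 by (simp add: power2_eq_square algebra_simps)
  then show ?thesis
    by (simp add: sum.distrib sum_subtractf sum_distrib_left Re_sum del: complex_cnj_mult times_complex.simps)
qed

lemma cmod_sum_mult_le:
  fixes x y :: "'a \<Rightarrow> complex"
  shows "(cmod (\<Sum>k\<in>I. cnj (y k) * x k))\<^sup>2 \<le> (\<Sum>k\<in>I. (cmod (y k))\<^sup>2) * (\<Sum>k\<in>I. (cmod (x k))\<^sup>2)"
proof -
  have "cmod (\<Sum>k\<in>I. cnj (y k) * x k) \<le> (\<Sum>k\<in>I. cmod (y k) * cmod (x k))"
    by (rule order_trans[OF norm_sum]) (simp add: norm_mult)
  then have "(cmod (\<Sum>k\<in>I. cnj (y k) * x k))\<^sup>2 \<le> (\<Sum>k\<in>I. cmod (y k) * cmod (x k))\<^sup>2"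
    by (rule power_mono) simp
  also have "\<dots> \<le> (\<Sum>k\<in>I. (cmod (y k))\<^sup>2) * (\<Sum>k\<in>I. (cmod (x k))\<^sup>2)"
    by (rule Cauchy_Schwarz_ineq_sum)
  finally show ?thesis .
qed

text \<open>\<open>\<beta>0\<close> is the pairing of the tuple \<open>b\<close> with its
  derivative, \<open>\<alpha>\<close> that of \<open>a\<close>; \<open>A2\<close> and
  \<open>B2\<close> are the squared norms of the derivatives, and \<open>Bt\<close> is the one of
  the covariant derivative of \<open>b\<close>. In terms of
  \<open>\<beta> = \<beta>0 - \<kappa> * B\<close> the mixed terms cancel. What remains is the
  hypothesis on \<open>A2\<close> times \<open>\<delta> * Q\<close>, plus
  \<open>1 - \<epsilon>\<close> times the Cauchy-Schwarz inequality with \<open>B\<close> enlarged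
  to \<open>Q\<close>.\<close>

lemma curvature_inequality_real:
  fixes \<alpha> \<beta>0 \<kappa> :: complex and N B Q \<delta> \<epsilon> A2 B2 Bt :: real
  assumes N: "0 < N" and B: "0 \<le> B" and \<delta>: "0 < \<delta>" and \<epsilon>: "0 \<le> \<epsilon>" "\<epsilon> \<le> 1"
    and Q: "Q = B + \<delta> * N" and \<alpha>: "\<alpha> = \<kappa> * of_real N"
    and A2: "(cmod \<kappa>)\<^sup>2 * N \<le> A2"
    and Bt: "Bt = B2 - 2 * Re (cnj \<kappa> * \<beta>0) + (cmod \<kappa>)\<^sup>2 * B" and Bt0: "0 \<le> Bt"
    and CS: "(cmod (\<beta>0 - \<kappa> * of_real B))\<^sup>2 \<le> B * Bt"
  shows "\<epsilon> * Bt / Q \<le> ((B2 + \<delta> * A2) / Q - (cmod (\<beta>0 + of_real \<delta> * \<alpha>))\<^sup>2 / Q\<^sup>2)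
     + \<epsilon> * (cmod ((\<beta>0 + of_real \<delta> * \<alpha>) / of_real Q - \<kappa>))\<^sup>2"
proof -
  have Qp: "0 < Q" using assms by (simp add: add_nonneg_pos)
  define \<beta> where "\<beta> = \<beta>0 - \<kappa> * of_real B"
  have \<gamma>: "\<beta>0 + of_real \<delta> * \<alpha> = \<beta> + \<kappa> * of_real Q" by (simp add: \<beta>_def \<alpha> Q algebra_simps)
  have s: "(cmod (\<beta> + \<kappa> * of_real Q))\<^sup>2 = (cmod \<beta>)\<^sup>2 + 2 * Re (cnj \<kappa> * \<beta>) * Q + (cmod \<kappa>)\<^sup>2 * Q\<^sup>2"
    unfolding cmod_power2 by (simp add: power2_eq_square algebra_simps)
  have \<beta>0: "Re (cnj \<kappa> * \<beta>0) = Re (cnj \<kappa> * \<beta>) + (cmod \<kappa>)\<^sup>2 * B"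
    unfolding cmod_power2 by (simp add: \<beta>_def power2_eq_square algebra_simps)
  have d: "(\<beta> + \<kappa> * of_real Q) / of_real Q - \<kappa> = \<beta> / of_real Q" using Qp by (simp add: field_simps)
  have CS': "(cmod \<beta>)\<^sup>2 \<le> Q * Bt"
  proof -
    have "B * Bt \<le> Q * Bt" using Bt0 N \<delta> unfolding Q by (intro mult_right_mono) auto
    then show ?thesis using CS by (simp add: \<beta>_def)
  qed
  \<comment> \<open>The claim multiplied by \<open>Q\<^sup>2\<close>.\<close>
  have "\<epsilon> * Bt * Q \<le> (B2 + \<delta> * A2) * Q - ((cmod \<beta>)\<^sup>2 + 2 * Re (cnj \<kappa> * \<beta>) * Q + (cmod \<kappa>)\<^sup>2 * Q\<^sup>2) + \<epsilon> * (cmod \<beta>)\<^sup>2"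
  proof -
    have "(1 - \<epsilon>) * (cmod \<beta>)\<^sup>2 \<le> (1 - \<epsilon>) * (Q * Bt)" using CS' \<epsilon> by (intro mult_left_mono) auto
    moreover have "\<delta> * ((cmod \<kappa>)\<^sup>2 * N) * Q \<le> \<delta> * A2 * Q" using A2 \<delta> Qp by (intro mult_right_mono mult_left_mono) auto
    moreover have "B2 = Bt + 2 * Re (cnj \<kappa> * \<beta>) + (cmod \<kappa>)\<^sup>2 * B" using Bt \<beta>0 by linarith
    moreover have "(cmod \<kappa>)\<^sup>2 * Q\<^sup>2 = (cmod \<kappa>)\<^sup>2 * B * Q + \<delta> * ((cmod \<kappa>)\<^sup>2 * N) * Q"
      by (simp add: Q algebra_simps power2_eq_square)
    ultimately show ?thesis by (simp add: algebra_simps)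
  qed
  then have "\<epsilon> * Bt * Q / Q\<^sup>2 \<le> ((B2 + \<delta> * A2) * Q - (cmod (\<beta> + \<kappa> * of_real Q))\<^sup>2 + \<epsilon> * (cmod \<beta>)\<^sup>2) / Q\<^sup>2"
    unfolding s by (intro divide_right_mono) auto
  also have "\<dots> = ((B2 + \<delta> * A2) / Q - (cmod (\<beta> + \<kappa> * of_real Q))\<^sup>2 / Q\<^sup>2) + \<epsilon> * (cmod (\<beta> / of_real Q))\<^sup>2"
    using Qp by (simp add: norm_divide power_divide add_divide_distrib diff_divide_distrib power2_eq_square)
  also have "\<epsilon> * Bt * Q / Q\<^sup>2 = \<epsilon> * Bt / Q" using Qp by (simp add: power2_eq_square)
  finally show ?thesis unfolding \<gamma> d .
qed

text \<open>The frame of the line bundle is normalised at each point by subtracting \<open>\<kappa>\<close> times the section,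
  which makes the derivative of \<open>a\<close> orthogonal to \<open>a\<close>; in this frame the curvature of \<open>ln N\<close>
  is a sum of squares.\<close>

locale holomorphic_tuples =
  fixes A :: "complex set" and I J :: "nat set" and a b :: "nat \<Rightarrow> complex \<Rightarrow> complex"
  assumes A: "open A" and fin: "finite I" "finite J"
    and hol_a: "\<And>k. k \<in> I \<Longrightarrow> a k holomorphic_on A" and hol_b: "\<And>k. k \<in> J \<Longrightarrow> b k holomorphic_on A"
    and nonzero: "\<And>z. z \<in> A \<Longrightarrow> \<exists>k\<in>I. a k z \<noteq> 0"
begin

definition "N z = (\<Sum>k\<in>I. (cmod (a k z))\<^sup>2)"
definition "B z = (\<Sum>k\<in>J. (cmod (b k z))\<^sup>2)"
text \<open>This is the derivative of \<open>ln N\<close> with respect to the holomorphic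
  coordinate. Hence \<open>deriv (b k) z - \<kappa> z * b k z\<close> is the covariant derivative
  for the Chern connection of the metric with weight \<open>ln N\<close>, and \<open>E\<close> and
  \<open>R\<close> are squared lengths of covariant derivatives in that metric.\<close>

definition "\<kappa> z = (\<Sum>k\<in>I. cnj (a k z) * deriv (a k) z) / of_real (N z)"
definition "E z = (\<Sum>k\<in>I. (cmod (deriv (a k) z - \<kappa> z * a k z))\<^sup>2) / N z"
definition "R z = (\<Sum>k\<in>J. (cmod (deriv (b k) z - \<kappa> z * b k z))\<^sup>2) / N z"

lemma N_pos: "z \<in> A \<Longrightarrow> 0 < N z"
  using nonzero[of z] unfolding N_def by (metis fin(1) sum_pos2 zero_le_power2 zero_less_norm_iff zero_less_power)

lemma B_nonneg: "0 \<le> B z"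
  unfolding B_def by (intro sum_nonneg) auto

lemma N_C2: "C2_grad_lap A N (\<lambda>z. 2 * cnj (\<Sum>k\<in>I. cnj (a k z) * deriv (a k) z)) (\<lambda>z. 4 * (\<Sum>k\<in>I. (cmod (deriv (a k) z))\<^sup>2))"
  using C2_grad_lap_sum[OF fin(1) C2_grad_lap_cmod_sq[OF hol_a A]]
  by (simp add: N_def[abs_def] sum_distrib_left)

lemma B_C2: "C2_grad_lap A B (\<lambda>z. 2 * cnj (\<Sum>k\<in>J. cnj (b k z) * deriv (b k) z)) (\<lambda>z. 4 * (\<Sum>k\<in>J. (cmod (deriv (b k) z))\<^sup>2))"
  using C2_grad_lap_sum[OF fin(2) C2_grad_lap_cmod_sq[OF hol_b A]]
  by (simp add: B_def[abs_def] sum_distrib_left)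

lemma \<kappa>_N: "z \<in> A \<Longrightarrow> (\<Sum>k\<in>I. cnj (a k z) * deriv (a k) z) = \<kappa> z * of_real (N z)"
  using N_pos[of z] by (simp add: \<kappa>_def)

text \<open>Pythagoras: \<open>\<kappa> * a\<close> is the orthogonal projection of the derivative
  of \<open>a\<close> onto \<open>a\<close>.\<close>

lemma E_eq: 
  assumes "z \<in> A"
  shows "E z = (\<Sum>k\<in>I. (cmod (deriv (a k) z))\<^sup>2) / N z - (cmod (\<kappa> z))\<^sup>2"
proof -
  have "E z * N z = (\<Sum>k\<in>I. (cmod (deriv (a k) z))\<^sup>2) - 2 * Re (cnj (\<kappa> z) * (\<kappa> z * of_real (N z))) + (cmod (\<kappa> z))\<^sup>2 * N z"
    using N_pos[OF assms] sum_cmod_diff_sq[of "\<lambda>k. deriv (a k) z" "\<kappa> z" "\<lambda>k. a k z" I]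
    by (simp add: E_def \<kappa>_N[OF assms] N_def)
  also have "Re (cnj (\<kappa> z) * (\<kappa> z * of_real (N z))) = (cmod (\<kappa> z))\<^sup>2 * N z"
    unfolding cmod_power2 by (simp add: power2_eq_square algebra_simps)
  finally show ?thesis using N_pos[OF assms] by (simp add: field_simps)
qed

lemma E_nonneg: "z \<in> A \<Longrightarrow> 0 \<le> E z"
  using N_pos[of z] by (simp add: E_def sum_nonneg)

lemma C2_ln_N: "C2_on A (\<lambda>z. ln (N z))"
  using C2_grad_lap_imp_C2_on[OF C2_grad_lap_ln[OF N_C2 N_pos]] .

lemma ddc_ln_N:
  assumes "z \<in> A"
  shows "ddc (\<lambda>z. ln (N z)) z = E z / pi"
proof -
  note N = N_pos[OF assms]
  have "ddc (\<lambda>z. ln (N z)) z = (- ((inverse (N z))\<^sup>2) * (cmod (2 * cnj (\<kappa> z * of_real (N z))))\<^sup>2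
      + inverse (N z) * (4 * (\<Sum>k\<in>I. (cmod (deriv (a k) z))\<^sup>2))) / (4 * pi)"
    using C2_grad_lap_ddc[OF C2_grad_lap_ln[OF N_C2 N_pos] A assms] by (simp add: \<kappa>_N[OF assms])
  also have "\<dots> = E z / pi"
    using N unfolding E_eq[OF assms]
    by (simp add: norm_mult power_mult_distrib field_simps)
  finally show ?thesis .
qed

text \<open>This form avoids the quotient: \<open>B + \<delta> * N\<close> is a weighted sum of
  squared moduli like \<open>N\<close>, so the derivatives of the power follow from those of two
  such sums through \<open>ln\<close> and \<open>exp\<close>.\<close>

lemma powr_eq_exp:
  assumes "z \<in> A" "0 < \<delta>"
  shows "(B z / N z + \<delta>) powr \<epsilon> = exp (\<epsilon> * (ln (B z + \<delta> * N z) - ln (N z)))"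
proof -
  have "0 < N z" "0 \<le> B z" using assms N_pos B_nonneg by auto
  moreover have "B z / N z + \<delta> = (B z + \<delta> * N z) / N z" using \<open>0 < N z\<close> by (simp add: field_simps)
  moreover have "0 < B z + \<delta> * N z" using calculation assms by (simp add: add_nonneg_pos)
  ultimately show ?thesis by (simp add: powr_def ln_div)
qed

lemma Q_pos: "z \<in> A \<Longrightarrow> 0 < \<delta> \<Longrightarrow> 0 < B z + \<delta> * N z"
  using N_pos B_nonneg by (simp add: add_nonneg_pos)

text \<open>\<open>\<gamma>\<close> plays for \<open>B + \<delta> * N\<close> the role that the
  pairing of \<open>a\<close> with its derivative plays for \<open>N\<close>: twice its conjugate is
  the gradient. The formula for \<open>l\<close> is the Laplacian of the exponential of a difference
  of logarithms.\<close>

lemma powr_C2: 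
  assumes "0 < \<delta>"
  defines "\<gamma> \<equiv> \<lambda>z. (\<Sum>k\<in>J. cnj (b k z) * deriv (b k) z) + of_real \<delta> * (\<kappa> z * of_real (N z))"
  shows "\<exists>g l. C2_grad_lap A (\<lambda>z. exp (\<epsilon> * (ln (B z + \<delta> * N z) - ln (N z)))) g l \<and>
    (\<forall>z\<in>A. l z = exp (\<epsilon> * (ln (B z + \<delta> * N z) - ln (N z))) *
      (\<epsilon>\<^sup>2 * (4 * (cmod (\<gamma> z / of_real (B z + \<delta> * N z) - \<kappa> z))\<^sup>2) +
       \<epsilon> * (4 * (((\<Sum>k\<in>J. (cmod (deriv (b k) z))\<^sup>2) + \<delta> * (\<Sum>k\<in>I. (cmod (deriv (a k) z))\<^sup>2)) / (B z + \<delta> * N z)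
          - (cmod (\<gamma> z))\<^sup>2 / (B z + \<delta> * N z)\<^sup>2) - 4 * E z)))"
proof -
  let ?Q = "\<lambda>z. B z + \<delta> * N z"
  define gQ where "gQ = (\<lambda>z. 2 * cnj (\<gamma> z))"
  define gN where "gN = (\<lambda>z. 2 * cnj (\<kappa> z * of_real (N z)))"
  define lQ where "lQ = (\<lambda>z. 4 * ((\<Sum>k\<in>J. (cmod (deriv (b k) z))\<^sup>2) + \<delta> * (\<Sum>k\<in>I. (cmod (deriv (a k) z))\<^sup>2)))"
  define lN where "lN = (\<lambda>z. 4 * (\<Sum>k\<in>I. (cmod (deriv (a k) z))\<^sup>2))"
  have cong: "C2_grad_lap A u g' l'" if "C2_grad_lap A u g l" "\<And>z. z \<in> A \<Longrightarrow> g' z = g z" "\<And>z. z \<in> A \<Longrightarrow> l' z = l z" for u g g' l l'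
    using that unfolding C2_grad_lap_def by metis
  have CN: "C2_grad_lap A N gN lN"
    by (rule cong[OF N_C2]) (auto simp: gN_def lN_def \<kappa>_N)
  have CQ: "C2_grad_lap A ?Q gQ lQ"
    by (rule cong[OF C2_grad_lap_add[OF B_C2 C2_grad_lap_cmult[OF N_C2]]])
      (auto simp: gQ_def lQ_def \<gamma>_def \<kappa>_N scaleR_conv_of_real algebra_simps)
  have LQ: "C2_grad_lap A (\<lambda>z. ln (?Q z)) (\<lambda>z. inverse (?Q z) *\<^sub>R gQ z) (\<lambda>z. - (inverse (?Q z) ^ 2) * (cmod (gQ z))\<^sup>2 + inverse (?Q z) * lQ z)"
    by (rule C2_grad_lap_ln[OF CQ Q_pos[OF _ assms(1)]])
  have LN: "C2_grad_lap A (\<lambda>z. ln (N z)) (\<lambda>z. inverse (N z) *\<^sub>R gN z) (\<lambda>z. - (inverse (N z) ^ 2) * (cmod (gN z))\<^sup>2 + inverse (N z) * lN z)"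
    by (rule C2_grad_lap_ln[OF CN N_pos])
  note L = C2_grad_lap_exp[OF C2_grad_lap_cmult[OF C2_grad_lap_diff[OF LQ LN], of \<epsilon>]]
  show ?thesis
  proof (intro exI conjI, rule L, rule ballI)
    fix z assume z: "z \<in> A"
    note N = N_pos[OF z] and Q = Q_pos[OF z assms(1)]
    have "inverse (?Q z) *\<^sub>R gQ z - inverse (N z) *\<^sub>R gN z = 2 * cnj (\<gamma> z / of_real (?Q z) - \<kappa> z)"
      using N by (simp add: gQ_def gN_def scaleR_conv_of_real field_simps)
    then have g: "(cmod (\<epsilon> *\<^sub>R (inverse (?Q z) *\<^sub>R gQ z - inverse (N z) *\<^sub>R gN z)))\<^sup>2
        = \<epsilon>\<^sup>2 * (4 * (cmod (\<gamma> z / of_real (?Q z) - \<kappa> z))\<^sup>2)"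
      by (simp add: norm_mult power_mult_distrib del: complex_cnj_diff complex_cnj_divide)
    have lQ: "- (inverse (?Q z) ^ 2) * (cmod (gQ z))\<^sup>2 + inverse (?Q z) * lQ z = 
       4 * (((\<Sum>k\<in>J. (cmod (deriv (b k) z))\<^sup>2) + \<delta> * (\<Sum>k\<in>I. (cmod (deriv (a k) z))\<^sup>2)) / (?Q z)
          - (cmod (\<gamma> z))\<^sup>2 / (?Q z)\<^sup>2)"
      by (simp add: gQ_def lQ_def norm_mult power_mult_distrib power_inverse divide_inverse algebra_simps)
    have lN: "- (inverse (N z) ^ 2) * (cmod (gN z))\<^sup>2 + inverse (N z) * lN z = 4 * E z"
      using N unfolding E_eq[OF z] by (simp add: gN_def lN_def norm_mult power_mult_distrib field_simps)
    show "exp (\<epsilon> * (ln (?Q z) - ln (N z))) * (cmod (\<epsilon> *\<^sub>R (inverse (?Q z) *\<^sub>R gQ z - inverse (N z) *\<^sub>R gN z)))\<^sup>2 +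
      exp (\<epsilon> * (ln (?Q z) - ln (N z))) * (\<epsilon> * (- ((inverse (?Q z))\<^sup>2) * (cmod (gQ z))\<^sup>2 + inverse (?Q z) * lQ z -
        (- ((inverse (N z))\<^sup>2) * (cmod (gN z))\<^sup>2 + inverse (N z) * lN z))) =
     exp (\<epsilon> * (ln (?Q z) - ln (N z))) * (\<epsilon>\<^sup>2 * (4 * (cmod (\<gamma> z / of_real (?Q z) - \<kappa> z))\<^sup>2) +
       \<epsilon> * (4 * (((\<Sum>k\<in>J. (cmod (deriv (b k) z))\<^sup>2) + \<delta> * (\<Sum>k\<in>I. (cmod (deriv (a k) z))\<^sup>2)) / (?Q z)
          - (cmod (\<gamma> z))\<^sup>2 / (?Q z)\<^sup>2) - 4 * E z))"
      unfolding g lQ lN by (simp only: distrib_left)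
  qed
qed

lemma powr_C2_on: "0 < \<delta> \<Longrightarrow> C2_on A (\<lambda>z. (B z / N z + \<delta>) powr \<epsilon>)"
  using powr_C2[of \<delta> \<epsilon>] by (auto intro!: C2_on_cong[OF C2_grad_lap_imp_C2_on] powr_eq_exp[symmetric] A)

text \<open>In the Laplacian of the power, \<open>- ln N\<close> contributes minus the power times
  \<open>E\<close>; after multiplication by \<open>pi / \<epsilon>\<close> this cancels the first
  summand on the right. Both sides then share the factor \<open>u powr \<epsilon>\<close>, and the
  rest is \<open>curvature_inequality_real\<close>.\<close>

lemma curvature_inequality:
  assumes z: "z \<in> A" and \<delta>: "0 < \<delta>" and \<epsilon>: "0 < \<epsilon>" "\<epsilon> \<le> 1"
  shows "\<epsilon> * (B z / N z + \<delta>) powr (\<epsilon> - 1) * R z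
    \<le> (B z / N z + \<delta>) powr \<epsilon> * E z + pi / \<epsilon> * ddc (\<lambda>z. (B z / N z + \<delta>) powr \<epsilon>) z"
proof -
  define \<gamma> where "\<gamma> = (\<Sum>k\<in>J. cnj (b k z) * deriv (b k) z) + of_real \<delta> * (\<kappa> z * of_real (N z))"
  define Q where "Q = B z + \<delta> * N z"
  define u where "u = B z / N z + \<delta>"
  define A2 where "A2 = (\<Sum>k\<in>I. (cmod (deriv (a k) z))\<^sup>2)"
  define B2 where "B2 = (\<Sum>k\<in>J. (cmod (deriv (b k) z))\<^sup>2)"
  define Bt where "Bt = (\<Sum>k\<in>J. (cmod (deriv (b k) z - \<kappa> z * b k z))\<^sup>2)"
  note N = N_pos[OF z] and Q = Q_pos[OF z \<delta>, folded Q_def]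
  have u: "u = Q / N z" "0 < u" using N Q by (auto simp: u_def Q_def field_simps)
  have curv: "\<epsilon> * Bt / Q \<le> ((B2 + \<delta> * A2) / Q - (cmod \<gamma>)\<^sup>2 / Q\<^sup>2) + \<epsilon> * (cmod (\<gamma> / of_real Q - \<kappa> z))\<^sup>2"
    unfolding \<gamma>_def
  proof (rule curvature_inequality_real[OF N B_nonneg \<delta>])
    show "(cmod (\<kappa> z))\<^sup>2 * N z \<le> A2"
      using E_nonneg[OF z] N unfolding E_eq[OF z] A2_def by (simp add: field_simps)
    show "Bt = B2 - 2 * Re (cnj (\<kappa> z) * (\<Sum>k\<in>J. cnj (b k z) * deriv (b k) z)) + (cmod (\<kappa> z))\<^sup>2 * B z"
      unfolding Bt_def B2_def B_def by (rule sum_cmod_diff_sq)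
    have "(\<Sum>k\<in>J. cnj (b k z) * deriv (b k) z) - \<kappa> z * of_real (B z) = (\<Sum>k\<in>J. cnj (b k z) * (deriv (b k) z - \<kappa> z * b k z))"
      unfolding B_def of_real_sum sum_distrib_left sum_subtractf[symmetric]
    proof (intro sum.cong refl)
      fix k
      have "of_real ((cmod (b k z))\<^sup>2) = b k z * cnj (b k z)"
        by (metis complex_norm_square of_real_power)
      then show "cnj (b k z) * deriv (b k) z - \<kappa> z * of_real ((cmod (b k z))\<^sup>2) = cnj (b k z) * (deriv (b k) z - \<kappa> z * b k z)"
        by (simp add: algebra_simps)
    qed
    then show "(cmod ((\<Sum>k\<in>J. cnj (b k z) * deriv (b k) z) - \<kappa> z * of_real (B z)))\<^sup>2 \<le> B z * Bt"
      unfolding B_def Bt_def using cmod_sum_mult_le by metis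
  qed (use \<epsilon> in \<open>auto simp: Q_def Bt_def sum_nonneg\<close>)
  have d: "ddc (\<lambda>z. (B z / N z + \<delta>) powr \<epsilon>) z = u powr \<epsilon> * (\<epsilon>\<^sup>2 * (4 * (cmod (\<gamma> / of_real Q - \<kappa> z))\<^sup>2) +
       \<epsilon> * (4 * ((B2 + \<delta> * A2) / Q - (cmod \<gamma>)\<^sup>2 / Q\<^sup>2) - 4 * E z)) / (4 * pi)"
  proof -
    obtain g l where gl: "C2_grad_lap A (\<lambda>z. exp (\<epsilon> * (ln (B z + \<delta> * N z) - ln (N z)))) g l"
      "l z = exp (\<epsilon> * (ln Q - ln (N z))) * (\<epsilon>\<^sup>2 * (4 * (cmod (\<gamma> / of_real Q - \<kappa> z))\<^sup>2) +
       \<epsilon> * (4 * ((B2 + \<delta> * A2) / Q - (cmod \<gamma>)\<^sup>2 / Q\<^sup>2) - 4 * E z))"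
      using powr_C2[OF \<delta>, of \<epsilon>] z unfolding \<gamma>_def Q_def A2_def B2_def by blast
    have "ddc (\<lambda>z. (B z / N z + \<delta>) powr \<epsilon>) z = ddc (\<lambda>z. exp (\<epsilon> * (ln (B z + \<delta> * N z) - ln (N z)))) z"
      by (intro ddc_cong eventually_mono[OF eventually_nhds_in_open[OF A z]] powr_eq_exp \<delta>)
    also have "\<dots> = l z / (4 * pi)" by (rule C2_grad_lap_ddc[OF gl(1) A z])
    finally show ?thesis unfolding gl(2) u_def Q_def using powr_eq_exp[OF z \<delta>, of \<epsilon>] by simp
  qed
  have rhs: "u powr \<epsilon> * E z + pi / \<epsilon> * ddc (\<lambda>z. (B z / N z + \<delta>) powr \<epsilon>) z
     = u powr \<epsilon> * (((B2 + \<delta> * A2) / Q - (cmod \<gamma>)\<^sup>2 / Q\<^sup>2) + \<epsilon> * (cmod (\<gamma> / of_real Q - \<kappa> z))\<^sup>2)"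
    unfolding d using \<epsilon> by (simp add: field_simps power2_eq_square)
  have "\<epsilon> * u powr (\<epsilon> - 1) * R z = u powr \<epsilon> * (\<epsilon> * Bt / Q)"
  proof -
    have "u powr (\<epsilon> - 1) = u powr \<epsilon> * (N z / Q)" using u N Q by (simp add: powr_diff)
    moreover have "R z = Bt / N z" by (simp add: R_def Bt_def)
    ultimately show ?thesis using N Q by simp
  qed
  also have "\<dots> \<le> u powr \<epsilon> * (((B2 + \<delta> * A2) / Q - (cmod \<gamma>)\<^sup>2 / Q\<^sup>2) + \<epsilon> * (cmod (\<gamma> / of_real Q - \<kappa> z))\<^sup>2)"
    by (intro mult_left_mono curv) simp
  also note rhs[symmetric]
  finally show ?thesis by (simp only: u_def)
qed

end

lemma gradient_unique:
  assumes "(u has_derivative (\<lambda>h. a * Re h + b * Im h)) (at z)" "(u has_derivative (\<lambda>h. a' * Re h + b' * Im h)) (at z)"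
  shows "a = a'" "b = b'"
proof -
  have "(\<lambda>h. a * Re h + b * Im h) = (\<lambda>h. a' * Re h + b' * Im h)"
    by (rule has_derivative_unique[OF assms])
  from fun_cong[OF this, of 1] fun_cong[OF this, of \<i>] show "a = a'" "b = b'" by auto
qed

text \<open>The partial derivatives chosen on the neighbourhoods \<open>S z\<close> are unrelated
  choices. As derivatives are unique, the diagonal function \<open>p w w\<close> agrees with
  \<open>p z w\<close> on \<open>S z\<close>, and likewise for the others, so the diagonal inherits
  differentiability and continuity.\<close>

lemma C2_on_UNIV_local:
  assumes "\<And>z. \<exists>S v. open S \<and> z \<in> S \<and> C2_on S v \<and> (\<forall>w\<in>S. v w = u w)"
  shows "C2_on UNIV u"
proof -
  have "\<exists>S p q pp pq qp qq. open S \<and> z \<in> S \<and> C2d S u p q pp pq qp qq" for z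
    using assms[of z] C2_on_cong unfolding C2_on_iff by metis
  then obtain S p q pp pq qp qq where S: "\<And>z. open (S z)" "\<And>z. z \<in> S z"
    and C: "\<And>z. C2d (S z) u (p z) (q z) (pp z) (pq z) (qp z) (qq z)" by metis
  have Cd: "(u has_derivative (\<lambda>h. p z w * Re h + q z w * Im h)) (at w)"
    "(p z has_derivative (\<lambda>h. pp z w * Re h + pq z w * Im h)) (at w)"
    "(q z has_derivative (\<lambda>h. qp z w * Re h + qq z w * Im h)) (at w)" if "w \<in> S z" for z w
    using C[of z] that by (auto simp: C2d_def)
  have pq: "p w w = p z w" "q w w = q z w" if "w \<in> S z" for z w
    using gradient_unique[OF Cd(1)[OF S(2)] Cd(1)[OF that]] by auto
  have dp: "((\<lambda>w. p w w) has_derivative (\<lambda>h. pp z w * Re h + pq z w * Im h)) (at w)"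
    "((\<lambda>w. q w w) has_derivative (\<lambda>h. qp z w * Re h + qq z w * Im h)) (at w)" if "w \<in> S z" for z w
    using has_derivative_transform_within_open[OF Cd(2)[OF that] S(1) that]
      has_derivative_transform_within_open[OF Cd(3)[OF that] S(1) that] pq by simp_all
  have ppqq: "pp w w = pp z w" "pq w w = pq z w" "qp w w = qp z w" "qq w w = qq z w" if "w \<in> S z" for z w
    using gradient_unique[OF dp(1)[OF S(2)] dp(1)[OF that]] gradient_unique[OF dp(2)[OF S(2)] dp(2)[OF that]] by auto
  have cont: "isCont (\<lambda>w. g w w) z" if "isCont (g z) z" "\<And>w. w \<in> S z \<Longrightarrow> g w w = g z w" for g :: "complex \<Rightarrow> complex \<Rightarrow> real" and z
  proof -
    have "eventually (\<lambda>w. g w w = g z w) (nhds z)"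
      by (rule eventually_mono[OF eventually_nhds_in_open[OF S(1) S(2)]]) (rule that(2))
    then show ?thesis using that(1) isCont_cong[of "\<lambda>w. g w w" "g z"] by simp
  qed
  have "C2d UNIV u (\<lambda>w. p w w) (\<lambda>w. q w w) (\<lambda>w. pp w w) (\<lambda>w. pq w w) (\<lambda>w. qp w w) (\<lambda>w. qq w w)"
    unfolding C2d_def
  proof (intro ballI conjI)
    fix z
    note c = C2d_isCont(4-7)[OF C S(2), of z]
    show "(u has_derivative (\<lambda>h. p z z * Re h + q z z * Im h)) (at z)" by (rule Cd(1)[OF S(2)])
    show "((\<lambda>w. p w w) has_derivative (\<lambda>h. pp z z * Re h + pq z z * Im h)) (at z)" by (rule dp(1)[OF S(2)])
    show "((\<lambda>w. q w w) has_derivative (\<lambda>h. qp z z * Re h + qq z z * Im h)) (at z)" by (rule dp(2)[OF S(2)])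
    show "isCont (\<lambda>w. pp w w) z" by (rule cont[OF c(1) ppqq(1)])
    show "isCont (\<lambda>w. pq w w) z" by (rule cont[OF c(2) ppqq(2)])
    show "isCont (\<lambda>w. qp w w) z" by (rule cont[OF c(3) ppqq(3)])
    show "isCont (\<lambda>w. qq w w) z" by (rule cont[OF c(4) ppqq(4)])
  qed
  then show ?thesis unfolding C2_on_iff by (intro exI)
qed

text \<open>Fatou's lemma, once for the inner and once for the outer integral. The kernel
  \<open>W\<close> absorbs \<open>1 / t\<close> and both indicators, so that a single nonnegative
  integrand converges almost everywhere.\<close>

lemma nevanlinna_nn_le_liminf:
  assumes [measurable]: "\<And>m. \<rho>m m \<in> borel_measurable borel" "\<rho> \<in> borel_measurable borel"
    and lim: "AE z in lborel. (\<lambda>m. \<rho>m m z) \<longlonglongrightarrow> \<rho> z"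
    and K: "\<And>m. nevanlinna_nn (\<rho>m m) r \<le> K"
  shows "nevanlinna_nn \<rho> r \<le> K"
proof -
  define W :: "real \<Rightarrow> complex \<Rightarrow> ennreal" where
    "W = (\<lambda>t z. if norm z < t \<and> 0 < t \<and> t < r then ennreal (1 / t) else 0)"
  have [measurable]: "(\<lambda>(t, z). W t z) \<in> borel_measurable (lborel \<Otimes>\<^sub>M lborel)"
    unfolding W_def split_beta by measurable
  have [measurable]: "W t \<in> borel_measurable lborel" for t
    unfolding W_def by measurable
  have W: "nevanlinna_nn \<tau> r = (\<integral>\<^sup>+ t. \<integral>\<^sup>+ z. W t z * ennreal (\<tau> z) \<partial>lborel \<partial>lborel)"
    if [measurable]: "\<tau> \<in> borel_measurable borel" for \<tau>
    unfolding nevanlinna_nn_def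
  proof (rule nn_integral_cong)
    fix t :: real
    have "ennreal (1 / t) * (\<integral>\<^sup>+ z\<in>ball 0 t. ennreal (\<tau> z) \<partial>lborel) * indicator {0<..<r} t
       = (ennreal (1 / t) * indicator {0<..<r} t) * (\<integral>\<^sup>+ z\<in>ball 0 t. ennreal (\<tau> z) \<partial>lborel)"
      by (simp add: mult_ac)
    also have "\<dots> = (\<integral>\<^sup>+ z. (ennreal (1 / t) * indicator {0<..<r} t) * (ennreal (\<tau> z) * indicator (ball 0 t) z) \<partial>lborel)"
      by (rule nn_integral_cmult[symmetric]) measurable
    also have "\<dots> = (\<integral>\<^sup>+ z. W t z * ennreal (\<tau> z) \<partial>lborel)"
      by (intro nn_integral_cong) (auto simp: W_def indicator_def)
    finally show "ennreal (1 / t) * (\<integral>\<^sup>+ z\<in>ball 0 t. ennreal (\<tau> z) \<partial>lborel) * indicator {0<..<r} t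
       = (\<integral>\<^sup>+ z. W t z * ennreal (\<tau> z) \<partial>lborel)" .
  qed
  have "nevanlinna_nn \<rho> r = (\<integral>\<^sup>+ t. \<integral>\<^sup>+ z. W t z * ennreal (\<rho> z) \<partial>lborel \<partial>lborel)"
    by (rule W) measurable
  also have "\<dots> = (\<integral>\<^sup>+ t. \<integral>\<^sup>+ z. liminf (\<lambda>m. W t z * ennreal (\<rho>m m z)) \<partial>lborel \<partial>lborel)"
  proof (rule nn_integral_cong, rule nn_integral_cong_AE)
    fix t :: real
    show "AE z in lborel. W t z * ennreal (\<rho> z) = liminf (\<lambda>m. W t z * ennreal (\<rho>m m z))"
      using lim
    proof eventually_elim
      case (elim z)
      have "(\<lambda>m. W t z * ennreal (\<rho>m m z)) \<longlonglongrightarrow> W t z * ennreal (\<rho> z)"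
        by (intro ennreal_tendsto_cmult tendsto_ennrealI elim) (simp add: W_def)
      then show ?case by (rule lim_imp_Liminf[OF sequentially_bot, symmetric])
    qed
  qed
  also have "\<dots> \<le> (\<integral>\<^sup>+ t. liminf (\<lambda>m. \<integral>\<^sup>+ z. W t z * ennreal (\<rho>m m z) \<partial>lborel) \<partial>lborel)"
    by (intro nn_integral_mono nn_integral_liminf) measurable
  also have "\<dots> \<le> liminf (\<lambda>m. \<integral>\<^sup>+ t. \<integral>\<^sup>+ z. W t z * ennreal (\<rho>m m z) \<partial>lborel \<partial>lborel)"
    by (intro nn_integral_liminf) measurable
  also have "\<dots> = liminf (\<lambda>m. nevanlinna_nn (\<rho>m m) r)"
    by (simp add: W)
  also have "\<dots> \<le> K"
    using K by (intro Liminf_le) auto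
  finally show ?thesis .
qed

section \<open>Complex lines, holomorphic functions on the ambient space, homogeneous
  polynomials\<close>

lemma vmult_vmult: "a *s (b *s (v::complex^'n)) = (a * b) *s v" by (simp add: vec_eq_iff mult.assoc)
lemma mem_cline: "w \<in> cline v \<longleftrightarrow> (\<exists>c. w = c *s v)" by (auto simp: cline_def)
lemma self_mem_cline [simp]: "v \<in> cline v" unfolding mem_cline by (rule exI[of _ 1]) simp

lemma cline_vmult [simp]:
  assumes "c \<noteq> 0" shows "cline (c *s v) = cline v"
proof -
  have "(\<exists>d. w = (d * c) *s v) \<longleftrightarrow> (\<exists>d. w = d *s v)" for w
    using assms by (metis nonzero_eq_divide_eq)
  then show ?thesis by (simp add: set_eq_iff mem_cline vmult_vmult)
qed

lemma cline_eqI: "w \<in> cline v \<Longrightarrow> w \<noteq> 0 \<Longrightarrow> cline w = cline v"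
  unfolding mem_cline by auto

lemma proj_cline: "x \<in> proj_space \<Longrightarrow> v \<in> x \<Longrightarrow> v \<noteq> 0 \<Longrightarrow> cline v = x"
  unfolding proj_space_def using cline_eqI by blast

lemma proj_obtain:
  assumes "x \<in> proj_space" obtains v where "v \<noteq> 0" "cline v = x"
  using assms unfolding proj_space_def by auto

lemma mholomorphic_on_isCont: "mholomorphic_on A G \<Longrightarrow> w \<in> A \<Longrightarrow> isCont G w"
  unfolding mholomorphic_on_def using has_derivative_continuous by blast

lemma mholomorphic_on_const: "open A \<Longrightarrow> mholomorphic_on A (\<lambda>_. c)"
  unfolding mholomorphic_on_def by (auto intro!: exI[of _ "\<lambda>_. 0"])

lemma mholomorphic_on_subset: "mholomorphic_on A G \<Longrightarrow> B \<subseteq> A \<Longrightarrow> open B \<Longrightarrow> mholomorphic_on B G"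
  unfolding mholomorphic_on_def by blast

lemma mholomorphic_on_add:
  assumes "mholomorphic_on A G" "mholomorphic_on A H"
  shows "mholomorphic_on A (\<lambda>w. G w + H w)"
  unfolding mholomorphic_on_def
proof (intro conjI ballI)
  show "open A" using assms by (auto simp: mholomorphic_on_def)
  fix w assume w: "w \<in> A"
  obtain G' where G: "(G has_derivative G') (at w)" "\<And>c v. G' (c *s v) = c * G' v"
    using assms(1) w unfolding mholomorphic_on_def by blast
  obtain H' where H: "(H has_derivative H') (at w)" "\<And>c v. H' (c *s v) = c * H' v"
    using assms(2) w unfolding mholomorphic_on_def by blast
  show "\<exists>G'. ((\<lambda>w. G w + H w) has_derivative G') (at w) \<and> (\<forall>c v. G' (c *s v) = c * G' v)"
    using has_derivative_add[OF G(1) H(1)] G(2) H(2) by (auto simp: algebra_simps intro!: exI)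
qed

lemma mholomorphic_on_mult:
  assumes "mholomorphic_on A G" "mholomorphic_on A H"
  shows "mholomorphic_on A (\<lambda>w. G w * H w)"
  unfolding mholomorphic_on_def
proof (intro conjI ballI)
  show "open A" using assms by (auto simp: mholomorphic_on_def)
  fix w assume w: "w \<in> A"
  obtain G' where G: "(G has_derivative G') (at w)" "\<And>c v. G' (c *s v) = c * G' v"
    using assms(1) w unfolding mholomorphic_on_def by blast
  obtain H' where H: "(H has_derivative H') (at w)" "\<And>c v. H' (c *s v) = c * H' v"
    using assms(2) w unfolding mholomorphic_on_def by blast
  show "\<exists>G'. ((\<lambda>w. G w * H w) has_derivative G') (at w) \<and> (\<forall>c v. G' (c *s v) = c * G' v)"
    using has_derivative_mult[OF G(1) H(1)] G(2) H(2) by (auto simp: algebra_simps intro!: exI)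
qed

lemma mholomorphic_on_inverse:
  assumes "mholomorphic_on A G" "\<And>w. w \<in> A \<Longrightarrow> G w \<noteq> 0"
  shows "mholomorphic_on A (\<lambda>w. inverse (G w))"
  unfolding mholomorphic_on_def
proof (intro conjI ballI)
  show "open A" using assms by (auto simp: mholomorphic_on_def)
  fix w assume w: "w \<in> A"
  obtain G' where G: "(G has_derivative G') (at w)" "\<And>c v. G' (c *s v) = c * G' v"
    using assms(1) w unfolding mholomorphic_on_def by blast
  show "\<exists>G'. ((\<lambda>w. inverse (G w)) has_derivative G') (at w) \<and> (\<forall>c v. G' (c *s v) = c * G' v)"
    using Deriv.has_derivative_inverse[OF assms(2)[OF w] G(1)] G(2) by (auto simp: algebra_simps intro!: exI)
qed

lemma mholomorphic_on_scale:
  assumes "mholomorphic_on A G" "c \<noteq> 0"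
  shows "mholomorphic_on ((\<lambda>w. c *s w) -` A) (\<lambda>w. G (c *s w))"
  unfolding mholomorphic_on_def
proof (intro conjI ballI)
  have lin: "bounded_linear (\<lambda>w::complex^'n. c *s w)"
    by (intro linear_conv_bounded_linear[THEN iffD1] linearI) (auto simp: vec_eq_iff algebra_simps)
  show "open ((\<lambda>w. c *s w) -` A)"
    using assms linear_continuous_on[OF lin, of UNIV] by (auto simp: mholomorphic_on_def intro!: open_vimage)
  fix w assume w: "w \<in> (\<lambda>w. c *s w) -` A"
  then obtain G' where G: "(G has_derivative G') (at (c *s w))" "\<And>c v. G' (c *s v) = c * G' v"
    using assms(1) unfolding mholomorphic_on_def by blast
  have "((\<lambda>w. G (c *s w)) has_derivative (\<lambda>h. G' (c *s h))) (at w)"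
    by (rule has_derivative_compose[OF bounded_linear_imp_has_derivative[OF lin] G(1)])
  then show "\<exists>G'. ((\<lambda>w. G (c *s w)) has_derivative G') (at w) \<and> (\<forall>c v. G' (c *s v) = c * G' v)"
    using G(2) by (auto simp: vmult_vmult mult.commute intro!: exI)
qed

lemma poly_mholomorphic:
  assumes "p \<in> alg_gen {(\<lambda>v::complex^'n. v $ i) |i. True}"
  shows "mholomorphic_on UNIV p"
  using assms
proof induction
  case (gen g)
  then obtain i where g: "g = (\<lambda>v. v $ i)" by auto
  have "bounded_linear (\<lambda>v::complex^'n. v $ i)" by (rule bounded_linear_vec_nth)
  then show ?case unfolding mholomorphic_on_def g
    by (auto intro!: exI[of _ "\<lambda>v. v $ i"] bounded_linear_imp_has_derivative)
qed (auto intro: mholomorphic_on_const mholomorphic_on_add mholomorphic_on_mult)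

lemma homogeneous_poly_mholomorphic: "homogeneous_poly d p \<Longrightarrow> mholomorphic_on UNIV p"
  unfolding homogeneous_poly_def using poly_mholomorphic by blast

lemma homogeneous_poly_continuous: "homogeneous_poly d p \<Longrightarrow> isCont p w"
  using mholomorphic_on_isCont[OF homogeneous_poly_mholomorphic] by blast

lemma homogeneous_poly_scale: "homogeneous_poly d p \<Longrightarrow> p (c *s v) = c ^ d * p v"
  unfolding homogeneous_poly_def by blast

lemma homogeneous_poly_nonzero_iff:
  "homogeneous_poly d p \<Longrightarrow> c \<noteq> 0 \<Longrightarrow> p (c *s v) \<noteq> 0 \<longleftrightarrow> p v \<noteq> 0"
  by (simp add: homogeneous_poly_scale)

lemma homogeneous_poly_mult: "homogeneous_poly d p \<Longrightarrow> homogeneous_poly e q \<Longrightarrow> homogeneous_poly (d + e) (\<lambda>v. p v * q v)"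
  unfolding homogeneous_poly_def by (auto intro: alg_gen.mult simp: power_add)

lemma homogeneous_poly_const: "homogeneous_poly 0 (\<lambda>v. c)"
  unfolding homogeneous_poly_def by (auto intro: alg_gen.const)

lemma homogeneous_poly_coord: "homogeneous_poly 1 (\<lambda>v. v $ i)"
  unfolding homogeneous_poly_def by (auto intro: alg_gen.gen)

lemma homogeneous_poly_power: "homogeneous_poly d p \<Longrightarrow> homogeneous_poly (d * n) (\<lambda>v. p v ^ n)"
proof (induction n)
  case 0 show ?case using homogeneous_poly_const[of 1] by simp
next
  case (Suc n) then show ?case using homogeneous_poly_mult[of d p "d * n" "\<lambda>v. p v ^ n"] by simp
qed

subsection \<open>Zariski open sets and regular functions\<close>

text \<open>Every line contains the zero vector, so \<open>variety_of\<close> also lets a value at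
  \<open>0\<close> witness membership. This form tests nonzero vectors only and displays the
  nonvanishing sets of single polynomials as a basis.\<close>

lemma mem_zopens_iff:
  assumes "X \<subseteq> proj_space"
  shows "W \<in> zopens (variety_of X) \<longleftrightarrow> W \<subseteq> X \<and>
    (\<forall>x\<in>W. \<exists>d p. homogeneous_poly d p \<and> (\<forall>v\<in>x - {0}. p v \<noteq> 0) \<and> {y \<in> X. \<exists>v\<in>y. v \<noteq> 0 \<and> p v \<noteq> 0} \<subseteq> W)"
    (is "?L \<longleftrightarrow> ?R")
proof
  assume ?L
  then obtain T where T: "\<forall>p\<in>T. \<exists>d. homogeneous_poly d p" and W: "W = {x \<in> X. \<exists>p\<in>T. \<exists>v\<in>x. p v \<noteq> 0}"
    by (auto simp: variety_of_def)
  show ?R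
  proof (intro conjI ballI)
    show "W \<subseteq> X" using W by auto
    fix x assume x: "x \<in> W"
    then obtain p v where p: "p \<in> T" "v \<in> x" "p v \<noteq> 0" "x \<in> X" unfolding W by auto
    obtain d where d: "homogeneous_poly d p" using T p(1) by auto
    obtain v0 where v0: "v0 \<noteq> 0" "x = cline v0" using p(4) assms by (metis proj_obtain subsetD)
    show "\<exists>d p. homogeneous_poly d p \<and> (\<forall>v\<in>x - {0}. p v \<noteq> 0) \<and> {y \<in> X. \<exists>v\<in>y. v \<noteq> 0 \<and> p v \<noteq> 0} \<subseteq> W"
    proof (cases "v = 0")
      case True
      \<comment> \<open>A homogeneous polynomial that does not vanish at the zero vector has degree
        0 and is constant.\<close>
      have "p 0 = 0 ^ d * p v0" using homogeneous_poly_scale[OF d, of 0 v0] by simp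
      then have d0: "d = 0" using p(3) True by (cases d) auto
      have pv0: "p w = p v0" for w using homogeneous_poly_scale[OF d, of 0 w] homogeneous_poly_scale[OF d, of 0 v0] d0 by simp
      have c: "p w \<noteq> 0" for w using pv0[of w] pv0[of v] p(3) by simp
      show ?thesis using d c p(1) unfolding W by (intro exI[of _ d] exI[of _ p]) auto
    next
      case False
      obtain c where c: "v = c *s v0" using p(2) v0 by (auto simp: mem_cline)
      have "p w \<noteq> 0" if "w \<in> x - {0}" for w
      proof -
        have "w \<in> cline v" using that c False v0 by simp
        then obtain e where "w = e *s v" by (auto simp: mem_cline)
        then show ?thesis using that p(3) d by (auto simp: homogeneous_poly_scale)
      qed
      then show ?thesis using d p(1) unfolding W by (intro exI[of _ d] exI[of _ p]) auto
    qed
  qed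
next
  assume R: ?R
  define T where "T = {p. \<exists>d. homogeneous_poly d p \<and> {y \<in> X. \<exists>v\<in>y. v \<noteq> 0 \<and> p v \<noteq> 0} \<subseteq> W}"
  \<comment> \<open>Multiplication by the coordinates produces polynomials of positive degree. They
    vanish at the zero vector, so every witness of membership is a nonzero vector.\<close>
  define T' where "T' = {\<lambda>v. p v * v $ i |p i. p \<in> T}"
  have "\<forall>p\<in>T'. \<exists>d. homogeneous_poly d p"
    unfolding T'_def T_def using homogeneous_poly_mult[OF _ homogeneous_poly_coord] by blast
  moreover have "W = {x \<in> X. \<exists>p\<in>T'. \<exists>v\<in>x. p v \<noteq> 0}"
  proof (intro set_eqI iffI)
    fix x assume x: "x \<in> W"
    then obtain d p where p: "homogeneous_poly d p" "\<forall>v\<in>x - {0}. p v \<noteq> 0" "{y \<in> X. \<exists>v\<in>y. v \<noteq> 0 \<and> p v \<noteq> 0} \<subseteq> W"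
      using R by blast
    have xX: "x \<in> X" using x R by auto
    then obtain v where v: "v \<noteq> 0" "cline v = x" using assms by (metis proj_obtain subsetD)
    then have vx: "v \<in> x" by auto
    obtain i where i: "v $ i \<noteq> 0" using v(1) by (auto simp: vec_eq_iff)
    have "p \<in> T" using p unfolding T_def by blast
    then have T': "(\<lambda>v. p v * v $ i) \<in> T'" unfolding T'_def by blast
    have nz: "p v * v $ i \<noteq> 0" using p(2) v(1) vx i by auto
    show "x \<in> {x \<in> X. \<exists>p\<in>T'. \<exists>v\<in>x. p v \<noteq> 0}"
      by (intro CollectI conjI xX bexI[OF _ T'] bexI[OF _ vx]) (rule nz)
  next
    fix x assume "x \<in> {x \<in> X. \<exists>p\<in>T'. \<exists>v\<in>x. p v \<noteq> 0}"
    then obtain p' v where p': "x \<in> X" "p' \<in> T'" "v \<in> x" "p' v \<noteq> 0" by blast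
    then obtain p i where "p' = (\<lambda>v. p v * v $ i)" "p \<in> T" unfolding T'_def by blast
    then have p: "x \<in> X" "p \<in> T" "v \<in> x" "p v * v $ i \<noteq> 0" using p' by auto
    then have "v \<noteq> 0" "p v \<noteq> 0" by auto
    then have "x \<in> {y \<in> X. \<exists>v\<in>y. v \<noteq> 0 \<and> p v \<noteq> 0}" using p by blast
    then show "x \<in> W" using p(2) unfolding T_def by blast
  qed
  ultimately show ?L by (auto simp: variety_of_def)
qed

lemma zopens_subset: "W \<in> zopens (variety_of X) \<Longrightarrow> W \<subseteq> X"
  by (auto simp: variety_of_def)

lemma zopens_whole: "X \<in> zopens (variety_of X)" if "X \<subseteq> proj_space"
  unfolding mem_zopens_iff[OF that]
  by (intro conjI ballI exI[of _ 0] exI[of _ "\<lambda>_. 1"]) (auto intro: homogeneous_poly_const)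

lemma zopens_Union: "X \<subseteq> proj_space \<Longrightarrow> \<Union>(zopens (variety_of X)) = X"
  using zopens_whole[of X] zopens_subset by blast

lemma zopens_Int:
  assumes X: "X \<subseteq> proj_space" and W: "W1 \<in> zopens (variety_of X)" "W2 \<in> zopens (variety_of X)"
  shows "W1 \<inter> W2 \<in> zopens (variety_of X)"
  unfolding mem_zopens_iff[OF X]
proof (intro conjI ballI)
  show "W1 \<inter> W2 \<subseteq> X" using W zopens_subset by blast
  fix x assume x: "x \<in> W1 \<inter> W2"
  obtain d p where p: "homogeneous_poly d p" "\<forall>v\<in>x - {0}. p v \<noteq> 0" "{y \<in> X. \<exists>v\<in>y. v \<noteq> 0 \<and> p v \<noteq> 0} \<subseteq> W1"
    using W(1) x unfolding mem_zopens_iff[OF X] by blast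
  obtain e q where q: "homogeneous_poly e q" "\<forall>v\<in>x - {0}. q v \<noteq> 0" "{y \<in> X. \<exists>v\<in>y. v \<noteq> 0 \<and> q v \<noteq> 0} \<subseteq> W2"
    using W(2) x unfolding mem_zopens_iff[OF X] by blast
  show "\<exists>d p. homogeneous_poly d p \<and> (\<forall>v\<in>x - {0}. p v \<noteq> 0) \<and> {y \<in> X. \<exists>v\<in>y. v \<noteq> 0 \<and> p v \<noteq> 0} \<subseteq> W1 \<inter> W2"
  proof (intro exI conjI)
    show "homogeneous_poly (d + e) (\<lambda>v. p v * q v)" by (rule homogeneous_poly_mult[OF p(1) q(1)])
    show "\<forall>v\<in>x - {0}. p v * q v \<noteq> 0" using p(2) q(2) by simp
    have "{y \<in> X. \<exists>v\<in>y. v \<noteq> 0 \<and> p v * q v \<noteq> 0} \<subseteq> {y \<in> X. \<exists>v\<in>y. v \<noteq> 0 \<and> p v \<noteq> 0} \<inter> {y \<in> X. \<exists>v\<in>y. v \<noteq> 0 \<and> q v \<noteq> 0}"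
      by auto
    then show "{y \<in> X. \<exists>v\<in>y. v \<noteq> 0 \<and> p v * q v \<noteq> 0} \<subseteq> W1 \<inter> W2" using p(3) q(3) by blast
  qed
qed

lemma variety_regs_iff:
  "g \<in> regs (variety_of X) W \<longleftrightarrow> (\<forall>x\<in>W. \<exists>d p q. homogeneous_poly d p \<and> homogeneous_poly d q \<and>
                (\<forall>v\<in>x - {0}. q v \<noteq> 0) \<and> (\<forall>y\<in>W. \<forall>v\<in>y - {0}. q v \<noteq> 0 \<longrightarrow> g y = p v / q v))"
  by (simp add: variety_of_def)

lemma variety_regsI:
  assumes "\<And>x. x \<in> W \<Longrightarrow> \<exists>d p q. homogeneous_poly d p \<and> homogeneous_poly d q \<and>
     (\<forall>v\<in>x - {0}. q v \<noteq> 0) \<and> (\<forall>y\<in>W. \<forall>v\<in>y - {0}. q v \<noteq> 0 \<longrightarrow> g y = p v / q v)"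
  shows "g \<in> regs (variety_of X) W"
  using assms unfolding variety_regs_iff by (rule ballI)

lemma fraction_exI:
  assumes "homogeneous_poly d p" "homogeneous_poly d q" "\<And>v. v \<in> x - {0} \<Longrightarrow> q v \<noteq> 0"
    "\<And>y v. y \<in> W \<Longrightarrow> v \<in> y - {0} \<Longrightarrow> q v \<noteq> 0 \<Longrightarrow> g y = p v / q v"
  shows "\<exists>d p q. homogeneous_poly d p \<and> homogeneous_poly d q \<and>
     (\<forall>v\<in>x - {0}. q v \<noteq> 0) \<and> (\<forall>y\<in>W. \<forall>v\<in>y - {0}. q v \<noteq> 0 \<longrightarrow> g y = p v / q v)"
  using assms by blast

lemma regs_restrict_cong:
  assumes "g \<in> regs (variety_of X) W" "W' \<subseteq> W" "\<And>x. x \<in> W' \<Longrightarrow> g x = h x"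
  shows "h \<in> regs (variety_of X) W'"
proof (rule variety_regsI)
  fix x assume "x \<in> W'"
  then have "x \<in> W" using assms(2) by blast
  then obtain d p q where 1: "homogeneous_poly d p" "homogeneous_poly d q" "\<forall>v\<in>x - {0}. q v \<noteq> 0"
    "\<forall>y\<in>W. \<forall>v\<in>y - {0}. q v \<noteq> 0 \<longrightarrow> g y = p v / q v" using assms(1) unfolding variety_regs_iff by blast
  show "\<exists>d p q. homogeneous_poly d p \<and> homogeneous_poly d q \<and>
     (\<forall>v\<in>x - {0}. q v \<noteq> 0) \<and> (\<forall>y\<in>W'. \<forall>v\<in>y - {0}. q v \<noteq> 0 \<longrightarrow> h y = p v / q v)"
  proof (rule fraction_exI[OF 1(1,2)])
    show "q v \<noteq> 0" if "v \<in> x - {0}" for v using 1(3) that by blast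
    show "h y = p v / q v" if "y \<in> W'" "v \<in> y - {0}" "q v \<noteq> 0" for y v
      using 1(4) assms(2) assms(3)[OF that(1)] that by (metis subsetD)
  qed
qed

lemma regs_restrict: "g \<in> regs (variety_of X) W \<Longrightarrow> W' \<subseteq> W \<Longrightarrow> g \<in> regs (variety_of X) W'"
  by (rule regs_restrict_cong) simp_all

lemma regs_const: "(\<lambda>_. c) \<in> regs (variety_of X) W"
  by (rule variety_regsI, rule fraction_exI[OF homogeneous_poly_const[of c] homogeneous_poly_const[of 1]]) simp_all

lemma regs_mult:
  assumes "g \<in> regs (variety_of X) W" "h \<in> regs (variety_of X) W"
  shows "(\<lambda>x. g x * h x) \<in> regs (variety_of X) W"
  unfolding variety_regs_iff
proof
  fix x assume x: "x \<in> W"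
  obtain d p q where 1: "homogeneous_poly d p" "homogeneous_poly d q" "\<forall>v\<in>x - {0}. q v \<noteq> 0"
    "\<forall>y\<in>W. \<forall>v\<in>y - {0}. q v \<noteq> 0 \<longrightarrow> g y = p v / q v" using assms(1) x unfolding variety_regs_iff by blast
  obtain e p' q' where 2: "homogeneous_poly e p'" "homogeneous_poly e q'" "\<forall>v\<in>x - {0}. q' v \<noteq> 0"
    "\<forall>y\<in>W. \<forall>v\<in>y - {0}. q' v \<noteq> 0 \<longrightarrow> h y = p' v / q' v" using assms(2) x unfolding variety_regs_iff by blast
  show "\<exists>d p q. homogeneous_poly d p \<and> homogeneous_poly d q \<and> (\<forall>v\<in>x - {0}. q v \<noteq> 0) \<and>
     (\<forall>y\<in>W. \<forall>v\<in>y - {0}. q v \<noteq> 0 \<longrightarrow> g y * h y = p v / q v)"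
    by (rule fraction_exI[OF homogeneous_poly_mult[OF 1(1) 2(1)] homogeneous_poly_mult[OF 1(2) 2(2)]])
      (use 1 2 in auto)
qed

lemma regs_inverse:
  assumes "g \<in> regs (variety_of X) W" "\<And>x. x \<in> W \<Longrightarrow> g x \<noteq> 0" "W \<subseteq> X" "X \<subseteq> proj_space"
  shows "(\<lambda>x. inverse (g x)) \<in> regs (variety_of X) W"
  unfolding variety_regs_iff
proof
  fix x assume x: "x \<in> W"
  obtain d p q where 1: "homogeneous_poly d p" "homogeneous_poly d q" "\<forall>v\<in>x - {0}. q v \<noteq> 0"
    "\<forall>y\<in>W. \<forall>v\<in>y - {0}. q v \<noteq> 0 \<longrightarrow> g y = p v / q v" using assms(1) x unfolding variety_regs_iff by blast
  have "p v \<noteq> 0" if "v \<in> x - {0}" for v using assms(2)[OF x] 1(3,4) x that by force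
  then show "\<exists>d p q. homogeneous_poly d p \<and> homogeneous_poly d q \<and> (\<forall>v\<in>x - {0}. q v \<noteq> 0) \<and>
     (\<forall>y\<in>W. \<forall>v\<in>y - {0}. q v \<noteq> 0 \<longrightarrow> inverse (g y) = p v / q v)"
    by - (rule fraction_exI[OF homogeneous_poly_mult[OF 1(2,2)] homogeneous_poly_mult[OF 1(1,2)]], use 1 in auto)
qed

lemma regs_power: "g \<in> regs (variety_of X) W \<Longrightarrow> (\<lambda>x. g x ^ n) \<in> regs (variety_of X) W"
  by (induction n) (auto intro: regs_const regs_mult)

section \<open>Convergence of sequences in the complex topology\<close>

lemma tendsto_transform:
  assumes "(f \<longlongrightarrow> l) F" "eventually (\<lambda>n. f n = g n) F" "l = l'"
  shows "(g \<longlongrightarrow> l') F"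
  using Lim_transform_eventually[OF assms(1,2)] assms(3) by simp

lemma tendsto_transform':
  "(f \<longlongrightarrow> l) F \<Longrightarrow> l = l' \<Longrightarrow> eventually (\<lambda>n. f n = g n) F \<Longrightarrow> (g \<longlongrightarrow> l') F"
  by (rule tendsto_transform)

lemma generated_topology_eventually:
  assumes "openin (topology_generated_by S) \<Omega>" "x \<in> \<Omega>"
    and "\<And>U. U \<in> S \<Longrightarrow> x \<in> U \<Longrightarrow> eventually (\<lambda>n. xs n \<in> U) F"
  shows "eventually (\<lambda>n. xs n \<in> \<Omega>) F"
proof -
  have "generate_topology_on S \<Omega>" using assms(1) openin_topology_generated_by_iff by blast
  then show ?thesis using assms(2)
  proof induction
    case (Int a b)
    then show ?case by (simp add: eventually_conj)
  next
    case (UN K)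
    then obtain k where k: "k \<in> K" "x \<in> k" by auto
    then have "eventually (\<lambda>n. xs n \<in> k) F" using UN by auto
    then show ?case by eventually_elim (use k in auto)
  qed (use assms(3) in auto)
qed

lemma complex_topology_generator:
  assumes "W \<in> zopens T" "g \<in> regs T W" "open B"
  shows "{w \<in> W. g w \<in> B} \<in> {{w \<in> W. g w \<in> B} |W g B. W \<in> zopens T \<and> g \<in> regs T W \<and> open B}"
  by (rule CollectI, rule exI[of _ W], rule exI[of _ g], rule exI[of _ B]) (simp add: assms)

lemma limitin_complex_topology:
  assumes x: "x \<in> W0" "W0 \<in> zopens T" "g0 \<in> regs T W0"
    and W: "\<And>W. W \<in> zopens T \<Longrightarrow> x \<in> W \<Longrightarrow> eventually (\<lambda>n. xs n \<in> W) F"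
    and g: "\<And>W g. W \<in> zopens T \<Longrightarrow> x \<in> W \<Longrightarrow> g \<in> regs T W \<Longrightarrow> ((\<lambda>n. g (xs n)) \<longlongrightarrow> g x) F"
  shows "limitin (complex_topology T) xs x F"
  unfolding limitin_def
proof (intro conjI allI impI)
  have "{w \<in> W0. g0 w \<in> UNIV} \<in> {{w \<in> W. g w \<in> B} |W g B. W \<in> zopens T \<and> g \<in> regs T W \<and> open B}"
    by (rule complex_topology_generator[OF x(2,3) open_UNIV])
  then show "x \<in> topspace (complex_topology T)"
    unfolding complex_topology_def topology_generated_by_topspace by (rule UnionI) (simp add: x(1))
  fix \<Omega> assume \<Omega>: "openin (complex_topology T) \<Omega> \<and> x \<in> \<Omega>"
  show "eventually (\<lambda>n. xs n \<in> \<Omega>) F"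
  proof (rule generated_topology_eventually[OF conjunct1[OF \<Omega>, unfolded complex_topology_def] conjunct2[OF \<Omega>]])
    fix U assume "U \<in> {{w \<in> W. g w \<in> B} |W g B. W \<in> zopens T \<and> g \<in> regs T W \<and> open B}" and xU: "x \<in> U"
    then obtain W h B where U: "U = {w \<in> W. h w \<in> B}" "W \<in> zopens T" "h \<in> regs T W" "open B" by blast
    have "eventually (\<lambda>n. xs n \<in> W) F" using W[OF U(2)] xU U by simp
    moreover have "eventually (\<lambda>n. h (xs n) \<in> B) F"
      using topological_tendstoD[OF g[OF U(2) _ U(3)] U(4)] xU U by simp
    ultimately show "eventually (\<lambda>n. xs n \<in> U) F"
      unfolding U by eventually_elim simp
  qed
qed

text \<open>Convergence expressed by nonzero lifts to the cone. It implies convergence in the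
  topology generated by the regular functions, and homogeneous polynomials and holomorphic functions
  of the ambient space pass to the limit on the lifts.\<close>

definition cconv :: "('n::finite) pt set \<Rightarrow> (nat \<Rightarrow> 'n pt) \<Rightarrow> 'n pt \<Rightarrow> bool" where
  "cconv X xs x \<longleftrightarrow> x \<in> X \<and> (\<forall>n. xs n \<in> X) \<and>
     (\<exists>vs v. vs \<longlonglongrightarrow> v \<and> v \<noteq> 0 \<and> cline v = x \<and> (\<forall>n. vs n \<noteq> 0 \<and> cline (vs n) = xs n))"

lemma cconvE:
  assumes "cconv X xs x"
  obtains vs v where "x \<in> X" "\<And>n. xs n \<in> X" "vs \<longlonglongrightarrow> v" "v \<noteq> 0" "cline v = x" "v \<in> x"
    "\<And>n. vs n \<noteq> 0" "\<And>n. cline (vs n) = xs n" "\<And>n. vs n \<in> xs n"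
proof -
  obtain vs v where *: "vs \<longlonglongrightarrow> v" "v \<noteq> 0" "cline v = x" "\<forall>n. vs n \<noteq> 0 \<and> cline (vs n) = xs n"
    using assms unfolding cconv_def by auto
  show ?thesis
  proof (rule that[of vs v])
    show "v \<in> x" using *(3) by auto
    show "vs n \<in> xs n" for n using *(4) self_mem_cline[of "vs n"] by simp
  qed (use assms * in \<open>auto simp: cconv_def\<close>)
qed

lemma cconv_subseq: "cconv X xs x \<Longrightarrow> strict_mono r \<Longrightarrow> cconv X (xs \<circ> r) x"
proof (erule cconvE)
  fix vs v
  assume r: "strict_mono r" and *: "x \<in> X" "\<And>n. xs n \<in> X" "vs \<longlonglongrightarrow> v" "v \<noteq> 0" "cline v = x"
    "\<And>n. vs n \<noteq> 0" "\<And>n. cline (vs n) = xs n"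
  show "cconv X (xs \<circ> r) x"
    unfolding cconv_def
    by (intro conjI exI[of _ "vs \<circ> r"] exI[of _ v] LIMSEQ_subseq_LIMSEQ r) (use * in auto)
qed

lemma zopens_cconv:
  assumes X: "X \<subseteq> proj_space" and W: "W \<in> zopens (variety_of X)" "x \<in> W" and c: "cconv X xs x"
  shows "eventually (\<lambda>n. xs n \<in> W) sequentially"
proof -
  obtain vs v where v: "x \<in> X" "\<And>n. xs n \<in> X" "vs \<longlonglongrightarrow> v" "v \<noteq> 0" "cline v = x" "v \<in> x"
    "\<And>n. vs n \<noteq> 0" "\<And>n. cline (vs n) = xs n" "\<And>n. vs n \<in> xs n" by (rule cconvE[OF c]) (rule that)
  obtain d p where p: "homogeneous_poly d p" "\<forall>v\<in>x - {0}. p v \<noteq> 0" "{y \<in> X. \<exists>v\<in>y. v \<noteq> 0 \<and> p v \<noteq> 0} \<subseteq> W"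
    using W unfolding mem_zopens_iff[OF X] by blast
  have "(\<lambda>n. p (vs n)) \<longlonglongrightarrow> p v"
    by (rule isCont_tendsto_compose[OF homogeneous_poly_continuous[OF p(1)] v(3)])
  moreover have "p v \<noteq> 0" using p(2) v by auto
  ultimately have "eventually (\<lambda>n. p (vs n) \<noteq> 0) sequentially"
    by (rule tendsto_imp_eventually_ne)
  then show ?thesis
  proof eventually_elim
    case (elim n)
    then have "xs n \<in> {y \<in> X. \<exists>v\<in>y. v \<noteq> 0 \<and> p v \<noteq> 0}" using v(2,7,9) by blast
    then show ?case using p(3) by blast
  qed
qed

lemma regs_cconv:
  assumes X: "X \<subseteq> proj_space" and W: "W \<in> zopens (variety_of X)" "x \<in> W" and g: "g \<in> regs (variety_of X) W"
    and c: "cconv X xs x"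
  shows "(\<lambda>n. g (xs n)) \<longlonglongrightarrow> g x"
proof -
  obtain vs v where v: "x \<in> X" "\<And>n. xs n \<in> X" "vs \<longlonglongrightarrow> v" "v \<noteq> 0" "cline v = x" "v \<in> x"
    "\<And>n. vs n \<noteq> 0" "\<And>n. cline (vs n) = xs n" "\<And>n. vs n \<in> xs n" by (rule cconvE[OF c]) (rule that)
  obtain d p q where q: "homogeneous_poly d p" "homogeneous_poly d q" "\<forall>v\<in>x - {0}. q v \<noteq> 0"
    "\<forall>y\<in>W. \<forall>v\<in>y - {0}. q v \<noteq> 0 \<longrightarrow> g y = p v / q v" using g W(2) unfolding variety_regs_iff by blast
  have qv: "q v \<noteq> 0" using q(3) v by auto
  have lp: "(\<lambda>n. p (vs n)) \<longlonglongrightarrow> p v" and lq: "(\<lambda>n. q (vs n)) \<longlonglongrightarrow> q v"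
    using isCont_tendsto_compose[OF homogeneous_poly_continuous v(3)] q(1,2) by blast+
  have "(\<lambda>n. p (vs n) / q (vs n)) \<longlonglongrightarrow> p v / q v" by (rule tendsto_divide[OF lp lq qv])
  moreover have "p v / q v = g x" using q(4) W(2) v(4,6) qv by simp
  moreover have "eventually (\<lambda>n. p (vs n) / q (vs n) = g (xs n)) sequentially"
    using zopens_cconv[OF X W c] tendsto_imp_eventually_ne[OF lq qv]
  proof eventually_elim
    case (elim n)
    then show ?case using q(4)[rule_format, of "xs n" "vs n"] v(7)[of n] v(9)[of n] by simp
  qed
  ultimately show ?thesis by (rule tendsto_transform')
qed

lemma cconv_limitin:
  assumes X: "X \<subseteq> proj_space" and c: "cconv X xs x"
  shows "limitin (complex_topology (variety_of X)) xs x sequentially"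
  using c by (intro limitin_complex_topology[OF _ zopens_whole[OF X] regs_const] zopens_cconv[OF X] regs_cconv[OF X])
    (auto simp: cconv_def)

lemma cconv_openin:
  assumes X: "X \<subseteq> proj_space" and c: "cconv X xs x" "open_in_manifold X \<Omega>" "x \<in> \<Omega>"
  shows "eventually (\<lambda>n. xs n \<in> \<Omega>) sequentially"
  using cconv_limitin[OF X c(1)] c(2,3) unfolding limitin_def by blast

lemma topspace_complex_topology_variety: "X \<subseteq> proj_space \<Longrightarrow> topspace (complex_topology (variety_of X)) = X"
proof
  assume X: "X \<subseteq> proj_space"
  show "topspace (complex_topology (variety_of X)) \<subseteq> X"
    unfolding complex_topology_def topology_generated_by_topspace using zopens_subset by fastforce
  have "{w \<in> X. (0::complex) \<in> UNIV} \<in> {{w \<in> W. g w \<in> B} |W g B. W \<in> zopens (variety_of X) \<and> g \<in> regs (variety_of X) W \<and> open B}"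
    by (rule complex_topology_generator[OF zopens_whole[OF X] regs_const open_UNIV])
  then show "X \<subseteq> topspace (complex_topology (variety_of X))"
    unfolding complex_topology_def topology_generated_by_topspace by auto
qed

lemma openin_manifold_whole: "X \<subseteq> proj_space \<Longrightarrow> open_in_manifold X X"
  using topspace_complex_topology_variety openin_topspace by metis

lemma zopens_openin:
  assumes "W \<in> zopens T" "g \<in> regs T W"
  shows "openin (complex_topology T) W"
  unfolding complex_topology_def
proof (rule topology_generated_by_Basis)
  show "W \<in> {{w \<in> W. g w \<in> B} |W g B. W \<in> zopens T \<and> g \<in> regs T W \<and> open B}"
    using complex_topology_generator[OF assms open_UNIV] by simp
qed

lemma cconv_real_function:
  assumes X: "X \<subseteq> proj_space" and c: "cconv X xs x"
    and cont: "continuous_map (subtopology (complex_topology (variety_of X)) U) euclideanreal g"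
    and U: "open_in_manifold X U" "x \<in> U"
  shows "(\<lambda>n. g (xs n)) \<longlonglongrightarrow> g x"
proof -
  have "limitin (subtopology (complex_topology (variety_of X)) U) xs x sequentially"
    unfolding limitin_subtopology using cconv_limitin[OF X c] cconv_openin[OF X c U] U(2) by simp
  from continuous_map_limit[OF cont this] show ?thesis by (simp add: o_def)
qed

section \<open>Compactness and germs of holomorphic functions\<close>

lemma projective_manifold_subset: "projective_manifold X \<Longrightarrow> X \<subseteq> proj_space"
  by (simp add: projective_manifold_def)

text \<open>Lifts of norm 1 lie in the intersection of the closed cone with the unit sphere, which
  is compact. A limit there is nonzero and therefore spans a point of \<open>X\<close>.\<close>

lemma projective_manifold_compact:
  fixes X :: "('n::finite) pt set"
  assumes X: "projective_manifold X" and xs: "\<And>n. xs n \<in> X"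
  obtains r x where "strict_mono (r :: nat \<Rightarrow> nat)" "cconv X (xs \<circ> r) x"
proof -
  note XP = projective_manifold_subset[OF X]
  have "\<exists>v. norm v = 1 \<and> cline v = xs n" for n
  proof -
    obtain w where w: "w \<noteq> 0" "cline w = xs n" using proj_obtain XP xs by (metis subsetD)
    have e: "(1 / norm w) *\<^sub>R w = complex_of_real (1 / norm w) *s w"
      unfolding vec_eq_iff vector_scaleR_component vector_smult_component by (auto simp: complex_eq_iff)
    have "norm ((1 / norm w) *\<^sub>R w) = 1" using w by simp
    moreover have "cline ((1 / norm w) *\<^sub>R w) = xs n" using w unfolding e by (subst cline_vmult) auto
    ultimately show ?thesis by blast
  qed
  then obtain vs where vs: "\<And>n. norm (vs n) = 1" "\<And>n. cline (vs n) = xs n" by metis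
  have comp: "compact (insert 0 (\<Union>X) \<inter> sphere (0::complex^'n) 1)"
    using X by (intro closed_Int_compact) (auto simp: projective_manifold_def)
  have "vs n \<in> insert 0 (\<Union>X) \<inter> sphere 0 1" for n
    using vs[of n] xs[of n] self_mem_cline by (auto simp del: self_mem_cline)
  then obtain v r where v: "v \<in> insert 0 (\<Union>X) \<inter> sphere 0 1" "strict_mono (r :: nat \<Rightarrow> nat)" "(vs \<circ> r) \<longlonglongrightarrow> v"
    using comp[unfolded compact_eq_seq_compact_metric seq_compact_def, rule_format, of vs] by blast
  have v0: "v \<noteq> 0" "norm v = 1" using v by auto
  then obtain x where x: "x \<in> X" "v \<in> x" using v by auto
  then have "cline v = x" using proj_cline XP v0(1) by blast
  moreover have "vs n \<noteq> 0" for n using vs(1)[of n] by auto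
  ultimately have "cconv X (xs \<circ> r) x"
    unfolding cconv_def using x(1) xs v(3) v0(1) vs(2) by (intro conjI exI[of _ "vs \<circ> r"] exI[of _ v]) auto
  then show ?thesis using that v(2) by blast
qed

text \<open>\<open>holo_at\<close> provides a holomorphic extension near one vector over
  \<open>x\<close>; composition with a scaling moves it to any other.\<close>

lemma holo_at_at:
  assumes X: "X \<subseteq> proj_space" "x \<in> X" and g: "holo_at X x g" and v: "v \<in> x" "v \<noteq> 0"
  obtains A G where "v \<in> A" "mholomorphic_on A G" "\<And>w. w \<in> A \<Longrightarrow> w \<noteq> 0 \<Longrightarrow> cline w \<in> X \<Longrightarrow> g (cline w) = G w"
proof -
  obtain v' A G where *: "v' \<in> x - {0}" "v' \<in> A" "mholomorphic_on A G" "\<forall>w \<in> A - {0}. cline w \<in> X \<longrightarrow> g (cline w) = G w"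
    using g unfolding holo_at_def by blast
  have "v' \<in> cline v" using X v * proj_cline by blast
  then obtain c where c: "v' = c *s v" by (auto simp: mem_cline)
  then have c0: "c \<noteq> 0" using *(1) by auto
  show ?thesis
  proof (rule that[of "(\<lambda>w. c *s w) -` A" "\<lambda>w. G (c *s w)"])
    show "v \<in> (\<lambda>w. c *s w) -` A" using c * by simp
    show "mholomorphic_on ((*s) c -` A) (\<lambda>w. G (c *s w))" by (rule mholomorphic_on_scale[OF *(3) c0])
    show "g (cline w) = G (c *s w)" if "w \<in> (\<lambda>w. c *s w) -` A" "w \<noteq> 0" "cline w \<in> X" for w
    proof -
      show ?thesis using *(4)[rule_format, of "c *s w"] that c0 by simp
    qed
  qed
qed

lemma holo_at_cconv:
  assumes X: "X \<subseteq> proj_space" and g: "holo_at X x g" and c: "cconv X xs x"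
  shows "(\<lambda>n. g (xs n)) \<longlonglongrightarrow> g x" "eventually (\<lambda>n. holo_at X (xs n) g) sequentially"
proof -
  obtain vs v where v: "x \<in> X" "\<And>n. xs n \<in> X" "vs \<longlonglongrightarrow> v" "v \<noteq> 0" "cline v = x" "v \<in> x"
    "\<And>n. vs n \<noteq> 0" "\<And>n. cline (vs n) = xs n" "\<And>n. vs n \<in> xs n" by (rule cconvE[OF c]) (rule that)
  obtain A G where A: "v \<in> A" "mholomorphic_on A G" "\<And>w. w \<in> A \<Longrightarrow> w \<noteq> 0 \<Longrightarrow> cline w \<in> X \<Longrightarrow> g (cline w) = G w"
    using holo_at_at[OF X v(1) g v(6) v(4)] by blast
  have "open A" using A(2) by (simp add: mholomorphic_on_def)
  then have ev: "eventually (\<lambda>n. vs n \<in> A) sequentially" using topological_tendstoD[OF v(3) _ A(1)] by blast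
  have "(\<lambda>n. G (vs n)) \<longlonglongrightarrow> G v" by (rule isCont_tendsto_compose[OF mholomorphic_on_isCont[OF A(2,1)] v(3)])
  moreover have "eventually (\<lambda>n. G (vs n) = g (xs n)) sequentially"
    using ev
  proof eventually_elim
    case (elim n) then show ?case using A(3)[of "vs n"] v(2)[of n] v(7)[of n] v(8)[of n] by simp
  qed
  moreover have "G v = g x" using A(3)[OF A(1) v(4)] v by simp
  ultimately show "(\<lambda>n. g (xs n)) \<longlonglongrightarrow> g x" by (rule tendsto_transform)
  show "eventually (\<lambda>n. holo_at X (xs n) g) sequentially"
    using ev
  proof eventually_elim
    case (elim n)
    show ?case unfolding holo_at_def using elim A(2,3) v(7)[of n] v(9)[of n] by blast
  qed
qed

lemma holo_at_const:
  assumes "X \<subseteq> proj_space" "x \<in> X" shows "holo_at X x (\<lambda>_. c)"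
proof -
  obtain v where v: "v \<noteq> 0" "cline v = x" using assms proj_obtain by (metis subsetD)
  show ?thesis unfolding holo_at_def
    by (rule bexI[of _ v], rule exI[of _ UNIV], rule exI[of _ "\<lambda>_. c"])
      (use v in \<open>auto intro: mholomorphic_on_const\<close>)
qed

lemma holo_at_combine:
  fixes X :: "('n::finite) pt set"
  assumes X: "X \<subseteq> proj_space" "x \<in> X" and gh: "holo_at X x g" "holo_at X x h"
    and op: "\<And>A G (H :: complex ^ 'n \<Rightarrow> complex). mholomorphic_on A G \<Longrightarrow> mholomorphic_on A H \<Longrightarrow> mholomorphic_on A (\<lambda>w. f (G w) (H w))"
  shows "holo_at X x (\<lambda>y. f (g y) (h y))"
proof -
  obtain v where v: "v \<noteq> 0" "cline v = x" using X proj_obtain by (metis subsetD)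
  then have vx: "v \<in> x" by auto
  obtain A G where A: "v \<in> A" "mholomorphic_on A G" "\<And>w. w \<in> A \<Longrightarrow> w \<noteq> 0 \<Longrightarrow> cline w \<in> X \<Longrightarrow> g (cline w) = G w"
    using holo_at_at[OF X gh(1) vx v(1)] by blast
  obtain B H where B: "v \<in> B" "mholomorphic_on B H" "\<And>w. w \<in> B \<Longrightarrow> w \<noteq> 0 \<Longrightarrow> cline w \<in> X \<Longrightarrow> h (cline w) = H w"
    using holo_at_at[OF X gh(2) vx v(1)] by blast
  have op': "open (A \<inter> B)" using A(2) B(2) by (auto simp: mholomorphic_on_def)
  have "mholomorphic_on (A \<inter> B) G" "mholomorphic_on (A \<inter> B) H"
    using mholomorphic_on_subset[OF A(2) _ op'] mholomorphic_on_subset[OF B(2) _ op'] by auto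
  then have m: "mholomorphic_on (A \<inter> B) (\<lambda>w. f (G w) (H w))" by (rule op[of "A \<inter> B" G H])
  show ?thesis unfolding holo_at_def
    by (rule bexI[of _ v], rule exI[of _ "A \<inter> B"], rule exI[of _ "\<lambda>w. f (G w) (H w)"])
      (use m A B vx v in auto)
qed

lemma holo_at_add: "X \<subseteq> proj_space \<Longrightarrow> x \<in> X \<Longrightarrow> holo_at X x g \<Longrightarrow> holo_at X x h \<Longrightarrow> holo_at X x (\<lambda>y. g y + h y)"
  by (rule holo_at_combine[of X x g h "(+)"]) (auto intro: mholomorphic_on_add)

lemma holo_at_mult: "X \<subseteq> proj_space \<Longrightarrow> x \<in> X \<Longrightarrow> holo_at X x g \<Longrightarrow> holo_at X x h \<Longrightarrow> holo_at X x (\<lambda>y. g y * h y)"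
  by (rule holo_at_combine[of X x g h "(*)"]) (auto intro: mholomorphic_on_mult)

lemma holo_at_sum:
  assumes "X \<subseteq> proj_space" "x \<in> X" "\<And>k. k \<in> I \<Longrightarrow> holo_at X x (g k)"
  shows "holo_at X x (\<lambda>y. \<Sum>k\<in>I. g k y)"
  using assms(3)
proof (induction I rule: infinite_finite_induct)
  case (insert k I)
  then show ?case using holo_at_add[OF assms(1,2), of "g k" "\<lambda>y. \<Sum>k\<in>I. g k y"] by simp
qed (use holo_at_const[OF assms(1,2)] in auto)

lemma regs_holo_at:
  assumes X: "X \<subseteq> proj_space" and W: "W \<in> zopens (variety_of X)" "x \<in> W" and g: "g \<in> regs (variety_of X) W"
  shows "holo_at X x g"
proof -
  obtain d0 p0 where p0: "homogeneous_poly d0 p0" "\<forall>v\<in>x - {0}. p0 v \<noteq> 0" "{y \<in> X. \<exists>v\<in>y. v \<noteq> 0 \<and> p0 v \<noteq> 0} \<subseteq> W"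
    using W unfolding mem_zopens_iff[OF X] by blast
  obtain d p q where q: "homogeneous_poly d p" "homogeneous_poly d q" "\<forall>v\<in>x - {0}. q v \<noteq> 0"
    "\<forall>y\<in>W. \<forall>v\<in>y - {0}. q v \<noteq> 0 \<longrightarrow> g y = p v / q v" using g W(2) unfolding variety_regs_iff by blast
  have "x \<in> X" using W zopens_subset by blast
  then obtain v where v: "v \<noteq> 0" "cline v = x" using X proj_obtain by (metis subsetD)
  then have vx: "v \<in> x" by auto
  define A where "A = {w. p0 w * q w \<noteq> 0}"
  have hol: "mholomorphic_on UNIV p0" "mholomorphic_on UNIV p" "mholomorphic_on UNIV q"
    using homogeneous_poly_mholomorphic p0 q by blast+
  have "continuous_on UNIV (\<lambda>w. p0 w * q w)"
    using mholomorphic_on_isCont[OF mholomorphic_on_mult[OF hol(1,3)]] by (simp add: continuous_at_imp_continuous_on)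
  then have oA: "open A" unfolding A_def by (rule open_Collect_neq) simp
  have m: "mholomorphic_on A (\<lambda>w. p w * inverse (q w))"
    by (intro mholomorphic_on_mult mholomorphic_on_inverse mholomorphic_on_subset[OF hol(2)]
         mholomorphic_on_subset[OF hol(3)] oA) (auto simp: A_def)
  show ?thesis unfolding holo_at_def
  proof (rule bexI[of _ v], rule exI[of _ A], rule exI[of _ "\<lambda>w. p w * inverse (q w)"], intro conjI m ballI impI)
    show "v \<in> A" using p0(2) q(3) vx v by (auto simp: A_def)
    show "v \<in> x - {0}" using vx v by simp
    fix w assume w: "w \<in> A - {0}" "cline w \<in> X"
    then have "cline w \<in> {y \<in> X. \<exists>v\<in>y. v \<noteq> 0 \<and> p0 v \<noteq> 0}" by (auto simp: A_def intro!: bexI[of _ w])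
    then have "cline w \<in> W" using p0(3) by blast
    then have "g (cline w) = p w / q w" using q(4) w by (auto simp: A_def)
    then show "g (cline w) = p w * inverse (q w)" by (simp add: divide_inverse)
  qed
qed

section \<open>Tangent vectors and convergence of tangent directions\<close>

lemma tangent_germ: "D \<in> tangent_space X x \<Longrightarrow> holo_at X x g \<Longrightarrow> holo_at X x h \<Longrightarrow> germ_eq X x g h \<Longrightarrow> D g = D h"
  by (simp add: tangent_space_def)

lemma tangent_linear: "D \<in> tangent_space X x \<Longrightarrow> holo_at X x g \<Longrightarrow> holo_at X x h \<Longrightarrow>
   D (\<lambda>y. a * g y + b * h y) = a * D g + b * D h"
  by (simp add: tangent_space_def)

lemma tangent_mult: "D \<in> tangent_space X x \<Longrightarrow> holo_at X x g \<Longrightarrow> holo_at X x h \<Longrightarrow>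
   D (\<lambda>y. g y * h y) = g x * D h + h x * D g"
  by (simp add: tangent_space_def)

lemma tangent_add: "D \<in> tangent_space X x \<Longrightarrow> holo_at X x g \<Longrightarrow> holo_at X x h \<Longrightarrow> D (\<lambda>y. g y + h y) = D g + D h"
  using tangent_linear[of D X x g h 1 1] by simp

lemma tangent_zero:
  assumes "X \<subseteq> proj_space" "x \<in> X" "D \<in> tangent_space X x"
  shows "D (\<lambda>_. 0) = 0"
  using tangent_linear[OF assms(3) holo_at_const[OF assms(1,2), of 0] holo_at_const[OF assms(1,2), of 0], of 0 0] by simp

lemma tangent_const:
  assumes "X \<subseteq> proj_space" "x \<in> X" "D \<in> tangent_space X x"
  shows "D (\<lambda>_. c) = 0"
proof -
  note h = holo_at_const[OF assms(1,2)]
  have "D (\<lambda>y. 1 * 1) = 1 * D (\<lambda>_. 1) + 1 * D (\<lambda>_. 1)" by (rule tangent_mult[OF assms(3) h h])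
  then have "D (\<lambda>_. 1) = 0" by simp
  then show ?thesis using tangent_linear[OF assms(3) h[of 1] h[of 1], of c 0] by simp
qed

lemma tangent_sum:
  assumes X: "X \<subseteq> proj_space" "x \<in> X" "D \<in> tangent_space X x"
    and "\<And>k. k \<in> I \<Longrightarrow> holo_at X x (g k)" "finite I"
  shows "D (\<lambda>y. \<Sum>k\<in>I. g k y) = (\<Sum>k\<in>I. D (g k))"
  using assms(5,4)
proof (induction I rule: finite_induct)
  case empty show ?case using tangent_zero[OF X] by simp
next
  case (insert k I)
  then have "D (\<lambda>y. g k y + (\<Sum>k\<in>I. g k y)) = D (g k) + D (\<lambda>y. \<Sum>k\<in>I. g k y)"
    by (intro tangent_add[OF X(3)] holo_at_sum[OF X(1,2)]) auto
  then show ?case using insert by simp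
qed

lemma tline_eq_scale:
  assumes "c \<noteq> 0" shows "tline (\<lambda>g. c * D g) = tline D"
proof -
  have "(\<exists>d. E = (\<lambda>g. d * (c * D g))) \<longleftrightarrow> (\<exists>d. E = (\<lambda>g. d * D g))" for E
  proof
    assume "\<exists>d. E = (\<lambda>g. d * D g)"
    then obtain d where "E = (\<lambda>g. d * D g)" by auto
    then have "E = (\<lambda>g. (d / c) * (c * D g))" using assms by simp
    then show "\<exists>d. E = (\<lambda>g. d * (c * D g))" by (rule exI)
  next
    assume "\<exists>d. E = (\<lambda>g. d * (c * D g))"
    then obtain d where "E = (\<lambda>g. d * (c * D g))" by auto
    then have "E = (\<lambda>g. (d * c) * D g)" by (simp add: mult.assoc)
    then show "\<exists>d. E = (\<lambda>g. d * D g)" by (rule exI)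
  qed
  then show ?thesis unfolding tline_def by simp
qed

lemma mem_tline: "E \<in> tline D \<longleftrightarrow> (\<exists>c. E = (\<lambda>g. c * D g))" by (auto simp: tline_def)

lemma self_mem_tline: "D \<in> tline D"
  unfolding mem_tline by (rule exI[of _ 1]) simp

lemma fibre_poly_scale: "fibre_poly X U m P \<Longrightarrow> P (x, \<lambda>g. c * D g) = c ^ m * P (x, D)"
  by (induction rule: fibre_poly.induct) (auto simp: algebra_simps power_add)

text \<open>By homogeneity of \<open>Q\<close> it suffices to test one spanning vector of the
  line.\<close>

lemma basic_open_tline_iff:
  assumes "fibre_poly X U m Q" "D \<noteq> (\<lambda>_. 0)"
  shows "(x, tline D) \<in> basic_open X V U Q \<longleftrightarrow> (x, tline D) \<in> lines_in X V \<and> x \<in> U \<and> Q (x, D) \<noteq> 0"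
proof -
  have "(\<forall>E \<in> tline D - {\<lambda>_. 0}. Q (x, E) \<noteq> 0) \<longleftrightarrow> Q (x, D) \<noteq> 0"
  proof
    assume "\<forall>E \<in> tline D - {\<lambda>_. 0}. Q (x, E) \<noteq> 0"
    then show "Q (x, D) \<noteq> 0" using self_mem_tline[of D] assms(2) by blast
  next
    assume Q: "Q (x, D) \<noteq> 0"
    show "\<forall>E \<in> tline D - {\<lambda>_. 0}. Q (x, E) \<noteq> 0"
    proof
      fix E assume "E \<in> tline D - {\<lambda>_. 0}"
      then obtain c where c: "E = (\<lambda>g. c * D g)" "E \<noteq> (\<lambda>_. 0)" by (auto simp: mem_tline)
      then have "c \<noteq> 0" by auto
      then show "Q (x, E) \<noteq> 0" using Q fibre_poly_scale[OF assms(1)] c by simp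
    qed
  qed
  then show ?thesis by (simp add: basic_open_def)
qed

lemma is_fraction_on_tline:
  "is_fraction_on W g P Q \<Longrightarrow> (x, tline D) \<in> W \<Longrightarrow> D \<noteq> (\<lambda>_. 0) \<Longrightarrow> g (x, tline D) = P (x, D) / Q (x, D)"
  unfolding is_fraction_on_def using self_mem_tline[of D] by fastforce

lemma lines_in_iff: "w \<in> lines_in X V \<longleftrightarrow> (\<exists>x D. w = (x, tline D) \<and> x \<in> X \<and> D \<in> V x \<and> D \<noteq> (\<lambda>_. 0))"
  by (auto simp: lines_in_def)

lemma lines_inI: "x \<in> X \<Longrightarrow> D \<in> V x \<Longrightarrow> D \<noteq> (\<lambda>_. 0) \<Longrightarrow> (x, tline D) \<in> lines_in X V"
  unfolding lines_in_iff by blast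

lemma affine_open_zopens: "affine_open S U \<Longrightarrow> U \<in> zopens S"
  by (simp add: affine_open_def)

text \<open>Convergence of lines in \<open>P(V)\<close>, expressed by nonzero vectors that span
  them. Tangent vectors at different points are compared through their values on functions
  holomorphic near the limit point; this is enough for fibre polynomials and hence for the regular
  functions on \<open>P(V)\<close>.\<close>

definition tconv :: "('n::finite) pt set \<Rightarrow> ('n pt \<Rightarrow> 'n tv set) \<Rightarrow> (nat \<Rightarrow> 'n pt) \<Rightarrow> (nat \<Rightarrow> 'n tv) \<Rightarrow> 'n pt \<Rightarrow> 'n tv \<Rightarrow> bool" where
  "tconv X V xs Ds x D \<longleftrightarrow> cconv X xs x \<and> (\<forall>n. Ds n \<in> V (xs n) \<and> Ds n \<noteq> (\<lambda>_. 0)) \<and> D \<in> V x \<and> D \<noteq> (\<lambda>_. 0) \<and>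
     (\<forall>g. holo_at X x g \<longrightarrow> (\<lambda>n. Ds n g) \<longlonglongrightarrow> D g)"

lemma fibre_poly_tconv:
  assumes X: "X \<subseteq> proj_space" and U: "U \<in> zopens (variety_of X)" "x \<in> U" and c: "tconv X V xs Ds x D"
    and P: "fibre_poly X U m P"
  shows "(\<lambda>n. P (xs n, Ds n)) \<longlonglongrightarrow> P (x, D)"
  using P
proof induction
  case (base a)
  then show ?case using regs_cconv[OF X U] c by (simp add: tconv_def)
next
  case (diff a)
  then show ?case using regs_holo_at[OF X U] c by (simp add: tconv_def)
qed (auto intro: tendsto_intros)

lemma basic_open_tconv:
  assumes X: "X \<subseteq> proj_space" and U: "U \<in> zopens (variety_of X)" and c: "tconv X V xs Ds x D"
    and Q: "fibre_poly X U m Q" "(x, tline D) \<in> basic_open X V U Q"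
  shows "eventually (\<lambda>n. (xs n, tline (Ds n)) \<in> basic_open X V U Q) sequentially" "Q (x, D) \<noteq> 0" "x \<in> U"
proof -
  have D: "D \<noteq> (\<lambda>_. 0)" "\<And>n. Ds n \<noteq> (\<lambda>_. 0)" "\<And>n. Ds n \<in> V (xs n)" "cconv X xs x"
    using c by (auto simp: tconv_def)
  have Qx: "x \<in> U" "Q (x, D) \<noteq> 0" using basic_open_tline_iff[OF Q(1) D(1)] Q(2) by auto
  then show "Q (x, D) \<noteq> 0" "x \<in> U" by auto
  have "eventually (\<lambda>n. Q (xs n, Ds n) \<noteq> 0) sequentially"
    by (rule tendsto_imp_eventually_ne[OF fibre_poly_tconv[OF X U Qx(1) c Q(1)] Qx(2)])
  moreover have "eventually (\<lambda>n. xs n \<in> U) sequentially" by (rule zopens_cconv[OF X U Qx(1) D(4)])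
  ultimately show "eventually (\<lambda>n. (xs n, tline (Ds n)) \<in> basic_open X V U Q) sequentially"
  proof eventually_elim
    case (elim n)
    have "xs n \<in> X" using D(4) by (simp add: cconv_def)
    then show ?case using elim basic_open_tline_iff[OF Q(1) D(2)] lines_inI D(2,3) by metis
  qed
qed

lemma projectivization_zopens_iff: "W \<in> zopens (projectivization X V) \<longleftrightarrow> W \<subseteq> lines_in X V \<and>
        (\<forall>w\<in>W. \<exists>U m Q. affine_open (variety_of X) U \<and> fibre_poly X U m Q \<and>
           w \<in> basic_open X V U Q \<and> basic_open X V U Q \<subseteq> W)"
  by (simp add: projectivization_def)

lemma projectivization_regs_iff: "g \<in> regs (projectivization X V) W \<longleftrightarrow> (\<forall>w\<in>W. \<exists>U m P Q. affine_open (variety_of X) U \<and>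
           fibre_poly X U m P \<and> fibre_poly X U m Q \<and>
           w \<in> basic_open X V U Q \<and> is_fraction_on (W \<inter> basic_open X V U Q) g P Q)"
  by (simp add: projectivization_def)

lemma zopens_tconv:
  assumes X: "X \<subseteq> proj_space" and c: "tconv X V xs Ds x D" and W: "W \<in> zopens (projectivization X V)" "(x, tline D) \<in> W"
  shows "eventually (\<lambda>n. (xs n, tline (Ds n)) \<in> W) sequentially"
proof -
  obtain U m Q where Q: "affine_open (variety_of X) U" "fibre_poly X U m Q"
    "(x, tline D) \<in> basic_open X V U Q" "basic_open X V U Q \<subseteq> W"
    using W unfolding projectivization_zopens_iff by blast
  from basic_open_tconv(1)[OF X affine_open_zopens[OF Q(1)] c Q(2,3)] show ?thesis
    by eventually_elim (use Q(4) in blast)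
qed

lemma regs_tconv:
  assumes X: "X \<subseteq> proj_space" and c: "tconv X V xs Ds x D" and W: "W \<in> zopens (projectivization X V)" "(x, tline D) \<in> W"
    and g: "g \<in> regs (projectivization X V) W"
  shows "(\<lambda>n. g (xs n, tline (Ds n))) \<longlonglongrightarrow> g (x, tline D)"
proof -
  obtain U m P Q where Q: "affine_open (variety_of X) U" "fibre_poly X U m P" "fibre_poly X U m Q"
    "(x, tline D) \<in> basic_open X V U Q" "is_fraction_on (W \<inter> basic_open X V U Q) g P Q"
    using W(2) g unfolding projectivization_regs_iff by blast
  note U = affine_open_zopens[OF Q(1)]
  note b = basic_open_tconv[OF X U c Q(3,4)]
  have D: "D \<noteq> (\<lambda>_. 0)" "\<And>n. Ds n \<noteq> (\<lambda>_. 0)" using c by (auto simp: tconv_def)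
  have "(\<lambda>n. P (xs n, Ds n) / Q (xs n, Ds n)) \<longlonglongrightarrow> P (x, D) / Q (x, D)"
    by (intro tendsto_divide fibre_poly_tconv[OF X U b(3) c Q(2)] fibre_poly_tconv[OF X U b(3) c Q(3)] b(2))
  moreover have "P (x, D) / Q (x, D) = g (x, tline D)"
    using is_fraction_on_tline[OF Q(5)] W(2) Q(4) D(1) by simp
  moreover have "eventually (\<lambda>n. P (xs n, Ds n) / Q (xs n, Ds n) = g (xs n, tline (Ds n))) sequentially"
    using b(1) zopens_tconv[OF X c W]
  proof eventually_elim
    case (elim n)
    then show ?case using is_fraction_on_tline[OF Q(5) _ D(2)] by simp
  qed
  ultimately show ?thesis by (rule tendsto_transform')
qed

text \<open>A regular function must be a fraction whose denominator does not vanish at the point.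
  Openness of \<open>W\<close> supplies such a \<open>Q\<close>, and the constant is
  \<open>Q / Q\<close>.\<close>

lemma projectivization_regs_one:
  assumes "W \<in> zopens (projectivization X V)" shows "(\<lambda>_. 1) \<in> regs (projectivization X V) W"
  unfolding projectivization_regs_iff
proof
  fix w assume "w \<in> W"
  then obtain U m Q where Q: "affine_open (variety_of X) U" "fibre_poly X U m Q" "w \<in> basic_open X V U Q"
    using assms unfolding projectivization_zopens_iff by blast
  have "is_fraction_on (W \<inter> basic_open X V U Q) (\<lambda>_. 1) Q Q"
    unfolding is_fraction_on_def by (auto simp: basic_open_def)
  then show "\<exists>U m P Q. affine_open (variety_of X) U \<and> fibre_poly X U m P \<and> fibre_poly X U m Q \<and>
           w \<in> basic_open X V U Q \<and> is_fraction_on (W \<inter> basic_open X V U Q) (\<lambda>_. 1) P Q"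
    using Q by blast
qed

lemma tconv_limitin:
  assumes X: "X \<subseteq> proj_space" and c: "tconv X V xs Ds x D" and W: "W \<in> zopens (projectivization X V)" "(x, tline D) \<in> W"
  shows "limitin (complex_topology (projectivization X V)) (\<lambda>n. (xs n, tline (Ds n))) (x, tline D) sequentially"
proof (rule limitin_complex_topology[OF W(2,1) projectivization_regs_one[OF W(1)]])
  fix W assume W: "W \<in> zopens (projectivization X V)" "(x, tline D) \<in> W"
  show "eventually (\<lambda>n. (xs n, tline (Ds n)) \<in> W) sequentially" by (rule zopens_tconv[OF X c W])
  fix g assume "g \<in> regs (projectivization X V) W"
  then show "(\<lambda>n. g (xs n, tline (Ds n))) \<longlonglongrightarrow> g (x, tline D)" by (rule regs_tconv[OF X c W])
qed

lemma bounded_family_convergent_subseq: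
  fixes c :: "nat \<Rightarrow> nat \<Rightarrow> complex"
  assumes "\<And>n i. i < k \<Longrightarrow> cmod (c n i) \<le> B"
  shows "\<exists>r l. strict_mono (r :: nat \<Rightarrow> nat) \<and> (\<forall>i<k. (\<lambda>n. c (r n) i) \<longlonglongrightarrow> l i)"
  using assms
proof (induction k)
  case 0
  show ?case by (rule exI[of _ id]) (auto simp: strict_mono_def)
next
  case (Suc k)
  then obtain r l where r: "strict_mono (r :: nat \<Rightarrow> nat)" "\<forall>i<k. (\<lambda>n. c (r n) i) \<longlonglongrightarrow> l i" by force
  have "bounded (range (\<lambda>n. c (r n) k))" using Suc.prems by (auto simp: bounded_iff)
  then obtain l' r' where r': "strict_mono (r' :: nat \<Rightarrow> nat)" "((\<lambda>n. c (r n) k) \<circ> r') \<longlonglongrightarrow> l'"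
    using bounded_imp_convergent_subsequence by blast
  have "(\<lambda>n. c ((r \<circ> r') n) i) \<longlonglongrightarrow> (l(k := l')) i" if "i < Suc k" for i
  proof (cases "i = k")
    case True then show ?thesis using r'(2) by (simp add: o_def)
  next
    case False
    then have "i < k" using that by simp
    from LIMSEQ_subseq_LIMSEQ[OF r(2)[rule_format, OF this] r'(1)] show ?thesis using False by (simp add: o_def)
  qed
  then show ?case using strict_mono_o[OF r(1) r'(1)] by blast
qed

text \<open>In a local frame the coefficients are scaled so that their absolute values add up to 1.
  A subsequence of them converges, and linear independence of the frame makes the limit vector
  nonzero. Since the tangent vectors change by factors, only homogeneous statements can be carried
  to the limit.\<close>

lemma tconv_compact:
  fixes X :: "('n::finite) pt set"
  assumes M: "directed_projective_manifold X V" and xs: "\<And>n. xs n \<in> X" and Ds: "\<And>n. Ds n \<in> V (xs n)" "\<And>n. Ds n \<noteq> (\<lambda>_. 0)"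
  obtains r x Es D where "strict_mono (r :: nat \<Rightarrow> nat)" "tconv X V (xs \<circ> r) Es x D"
    "\<And>n. \<exists>c. c \<noteq> 0 \<and> Es n = (\<lambda>g. c * Ds (r n) g)"
proof -
  have X: "projective_manifold X" and V: "holomorphic_subbundle X V" using M by (auto simp: directed_projective_manifold_def)
  note XP = projective_manifold_subset[OF X]
  obtain r1 x where r1: "strict_mono (r1 :: nat \<Rightarrow> nat)" "cconv X (xs \<circ> r1) x"
    using projective_manifold_compact[OF X, of xs] xs by blast
  have xX: "x \<in> X" using r1(2) by (simp add: cconv_def)
  obtain \<Omega> k v where fr: "open_in_manifold X \<Omega>" "x \<in> \<Omega>"
    and frame: "\<forall>y\<in>\<Omega>. V y = {(\<lambda>g. \<Sum>i<k. c i * v i y g) |c. True} \<and>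
           (\<forall>c. (\<forall>g. (\<Sum>i<k. c i * v i y g) = 0) \<longrightarrow> (\<forall>i<(k::nat). c i = 0)) \<and>
           (\<forall>i<k. \<forall>g. holo_at X y g \<longrightarrow> holo_at X y (\<lambda>y'. v i y' g))"
    using bspec[OF conjunct2[OF V[unfolded holomorphic_subbundle_def]] xX] by (elim exE conjE) (rule that)
  have fr1: "V y = {(\<lambda>g. \<Sum>i<k. c i * v i y g) |c. True}" if "y \<in> \<Omega>" for y
    using bspec[OF frame that] by (rule conjunct1)
  have fr2: "\<forall>i<k. c i = 0" if "y \<in> \<Omega>" "\<forall>g. (\<Sum>i<k. c i * v i y g) = 0" for y c
    using bspec[OF frame that(1), THEN conjunct2, THEN conjunct1, THEN spec, THEN mp, OF that(2)] .
  have fr3: "holo_at X y (\<lambda>y'. v i y' g)" if "y \<in> \<Omega>" "i < k" "holo_at X y g" for y i g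
    using bspec[OF frame that(1), THEN conjunct2, THEN conjunct2, THEN spec, THEN mp, OF that(2), THEN spec, THEN mp, OF that(3)] .
  obtain N where N: "\<And>n. n \<ge> N \<Longrightarrow> xs (r1 n) \<in> \<Omega>"
    using cconv_openin[OF XP r1(2) fr] by (auto simp: eventually_sequentially)
  define r2 where "r2 = r1 \<circ> (\<lambda>n. n + N)"
  have sm: "strict_mono (\<lambda>n. n + N)" by (simp add: strict_mono_def)
  have r2: "strict_mono r2" "cconv X (xs \<circ> r2) x" "\<And>n. xs (r2 n) \<in> \<Omega>"
    using strict_mono_o[OF r1(1) sm] cconv_subseq[OF r1(2) sm] N by (auto simp: r2_def o_assoc)
  have "\<exists>c. Ds (r2 n) = (\<lambda>g. \<Sum>i<k. c i * v i (xs (r2 n)) g)" for n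
    using Ds(1)[of "r2 n"] fr1[OF r2(3)[of n]] by auto
  then obtain c where c: "\<And>n. Ds (r2 n) = (\<lambda>g. \<Sum>i<k. c n i * v i (xs (r2 n)) g)" by metis
  define s where "s n = (\<Sum>i<k. cmod (c n i))" for n
  have s: "s n > 0" for n
  proof (rule ccontr)
    assume "\<not> s n > 0"
    then have "s n = 0" unfolding s_def by (meson le_less not_less norm_ge_zero sum_nonneg)
    then have "\<forall>i<k. c n i = 0" unfolding s_def by (simp add: sum_nonneg_eq_0_iff)
    then show False using Ds(2)[of "r2 n"] c[of n] by simp
  qed
  define c' where "c' n i = c n i / of_real (s n)" for n i
  have c'1: "(\<Sum>i<k. cmod (c' n i)) = 1" for n
    using s[of n] by (simp add: c'_def norm_divide flip: sum_divide_distrib) (simp add: s_def)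
  have "cmod (c' n i) \<le> 1" if "i < k" for n i
    using member_le_sum[of i "{..<k}" "\<lambda>i. cmod (c' n i)"] that c'1[of n] by simp
  then obtain r3 l where r3: "strict_mono (r3 :: nat \<Rightarrow> nat)" "\<And>i. i < k \<Longrightarrow> (\<lambda>n. c' (r3 n) i) \<longlonglongrightarrow> l i"
    using bounded_family_convergent_subseq[of k c' 1] by blast
  have l1: "(\<Sum>i<k. cmod (l i)) = 1"
  proof -
    have "(\<lambda>n. \<Sum>i<k. cmod (c' (r3 n) i)) \<longlonglongrightarrow> (\<Sum>i<k. cmod (l i))"
      by (intro tendsto_sum tendsto_norm r3) auto
    then show ?thesis unfolding c'1 by (simp add: LIMSEQ_const_iff)
  qed
  define Es where "Es n = (\<lambda>g. \<Sum>i<k. c' (r3 n) i * v i (xs (r2 (r3 n))) g)" for n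
  define D where "D = (\<lambda>g. \<Sum>i<k. l i * v i x g)"
  define r where "r = r2 \<circ> r3"
  have Es: "Es n = (\<lambda>g. (1 / of_real (s (r3 n))) * Ds (r n) g)" for n
    unfolding Es_def r_def c c'_def by (simp add: sum_divide_distrib c)
  have cc: "cconv X (xs \<circ> r) x" using cconv_subseq[OF r2(2) r3(1)] by (simp add: r_def o_assoc)
  have "tconv X V (xs \<circ> r) Es x D"
    unfolding tconv_def
  proof (intro conjI allI impI cc)
    show "Es n \<in> V ((xs \<circ> r) n)" for n
      using fr1[OF r2(3)[of "r3 n"]] unfolding Es_def r_def by auto
    show "D \<in> V x" using fr1[OF fr(2)] unfolding D_def by auto
    show "Es n \<noteq> (\<lambda>_. 0)" for n
      using Ds(2)[of "r n"] s[of "r3 n"] unfolding Es by (auto simp: fun_eq_iff)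
    show "D \<noteq> (\<lambda>_. 0)"
    proof
      assume "D = (\<lambda>_. 0)"
      then have "\<forall>g. (\<Sum>i<k. l i * v i x g) = 0" unfolding D_def by metis
      then have "\<forall>i<k. l i = 0" by (rule fr2[OF fr(2)])
      then show False using l1 by simp
    qed
    fix g assume g: "holo_at X x g"
    have "(\<lambda>n. v i ((xs \<circ> r) n) g) \<longlonglongrightarrow> v i x g" if "i < k" for i
      using holo_at_cconv(1)[OF XP fr3[OF fr(2) that g] cc] .
    then show "(\<lambda>n. Es n g) \<longlonglongrightarrow> D g"
      unfolding Es_def D_def by (intro tendsto_sum tendsto_mult r3) (auto simp: r_def o_def)
  qed
  moreover have "\<exists>c. c \<noteq> 0 \<and> Es n = (\<lambda>g. c * Ds (r n) g)" for n
    using s[of "r3 n"] unfolding Es by (intro exI[of _ "1 / of_real (s (r3 n))"]) auto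
  ultimately show ?thesis using that strict_mono_o[OF r2(1) r3(1)] unfolding r_def by blast
qed

section \<open>Basic open subsets of affine charts\<close>

lemma alg_gen_mono:
  assumes "g \<in> alg_gen G" "G \<subseteq> G'" shows "g \<in> alg_gen G'"
  using assms(1) by induction (use assms(2) in \<open>auto intro: alg_gen.intros\<close>)

lemma affine_polys_cong:
  assumes "p \<in> affine_polys m" "\<And>i. i < m \<Longrightarrow> y i = y' i"
  shows "p y = p y'"
  using assms unfolding affine_polys_def by (induction rule: alg_gen.induct) auto

lemma affine_polys_Suc: "p \<in> affine_polys m \<Longrightarrow> p \<in> affine_polys (Suc m)"
  unfolding affine_polys_def by (erule alg_gen_mono) (auto intro: less_SucI)

lemma affine_polys_const: "(\<lambda>_. c) \<in> affine_polys m"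
  unfolding affine_polys_def by (rule alg_gen.const)

lemma affine_polys_coord: "i < m \<Longrightarrow> (\<lambda>y. y i) \<in> affine_polys m"
  unfolding affine_polys_def by (rule alg_gen.gen) auto

lemma affine_polys_add: "p \<in> affine_polys m \<Longrightarrow> q \<in> affine_polys m \<Longrightarrow> (\<lambda>y. p y + q y) \<in> affine_polys m"
  unfolding affine_polys_def by (rule alg_gen.add)

lemma affine_polys_mult: "p \<in> affine_polys m \<Longrightarrow> q \<in> affine_polys m \<Longrightarrow> (\<lambda>y. p y * q y) \<in> affine_polys m"
  unfolding affine_polys_def by (rule alg_gen.mult)

lemma affine_polys_power: "p \<in> affine_polys m \<Longrightarrow> (\<lambda>y. p y ^ k) \<in> affine_polys m"
  by (induction k) (simp_all add: affine_polys_const affine_polys_mult)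

text \<open>Where \<open>y m * p y = 1\<close> holds, the last coordinate is the inverse of
  \<open>p\<close>, so a high enough power of \<open>p\<close> removes it from any
  polynomial.\<close>

lemma affine_polys_clear_denominator:
  assumes "r \<in> affine_polys (Suc m)" and p: "p \<in> affine_polys m"
  shows "\<exists>r'\<in>affine_polys m. \<exists>k. \<forall>y. y m * p y = 1 \<longrightarrow> r y * p y ^ k = r' y"
  using assms(1) unfolding affine_polys_def[of "Suc m"]
proof (induction rule: alg_gen.induct)
  case (const c)
  show ?case by (rule bexI[OF _ affine_polys_const[of c]], rule exI[of _ 0]) simp
next
  case (gen g)
  then obtain i where i: "g = (\<lambda>y. y i)" "i < Suc m" by blast
  show ?case
  proof (cases "i = m")
    case True
    show ?thesis by (rule bexI[OF _ affine_polys_const[of 1]], rule exI[of _ 1]) (simp add: i True)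
  next
    case False
    then have "i < m" using i by simp
    then show ?thesis by (intro bexI[OF _ affine_polys_coord[of i]]) (rule exI[of _ 0], auto simp: i)
  qed
next
  case (add g h)
  obtain g' k where g: "g' \<in> affine_polys m" "\<forall>y. y m * p y = 1 \<longrightarrow> g y * p y ^ k = g' y"
    using add.IH(1) by (elim bexE exE) (rule that)
  obtain h' l where h: "h' \<in> affine_polys m" "\<forall>y. y m * p y = 1 \<longrightarrow> h y * p y ^ l = h' y"
    using add.IH(2) by (elim bexE exE) (rule that)
  have m: "(\<lambda>y. g' y * p y ^ l + h' y * p y ^ k) \<in> affine_polys m"
    by (intro affine_polys_add affine_polys_mult affine_polys_power g h p)
  show ?case
  proof (rule bexI[OF _ m], rule exI[of _ "k + l"], intro allI impI)
    fix y assume y: "y m * p y = 1"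
    show "(g y + h y) * p y ^ (k + l) = g' y * p y ^ l + h' y * p y ^ k"
      unfolding g(2)[rule_format, OF y, symmetric] h(2)[rule_format, OF y, symmetric] by (simp add: power_add algebra_simps)
  qed
next
  case (mult g h)
  obtain g' k where g: "g' \<in> affine_polys m" "\<forall>y. y m * p y = 1 \<longrightarrow> g y * p y ^ k = g' y"
    using mult.IH(1) by (elim bexE exE) (rule that)
  obtain h' l where h: "h' \<in> affine_polys m" "\<forall>y. y m * p y = 1 \<longrightarrow> h y * p y ^ l = h' y"
    using mult.IH(2) by (elim bexE exE) (rule that)
  have m: "(\<lambda>y. g' y * h' y) \<in> affine_polys m"
    by (intro affine_polys_mult g h)
  show ?case
  proof (rule bexI[OF _ m], rule exI[of _ "k + l"], intro allI impI)
    fix y assume y: "y m * p y = 1"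
    show "(g y * h y) * p y ^ (k + l) = g' y * h' y"
      unfolding g(2)[rule_format, OF y, symmetric] h(2)[rule_format, OF y, symmetric] by (simp add: power_add algebra_simps)
  qed
qed

lemma chart_regs_iff:
  assumes "affine_chart S U m H" "W \<subseteq> U" "W \<in> zopens S"
  shows "g \<in> regs S W \<longleftrightarrow> (\<forall>w\<in>W. \<exists>p\<in>affine_polys m. \<exists>q\<in>affine_polys m.
          q (H w) \<noteq> 0 \<and> (\<forall>u\<in>W. q (H u) \<noteq> 0 \<longrightarrow> g u = p (H u) / q (H u)))"
  using assms unfolding affine_chart_def by simp

lemma chart_zopens_iff:
  assumes "affine_chart S U m H" "W \<subseteq> U"
  shows "W \<in> zopens S \<longleftrightarrow> (\<exists>T \<subseteq> affine_polys m. W = {u \<in> U. \<exists>p\<in>T. p (H u) \<noteq> 0})"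
  using assms unfolding affine_chart_def by simp

lemma chart_poly_regs:
  assumes "affine_chart S U m H" "U \<in> zopens S" "p \<in> affine_polys m"
  shows "(\<lambda>u. p (H u)) \<in> regs S U"
  unfolding chart_regs_iff[OF assms(1) order_refl assms(2)]
  by (rule ballI, rule bexI[OF _ assms(3)], rule bexI[OF _ affine_polys_const[of 1]]) simp

lemma chart_basic_zopens:
  assumes "affine_chart S U m H" "p \<in> affine_polys m"
  shows "{u \<in> U. p (H u) \<noteq> 0} \<in> zopens S"
proof -
  have "\<exists>T \<subseteq> affine_polys m. {u \<in> U. p (H u) \<noteq> 0} = {u \<in> U. \<exists>p\<in>T. p (H u) \<noteq> 0}"
    by (rule exI[of _ "{p}"]) (use assms(2) in simp)
  then show ?thesis by (subst chart_zopens_iff[OF assms(1)]) auto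
qed

lemma chart_basic_nhd:
  assumes "affine_chart S U m H" "W \<in> zopens S" "W \<subseteq> U" "w \<in> W"
  obtains p where "p \<in> affine_polys m" "p (H w) \<noteq> 0" "{u \<in> U. p (H u) \<noteq> 0} \<subseteq> W"
proof -
  obtain T where T: "T \<subseteq> affine_polys m" "W = {u \<in> U. \<exists>p\<in>T. p (H u) \<noteq> 0}"
    using assms(2) unfolding chart_zopens_iff[OF assms(1,3)] by (elim exE conjE)
  then obtain p where "p \<in> T" "p (H w) \<noteq> 0" using assms(4) by auto
  then show ?thesis using that[of p] T by auto
qed

text \<open>The Rabinowitsch trick: with \<open>1 / p\<close> as an additional coordinate, the set
  where \<open>p\<close> does not vanish becomes the closed set given by the old equations and
  \<open>y m * p y = 1\<close>. Conversely, open sets and fractions in the new coordinates are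
  expressed in the old ones after multiplication by powers of \<open>p\<close>.\<close>

lemma affine_chart_basic_open:
  assumes U: "affine_chart S U m H" and p: "p \<in> affine_polys m"
  shows "affine_chart S {u \<in> U. p (H u) \<noteq> 0} (Suc m) (\<lambda>u. (H u)(m := 1 / p (H u)))" (is "affine_chart S ?D _ ?H")
proof -
  have inj: "inj_on H U" using U by (simp add: affine_chart_def)
  obtain T where T: "T \<subseteq> affine_polys m" "H ` U = {y. (\<forall>i\<ge>m. y i = 0) \<and> (\<forall>p\<in>T. p y = 0)}"
    using U[unfolded affine_chart_def, THEN conjunct2, THEN conjunct1] by (elim exE conjE)
  have H0: "H u i = 0" if "u \<in> U" "m \<le> i" for u i
  proof -
    have "H u \<in> H ` U" using that by simp
    then show ?thesis unfolding T(2) using that by simp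
  qed
  have low: "q (?H u) = q (H u)" if "q \<in> affine_polys m" for q u
    by (rule affine_polys_cong[OF that]) simp
  have clear: "\<exists>r'\<in>affine_polys m. \<exists>k. \<forall>u\<in>?D. r (?H u) * p (H u) ^ k = r' (H u)" if r: "r \<in> affine_polys (Suc m)" for r
  proof -
    obtain r' k where r': "r' \<in> affine_polys m" "\<And>y. y m * p y = 1 \<Longrightarrow> r y * p y ^ k = r' y"
      using affine_polys_clear_denominator[OF r p] by (elim bexE exE) (rule that, blast+)
    show ?thesis
    proof (rule bexI[OF _ r'(1)], rule exI[of _ k], rule ballI)
      fix u assume u: "u \<in> ?D"
      have "r (?H u) * p (?H u) ^ k = r' (?H u)" by (rule r'(2)) (use u in \<open>simp add: low[OF p]\<close>)
      then show "r (?H u) * p (H u) ^ k = r' (H u)" by (simp only: low[OF p] low[OF r'(1)])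
    qed
  qed
  show ?thesis
    unfolding affine_chart_def
  proof (intro conjI allI impI)
    show "inj_on ?H ?D"
    proof (rule inj_onI)
      fix u v assume uv: "u \<in> ?D" "v \<in> ?D" and e: "?H u = ?H v"
      have "H u i = H v i" for i
        using fun_cong[OF e, of i] H0[of u m] H0[of v m] uv by (cases "i = m") auto
      then have "H u = H v" by (rule ext)
      then show "u = v" using inj uv by (auto dest: inj_onD)
    qed
    have ym: "(\<lambda>y. y m * p y + (-1)) \<in> affine_polys (Suc m)"
      by (intro affine_polys_add affine_polys_mult affine_polys_const affine_polys_coord affine_polys_Suc p) simp
    show "\<exists>T\<subseteq>affine_polys (Suc m). ?H ` ?D = {y. (\<forall>i\<ge>Suc m. y i = 0) \<and> (\<forall>p\<in>T. p y = 0)}"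
    proof (rule exI[of _ "insert (\<lambda>y. y m * p y + (-1)) T"], intro conjI)
      show "insert (\<lambda>y. y m * p y + (-1)) T \<subseteq> affine_polys (Suc m)"
        using ym T(1) affine_polys_Suc by blast
      show "?H ` ?D = {y. (\<forall>i\<ge>Suc m. y i = 0) \<and> (\<forall>q\<in>insert (\<lambda>y. y m * p y + (-1)) T. q y = 0)}"
      proof (intro set_eqI iffI)
        fix y assume "y \<in> ?H ` ?D"
        then obtain u where u: "u \<in> U" "p (H u) \<noteq> 0" "y = ?H u" by auto
        have "H u \<in> H ` U" using u by simp
        then have "q (H u) = 0" if "q \<in> T" for q using that unfolding T(2) by simp
        then have "q y = 0" if "q \<in> T" for q using that low[of q u] T(1) u(3) by auto
        moreover have "y m * p y + (-1) = 0" using u low[OF p, of u] by simp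
        ultimately show "y \<in> {y. (\<forall>i\<ge>Suc m. y i = 0) \<and> (\<forall>q\<in>insert (\<lambda>y. y m * p y + (-1)) T. q y = 0)}"
          using u H0 by auto
      next
        fix y assume y: "y \<in> {y. (\<forall>i\<ge>Suc m. y i = 0) \<and> (\<forall>q\<in>insert (\<lambda>y. y m * p y + (-1)) T. q y = 0)}"
        have eq: "q (y(m := 0)) = q y" if "q \<in> affine_polys m" for q
          by (rule affine_polys_cong[OF that]) simp
        have "y(m := 0) \<in> H ` U" unfolding T(2)
        proof (intro CollectI conjI allI impI ballI)
          fix i assume "m \<le> i" then show "(y(m := 0)) i = 0" using y by (cases "i = m") auto
        next
          fix q assume "q \<in> T" then show "q (y(m := 0)) = 0" using eq[of q] T(1) y by auto
        qed
        then obtain u where u: "u \<in> U" "H u = y(m := 0)" by auto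
        have y1: "y m * p y = 1" using y by simp
        then have "p y \<noteq> 0" by auto
        then have py: "p (H u) \<noteq> 0" "1 / p (H u) = y m" unfolding u(2) eq[OF p] using y1 by (auto simp: field_simps)
        have "?H u = y" by (simp only: py(2)) (simp add: u(2))
        then show "y \<in> ?H ` ?D" using u(1) py(1) by (intro image_eqI[of y ?H u]) auto
      qed
    qed
  next
    fix W assume W: "W \<subseteq> ?D"
    then have WU: "W \<subseteq> U" by auto
    show "W \<in> zopens S \<longleftrightarrow> (\<exists>T \<subseteq> affine_polys (Suc m). W = {u \<in> ?D. \<exists>p\<in>T. p (?H u) \<noteq> 0})"
    proof
      assume "W \<in> zopens S"
      then obtain T1 where T1: "T1 \<subseteq> affine_polys m" "W = {u \<in> U. \<exists>p\<in>T1. p (H u) \<noteq> 0}"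
        unfolding chart_zopens_iff[OF U WU] by (elim exE conjE)
      have "(\<exists>q\<in>T1. q (?H u) \<noteq> 0) \<longleftrightarrow> (\<exists>q\<in>T1. q (H u) \<noteq> 0)" for u
        by (intro bex_cong refl, subst low) (use T1(1) in auto)
      then have "W = {u \<in> ?D. \<exists>p\<in>T1. p (?H u) \<noteq> 0}"
        using T1(2) W by auto
      then show "\<exists>T \<subseteq> affine_polys (Suc m). W = {u \<in> ?D. \<exists>p\<in>T. p (?H u) \<noteq> 0}"
        using T1(1) affine_polys_Suc by (intro exI[of _ T1]) auto
    next
      assume "\<exists>T \<subseteq> affine_polys (Suc m). W = {u \<in> ?D. \<exists>p\<in>T. p (?H u) \<noteq> 0}"
      then obtain T1 where T1: "T1 \<subseteq> affine_polys (Suc m)" "W = {u \<in> ?D. \<exists>p\<in>T1. p (?H u) \<noteq> 0}" by (elim exE conjE)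
      define T2 where "T2 = {s \<in> affine_polys m. \<forall>u\<in>U. s (H u) \<noteq> 0 \<longrightarrow> u \<in> W}"
      have "T2 \<subseteq> affine_polys m" unfolding T2_def by auto
      moreover have "W = {u \<in> U. \<exists>p\<in>T2. p (H u) \<noteq> 0}"
      proof (intro set_eqI iffI)
        fix u assume "u \<in> W"
        then obtain r where r: "u \<in> ?D" "r \<in> T1" "r (?H u) \<noteq> 0" unfolding T1(2) by auto
        obtain r' k where r': "r' \<in> affine_polys m" "\<forall>u\<in>?D. r (?H u) * p (H u) ^ k = r' (H u)"
          using clear[OF subsetD[OF T1(1) r(2)]] by (elim bexE exE) (rule that)
        have "v \<in> W" if v: "v \<in> U" "p (H v) * r' (H v) \<noteq> 0" for v
        proof -
          have vD: "v \<in> ?D" using v by auto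
          then have "r (?H v) \<noteq> 0" using bspec[OF r'(2) vD] v(2) by auto
          then show ?thesis unfolding T1(2) using vD r(2) by auto
        qed
        then have in2: "(\<lambda>y. p y * r' y) \<in> T2" unfolding T2_def using affine_polys_mult[OF p r'(1)] by simp
        have "r' (H u) = r (?H u) * p (H u) ^ k" using bspec[OF r'(2) r(1)] by (rule sym)
        then have "p (H u) * r' (H u) \<noteq> 0" using r by auto
        then show "u \<in> {u \<in> U. \<exists>p\<in>T2. p (H u) \<noteq> 0}"
          using r(1) by (intro CollectI conjI bexI[OF _ in2]) auto
      qed (auto simp: T2_def)
      ultimately show "W \<in> zopens S" unfolding chart_zopens_iff[OF U WU] by (intro exI[of _ T2] conjI)
    qed
  next
    fix W assume W: "W \<subseteq> ?D" "W \<in> zopens S"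
    then have WU: "W \<subseteq> U" by auto
    have "g \<in> regs S W \<longleftrightarrow> (\<forall>w\<in>W. \<exists>a\<in>affine_polys (Suc m). \<exists>q\<in>affine_polys (Suc m).
          q (?H w) \<noteq> 0 \<and> (\<forall>u\<in>W. q (?H u) \<noteq> 0 \<longrightarrow> g u = a (?H u) / q (?H u)))" (is "_ \<longleftrightarrow> ?R") for g
    proof
      assume g: "g \<in> regs S W"
      show ?R
      proof
        fix w assume w: "w \<in> W"
        obtain a q where aq: "a \<in> affine_polys m" "q \<in> affine_polys m" "q (H w) \<noteq> 0"
          "\<forall>u\<in>W. q (H u) \<noteq> 0 \<longrightarrow> g u = a (H u) / q (H u)"
          using g[unfolded chart_regs_iff[OF U WU W(2)], THEN bspec, OF w] by (elim bexE conjE) (rule that)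
        show "\<exists>a\<in>affine_polys (Suc m). \<exists>q\<in>affine_polys (Suc m).
          q (?H w) \<noteq> 0 \<and> (\<forall>u\<in>W. q (?H u) \<noteq> 0 \<longrightarrow> g u = a (?H u) / q (?H u))"
          by (rule bexI[OF _ affine_polys_Suc[OF aq(1)]], rule bexI[OF _ affine_polys_Suc[OF aq(2)]],
              unfold low[OF aq(1)] low[OF aq(2)], rule conjI[OF aq(3,4)])
      qed
    next
      assume R: ?R
      show "g \<in> regs S W"
        unfolding chart_regs_iff[OF U WU W(2)]
      proof
        fix w assume w: "w \<in> W"
        obtain a q where aq: "a \<in> affine_polys (Suc m)" "q \<in> affine_polys (Suc m)" "q (?H w) \<noteq> 0"
          "\<forall>u\<in>W. q (?H u) \<noteq> 0 \<longrightarrow> g u = a (?H u) / q (?H u)" using bspec[OF R w] by (elim bexE conjE) (rule that)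
        obtain a' k where a': "a' \<in> affine_polys m" "\<forall>u\<in>?D. a (?H u) * p (H u) ^ k = a' (H u)"
          using clear[OF aq(1)] by (elim bexE exE) (rule that)
        obtain q' l where q': "q' \<in> affine_polys m" "\<forall>u\<in>?D. q (?H u) * p (H u) ^ l = q' (H u)"
          using clear[OF aq(2)] by (elim bexE exE) (rule that)
        have m1: "(\<lambda>y. a' y * p y ^ l) \<in> affine_polys m" and m2: "(\<lambda>y. q' y * p y ^ k) \<in> affine_polys m"
          by (intro affine_polys_mult affine_polys_power a' q' p)+
        show "\<exists>a\<in>affine_polys m. \<exists>q\<in>affine_polys m.
          q (H w) \<noteq> 0 \<and> (\<forall>u\<in>W. q (H u) \<noteq> 0 \<longrightarrow> g u = a (H u) / q (H u))"
        proof (rule bexI[OF _ m1], rule bexI[OF _ m2], intro conjI ballI impI)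
          have "w \<in> ?D" using w W by auto
          then show "q' (H w) * p (H w) ^ k \<noteq> 0" using aq(3) bspec[OF q'(2), of w] by auto
          fix u assume u: "u \<in> W" "q' (H u) * p (H u) ^ k \<noteq> 0"
          have uD: "u \<in> ?D" using u W by auto
          have qe: "q' (H u) = q (?H u) * p (H u) ^ l" and ae: "a' (H u) = a (?H u) * p (H u) ^ k"
            using bspec[OF q'(2) uD] bspec[OF a'(2) uD] by auto
          have "q (?H u) \<noteq> 0" "p (H u) \<noteq> 0" using u(2) uD unfolding qe by auto
          then show "g u = a' (H u) * p (H u) ^ l / (q' (H u) * p (H u) ^ k)"
            using aq(4) u(1) unfolding qe ae by (simp add: field_simps)
        qed
      qed
    qed
    then show "regs S W = {g. \<forall>w\<in>W. \<exists>a\<in>affine_polys (Suc m). \<exists>q\<in>affine_polys (Suc m).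
          q (?H w) \<noteq> 0 \<and> (\<forall>u\<in>W. q (?H u) \<noteq> 0 \<longrightarrow> g u = a (?H u) / q (?H u))}"
      by blast
  qed
qed

lemma affine_open_basic:
  assumes "affine_chart S U m H" "p \<in> affine_polys m"
  shows "affine_open S {u \<in> U. p (H u) \<noteq> 0}"
  unfolding affine_open_def using chart_basic_zopens[OF assms] affine_chart_basic_open[OF assms] by blast

section \<open>Ideal sheaves on affine open sets\<close>

lemma closed_subscheme_ideal:
  assumes "closed_subscheme S I" "W \<in> zopens S"
  shows "I W \<subseteq> regs S W" "(\<lambda>_. 0) \<in> I W"
    "g \<in> I W \<Longrightarrow> h \<in> I W \<Longrightarrow> (\<lambda>x. g x + h x) \<in> I W"
    "a \<in> regs S W \<Longrightarrow> g \<in> I W \<Longrightarrow> (\<lambda>x. a x * g x) \<in> I W"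
    "W' \<in> zopens S \<Longrightarrow> W' \<subseteq> W \<Longrightarrow> I W \<subseteq> I W'"
proof -
  note I = assms(1)[unfolded closed_subscheme_def, THEN conjunct1, unfolded ideal_sheaf_def]
  note a = bspec[OF conjunct1[OF I] assms(2)] and b = bspec[OF conjunct1[OF conjunct2[OF I]] assms(2)]
  show "I W \<subseteq> regs S W" "(\<lambda>_. 0) \<in> I W" by (rule a[THEN conjunct1] a[THEN conjunct2, THEN conjunct1])+
  show "(\<lambda>x. g x + h x) \<in> I W" if "g \<in> I W" "h \<in> I W"
    by (rule a[THEN conjunct2, THEN conjunct2, THEN conjunct1, THEN bspec, OF that(1), THEN bspec, OF that(2)])
  show "(\<lambda>x. a x * g x) \<in> I W" if "a \<in> regs S W" "g \<in> I W"
    by (rule a[THEN conjunct2, THEN conjunct2, THEN conjunct2, THEN bspec, OF that(1), THEN bspec, OF that(2)])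
  show "I W \<subseteq> I W'" if "W' \<in> zopens S" "W' \<subseteq> W"
    by (rule b[THEN bspec, OF that(1), THEN mp, OF that(2)])
qed

lemma closed_subscheme_localize:
  assumes "closed_subscheme S I" "affine_open S U" "a \<in> regs S U" "g \<in> I {u \<in> U. a u \<noteq> 0}"
  obtains b n where "b \<in> I U" "\<And>u. u \<in> U \<Longrightarrow> a u \<noteq> 0 \<Longrightarrow> g u = b u / a u ^ n"
proof -
  have eq: "I {u \<in> U. a u \<noteq> 0} = {g \<in> regs S {u \<in> U. a u \<noteq> 0}.
             \<exists>b\<in>I U. \<exists>n::nat. \<forall>u\<in>U. a u \<noteq> 0 \<longrightarrow> g u = b u / a u ^ n}"
    using assms(1)[unfolded closed_subscheme_def, THEN conjunct2, THEN spec, THEN spec, THEN mp] assms(2,3) by auto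
  obtain b n where b: "b \<in> I U" "\<forall>u\<in>U. a u \<noteq> 0 \<longrightarrow> g u = b u / a u ^ n"
    using assms(4) unfolding eq mem_Collect_eq by (elim conjE bexE exE)
  then show ?thesis by (intro that[of b n]) auto
qed

text \<open>The neighbourhood is a basic open subset of the prescribed \<open>U\<close>, so that
  quasi-coherence over \<open>U\<close> relates its sections to those over \<open>U\<close>.\<close>

lemma affine_nhd:
  assumes X: "X \<subseteq> proj_space" and U: "affine_open (variety_of X) U" "x \<in> U" and W: "W \<in> zopens (variety_of X)" "x \<in> W"
  obtains a where "a \<in> regs (variety_of X) U" "a x \<noteq> 0" "{u \<in> U. a u \<noteq> 0} \<subseteq> W" "affine_open (variety_of X) {u \<in> U. a u \<noteq> 0}"
proof -
  obtain m H where H: "affine_chart (variety_of X) U m H" "U \<in> zopens (variety_of X)"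
    using U(1) by (auto simp: affine_open_def)
  have "U \<inter> W \<in> zopens (variety_of X)" by (rule zopens_Int[OF X H(2) W(1)])
  then obtain p where p: "p \<in> affine_polys m" "p (H x) \<noteq> 0" "{u \<in> U. p (H u) \<noteq> 0} \<subseteq> U \<inter> W"
    by (rule chart_basic_nhd[OF H(1), of "U \<inter> W" x]) (use U(2) W(2) that in auto)
  show ?thesis
  proof (rule that)
    show "(\<lambda>u. p (H u)) \<in> regs (variety_of X) U" by (rule chart_poly_regs[OF H p(1)])
    show "affine_open (variety_of X) {u \<in> U. p (H u) \<noteq> 0}" by (rule affine_open_basic[OF H(1) p(1)])
  qed (use p in auto)
qed

text \<open>By quasi-coherence a section over the basic open set is \<open>b / a ^ n\<close> with
  \<open>b\<close> a section over \<open>U\<close>; the inverse power of \<open>a\<close> goes into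
  the coefficients of \<open>b\<close>.\<close>

lemma generates_basic_open:
  assumes X: "X \<subseteq> proj_space" and I: "closed_subscheme (variety_of X) I" and U: "affine_open (variety_of X) U"
    and a: "a \<in> regs (variety_of X) U" and D: "{u \<in> U. a u \<noteq> 0} \<in> zopens (variety_of X)"
    and gen: "generates (variety_of X) I U s \<zeta>"
  shows "generates (variety_of X) I {u \<in> U. a u \<noteq> 0} s \<zeta>" (is "generates _ _ ?D _ _")
  unfolding generates_def
proof (intro conjI allI impI ballI)
  have "I U \<subseteq> I ?D" using closed_subscheme_ideal(5)[OF I affine_open_zopens[OF U] D] by blast
  then show "\<zeta> i \<in> I ?D" if "i < s" for i using gen that unfolding generates_def by blast
  fix g assume "g \<in> I ?D"
  then obtain b n where b: "b \<in> I U" "\<And>u. u \<in> U \<Longrightarrow> a u \<noteq> 0 \<Longrightarrow> g u = b u / a u ^ n"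
    by (rule closed_subscheme_localize[OF I U a]) (rule that)
  obtain \<alpha> where \<alpha>: "\<forall>i<s. \<alpha> i \<in> regs (variety_of X) U" "\<forall>u\<in>U. b u = (\<Sum>i<s. \<alpha> i u * \<zeta> i u)"
    using bspec[OF conjunct2[OF gen[unfolded generates_def]] b(1)] by (elim exE conjE) (rule that)
  have inv: "(\<lambda>u. inverse (a u ^ n)) \<in> regs (variety_of X) ?D"
    by (intro regs_inverse[OF regs_power[OF regs_restrict[OF a]] _ zopens_subset[OF D] X]) auto
  show "\<exists>\<alpha>. (\<forall>i<s. \<alpha> i \<in> regs (variety_of X) ?D) \<and> (\<forall>u\<in>?D. g u = (\<Sum>i<s. \<alpha> i u * \<zeta> i u))"
  proof (rule exI[of _ "\<lambda>i u. \<alpha> i u * inverse (a u ^ n)"], intro conjI allI impI ballI)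
    show "(\<lambda>u. \<alpha> i u * inverse (a u ^ n)) \<in> regs (variety_of X) ?D" if "i < s" for i
      by (rule regs_mult[OF regs_restrict[of "\<alpha> i" X U] inv]) (use \<alpha>(1) that in auto)
    fix u assume u: "u \<in> ?D"
    then have "g u = (\<Sum>i<s. \<alpha> i u * \<zeta> i u) * inverse (a u ^ n)"
      using b(2)[of u] \<alpha>(2) by (simp add: divide_inverse)
    then show "g u = (\<Sum>i<s. \<alpha> i u * inverse (a u ^ n) * \<zeta> i u)"
      unfolding sum_distrib_right by (simp add: mult_ac)
  qed
qed

section \<open>Homogeneous coordinates and sections of twisted ideal sheaves\<close>

definition rep :: "('n::finite) pt \<Rightarrow> complex ^ 'n" where
  "rep y = (SOME v. v \<in> y \<and> v \<noteq> 0)"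

lemma rep:
  assumes "y \<in> proj_space" shows "rep y \<in> y" "rep y \<noteq> 0" "cline (rep y) = y"
proof -
  obtain v where v: "v \<noteq> 0" "cline v = y" using assms proj_obtain by blast
  have "\<exists>v. v \<in> y \<and> v \<noteq> 0" by (rule exI[of _ v]) (use v in auto)
  from someI_ex[OF this] show "rep y \<in> y" "rep y \<noteq> 0" unfolding rep_def by auto
  then show "cline (rep y) = y" using proj_cline assms by blast
qed

lemma rep_multiple:
  assumes "y \<in> proj_space" "v \<in> y" "v \<noteq> 0" shows "\<exists>c. c \<noteq> 0 \<and> v = c *s rep y"
proof -
  have "v \<in> cline (rep y)" using rep(3)[OF assms(1)] assms(2) by simp
  then obtain c where "v = c *s rep y" by (auto simp: mem_cline)
  then show ?thesis using assms(3) by auto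
qed

lemma homogeneous_fraction_rep:
  assumes "homogeneous_poly d p" "homogeneous_poly d q" "y \<in> proj_space" "v \<in> y" "v \<noteq> 0"
  shows "p (rep y) / q (rep y) = p v / q v"
proof -
  obtain c where "c \<noteq> 0" "v = c *s rep y" using rep_multiple[OF assms(3-5)] by auto
  then show ?thesis using assms(1,2) by (simp add: homogeneous_poly_scale)
qed

lemma homogeneous_fraction_regs:
  assumes "X \<subseteq> proj_space" "W \<subseteq> X" "homogeneous_poly d p" "homogeneous_poly d q" "\<And>y v. y \<in> W \<Longrightarrow> v \<in> y \<Longrightarrow> v \<noteq> 0 \<Longrightarrow> q v \<noteq> 0"
  shows "(\<lambda>y. p (rep y) / q (rep y)) \<in> regs (variety_of X) W"
proof (rule variety_regsI)
  fix x assume x: "x \<in> W"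
  have nz: "q v \<noteq> 0" if "v \<in> x - {0}" for v
  proof (rule assms(5)[OF x])
    show "v \<in> x" "v \<noteq> 0" using that by blast+
  qed
  have eq: "p (rep y) / q (rep y) = p v / q v" if y: "y \<in> W" "v \<in> y - {0}" for y v
  proof (rule homogeneous_fraction_rep[OF assms(3,4)])
    show "y \<in> proj_space" by (rule subsetD[OF assms(1) subsetD[OF assms(2) y(1)]])
    show "v \<in> y" "v \<noteq> 0" using y(2) by blast+
  qed
  show "\<exists>d p' q'. homogeneous_poly d p' \<and> homogeneous_poly d q' \<and> (\<forall>v\<in>x - {0}. q' v \<noteq> 0) \<and>
     (\<forall>y\<in>W. \<forall>v\<in>y - {0}. q' v \<noteq> 0 \<longrightarrow> p (rep y) / q (rep y) = p' v / q' v)"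
    by (rule fraction_exI[OF assms(3,4) nz eq])
qed

lemma coordinate_zopen:
  assumes X: "X \<subseteq> proj_space"
  shows "{y \<in> X. rep y $ j \<noteq> 0} \<in> zopens (variety_of X)"
    "y \<in> X \<Longrightarrow> v \<in> y \<Longrightarrow> v \<noteq> 0 \<Longrightarrow> v $ j \<noteq> 0 \<longleftrightarrow> rep y $ j \<noteq> 0"
proof -
  show iff: "v $ j \<noteq> 0 \<longleftrightarrow> rep y $ j \<noteq> 0" if "y \<in> X" "v \<in> y" "v \<noteq> 0" for y v
  proof -
    have "\<exists>c. c \<noteq> 0 \<and> v = c *s rep y" by (rule rep_multiple[OF subsetD[OF X that(1)] that(2,3)])
    then obtain c where "c \<noteq> 0" "v = c *s rep y" by auto
    then show ?thesis by simp
  qed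
  show "{y \<in> X. rep y $ j \<noteq> 0} \<in> zopens (variety_of X)"
    unfolding mem_zopens_iff[OF X]
  proof (intro conjI ballI)
    fix x assume x: "x \<in> {y \<in> X. rep y $ j \<noteq> 0}"
    show "\<exists>d p. homogeneous_poly d p \<and> (\<forall>v\<in>x - {0}. p v \<noteq> 0) \<and> {y \<in> X. \<exists>v\<in>y. v \<noteq> 0 \<and> p v \<noteq> 0} \<subseteq> {y \<in> X. rep y $ j \<noteq> 0}"
    proof (rule exI[of _ 1], rule exI[of _ "\<lambda>v. v $ j"], intro conjI homogeneous_poly_coord)
      show "\<forall>v\<in>x - {0}. v $ j \<noteq> 0"
      proof
        fix v assume "v \<in> x - {0}"
        then show "v $ j \<noteq> 0" using iff[of x v] x by simp
      qed
      show "{y \<in> X. \<exists>v\<in>y. v \<noteq> 0 \<and> v $ j \<noteq> 0} \<subseteq> {y \<in> X. rep y $ j \<noteq> 0}"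
      proof
        fix y assume "y \<in> {y \<in> X. \<exists>v\<in>y. v \<noteq> 0 \<and> v $ j \<noteq> 0}"
        then obtain v where "y \<in> X" "v \<in> y" "v \<noteq> 0" "v $ j \<noteq> 0" by (elim CollectE conjE bexE)
        then show "y \<in> {y \<in> X. rep y $ j \<noteq> 0}" using iff[of y v] by simp
      qed
    qed
  qed auto
qed

text \<open>A section \<open>\<tau>\<close> of \<open>O(e)\<close> over \<open>X\<close>, as a homogeneous function on the cone, that lies in the ideal
  sheaf and does not vanish at \<open>x0\<close>. It is \<open>b p\<^sup>n\<close> for a local section \<open>b\<close> of the ideal sheaf on the
  open set where \<open>p\<close> does not vanish; compactness of \<open>X\<close> yields an exponent \<open>n\<close> that works everywhere.\<close>

lemma twisted_ideal_section:
  fixes X :: "('n::finite) pt set"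
  assumes M: "projective_manifold X" and I: "closed_subscheme (variety_of X) I"
    and cover: "\<And>x. x \<in> X \<Longrightarrow> \<exists>U. affine_open (variety_of X) U \<and> x \<in> U"
    and x0: "x0 \<in> X" "x0 \<notin> Supp (variety_of X) I"
  obtains e :: nat and \<tau> :: "complex ^ 'n \<Rightarrow> complex" where "e \<ge> 1"
    "\<And>c v. c \<noteq> 0 \<Longrightarrow> v \<noteq> 0 \<Longrightarrow> \<tau> (c *s v) = c ^ e * \<tau> v"
    "\<tau> (rep x0) \<noteq> 0"
    "\<And>x. x \<in> X \<Longrightarrow> \<exists>U j t. affine_open (variety_of X) U \<and> x \<in> U \<and> t \<in> I U \<and>
       (\<forall>y\<in>U. rep y $ j \<noteq> 0 \<and> t y = \<tau> (rep y) / (rep y $ j) ^ e)"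
proof -
  note XP = projective_manifold_subset[OF M]
  obtain W0 b where W0: "W0 \<in> zopens (variety_of X)" "x0 \<in> W0" "b \<in> I W0" "b x0 \<noteq> 0"
    using x0 zopens_Union[OF XP] unfolding Supp_def by blast
  obtain d0 p0 where p0: "homogeneous_poly d0 p0" "\<forall>v\<in>x0 - {0}. p0 v \<noteq> 0" "{y \<in> X. \<exists>v\<in>y. v \<noteq> 0 \<and> p0 v \<noteq> 0} \<subseteq> W0"
    using W0(1,2) unfolding mem_zopens_iff[OF XP] by blast
  have x0P: "x0 \<in> proj_space" using x0(1) XP by blast
  obtain j0 where j0: "rep x0 $ j0 \<noteq> 0" using rep(2)[OF x0P] by (auto simp: vec_eq_iff)
  \<comment> \<open>The extra factor \<open>v $ j0\<close> in \<open>p\<close> makes the degree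
    positive, which gives \<open>e \<ge> 1\<close> in the conclusion.\<close>
  define d where "d = d0 + 1"
  define p where "p = (\<lambda>v. p0 v * v $ j0)"
  have d1: "d \<ge> 1" by (simp add: d_def)
  have hp: "homogeneous_poly d p" unfolding d_def p_def by (rule homogeneous_poly_mult[OF p0(1) homogeneous_poly_coord])
  have px0: "p (rep x0) \<noteq> 0" using p0(2) rep[OF x0P] j0 by (auto simp: p_def)
  have pW0: "y \<in> W0" if "y \<in> X" "p (rep y) \<noteq> 0" for y
  proof -
    have "y \<in> {y \<in> X. \<exists>v\<in>y. v \<noteq> 0 \<and> p0 v \<noteq> 0}"
      using that rep[of y] XP by (auto simp: p_def intro!: bexI[of _ "rep y"])
    then show ?thesis using p0(3) by blast
  qed
  \<comment> \<open>Where \<open>p\<close> vanishes, \<open>b\<close> carries no information. The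
    value \<open>0\<close> there is the correct continuation once the power of \<open>p\<close>
    exceeds the pole order of \<open>b\<close>.\<close>
  define \<tau> where "\<tau> n v = (if p v = 0 then 0 else b (cline v) * p v ^ n)" for n v
  define good where "good x n \<longleftrightarrow> (\<exists>U j t. affine_open (variety_of X) U \<and> x \<in> U \<and> t \<in> I U \<and>
       (\<forall>y\<in>U. rep y $ j \<noteq> 0 \<and> t y = \<tau> n (rep y) / (rep y $ j) ^ (d * n)))" for x n
  have local: "\<exists>D k. affine_open (variety_of X) D \<and> x \<in> D \<and> (\<forall>y\<in>D. \<forall>n>k. good y n)" if x: "x \<in> X" for x
  proof -
    have xP: "x \<in> proj_space" using x XP by blast
    obtain U where U: "affine_open (variety_of X) U" "x \<in> U" using cover[OF x] by blast
    obtain j where j: "rep x $ j \<noteq> 0" using rep(2)[OF xP] by (auto simp: vec_eq_iff)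
    have xz: "x \<in> {y \<in> X. rep y $ j \<noteq> 0}" using x j by simp
    obtain a0 where a0: "a0 \<in> regs (variety_of X) U" "a0 x \<noteq> 0" "{u \<in> U. a0 u \<noteq> 0} \<subseteq> {y \<in> X. rep y $ j \<noteq> 0}" "affine_open (variety_of X) {u \<in> U. a0 u \<noteq> 0}"
      by (rule affine_nhd[OF XP U coordinate_zopen(1)[OF XP, of j] xz]) (rule that)
    define D where "D = {u \<in> U. a0 u \<noteq> 0}"
    have D: "affine_open (variety_of X) D" "x \<in> D" "D \<subseteq> X" "\<And>y. y \<in> D \<Longrightarrow> rep y $ j \<noteq> 0"
      using a0 U(2) by (auto simp: D_def)
    define a where "a y = p (rep y) / (rep y $ j) ^ d" for y
    have hq: "homogeneous_poly d (\<lambda>v. (v $ j) ^ d)" using homogeneous_poly_power[OF homogeneous_poly_coord, of d j] by simp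
    have a: "a \<in> regs (variety_of X) D"
      unfolding a_def
    proof (rule homogeneous_fraction_regs[OF XP D(3) hp hq])
      fix y v assume "y \<in> D" "v \<in> y" "v \<noteq> 0"
      then show "v $ j ^ d \<noteq> 0" using coordinate_zopen(2)[OF XP, of y v j] D(3,4) by auto
    qed
    obtain m H where H: "affine_chart (variety_of X) D m H" "D \<in> zopens (variety_of X)"
      using D(1) by (auto simp: affine_open_def)
    have az: "a y \<noteq> 0 \<longleftrightarrow> p (rep y) \<noteq> 0" if "y \<in> D" for y using D(4)[OF that] by (simp add: a_def)
    have Dp: "{u \<in> D. a u \<noteq> 0} \<in> zopens (variety_of X)"
      unfolding mem_zopens_iff[OF XP]
    proof (intro conjI ballI)
      show "{u \<in> D. a u \<noteq> 0} \<subseteq> X" using D(3) by blast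
      fix y assume y: "y \<in> {u \<in> D. a u \<noteq> 0}"
      obtain e1 p1 where p1: "homogeneous_poly e1 p1" "\<forall>v\<in>y - {0}. p1 v \<noteq> 0" "{y \<in> X. \<exists>v\<in>y. v \<noteq> 0 \<and> p1 v \<noteq> 0} \<subseteq> D"
        using H(2) y unfolding mem_zopens_iff[OF XP] by blast
      have nz: "p v \<noteq> 0 \<longleftrightarrow> p (rep y) \<noteq> 0" if "y \<in> X" "v \<in> y" "v \<noteq> 0" for v y
      proof -
        have "\<exists>c. c \<noteq> 0 \<and> v = c *s rep y" by (rule rep_multiple[OF subsetD[OF XP that(1)] that(2,3)])
        then obtain c where "c \<noteq> 0" "v = c *s rep y" by auto
        then show ?thesis using homogeneous_poly_nonzero_iff[OF hp] by simp
      qed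
      show "\<exists>d p. homogeneous_poly d p \<and> (\<forall>v\<in>y - {0}. p v \<noteq> 0) \<and> {y \<in> X. \<exists>v\<in>y. v \<noteq> 0 \<and> p v \<noteq> 0} \<subseteq> {u \<in> D. a u \<noteq> 0}"
      proof (rule exI[of _ "e1 + d"], rule exI[of _ "\<lambda>v. p1 v * p v"], intro conjI homogeneous_poly_mult p1(1) hp)
        show "\<forall>v\<in>y - {0}. p1 v * p v \<noteq> 0" using p1(2) nz y az D(3) by auto
        show "{y \<in> X. \<exists>v\<in>y. v \<noteq> 0 \<and> p1 v * p v \<noteq> 0} \<subseteq> {u \<in> D. a u \<noteq> 0}"
        proof
          fix y' assume y': "y' \<in> {y \<in> X. \<exists>v\<in>y. v \<noteq> 0 \<and> p1 v * p v \<noteq> 0}"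
          then have "y' \<in> {y \<in> X. \<exists>v\<in>y. v \<noteq> 0 \<and> p1 v \<noteq> 0}" by auto
          then have "y' \<in> D" using p1(3) by blast
          moreover have "p (rep y') \<noteq> 0" using nz y' by auto
          ultimately show "y' \<in> {u \<in> D. a u \<noteq> 0}" using az by simp
        qed
      qed
    qed
    have "{u \<in> D. a u \<noteq> 0} \<subseteq> W0" using az pW0 D(3) by blast
    then have "b \<in> I {u \<in> D. a u \<noteq> 0}" using closed_subscheme_ideal(5)[OF I W0(1) Dp] W0(3) by blast
    then obtain b' k where b': "b' \<in> I D" "\<And>u. u \<in> D \<Longrightarrow> a u \<noteq> 0 \<Longrightarrow> b u = b' u / a u ^ k"
      by (rule closed_subscheme_localize[OF I D(1) a]) (rule that)
    \<comment> \<open>The exponent has to exceed \<open>k\<close> strictly: then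
      \<open>a ^ (n - k)\<close> vanishes together with \<open>a\<close>, in agreement with
      \<open>\<tau>\<close>.\<close>
    have "good y n" if y: "y \<in> D" and n: "n > k" for y n
      unfolding good_def
    proof (rule exI[of _ D], rule exI[of _ j], rule exI[of _ "\<lambda>y. a y ^ (n - k) * b' y"], intro conjI ballI D(1) y)
      show "(\<lambda>y. a y ^ (n - k) * b' y) \<in> I D"
        by (rule closed_subscheme_ideal(4)[OF I H(2) regs_power[OF a] b'(1)])
      fix z assume z: "z \<in> D"
      show "rep z $ j \<noteq> 0" by (rule D(4)[OF z])
      show "a z ^ (n - k) * b' z = \<tau> n (rep z) / (rep z $ j) ^ (d * n)"
      proof (cases "a z = 0")
        case True
        then show ?thesis using az[OF z] n by (simp add: \<tau>_def)
      next
        case False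
        then have "p (rep z) \<noteq> 0" using az[OF z] by simp
        then have "\<tau> n (rep z) / (rep z $ j) ^ (d * n) = b z * a z ^ n"
          using rep(3)[of z] z D(3) XP by (auto simp: \<tau>_def a_def power_divide power_mult)
        also have "\<dots> = b' z * (a z ^ n / a z ^ k)" using b'(2)[OF z False] by simp
        also have "a z ^ n / a z ^ k = a z ^ (n - k)" using False n by (simp add: power_diff)
        finally show ?thesis by (simp add: mult.commute)
      qed
    qed
    then show ?thesis using D by blast
  qed
  have "\<exists>n\<ge>1. \<forall>x\<in>X. good x n"
  proof (rule ccontr)
    assume "\<not> (\<exists>n\<ge>1. \<forall>x\<in>X. good x n)"
    \<comment> \<open>If no exponent works everywhere, there is a bad point for each
      \<open>Suc n\<close>. Near a limit of these points all large exponents are good, a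
      contradiction.\<close>
    then have "\<forall>n. \<exists>x. x \<in> X \<and> \<not> good x (Suc n)" by auto
    then obtain xs where xs: "\<And>n. xs n \<in> X" "\<And>n. \<not> good (xs n) (Suc n)" by metis
    obtain r x where r: "strict_mono (r :: nat \<Rightarrow> nat)" "cconv X (xs \<circ> r) x"
      using projective_manifold_compact[OF M, of xs] xs(1) by blast
    then have "x \<in> X" by (simp add: cconv_def)
    then obtain D k where D: "affine_open (variety_of X) D" "x \<in> D" "\<forall>y\<in>D. \<forall>n>k. good y n" using local by blast
    have "eventually (\<lambda>n. xs (r n) \<in> D) sequentially"
      using zopens_cconv[OF XP affine_open_zopens[OF D(1)] D(2) r(2)] by simp
    moreover have "eventually (\<lambda>n. n \<ge> k) sequentially" by (rule eventually_ge_at_top)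
    ultimately have "eventually (\<lambda>n. False) sequentially"
    proof eventually_elim
      case (elim n)
      have "Suc (r n) > k" using seq_suble[OF r(1), of n] elim(2) by simp
      then show False using D(3) elim(1) xs(2)[of "r n"] by blast
    qed
    then show False by simp
  qed
  then obtain n where n: "n \<ge> 1" "\<forall>x\<in>X. good x n" by blast
  show ?thesis
  proof (rule that[of "d * n" "\<tau> n"])
    show "1 \<le> d * n" using d1 n(1) by simp
    show "\<tau> n (c *s v) = c ^ (d * n) * \<tau> n v" if "c \<noteq> 0" "v \<noteq> 0" for c v
      using that homogeneous_poly_scale[OF hp, of c v] by (simp add: \<tau>_def power_mult_distrib power_mult)
    show "\<tau> n (rep x0) \<noteq> 0" using px0 W0(4) rep(3)[OF x0P] by (simp add: \<tau>_def)
    show "\<exists>U j t. affine_open (variety_of X) U \<and> x \<in> U \<and> t \<in> I U \<and>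
       (\<forall>y\<in>U. rep y $ j \<noteq> 0 \<and> t y = \<tau> n (rep y) / (rep y $ j) ^ (d * n))" if "x \<in> X" for x
      using n(2) that unfolding good_def by blast
  qed
qed

section \<open>Nonvanishing sections of the prolongation\<close>

lemma fibre_poly_restrict:
  assumes "fibre_poly X U m P" "U' \<subseteq> U" shows "fibre_poly X U' m P"
  using assms(1)
proof induction
  case (base a) show ?case by (rule fibre_poly.base[OF regs_restrict[OF base assms(2)]])
next
  case (diff a) show ?case by (rule fibre_poly.diff[OF regs_restrict[OF diff assms(2)]])
qed (rule fibre_poly.add fibre_poly.mult; assumption)+

lemma fibre_poly_zero: "fibre_poly X U m (\<lambda>_. 0)"
proof (induction m)
  case 0
  show ?case using fibre_poly.base[OF regs_const[of 0 X U]] by (simp add: case_prod_unfold)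
next
  case (Suc m)
  from fibre_poly.mult[OF Suc fibre_poly.diff[OF regs_const[of 0 X U]]] show ?case by (simp add: case_prod_unfold)
qed

lemma fibre_poly_power: "fibre_poly X U m P \<Longrightarrow> fibre_poly X U (m * e) (\<lambda>p. P p ^ e)"
proof (induction e)
  case 0
  show ?case using fibre_poly.base[OF regs_const[of 1 X U]] by (simp add: case_prod_unfold)
next
  case (Suc e)
  from fibre_poly.mult[OF Suc.prems Suc.IH[OF Suc.prems]] show ?case by simp
qed

lemma fibre_poly_mult_base:
  assumes "fibre_poly X U m P" "a \<in> regs (variety_of X) U"
  shows "fibre_poly X U m (\<lambda>p. P p * a (fst p))"
  using fibre_poly.mult[OF assms(1) fibre_poly.base[OF assms(2)]] by (simp add: case_prod_unfold)

lemma fibre_poly_sum: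
  assumes "\<And>i. i < (s::nat) \<Longrightarrow> fibre_poly X U m (A i)"
  shows "fibre_poly X U m (\<lambda>p. \<Sum>i<s. A i p)"
  using assms
proof (induction s)
  case 0 show ?case using fibre_poly_zero by simp
next
  case (Suc s)
  from fibre_poly.add[OF Suc.IH Suc.prems[of s]] Suc.prems show ?case by simp
qed

lemma basic_open_mono:
  assumes "U' \<subseteq> U" shows "basic_open X V U' Q \<subseteq> basic_open X V U Q"
  using assms by (auto simp: basic_open_def)

text \<open>The denominators are multiplied together. In the application \<open>K\<close> consists
  of all coordinate indices.\<close>

lemma affine_polys_fractions_common_denominator:
  assumes "finite K" "\<And>k. k \<in> K \<Longrightarrow> \<exists>p\<in>affine_polys m. \<exists>q\<in>affine_polys m.
      q (H w) \<noteq> 0 \<and> (\<forall>u\<in>W. q (H u) \<noteq> 0 \<longrightarrow> g k u = p (H u) / q (H u))"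
  shows "\<exists>p. \<exists>q\<in>affine_polys m. q (H w) \<noteq> 0 \<and> (\<forall>k\<in>K. p k \<in> affine_polys m \<and>
      (\<forall>u\<in>W. q (H u) \<noteq> 0 \<longrightarrow> g k u = p k (H u) / q (H u)))"
  using assms
proof (induction K rule: finite_induct)
  case empty
  show ?case by (rule exI, rule bexI[OF _ affine_polys_const[of 1]]) simp
next
  case (insert k K)
  have "\<exists>p. \<exists>q\<in>affine_polys m. q (H w) \<noteq> 0 \<and> (\<forall>k\<in>K. p k \<in> affine_polys m \<and>
      (\<forall>u\<in>W. q (H u) \<noteq> 0 \<longrightarrow> g k u = p k (H u) / q (H u)))"
    by (rule insert.IH, rule insert.prems) simp
  then obtain p q where pq: "q \<in> affine_polys m" "q (H w) \<noteq> 0" "\<forall>k\<in>K. p k \<in> affine_polys m \<and>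
      (\<forall>u\<in>W. q (H u) \<noteq> 0 \<longrightarrow> g k u = p k (H u) / q (H u))" by (elim exE bexE conjE)
  obtain p0 q0 where pq0: "p0 \<in> affine_polys m" "q0 \<in> affine_polys m" "q0 (H w) \<noteq> 0"
    "\<forall>u\<in>W. q0 (H u) \<noteq> 0 \<longrightarrow> g k u = p0 (H u) / q0 (H u)"
    using insert.prems[of k] by (auto elim!: bexE)
  define p' where "p' j = (if j = k then (\<lambda>y. p0 y * q y) else (\<lambda>y. p j y * q0 y))" for j
  have mq: "(\<lambda>y. q0 y * q y) \<in> affine_polys m" by (rule affine_polys_mult[OF pq0(2) pq(1)])
  show ?case
  proof (rule exI[of _ p'], rule bexI[OF _ mq], intro conjI ballI impI)
    show "q0 (H w) * q (H w) \<noteq> 0" using pq pq0 by simp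
    fix j assume j: "j \<in> insert k K"
    show "p' j \<in> affine_polys m"
      using j pq pq0 by (auto simp: p'_def intro!: affine_polys_mult)
    fix u assume u: "u \<in> W" "q0 (H u) * q (H u) \<noteq> 0"
    show "g j u = p' j (H u) / (q0 (H u) * q (H u))"
      using j u pq(3) pq0(4) by (auto simp: p'_def)
  qed
qed

text \<open>The section has to be defined on all of \<open>U'\<close>, because the generators that
  accompany a Weil function generate the sections over that set. As \<open>U'\<close> need not lie
  over an affine subset of \<open>X\<close>, sections of the ideal sheaf cannot simply be pulled
  back. Instead a section of its twist by \<open>O(e)\<close> is multiplied with the
  \<open>e\<close>-th power of a section of \<open>O(-1)\<close> over \<open>U'\<close>, both
  nonzero at the given point.\<close>

lemma prolongation_nonvanishing:
  fixes X :: "('n::finite) pt set"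
  assumes M: "projective_manifold X" and I: "closed_subscheme (variety_of X) I"
    and cover: "\<And>x. x \<in> X \<Longrightarrow> \<exists>U s \<zeta>. affine_open (variety_of X) U \<and> x \<in> U \<and> generates (variety_of X) I U s \<zeta>"
    and U': "affine_open (projectivization X V) U'" "(x0, l0) \<in> U'"
    and x0: "x0 \<notin> Supp (variety_of X) I"
  obtains g where "g \<in> prolongation X V I U'" "g (x0, l0) \<noteq> 0"
proof -
  note XP = projective_manifold_subset[OF M]
  have U'z: "U' \<in> zopens (projectivization X V)" by (rule affine_open_zopens[OF U'(1)])
  then have U'l: "U' \<subseteq> lines_in X V" unfolding projectivization_zopens_iff by blast
  then have x0X: "x0 \<in> X" using U'(2) by (auto simp: lines_in_iff)
  then have x0P: "x0 \<in> proj_space" using XP by blast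
  have fstX: "fst u \<in> X" "fst u \<in> proj_space" if "u \<in> U'" for u
    using that U'l XP by (auto simp: lines_in_iff subset_eq)
  have cover': "\<exists>U. affine_open (variety_of X) U \<and> x \<in> U" if "x \<in> X" for x using cover[OF that] by blast
  obtain e \<tau> where \<tau>: "e \<ge> 1" "\<And>c v. c \<noteq> 0 \<Longrightarrow> v \<noteq> 0 \<Longrightarrow> \<tau> (c *s v) = c ^ e * \<tau> v"
    "\<tau> (rep x0) \<noteq> 0"
    and \<tau>loc: "\<And>x. x \<in> X \<Longrightarrow> \<exists>U j t. affine_open (variety_of X) U \<and> x \<in> U \<and> t \<in> I U \<and>
       (\<forall>y\<in>U. rep y $ j \<noteq> 0 \<and> t y = \<tau> (rep y) / (rep y $ j) ^ e)"
    by (rule twisted_ideal_section[OF M I cover' x0X x0]) (assumption, rule that)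
  obtain m H where H: "affine_chart (projectivization X V) U' m H" using U'(1) by (auto simp: affine_open_def)
  obtain i0 where i0: "rep x0 $ i0 \<noteq> 0" using rep(2)[OF x0P] by (auto simp: vec_eq_iff)
  \<comment> \<open>The quotients of the coordinates by the coordinate \<open>i0\<close> are regular
    on this part of \<open>U'\<close>; the chart of \<open>U'\<close> then turns them into fractions
    of polynomials.\<close>
  define W1 where "W1 = {u \<in> U'. rep (fst u) $ i0 \<noteq> 0}"
  have W1U: "W1 \<subseteq> U'" by (auto simp: W1_def)
  have nhd: "\<exists>D m Q. affine_open (variety_of X) D \<and> fibre_poly X D m Q \<and> u \<in> basic_open X V D Q \<and>
      basic_open X V D Q \<subseteq> W1 \<and> (\<forall>y\<in>D. rep y $ i0 \<noteq> 0)" if u: "u \<in> W1" for u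
  proof -
    have uU: "u \<in> U'" using u W1U by blast
    obtain U k Q where Q: "affine_open (variety_of X) U" "fibre_poly X U k Q" "u \<in> basic_open X V U Q" "basic_open X V U Q \<subseteq> U'"
      using U'z uU unfolding projectivization_zopens_iff by blast
    have fu: "fst u \<in> U" using Q(3) by (auto simp: basic_open_def)
    have fz: "fst u \<in> {y \<in> X. rep y $ i0 \<noteq> 0}" using u fstX[OF uU] by (auto simp: W1_def)
    obtain a where a: "a \<in> regs (variety_of X) U" "a (fst u) \<noteq> 0" "{y \<in> U. a y \<noteq> 0} \<subseteq> {y \<in> X. rep y $ i0 \<noteq> 0}"
       "affine_open (variety_of X) {y \<in> U. a y \<noteq> 0}"
      by (rule affine_nhd[OF XP Q(1) fu coordinate_zopen(1)[OF XP] fz]) (rule that)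
    define D where "D = {y \<in> U. a y \<noteq> 0}"
    have D: "D \<subseteq> U" "affine_open (variety_of X) D" "fst u \<in> D" "\<forall>y\<in>D. rep y $ i0 \<noteq> 0"
      using a fu by (auto simp: D_def)
    have "u \<in> basic_open X V D Q" using Q(3) D(3) by (auto simp: basic_open_def)
    moreover have "basic_open X V D Q \<subseteq> W1"
    proof
      fix w assume w: "w \<in> basic_open X V D Q"
      then have "w \<in> U'" using basic_open_mono[OF D(1), of X V Q] Q(4) by blast
      moreover have "fst w \<in> D" using w by (auto simp: basic_open_def)
      ultimately show "w \<in> W1" using D(4) by (auto simp: W1_def)
    qed
    ultimately show ?thesis using D(2,4) fibre_poly_restrict[OF Q(2) D(1)] by blast
  qed
  have W1: "W1 \<in> zopens (projectivization X V)"
    unfolding projectivization_zopens_iff using nhd W1U U'l by blast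
  have w0: "(x0, l0) \<in> W1" using U'(2) i0 by (simp add: W1_def)
  define g where "g i u = rep (fst u) $ i / rep (fst u) $ i0" for i and u :: "'n pt \<times> 'n tv set"
  have greg: "g i \<in> regs (projectivization X V) W1" for i
    unfolding projectivization_regs_iff
  proof
    fix u assume u: "u \<in> W1"
    obtain D k Q where D: "affine_open (variety_of X) D" "fibre_poly X D k Q" "u \<in> basic_open X V D Q"
      "basic_open X V D Q \<subseteq> W1" "\<forall>y\<in>D. rep y $ i0 \<noteq> 0" using nhd[OF u] by blast
    have DX: "D \<subseteq> X" using affine_open_zopens[OF D(1)] zopens_subset by blast
    have "(\<lambda>y. rep y $ i / rep y $ i0) \<in> regs (variety_of X) D"
      by (rule homogeneous_fraction_regs[OF XP DX homogeneous_poly_coord homogeneous_poly_coord])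
        (use coordinate_zopen(2)[OF XP] D(5) DX in blast)
    then have P: "fibre_poly X D k (\<lambda>p. Q p * (rep (fst p) $ i / rep (fst p) $ i0))"
      by (rule fibre_poly_mult_base[OF D(2)])
    have "is_fraction_on (W1 \<inter> basic_open X V D Q) (g i) (\<lambda>p. Q p * (rep (fst p) $ i / rep (fst p) $ i0)) Q"
      unfolding is_fraction_on_def by (auto simp: basic_open_def g_def)
    then show "\<exists>U m P Q. affine_open (variety_of X) U \<and> fibre_poly X U m P \<and> fibre_poly X U m Q \<and>
           u \<in> basic_open X V U Q \<and> is_fraction_on (W1 \<inter> basic_open X V U Q) (g i) P Q"
      using D(1-3) P by blast
  qed
  obtain p0 where p0: "p0 \<in> affine_polys m" "p0 (H (x0, l0)) \<noteq> 0" "{u \<in> U'. p0 (H u) \<noteq> 0} \<subseteq> W1"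
    by (rule chart_basic_nhd[OF H W1 W1U w0]) (rule that)
  have frac: "\<exists>p\<in>affine_polys m. \<exists>q\<in>affine_polys m.
      q (H (x0, l0)) \<noteq> 0 \<and> (\<forall>u\<in>W1. q (H u) \<noteq> 0 \<longrightarrow> g i u = p (H u) / q (H u))" for i
    using greg[of i] unfolding chart_regs_iff[OF H W1U W1] by (rule bspec[OF _ w0])
  obtain p q where pq: "q \<in> affine_polys m" "q (H (x0, l0)) \<noteq> 0" "\<forall>k\<in>UNIV. p k \<in> affine_polys m \<and>
      (\<forall>u\<in>W1. q (H u) \<noteq> 0 \<longrightarrow> g k u = p k (H u) / q (H u))"
    using affine_polys_fractions_common_denominator[OF finite, of UNIV m H "(x0, l0)" W1 g, OF frac]
    by (elim exE bexE conjE)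
  \<comment> \<open>\<open>\<mu>\<close> divided by the coordinate \<open>i0\<close> is the section
    of \<open>O(-1)\<close>: by \<open>\<mu>\<pi>\<close> it equals \<open>\<pi> j\<close> divided
    by the coordinate \<open>j\<close>. The common factor \<open>p0 * q\<close> kills both sides of
    \<open>\<mu>\<pi>\<close> outside the set where \<open>p j / q\<close> represents
    \<open>g j\<close>, so that the identity holds on all of \<open>U'\<close>.\<close>
  define \<mu> where "\<mu> = (\<lambda>y. p0 y * q y * (p0 y * q y))"
  define \<pi> where "\<pi> j = (\<lambda>y. p0 y * q y * (p0 y * p j y))" for j
  have \<pi>p: "\<pi> j \<in> affine_polys m" for j
    unfolding \<pi>_def using pq p0 by (auto intro!: affine_polys_mult)
  have \<mu>\<pi>: "\<mu> (H u) * rep (fst u) $ j = \<pi> j (H u) * rep (fst u) $ i0" if u: "u \<in> U'" for u j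
  proof (cases "p0 (H u) * q (H u) = 0")
    case False
    then have uW: "u \<in> W1" using p0(3) u by auto
    then have "rep (fst u) $ i0 \<noteq> 0" by (simp add: W1_def)
    moreover have "rep (fst u) $ j / rep (fst u) $ i0 = p j (H u) / q (H u)"
      using pq(3) uW False by (auto simp: g_def)
    ultimately have "q (H u) * rep (fst u) $ j = p j (H u) * rep (fst u) $ i0"
      using False by (simp add: field_simps)
    then show ?thesis by (simp add: \<mu>_def \<pi>_def)
  qed (auto simp: \<mu>_def \<pi>_def)
  have \<pi>0: "\<pi> j (H u) = 0" if u: "u \<in> U'" "rep (fst u) $ i0 = 0" for u j
  proof -
    obtain k where "rep (fst u) $ k \<noteq> 0" using rep(2)[OF fstX(2)[OF u(1)]] by (auto simp: vec_eq_iff)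
    then have "\<mu> (H u) = 0" using \<mu>\<pi>[OF u(1), of k] u(2) by simp
    then have "p0 (H u) * q (H u) = 0" by (simp add: \<mu>_def)
    then show ?thesis by (simp add: \<pi>_def)
  qed
  \<comment> \<open>Where the coordinate \<open>i0\<close> vanishes, every \<open>\<pi> j\<close>
    vanishes by \<open>\<pi>0\<close>; as \<open>e \<ge> 1\<close>, the value \<open>0\<close>
    agrees with the local formula \<open>Gloc\<close>.\<close>
  define G where "G u = (if rep (fst u) $ i0 = 0 then 0 else (\<mu> (H u) / rep (fst u) $ i0) ^ e * \<tau> (rep (fst u)))" for u
  have Gloc: "G u = \<pi> j (H u) ^ e * t (fst u)"
    if u: "u \<in> U'" and t: "rep (fst u) $ j \<noteq> 0" "t (fst u) = \<tau> (rep (fst u)) / (rep (fst u) $ j) ^ e" for u j t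
  proof (cases "rep (fst u) $ i0 = 0")
    case True
    then show ?thesis using \<pi>0[OF u True] \<tau>(1) by (simp add: G_def)
  next
    case False
    have "\<mu> (H u) / rep (fst u) $ i0 = \<pi> j (H u) / rep (fst u) $ j"
      using \<mu>\<pi>[OF u, of j] False t(1) by (simp add: field_simps)
    then show ?thesis using False by (simp add: G_def t(2) power_divide)
  qed
  have main: "\<exists>D s \<zeta> k P Q. affine_open (variety_of X) D \<and> generates (variety_of X) I D s \<zeta> \<and>
        P \<in> jet_ideal X D s \<zeta> k \<and> fibre_poly X D k P \<and> fibre_poly X D k Q \<and>
        w \<in> basic_open X V D Q \<and> is_fraction_on (U' \<inter> basic_open X V D Q) G P Q" if w: "w \<in> U'" for w
  proof -
    obtain U1 j t where U1: "affine_open (variety_of X) U1" "fst w \<in> U1" "t \<in> I U1"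
       "\<forall>y\<in>U1. rep y $ j \<noteq> 0 \<and> t y = \<tau> (rep y) / (rep y $ j) ^ e" using \<tau>loc[OF fstX(1)[OF w]] by blast
    obtain U2 s \<zeta> where U2: "affine_open (variety_of X) U2" "fst w \<in> U2" "generates (variety_of X) I U2 s \<zeta>"
      using cover[OF fstX(1)[OF w]] by blast
    have "(\<lambda>u. \<pi> j (H u)) \<in> regs (projectivization X V) U'" by (rule chart_poly_regs[OF H U'z \<pi>p])
    then obtain U3 k P1 Q1 where U3: "affine_open (variety_of X) U3" "fibre_poly X U3 k P1" "fibre_poly X U3 k Q1"
       "w \<in> basic_open X V U3 Q1" "is_fraction_on (U' \<inter> basic_open X V U3 Q1) (\<lambda>u. \<pi> j (H u)) P1 Q1"
      using w unfolding projectivization_regs_iff by blast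
    have w3: "fst w \<in> U3" using U3(4) by (auto simp: basic_open_def)
    have U13: "U1 \<inter> U3 \<in> zopens (variety_of X)" by (rule zopens_Int[OF XP affine_open_zopens[OF U1(1)] affine_open_zopens[OF U3(1)]])
    have w13: "fst w \<in> U1 \<inter> U3" using U1(2) w3 by blast
    obtain a where a: "a \<in> regs (variety_of X) U2" "a (fst w) \<noteq> 0" "{y \<in> U2. a y \<noteq> 0} \<subseteq> U1 \<inter> U3"
       "affine_open (variety_of X) {y \<in> U2. a y \<noteq> 0}"
      by (rule affine_nhd[OF XP U2(1,2) U13 w13]) (rule that)
    define D where "D = {y \<in> U2. a y \<noteq> 0}"
    have D: "affine_open (variety_of X) D" "fst w \<in> D" "D \<subseteq> U1" "D \<subseteq> U3" "generates (variety_of X) I D s \<zeta>"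
      using a U2(2) generates_basic_open[OF XP I U2(1) a(1) affine_open_zopens[OF a(4)] U2(3)] by (auto simp: D_def)
    note Dz = affine_open_zopens[OF D(1)]
    have tD: "t \<in> I D" using closed_subscheme_ideal(5)[OF I affine_open_zopens[OF U1(1)] Dz D(3)] U1(3) by blast
    obtain \<alpha> where \<alpha>: "\<forall>i<s. \<alpha> i \<in> regs (variety_of X) D" "\<forall>u\<in>D. t u = (\<Sum>i<s. \<alpha> i u * \<zeta> i u)"
      using bspec[OF conjunct2[OF D(5)[unfolded generates_def]] tD] by (elim exE conjE)
    have \<zeta>: "\<zeta> i \<in> regs (variety_of X) D" if "i < s" for i
      using conjunct1[OF D(5)[unfolded generates_def]] that closed_subscheme_ideal(1)[OF I Dz] by blast
    have P1: "fibre_poly X D (k * e) (\<lambda>p. P1 p ^ e)" and Q1: "fibre_poly X D (k * e) (\<lambda>p. Q1 p ^ e)"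
      using fibre_poly_power[OF fibre_poly_restrict[OF U3(2) D(4)]] fibre_poly_power[OF fibre_poly_restrict[OF U3(3) D(4)]] by auto
    define A where "A i = (\<lambda>p. P1 p ^ e * \<alpha> i (fst p))" for i
    \<comment> \<open>\<open>G\<close> is a multiple of a section of the ideal sheaf on
      \<open>X\<close>, so the generators of degree 0 suffice and the differentials receive the
      coefficient \<open>0\<close>.\<close>
    define P where "P = (\<lambda>(x, E). (\<Sum>i<s. A i (x, E) * \<zeta> i x) + (\<Sum>i<s. 0 * E (\<zeta> i)))"
    have A: "fibre_poly X D (k * e) (A i)" if "i < s" for i
      unfolding A_def by (rule fibre_poly_mult_base[OF P1]) (use \<alpha>(1) that in blast)
    have "\<exists>A B. (\<forall>i<s. fibre_poly X D (k * e) (A i)) \<and>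
     (\<forall>i<s. if k * e = 0 then B i = (\<lambda>_. 0) else fibre_poly X D (k * e - 1) (B i)) \<and>
     P = (\<lambda>(x, E). (\<Sum>i<s. A i (x, E) * \<zeta> i x) + (\<Sum>i<s. B i (x, E) * E (\<zeta> i)))"
      by (rule exI[of _ A], rule exI[of _ "\<lambda>_ _. 0"]) (simp add: A P_def fibre_poly_zero)
    then have Pj: "P \<in> jet_ideal X D s \<zeta> (k * e)" unfolding jet_ideal_def mem_Collect_eq .
    have "P = (\<lambda>p. \<Sum>i<s. A i p * \<zeta> i (fst p))" by (auto simp: P_def)
    then have Pf: "fibre_poly X D (k * e) P"
      using fibre_poly_sum[of s X D "k * e" "\<lambda>i p. A i p * \<zeta> i (fst p)", OF fibre_poly_mult_base[OF A \<zeta>]] by simp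
    have b3: "basic_open X V D (\<lambda>p. Q1 p ^ e) \<subseteq> basic_open X V U3 Q1"
      using D(4) \<tau>(1) by (auto simp: basic_open_def)
    have wb: "w \<in> basic_open X V D (\<lambda>p. Q1 p ^ e)"
      using U3(4) D(2) by (auto simp: basic_open_def)
    have "is_fraction_on (U' \<inter> basic_open X V D (\<lambda>p. Q1 p ^ e)) G P (\<lambda>p. Q1 p ^ e)"
      unfolding is_fraction_on_def
    proof (rule ballI, unfold split_beta, rule ballI)
      fix yl E assume yl: "yl \<in> U' \<inter> basic_open X V D (\<lambda>p. Q1 p ^ e)" and El: "E \<in> snd yl - {\<lambda>_. 0}"
      define y l where "y = fst yl" and "l = snd yl"
      have y: "(y, l) \<in> U'" "(y, l) \<in> basic_open X V D (\<lambda>p. Q1 p ^ e)" and E: "E \<in> l" "E \<noteq> (\<lambda>_. 0)"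
        using yl El by (auto simp: y_def l_def)
      have yD: "y \<in> D" using y(2) by (auto simp: basic_open_def)
      have "\<pi> j (H (y, l)) = P1 (y, E) / Q1 (y, E)"
        using U3(5) y b3 E unfolding is_fraction_on_def by blast
      moreover have "G (y, l) = \<pi> j (H (y, l)) ^ e * t y"
        using Gloc[OF y(1), of j t] U1(4) D(3) yD by auto
      ultimately have "G (y, l) = (P1 (y, E) / Q1 (y, E)) ^ e * (\<Sum>i<s. \<alpha> i y * \<zeta> i y)"
        using \<alpha>(2) yD by simp
      then have "G (y, l) = P (y, E) / Q1 (y, E) ^ e"
        by (simp add: P_def A_def power_divide sum_distrib_left sum_divide_distrib mult.assoc)
      then show "G (fst yl, snd yl) = P (fst yl, E) / Q1 (fst yl, E) ^ e" by (simp only: y_def l_def)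
    qed
    then show ?thesis using D(1,5) Pj Pf Q1 wb by blast
  qed
  show ?thesis
  proof (rule that)
    have "G \<in> regs (projectivization X V) U'"
      unfolding projectivization_regs_iff using main by blast
    then show "G \<in> prolongation X V I U'"
      unfolding prolongation_def using main by blast
    have "\<mu> (H (x0, l0)) \<noteq> 0" using p0(2) pq(2) by (simp add: \<mu>_def)
    then show "G (x0, l0) \<noteq> 0" using i0 \<tau>(3) by (simp add: G_def)
  qed
qed

subsection \<open>Norms and curvature of tuples\<close>

text \<open>Pointwise versions of \<open>N\<close>, \<open>\<kappa>\<close>, \<open>R\<close> and
  \<open>B / N\<close> from \<open>holomorphic_tuples\<close>. The values of the derivatives are
  separate arguments, so that they can come from any tangent vector and not only from a
  curve.\<close>

definition tN :: "nat set \<Rightarrow> (nat \<Rightarrow> complex) \<Rightarrow> real" where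
  "tN I a = (\<Sum>k\<in>I. (cmod (a k))\<^sup>2)"
definition tK :: "nat set \<Rightarrow> (nat \<Rightarrow> complex) \<Rightarrow> (nat \<Rightarrow> complex) \<Rightarrow> complex" where
  "tK I a a' = (\<Sum>k\<in>I. cnj (a k) * a' k) / of_real (tN I a)"
definition tR :: "nat set \<Rightarrow> nat set \<Rightarrow> (nat \<Rightarrow> complex) \<Rightarrow> (nat \<Rightarrow> complex) \<Rightarrow> (nat \<Rightarrow> complex) \<Rightarrow> (nat \<Rightarrow> complex) \<Rightarrow> real" where
  "tR I J a a' b b' = (\<Sum>k\<in>J. (cmod (b' k - tK I a a' * b k))\<^sup>2) / tN I a"
definition tH :: "nat set \<Rightarrow> nat set \<Rightarrow> (nat \<Rightarrow> complex) \<Rightarrow> (nat \<Rightarrow> complex) \<Rightarrow> real" where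
  "tH I J a b = tN J b / tN I a"

lemma tN_nonneg: "0 \<le> tN I a" unfolding tN_def by (intro sum_nonneg) auto

lemma tN_pos: "finite I \<Longrightarrow> k \<in> I \<Longrightarrow> a k \<noteq> 0 \<Longrightarrow> 0 < tN I a"
  unfolding tN_def by (rule sum_pos2[of I k]) auto

lemma tR_nonneg: "0 \<le> tR I J a a' b b'"
  unfolding tR_def by (intro divide_nonneg_nonneg sum_nonneg tN_nonneg) auto

lemma tH_nonneg: "0 \<le> tH I J a b"
  unfolding tH_def by (intro divide_nonneg_nonneg tN_nonneg)

lemma tN_scale: "tN I (\<lambda>k. g * a k) = (cmod g)\<^sup>2 * tN I a"
  by (simp add: tN_def norm_mult power_mult_distrib sum_distrib_left)

lemma tH_scale: "g \<noteq> 0 \<Longrightarrow> tH I J (\<lambda>k. g * a k) (\<lambda>k. g * b k) = tH I J a b"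
  by (simp add: tH_def tN_scale)

text \<open>\<open>g\<close> stands for the value of a transition function and \<open>d\<close> for
  its derivative; the connection coefficient changes by the logarithmic derivative.\<close>

lemma tK_change:
  assumes "g \<noteq> 0" "tN I a \<noteq> 0"
  shows "tK I (\<lambda>k. g * a k) (\<lambda>k. g * a' k + a k * d) = tK I a a' + d / g"
proof -
  have "(\<Sum>k\<in>I. cnj (g * a k) * (g * a' k + a k * d)) = cnj g * g * (\<Sum>k\<in>I. cnj (a k) * a' k) + cnj g * d * of_real (tN I a)"
    unfolding tN_def of_real_sum sum_distrib_left sum.distrib[symmetric]
  proof (intro sum.cong refl)
    fix k
    have "of_real ((cmod (a k))\<^sup>2) = a k * cnj (a k)" by (metis complex_norm_square of_real_power)
    then show "cnj (g * a k) * (g * a' k + a k * d) = cnj g * g * (cnj (a k) * a' k) + cnj g * d * of_real ((cmod (a k))\<^sup>2)"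
      by (simp add: algebra_simps)
  qed
  moreover have "of_real ((cmod g)\<^sup>2) = cnj g * g" by (metis complex_norm_square of_real_power mult.commute)
  ultimately show ?thesis
    unfolding tK_def tN_scale using assms by (simp add: field_simps)
qed

text \<open>The covariant derivative is just multiplied by \<open>g\<close>, and the modulus of
  \<open>g\<close> cancels against the one in \<open>tN\<close>. This makes the quantity independent
  of the trivialization.\<close>

lemma tR_change:
  assumes "g \<noteq> 0" "tN I a \<noteq> 0"
  shows "tR I J (\<lambda>k. g * a k) (\<lambda>k. g * a' k + a k * d) (\<lambda>k. g * b k) (\<lambda>k. g * b' k + b k * d) = tR I J a a' b b'"
proof -
  have "g * b' k + b k * d - (tK I a a' + d / g) * (g * b k) = g * (b' k - tK I a a' * b k)" for k
    using assms(1) by (simp add: field_simps)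
  then show ?thesis
    unfolding tR_def tK_change[OF assms] tN_scale
    using assms(1) by (simp add: norm_mult power_mult_distrib flip: sum_distrib_left)
qed

lemma tR_homogeneous: "tR I J a (\<lambda>k. c * a' k) b (\<lambda>k. c * b' k) = (cmod c)\<^sup>2 * tR I J a a' b b'"
proof -
  have "(\<Sum>k\<in>I. cnj (a k) * (c * a' k)) = c * (\<Sum>k\<in>I. cnj (a k) * a' k)"
    unfolding sum_distrib_left by (simp add: mult_ac)
  then have K: "tK I a (\<lambda>k. c * a' k) = c * tK I a a'" by (simp add: tK_def)
  have "c * b' k - c * tK I a a' * b k = c * (b' k - tK I a a' * b k)" for k by (simp add: algebra_simps)
  then show ?thesis unfolding tR_def K by (simp add: norm_mult power_mult_distrib flip: sum_distrib_left)
qed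

text \<open>Elimination of the last coordinate: if some \<open>w0\<close> in \<open>W\<close> has a
  nonzero one, subtracting multiples of \<open>w0\<close> reduces to \<open>M\<close> coordinates.
  The spanning vectors must come from \<open>W\<close> itself, hence the detour through preimages
  \<open>u k\<close> under \<open>P\<close>.\<close>

lemma finite_spanning_subset:
  fixes W :: "(nat \<Rightarrow> complex) set"
  shows "\<exists>(m::nat) w. (\<forall>k<m. w k \<in> W) \<and> (\<forall>v\<in>W. \<exists>c. \<forall>j<M. v j = (\<Sum>k<m. c k * w k j))"
proof (induction M arbitrary: W)
  case 0
  show ?case by (rule exI[of _ 0]) auto
next
  case (Suc M)
  show ?case
  proof (cases "\<forall>v\<in>W. v M = 0")
    case True
    obtain m w where w: "\<forall>k<m. w k \<in> W" "\<forall>v\<in>W. \<exists>c. \<forall>j<M. v j = (\<Sum>k<(m::nat). c k * w k j)" using Suc[of W] by auto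
    have "\<exists>c. \<forall>j<Suc M. v j = (\<Sum>k<m. c k * w k j)" if v: "v \<in> W" for v
    proof -
      obtain c where c: "\<forall>j<M. v j = (\<Sum>k<m. c k * w k j)" using w(2) v by auto
      have "v j = (\<Sum>k<m. c k * w k j)" if "j < Suc M" for j
      proof (cases "j = M")
        case True
        have "\<forall>k<m. w k M = 0" "v M = 0" using \<open>\<forall>v\<in>W. v M = 0\<close> v w(1) by blast+
        then show ?thesis by (simp add: True)
      qed (use that c in auto)
      then show ?thesis by blast
    qed
    then show ?thesis using w(1) by blast
  next
    case False
    then obtain w0 where w0: "w0 \<in> W" "w0 M \<noteq> 0" by auto
    define P where "P v = (\<lambda>j. v j - v M / w0 M * w0 j)" for v
    obtain m w' where w': "\<forall>k<m. w' k \<in> P ` W" "\<forall>v\<in>P ` W. \<exists>c. \<forall>j<M. v j = (\<Sum>k<(m::nat). c k * w' k j)"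
      using Suc[of "P ` W"] by auto
    have "\<forall>k. \<exists>v. k < m \<longrightarrow> v \<in> W \<and> w' k = P v" using w'(1) by blast
    then obtain u where u: "\<And>k. k < m \<Longrightarrow> u k \<in> W \<and> w' k = P (u k)" by metis
    define w where "w = u(m := w0)"
    have "\<exists>c. \<forall>j<Suc M. v j = (\<Sum>k<Suc m. c k * w k j)" if v: "v \<in> W" for v
    proof -
      obtain c where c: "\<forall>j<M. P v j = (\<Sum>k<m. c k * w' k j)" using w'(2) v by blast
      \<comment> \<open>The multiple of \<open>w0\<close> removed from \<open>v\<close>, minus what
        was removed from the vectors \<open>u k\<close>.\<close>
      define t where "t = v M / w0 M - (\<Sum>k<m. c k * (u k M / w0 M))"
      have "v j = (\<Sum>k<m. c k * u k j) + t * w0 j" if j: "j < Suc M" for j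
      proof (cases "j = M")
        case True
        have "(\<Sum>k<m. c k * (u k M / w0 M)) = (\<Sum>k<m. c k * u k M) / w0 M" by (simp add: sum_divide_distrib)
        then show ?thesis using w0(2) unfolding True t_def by (simp add: left_diff_distrib)
      next
        case False
        then have "P v j = (\<Sum>k<m. c k * w' k j)" using c j by simp
        also have "\<dots> = (\<Sum>k<m. c k * u k j - c k * (u k M / w0 M) * w0 j)"
          by (intro sum.cong refl) (use u in \<open>auto simp: P_def algebra_simps\<close>)
        also have "\<dots> = (\<Sum>k<m. c k * u k j) - (\<Sum>k<m. c k * (u k M / w0 M)) * w0 j"
          by (simp add: sum_subtractf sum_distrib_right)
        finally show ?thesis by (simp add: P_def t_def algebra_simps)
      qed
      then have "\<forall>j<Suc M. v j = (\<Sum>k<Suc m. (c(m := t)) k * w k j)" by (simp add: w_def)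
      then show ?thesis by blast
    qed
    moreover have "\<forall>k<Suc m. w k \<in> W" using u w0(1) by (auto simp: w_def less_Suc_eq)
    ultimately show ?thesis by blast
  qed
qed

section \<open>Estimates along convergent sequences\<close>

definition dominated :: "(nat \<Rightarrow> complex) \<Rightarrow> (nat \<Rightarrow> real) \<Rightarrow> bool" where
  "dominated F G \<longleftrightarrow> (\<exists>K\<ge>0. eventually (\<lambda>n. cmod (F n) \<le> K * G n) sequentially)"

lemma dominatedE:
  assumes "dominated F G" obtains K where "K \<ge> 0" "eventually (\<lambda>n. cmod (F n) \<le> K * G n) sequentially"
  using assms unfolding dominated_def by blast

lemma dominatedI: "K \<ge> 0 \<Longrightarrow> (\<And>n. cmod (F n) \<le> K * G n) \<Longrightarrow> dominated F G"
  unfolding dominated_def by (auto intro!: exI[of _ K])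

lemma dominated_add:
  assumes "dominated F G" "dominated F' G" shows "dominated (\<lambda>n. F n + F' n) G"
proof -
  obtain K where K: "K \<ge> 0" "eventually (\<lambda>n. cmod (F n) \<le> K * G n) sequentially" using assms(1) by (rule dominatedE)
  obtain K' where K': "K' \<ge> 0" "eventually (\<lambda>n. cmod (F' n) \<le> K' * G n) sequentially" using assms(2) by (rule dominatedE)
  have "eventually (\<lambda>n. cmod (F n + F' n) \<le> (K + K') * G n) sequentially"
    using K(2) K'(2)
  proof eventually_elim
    case (elim n)
    then show ?case using norm_triangle_ineq[of "F n" "F' n"] by (simp add: algebra_simps)
  qed
  then show ?thesis unfolding dominated_def using K K' by (intro exI[of _ "K + K'"]) auto
qed

lemma dominated_zero: "(\<And>n. 0 \<le> G n) \<Longrightarrow> dominated (\<lambda>n. 0) G"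
  by (rule dominatedI[of 0]) auto

lemma dominated_sum:
  assumes "finite I" "\<And>i. i \<in> I \<Longrightarrow> dominated (F i) G" "\<And>n. 0 \<le> G n"
  shows "dominated (\<lambda>n. \<Sum>i\<in>I. F i n) G"
  using assms by (induction I rule: finite_induct) (auto intro: dominated_add dominated_zero)

lemma dominated_mult:
  assumes "c \<longlonglongrightarrow> l" "dominated F G" "\<And>n. 0 \<le> G n"
  shows "dominated (\<lambda>n. c n * F n) G"
proof -
  obtain K where K: "K \<ge> 0" "eventually (\<lambda>n. cmod (F n) \<le> K * G n) sequentially" using assms(2) by (rule dominatedE)
  obtain B where B: "B > 0" "\<And>n. cmod (c n) \<le> B" using convergent_imp_Bseq[of c] assms(1) by (auto simp: Bseq_def convergent_def)
  have "eventually (\<lambda>n. cmod (c n * F n) \<le> (B * K) * G n) sequentially"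
    using K(2)
  proof eventually_elim
    case (elim n)
    have "cmod (c n) * cmod (F n) \<le> B * (K * G n)"
      by (intro mult_mono B elim) (use B K assms(3) in auto)
    then show ?case by (simp add: norm_mult mult.assoc)
  qed
  then show ?thesis unfolding dominated_def using K B by (intro exI[of _ "B * K"]) auto
qed

lemma dominated_cong:
  assumes "dominated F G" "eventually (\<lambda>n. F' n = F n) sequentially"
  shows "dominated F' G"
proof -
  obtain K where K: "K \<ge> 0" "eventually (\<lambda>n. cmod (F n) \<le> K * G n) sequentially" using assms(1) by (rule dominatedE)
  have "eventually (\<lambda>n. cmod (F' n) \<le> K * G n) sequentially"
    using K(2) assms(2) by eventually_elim simp
  then show ?thesis unfolding dominated_def using K by blast
qed

text \<open>\<open>P\<close> restricts the points, for instance to the complement of a support. The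
  limit point need not satisfy it, so \<open>loc\<close> has to cover limits on the support as
  well.\<close>

lemma bounded_by_compactness:
  fixes X :: "('n::finite) pt set"
  assumes M: "projective_manifold X"
    and loc: "\<And>xs x. cconv X xs x \<Longrightarrow> (\<And>n. P (xs n)) \<Longrightarrow> \<exists>K. eventually (\<lambda>n. F (xs n) \<le> K) sequentially"
  shows "\<exists>K. \<forall>x\<in>X. P x \<longrightarrow> F x \<le> (K::real)"
proof (rule ccontr)
  assume "\<nexists>K. \<forall>x\<in>X. P x \<longrightarrow> F x \<le> K"
  then have "\<forall>n::nat. \<exists>x. x \<in> X \<and> P x \<and> F x > real n" by (meson not_le)
  then obtain xs where xs: "\<And>n. xs n \<in> X" "\<And>n. P (xs n)" "\<And>n. F (xs n) > real n" by metis
  obtain r x where r: "strict_mono (r :: nat \<Rightarrow> nat)" "cconv X (xs \<circ> r) x"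
    using projective_manifold_compact[OF M, of xs] xs(1) by blast
  obtain K where "eventually (\<lambda>n. F ((xs \<circ> r) n) \<le> K) sequentially" using loc[OF r(2)] xs(2) by auto
  moreover have "eventually (\<lambda>n. n \<ge> nat \<lceil>K\<rceil>) sequentially" by (rule eventually_ge_at_top)
  ultimately have "eventually (\<lambda>n. False) sequentially"
  proof eventually_elim
    case (elim n)
    have "real (r n) < K" using elim(1) xs(3)[of "r n"] by simp
    moreover have "K \<le> real n" using elim(2) by linarith
    moreover have "n \<le> r n" using seq_suble[OF r(1)] .
    ultimately show False by linarith
  qed
  then show False by simp
qed

text \<open>A convergent subsequence exists only after the tangent vectors are rescaled. Both sides
  are homogeneous of degree 2, so rescaling does not affect the inequality.\<close>

lemma tangent_bounded_by_compactness:
  fixes X :: "('n::finite) pt set"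
  assumes M: "directed_projective_manifold X V"
    and hom: "\<And>x D c. x \<in> X \<Longrightarrow> F x (\<lambda>g. c * D g) = (cmod c)\<^sup>2 * F x D" "\<And>x D c. x \<in> X \<Longrightarrow> G x (\<lambda>g. c * D g) = (cmod c)\<^sup>2 * G x D"
    and G0: "\<And>x D. 0 \<le> G x D"
    and loc: "\<And>xs Ds x D. tconv X V xs Ds x D \<Longrightarrow> (\<And>n. P (xs n)) \<Longrightarrow>
      \<exists>K. eventually (\<lambda>n. F (xs n) (Ds n) \<le> K * G (xs n) (Ds n)) sequentially"
  shows "\<exists>K\<ge>0. \<forall>x\<in>X. \<forall>D\<in>V x. P x \<longrightarrow> D \<noteq> (\<lambda>_. 0) \<longrightarrow> F x D \<le> K * (G x D :: real)"
proof (rule ccontr)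
  assume neg: "\<not> ?thesis"
  have "\<exists>x D. x \<in> X \<and> D \<in> V x \<and> P x \<and> D \<noteq> (\<lambda>_. 0) \<and> F x D > real n * G x D" for n :: nat
  proof (rule ccontr)
    assume "\<nexists>x D. x \<in> X \<and> D \<in> V x \<and> P x \<and> D \<noteq> (\<lambda>_. 0) \<and> F x D > real n * G x D"
    then have "\<forall>x\<in>X. \<forall>D\<in>V x. P x \<longrightarrow> D \<noteq> (\<lambda>_. 0) \<longrightarrow> F x D \<le> real n * G x D" by (meson not_le)
    then show False using neg by (meson of_nat_0_le_iff)
  qed
  then obtain xs Ds where xs: "\<And>n. xs n \<in> X" "\<And>n. Ds n \<in> V (xs n)" "\<And>n. P (xs n)" "\<And>n. Ds n \<noteq> (\<lambda>_. 0)"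
    "\<And>n. F (xs n) (Ds n) > real n * G (xs n) (Ds n)" by metis
  obtain r x Es D where r: "strict_mono (r :: nat \<Rightarrow> nat)" "tconv X V (xs \<circ> r) Es x D"
    "\<And>n. \<exists>c. c \<noteq> 0 \<and> Es n = (\<lambda>g. c * Ds (r n) g)"
    by (rule tconv_compact[OF M xs(1,2,4)]) (rule that)
  obtain K where "eventually (\<lambda>n. F ((xs \<circ> r) n) (Es n) \<le> K * G ((xs \<circ> r) n) (Es n)) sequentially" using loc[OF r(2)] xs(3) by auto
  moreover have "eventually (\<lambda>n. n \<ge> nat \<lceil>K\<rceil>) sequentially" by (rule eventually_ge_at_top)
  ultimately have "eventually (\<lambda>n. False) sequentially"
  proof eventually_elim
    case (elim n)
    obtain c where c: "c \<noteq> 0" "Es n = (\<lambda>g. c * Ds (r n) g)" using r(3)[of n] by auto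
    have "(cmod c)\<^sup>2 * F (xs (r n)) (Ds (r n)) \<le> (cmod c)\<^sup>2 * (K * G (xs (r n)) (Ds (r n)))"
      using elim(1) hom[OF xs(1)[of "r n"]] unfolding c(2) by (simp add: mult.left_commute)
    then have "F (xs (r n)) (Ds (r n)) \<le> K * G (xs (r n)) (Ds (r n))" using c(1) by simp
    moreover have "K \<le> real (r n)"
      using elim(2) seq_suble[OF r(1), of n] by linarith
    then have "K * G (xs (r n)) (Ds (r n)) \<le> real (r n) * G (xs (r n)) (Ds (r n))" by (rule mult_right_mono[OF _ G0])
    ultimately show False using xs(5)[of "r n"] by linarith
  qed
  then show False by simp
qed

section \<open>Linear systems that separate 1-jets\<close>

locale directed_linear_system =
  fixes X :: "('n::finite) pt set" and V :: "'n pt \<Rightarrow> 'n tv set"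
    and L :: "('i, 'n) line_bundle" and S :: "('i, 'n) sect set" and M :: nat and \<sigma> :: "nat \<Rightarrow> ('i, 'n) sect"
  assumes manifold: "directed_projective_manifold X V"
    and holo_bundle: "holomorphic_line_bundle X L"
    and system: "linear_system X L S"
    and basis: "is_basis S M \<sigma>"
    and separates: "\<forall>x\<in>X. separates_1jets X L S x"
begin

lemma proj: "projective_manifold X" and subbundle: "holomorphic_subbundle X V" and XP: "X \<subseteq> proj_space"
  using manifold projective_manifold_subset by (auto simp: directed_projective_manifold_def)

lemma triv_open: "open_in_manifold X (triv_dom L i)"
  using holo_bundle by (simp add: holomorphic_line_bundle_def)

lemma triv_subset: "x \<in> triv_dom L i \<Longrightarrow> x \<in> X"
  using holo_bundle by (auto simp: holomorphic_line_bundle_def)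

text \<open>The same choice as in \<open>pullback_ddc\<close>, so that the two can be identified by
  unfolding.\<close>

definition tr :: "'n pt \<Rightarrow> 'i" where "tr x = (SOME i. x \<in> triv_dom L i)"

lemma tr_mem: "x \<in> X \<Longrightarrow> x \<in> triv_dom L (tr x)"
  unfolding tr_def using holo_bundle
  by - (rule someI_ex[of "\<lambda>i. x \<in> triv_dom L i"], auto simp: holomorphic_line_bundle_def)

lemma section_mem: "s \<in> S \<Longrightarrow> (\<forall>i. \<forall>x \<in> triv_dom L i. holo_at X x (s i)) \<and>
     (\<forall>i x. x \<notin> triv_dom L i \<longrightarrow> s i x = 0) \<and>
     (\<forall>i j. \<forall>x \<in> triv_dom L i \<inter> triv_dom L j. s i x = transition L i j x * s j x)"
  using subsetD[OF conjunct1[OF system[unfolded linear_system_def]], of s]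
  unfolding sections_def mem_Collect_eq .

lemma section_holo: "s \<in> S \<Longrightarrow> x \<in> triv_dom L i \<Longrightarrow> holo_at X x (s i)"
  using section_mem[THEN conjunct1] by blast

lemma transition: "x \<in> triv_dom L i \<Longrightarrow> x \<in> triv_dom L j \<Longrightarrow> holo_at X x (transition L i j) \<and> transition L i j x \<noteq> 0"
  using holo_bundle by (simp add: holomorphic_line_bundle_def)

lemma section_transition: "s \<in> S \<Longrightarrow> x \<in> triv_dom L i \<Longrightarrow> x \<in> triv_dom L j \<Longrightarrow> s i x = transition L i j x * s j x"
  using section_mem[THEN conjunct2, THEN conjunct2] by blast

lemma section_transition_derivative:
  assumes "s \<in> S" "x \<in> triv_dom L i" "x \<in> triv_dom L j" "D \<in> tangent_space X x"
  shows "D (s i) = transition L i j x * D (s j) + s j x * D (transition L i j)"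
proof -
  note x = triv_subset[OF assms(2)]
  have op: "open_in_manifold X (triv_dom L i \<inter> triv_dom L j)" by (intro openin_Int triv_open)
  have "germ_eq X x (s i) (\<lambda>y. transition L i j y * s j y)"
    unfolding germ_eq_def by (rule exI[of _ "triv_dom L i \<inter> triv_dom L j"]) (use op assms section_transition in auto)
  moreover have h: "holo_at X x (transition L i j)" "holo_at X x (s j)" "holo_at X x (s i)"
    using assms transition section_holo by blast+
  ultimately have "D (s i) = D (\<lambda>y. transition L i j y * s j y)"
    by (intro tangent_germ[OF assms(4) h(3) holo_at_mult[OF XP x h(1,2)]])
  then show ?thesis using tangent_mult[OF assms(4) h(1,2)] by simp
qed

lemma basis_mem: "k < M \<Longrightarrow> \<sigma> k \<in> S" using basis by (simp add: is_basis_def)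

lemma tangent_V: "x \<in> X \<Longrightarrow> D \<in> V x \<Longrightarrow> D \<in> tangent_space X x"
  using subbundle by (auto simp: holomorphic_subbundle_def)

lemma max_ideal_sq_vanishes:
  assumes "x \<in> X" "g \<in> max_ideal_sq X x" shows "g x = 0"
proof -
  have "\<exists>(n::nat) a b. (\<forall>k<n. holo_at X x (a k) \<and> b k \<in> {\<lambda>y. a y * b y |a b. a \<in> max_ideal X x \<and> b \<in> max_ideal X x}) \<and>
     germ_eq X x g (\<lambda>y. \<Sum>k<n. a k y * b k y)"
    using assms(2) unfolding max_ideal_sq_def germ_ideal_def mem_Collect_eq .
  then obtain n :: nat and a b where ab: "\<forall>k<n. holo_at X x (a k) \<and> b k \<in> {\<lambda>y. a y * b y |a b. a \<in> max_ideal X x \<and> b \<in> max_ideal X x}"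
    "germ_eq X x g (\<lambda>y. \<Sum>k<n. a k y * b k y)"
    by (elim exE conjE)
  have "b k x = 0" if k: "k < n" for k
  proof -
    have "b k \<in> {\<lambda>y. a y * b y |a b. a \<in> max_ideal X x \<and> b \<in> max_ideal X x}" using ab(1) k by simp
    then obtain c d where "b k = (\<lambda>y. c y * d y)" "c \<in> max_ideal X x" by (elim CollectE exE conjE)
    then show ?thesis by (simp add: max_ideal_def)
  qed
  moreover have "g x = (\<Sum>k<n. a k x * b k x)" using ab(2) unfolding germ_eq_def by auto
  ultimately show ?thesis by simp
qed

text \<open>Separation applied to the constant germ \<open>1\<close> yields a section with value
  \<open>1\<close> at \<open>x\<close>, because the square of the maximal ideal consists of
  functions that vanish there.\<close>

lemma basis_nonzero:
  assumes "x \<in> triv_dom L i" shows "\<exists>k<M. \<sigma> k i x \<noteq> 0"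
proof (rule ccontr)
  assume "\<not> ?thesis"
  then have z: "\<And>k. k < M \<Longrightarrow> \<sigma> k i x = 0" by auto
  note x = triv_subset[OF assms]
  have "\<forall>g. holo_at X x g \<longrightarrow> (\<exists>s\<in>S. (\<lambda>y. s i y - g y) \<in> max_ideal_sq X x)"
    using separates x assms by (simp add: separates_1jets_def)
  then obtain s where s: "s \<in> S" "(\<lambda>y. s i y - 1) \<in> max_ideal_sq X x" using holo_at_const[OF XP x, of 1] by auto
  have "s i x = 1" using max_ideal_sq_vanishes[OF x s(2)] by simp
  moreover obtain c where "s = (\<lambda>i x. \<Sum>k<M. c k * \<sigma> k i x)"
    using bspec[OF conjunct1[OF conjunct2[OF basis[unfolded is_basis_def]]] s(1)] by (elim exE)
  ultimately show False using z by simp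
qed

lemma N_pos: "x \<in> triv_dom L i \<Longrightarrow> 0 < tN {..<M} (\<lambda>k. \<sigma> k i x)"
  using basis_nonzero[of x i] tN_pos[of "{..<M}" _ "\<lambda>k. \<sigma> k i x"] by auto

text \<open>Up to the factor \<open>pi\<close> this is the form \<open>dd^c\<close> of the weight of
  the linear system, evaluated on \<open>D\<close>; along a curve \<open>Ez_ddc\<close> makes this
  precise.\<close>

definition EE :: "'i \<Rightarrow> 'n pt \<Rightarrow> 'n tv \<Rightarrow> real" where
  "EE i x D = tR {..<M} {..<M} (\<lambda>k. \<sigma> k i x) (\<lambda>k. D (\<sigma> k i)) (\<lambda>k. \<sigma> k i x) (\<lambda>k. D (\<sigma> k i))"

text \<open>By the product rule, a change of trivialization acts on values and derivatives as in
  \<open>tR_change\<close>, with the same factors for the basis and for the sections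
  \<open>\<tau>\<close>.\<close>

lemma tuple_change:
  assumes \<tau>: "\<And>k. k \<in> J \<Longrightarrow> \<tau> k \<in> S" and x: "x \<in> triv_dom L i" "x \<in> triv_dom L j" and D: "D \<in> tangent_space X x"
  shows "tR {..<M} J (\<lambda>k. \<sigma> k i x) (\<lambda>k. D (\<sigma> k i)) (\<lambda>k. \<tau> k i x) (\<lambda>k. D (\<tau> k i))
       = tR {..<M} J (\<lambda>k. \<sigma> k j x) (\<lambda>k. D (\<sigma> k j)) (\<lambda>k. \<tau> k j x) (\<lambda>k. D (\<tau> k j))"
    "tH {..<M} J (\<lambda>k. \<sigma> k i x) (\<lambda>k. \<tau> k i x) = tH {..<M} J (\<lambda>k. \<sigma> k j x) (\<lambda>k. \<tau> k j x)"
proof -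
  let ?g = "transition L i j x" and ?d = "D (transition L i j)"
  have g: "?g \<noteq> 0" using transition x by blast
  have v: "\<sigma> k i x = ?g * \<sigma> k j x" "D (\<sigma> k i) = ?g * D (\<sigma> k j) + \<sigma> k j x * ?d" if "k \<in> {..<M}" for k
    using section_transition section_transition_derivative basis_mem that x D by auto
  have w: "\<tau> k i x = ?g * \<tau> k j x" "D (\<tau> k i) = ?g * D (\<tau> k j) + \<tau> k j x * ?d" if "k \<in> J" for k
    using section_transition section_transition_derivative \<tau>[OF that] x D by auto
  have N: "tN {..<M} (\<lambda>k. \<sigma> k i x) = tN {..<M} (\<lambda>k. ?g * \<sigma> k j x)" 
    unfolding tN_def by (intro sum.cong refl) (simp only: v)
  have N': "tN J (\<lambda>k. \<tau> k i x) = tN J (\<lambda>k. ?g * \<tau> k j x)" 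
    unfolding tN_def by (intro sum.cong refl) (simp only: w)
  have K: "tK {..<M} (\<lambda>k. \<sigma> k i x) (\<lambda>k. D (\<sigma> k i)) = tK {..<M} (\<lambda>k. ?g * \<sigma> k j x) (\<lambda>k. ?g * D (\<sigma> k j) + \<sigma> k j x * ?d)"
    unfolding tK_def N by (intro arg_cong2[where f="(/)"] sum.cong refl) (simp only: v)
  have R: "tR {..<M} J (\<lambda>k. \<sigma> k i x) (\<lambda>k. D (\<sigma> k i)) (\<lambda>k. \<tau> k i x) (\<lambda>k. D (\<tau> k i))
     = tR {..<M} J (\<lambda>k. ?g * \<sigma> k j x) (\<lambda>k. ?g * D (\<sigma> k j) + \<sigma> k j x * ?d) (\<lambda>k. ?g * \<tau> k j x) (\<lambda>k. ?g * D (\<tau> k j) + \<tau> k j x * ?d)"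
    unfolding tR_def N K by (intro arg_cong2[where f="(/)"] sum.cong refl) (simp only: w)
  show "tR {..<M} J (\<lambda>k. \<sigma> k i x) (\<lambda>k. D (\<sigma> k i)) (\<lambda>k. \<tau> k i x) (\<lambda>k. D (\<tau> k i))
       = tR {..<M} J (\<lambda>k. \<sigma> k j x) (\<lambda>k. D (\<sigma> k j)) (\<lambda>k. \<tau> k j x) (\<lambda>k. D (\<tau> k j))"
    unfolding R using N_pos[OF x(2)] by (intro tR_change g) auto
  show "tH {..<M} J (\<lambda>k. \<sigma> k i x) (\<lambda>k. \<tau> k i x) = tH {..<M} J (\<lambda>k. \<sigma> k j x) (\<lambda>k. \<tau> k j x)"
    unfolding tH_def N N' using tH_scale[OF g] by (simp add: tH_def)
qed

lemma EE_change: "x \<in> triv_dom L i \<Longrightarrow> x \<in> triv_dom L j \<Longrightarrow> D \<in> tangent_space X x \<Longrightarrow> EE i x D = EE j x D"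
  unfolding EE_def by (rule tuple_change(1)) (simp_all add: basis_mem)

lemma EE_nonneg: "0 \<le> EE i x D" unfolding EE_def by (rule tR_nonneg)

lemma N_cconv:
  assumes "cconv X xs x" "x \<in> triv_dom L i"
  shows "(\<lambda>n. tN {..<M} (\<lambda>k. \<sigma> k i (xs n))) \<longlonglongrightarrow> tN {..<M} (\<lambda>k. \<sigma> k i x)"
  unfolding tN_def
  by (intro tendsto_sum tendsto_power tendsto_norm holo_at_cconv(1)[OF XP section_holo[OF basis_mem assms(2)] assms(1)]) auto

lemma tconvD:
  assumes "tconv X V xs Ds x D"
  shows "cconv X xs x" "x \<in> X" "\<And>n. xs n \<in> X" "\<And>n. Ds n \<in> V (xs n)" "\<And>n. Ds n \<noteq> (\<lambda>_. 0)" "D \<noteq> (\<lambda>_. 0)"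
    "\<And>g. holo_at X x g \<Longrightarrow> (\<lambda>n. Ds n g) \<longlonglongrightarrow> D g" "\<And>n. Ds n \<in> tangent_space X (xs n)"
  using assms tangent_V by (auto simp: tconv_def cconv_def)

lemma K_tconv:
  assumes c: "tconv X V xs Ds x D" and x: "x \<in> triv_dom L i"
  shows "(\<lambda>n. tK {..<M} (\<lambda>k. \<sigma> k i (xs n)) (\<lambda>k. Ds n (\<sigma> k i))) \<longlonglongrightarrow> tK {..<M} (\<lambda>k. \<sigma> k i x) (\<lambda>k. D (\<sigma> k i))"
  unfolding tK_def
  by (intro tendsto_divide tendsto_sum tendsto_mult tendsto_cnj tendsto_of_real N_cconv[OF tconvD(1)[OF c] x]
      holo_at_cconv(1)[OF XP section_holo[OF basis_mem x] tconvD(1)[OF c]] tconvD(7)[OF c] section_holo[OF basis_mem x])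
    (use N_pos[OF x] in auto)

lemma E_tconv:
  assumes c: "tconv X V xs Ds x D" and x: "x \<in> triv_dom L i"
  shows "(\<lambda>n. EE i (xs n) (Ds n)) \<longlonglongrightarrow> EE i x D"
  unfolding EE_def tR_def
  by (intro tendsto_divide tendsto_sum tendsto_power tendsto_norm tendsto_diff tendsto_mult N_cconv[OF tconvD(1)[OF c] x] K_tconv[OF c x]
      holo_at_cconv(1)[OF XP section_holo[OF basis_mem x] tconvD(1)[OF c]] tconvD(7)[OF c] section_holo[OF basis_mem x])
    (use N_pos[OF x] in auto)

lemma triv_eventually:
  assumes "cconv X xs x" "x \<in> triv_dom L i"
  shows "eventually (\<lambda>n. xs n \<in> triv_dom L i) sequentially"
  by (rule cconv_openin[OF XP assms(1) triv_open assms(2)])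

text \<open>The constant \<open>B\<close> comes from Cauchy-Schwarz: the chosen sections are
  combinations of the basis with coefficient vectors \<open>w k\<close>, whose squared lengths add
  up to \<open>B\<close>. It later bounds the quotient \<open>h\<close> along the whole
  curve.\<close>

lemma finite_spanning_sections:
  assumes "S' \<subseteq> S"
  shows "\<exists>(m::nat) \<tau> B. (\<forall>k<m. \<tau> k \<in> S') \<and> (\<forall>s\<in>S'. \<exists>c. s = (\<lambda>i x. \<Sum>k<m. c k * \<tau> k i x)) \<and>
     (\<forall>i x. tN {..<m} (\<lambda>k. \<tau> k i x) \<le> B * tN {..<M} (\<lambda>k. \<sigma> k i x)) \<and> 0 \<le> B"
proof -
  define comb where "comb c = (\<lambda>i x. \<Sum>j<M. c j * \<sigma> j i x)" for c
  define W where "W = {c. comb c \<in> S'}"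
  obtain m w where w: "\<forall>k<m. w k \<in> W" "\<forall>v\<in>W. \<exists>c. \<forall>j<M. v j = (\<Sum>k<(m::nat). c k * w k j)"
    using finite_spanning_subset[of W M] by blast
  define B where "B = (\<Sum>k<m. tN {..<M} (w k))"
  have 1: "\<forall>k<m. comb (w k) \<in> S'" using w(1) by (simp add: W_def)
  have 2: "\<forall>s\<in>S'. \<exists>c. s = (\<lambda>i x. \<Sum>k<m. c k * comb (w k) i x)"
  proof
    fix s assume s: "s \<in> S'"
    obtain v where v: "s = comb v"
      using bspec[OF conjunct1[OF conjunct2[OF basis[unfolded is_basis_def]]] subsetD[OF assms s]]
      unfolding comb_def by (elim exE)
    have "v \<in> W" using v s by (simp add: W_def)
    then obtain c where c: "\<forall>j<M. v j = (\<Sum>k<m. c k * w k j)" using bspec[OF w(2)] by blast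
    have "comb v i x = (\<Sum>k<m. c k * comb (w k) i x)" for i x
    proof -
      have "comb v i x = (\<Sum>j<M. \<Sum>k<m. c k * (w k j * \<sigma> j i x))"
        unfolding comb_def by (intro sum.cong refl) (simp add: c sum_distrib_right mult.assoc)
      also have "\<dots> = (\<Sum>k<m. \<Sum>j<M. c k * (w k j * \<sigma> j i x))" by (rule sum.swap)
      finally show ?thesis by (simp add: comb_def sum_distrib_left)
    qed
    then show "\<exists>c. s = (\<lambda>i x. \<Sum>k<m. c k * comb (w k) i x)" using v by (intro exI[of _ c]) (simp add: fun_eq_iff)
  qed
  have 3: "\<forall>i x. tN {..<m} (\<lambda>k. comb (w k) i x) \<le> B * tN {..<M} (\<lambda>k. \<sigma> k i x)"
  proof (intro allI)
    fix i x
    have "(cmod (comb (w k) i x))\<^sup>2 \<le> tN {..<M} (w k) * tN {..<M} (\<lambda>k. \<sigma> k i x)" for k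
      using cmod_sum_mult_le[of "\<lambda>j. cnj (w k j)" "\<lambda>j. \<sigma> j i x" "{..<M}"] by (simp add: comb_def tN_def)
    then show "tN {..<m} (\<lambda>k. comb (w k) i x) \<le> B * tN {..<M} (\<lambda>k. \<sigma> k i x)"
      unfolding B_def sum_distrib_right by (subst tN_def) (rule sum_mono)
  qed
  have 4: "0 \<le> B" unfolding B_def by (intro sum_nonneg tN_nonneg)
  show ?thesis by (rule exI[of _ m], rule exI[of _ "\<lambda>k. comb (w k)"], rule exI[of _ B]) (intro conjI 1 2 3 4)
qed

end

subsection \<open>Weil functions and the base ideal\<close>

definition max_cmod :: "nat \<Rightarrow> (nat \<Rightarrow> 'a \<Rightarrow> complex) \<Rightarrow> 'a \<Rightarrow> real" where
  "max_cmod r g u = Max ((\<lambda>i. cmod (g i u)) ` {..<r})"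

lemma max_cmod_ge: "i < r \<Longrightarrow> cmod (g i u) \<le> max_cmod r g u"
  unfolding max_cmod_def by (rule Max_ge) auto

lemma max_cmod_attained: "0 < r \<Longrightarrow> \<exists>i<r. max_cmod r g u = cmod (g i u)"
proof -
  assume "0 < r"
  then have "max_cmod r g u \<in> (\<lambda>i. cmod (g i u)) ` {..<r}"
    unfolding max_cmod_def by (intro Max_in) auto
  then show ?thesis by auto
qed

lemma max_cmod_nonneg: "0 < r \<Longrightarrow> 0 \<le> max_cmod r g u"
  using max_cmod_attained[of r g u] by auto

lemma weil_function_local:
  assumes "weil_function T I lam" "x \<in> \<Union>(zopens T)"
  obtains U r g C where "affine_open T U" "x \<in> U" "0 < r" "generates T I U r g"
    "continuous_map (subtopology (complex_topology T) U) euclideanreal C"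
    "\<And>u. u \<in> U \<Longrightarrow> u \<notin> Supp T I \<Longrightarrow> \<bar>lam u + ln (max_cmod r g u)\<bar> \<le> C u"
proof -
  obtain \<U> where \<U>: "\<forall>U\<in>\<U>. affine_open T U" "\<Union>\<U> = \<Union>(zopens T)"
    "\<forall>U\<in>\<U>. \<exists>r g C. 0 < r \<and> generates T I U r g \<and>
           continuous_map (subtopology (complex_topology T) U) euclideanreal C \<and>
           (\<forall>u \<in> U - Supp T I. \<bar>lam u + ln (Max ((\<lambda>i. cmod (g i u)) ` {..<r}))\<bar> \<le> C u)"
    using conjunct2[OF assms(1)[unfolded weil_function_def]] by (elim exE conjE)
  obtain U where U: "U \<in> \<U>" "x \<in> U" using \<U>(2) assms(2) by blast
  obtain r g C where rgC: "0 < r" "generates T I U r g"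
           "continuous_map (subtopology (complex_topology T) U) euclideanreal C"
           "\<forall>u \<in> U - Supp T I. \<bar>lam u + ln (Max ((\<lambda>i. cmod (g i u)) ` {..<r}))\<bar> \<le> C u"
    using bspec[OF \<U>(3) U(1)] by (elim exE conjE)
  show ?thesis
  proof (rule that[OF bspec[OF \<U>(1) U(1)] U(2) rgC(1-3)])
    fix u assume u: "u \<in> U" "u \<notin> Supp T I"
    show "\<bar>lam u + ln (max_cmod r g u)\<bar> \<le> C u"
      unfolding max_cmod_def by (rule bspec[OF rgC(4)]) (use u in blast)
  qed
qed

lemma dominated_tN:
  assumes "finite J" "\<And>k. k \<in> J \<Longrightarrow> dominated (F k) G" "\<And>n. 0 \<le> G n"
  shows "\<exists>K\<ge>0. eventually (\<lambda>n. tN J (\<lambda>k. F k n) \<le> K * (G n)\<^sup>2) sequentially"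
proof -
  have "\<forall>k. \<exists>K. k \<in> J \<longrightarrow> K \<ge> 0 \<and> eventually (\<lambda>n. cmod (F k n) \<le> K * G n) sequentially"
    using assms(2) unfolding dominated_def by blast
  then obtain K where K: "\<And>k. k \<in> J \<Longrightarrow> K k \<ge> 0" "\<And>k. k \<in> J \<Longrightarrow> eventually (\<lambda>n. cmod (F k n) \<le> K k * G n) sequentially"
    by metis
  have "eventually (\<lambda>n. \<forall>k\<in>J. cmod (F k n) \<le> K k * G n) sequentially"
    using K(2) assms(1) by (simp add: eventually_ball_finite)
  then have "eventually (\<lambda>n. tN J (\<lambda>k. F k n) \<le> (\<Sum>k\<in>J. (K k)\<^sup>2) * (G n)\<^sup>2) sequentially"
  proof eventually_elim
    case (elim n)
    have "(cmod (F k n))\<^sup>2 \<le> (K k)\<^sup>2 * (G n)\<^sup>2" if "k \<in> J" for k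
      using power_mono[of "cmod (F k n)" "K k * G n" 2] elim that by (simp add: power_mult_distrib)
    then show ?case unfolding tN_def sum_distrib_right by (rule sum_mono)
  qed
  then show ?thesis by (intro exI[of _ "\<Sum>k\<in>J. (K k)\<^sup>2"]) (auto intro: sum_nonneg)
qed

text \<open>The generators over \<open>U\<close> still generate on a basic open neighbourhood inside
  \<open>W\<close>, and the regular coefficients are bounded along a convergent sequence.\<close>

lemma ideal_element_dominated:
  assumes X: "X \<subseteq> proj_space" and I: "closed_subscheme (variety_of X) I" and U: "affine_open (variety_of X) U" "x \<in> U"
    and gen: "generates (variety_of X) I U r g" and r: "0 < r"
    and W: "W \<in> zopens (variety_of X)" "x \<in> W" and b: "b \<in> I W" and c: "cconv X xs x"
  shows "dominated (\<lambda>n. b (xs n)) (\<lambda>n. max_cmod r g (xs n))"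
proof -
  obtain a where a: "a \<in> regs (variety_of X) U" "a x \<noteq> 0" "{u \<in> U. a u \<noteq> 0} \<subseteq> W" "affine_open (variety_of X) {u \<in> U. a u \<noteq> 0}"
    by (rule affine_nhd[OF X U W]) (rule that)
  let ?D = "{u \<in> U. a u \<noteq> 0}"
  note D = affine_open_zopens[OF a(4)]
  have bD: "b \<in> I ?D" using closed_subscheme_ideal(5)[OF I W(1) D a(3)] b by blast
  have genD: "generates (variety_of X) I ?D r g" by (rule generates_basic_open[OF X I U(1) a(1) D gen])
  obtain \<alpha> where \<alpha>: "\<forall>i<r. \<alpha> i \<in> regs (variety_of X) ?D" "\<forall>u\<in>?D. b u = (\<Sum>i<r. \<alpha> i u * g i u)"
    using bspec[OF conjunct2[OF genD[unfolded generates_def]] bD] by (elim exE conjE)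
  have xD: "x \<in> ?D" using U(2) a(2) by simp
  have "dominated (\<lambda>n. \<Sum>i<r. \<alpha> i (xs n) * g i (xs n)) (\<lambda>n. max_cmod r g (xs n))"
  proof (intro dominated_sum)
    fix i assume i: "i \<in> {..<r}"
    show "dominated (\<lambda>n. \<alpha> i (xs n) * g i (xs n)) (\<lambda>n. max_cmod r g (xs n))"
    proof (rule dominated_mult)
      show "(\<lambda>n. \<alpha> i (xs n)) \<longlonglongrightarrow> \<alpha> i x" by (rule regs_cconv[OF X D xD _ c]) (use \<alpha>(1) i in blast)
      show "dominated (\<lambda>n. g i (xs n)) (\<lambda>n. max_cmod r g (xs n))"
        by (rule dominatedI[of 1]) (use max_cmod_ge i in auto)
    qed (rule max_cmod_nonneg[OF r])
  qed (simp_all add: max_cmod_nonneg[OF r])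
  moreover have "eventually (\<lambda>n. b (xs n) = (\<Sum>i<r. \<alpha> i (xs n) * g i (xs n))) sequentially"
    using zopens_cconv[OF X D xD c] by eventually_elim (rule bspec[OF \<alpha>(2)])
  ultimately show ?thesis by (rule dominated_cong)
qed

lemma germ_eq_cconv:
  assumes "X \<subseteq> proj_space" "germ_eq X x g h" "cconv X xs x"
  shows "eventually (\<lambda>n. germ_eq X (xs n) g h \<and> g (xs n) = h (xs n)) sequentially"
proof -
  obtain \<Omega> where \<Omega>: "open_in_manifold X \<Omega>" "x \<in> \<Omega>" "\<forall>y\<in>\<Omega>. g y = h y" using assms(2) unfolding germ_eq_def by blast
  show ?thesis using cconv_openin[OF assms(1,3) \<Omega>(1,2)]
    by eventually_elim (use \<Omega> in \<open>auto simp: germ_eq_def\<close>)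
qed

lemma germ_idealE:
  assumes "h \<in> germ_ideal X x G"
  obtains n :: nat and a b where "\<And>k. k < n \<Longrightarrow> holo_at X x (a k)" "\<And>k. k < n \<Longrightarrow> b k \<in> G" "germ_eq X x h (\<lambda>y. \<Sum>k<n. a k y * b k y)"
proof -
  obtain n :: nat and a b where "\<forall>k<n. holo_at X x (a k) \<and> b k \<in> G" "germ_eq X x h (\<lambda>y. \<Sum>k<n. a k y * b k y)"
    using assms unfolding germ_ideal_def mem_Collect_eq by (elim exE conjE)
  then show ?thesis by (intro that[of n a b]) auto
qed

lemma an_stalkI:
  assumes X: "X \<subseteq> proj_space" "x \<in> X" and W: "W \<in> zopens (variety_of X)" "x \<in> W" "g \<in> I W"
  shows "g \<in> an_stalk X I x"
  unfolding an_stalk_def germ_ideal_def mem_Collect_eq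
proof (rule exI[of _ 1], rule exI[of _ "\<lambda>_ _. 1"], rule exI[of _ "\<lambda>_. g"], intro conjI allI impI)
  show "holo_at X x (\<lambda>_. 1)" by (rule holo_at_const[OF X])
  show "g \<in> \<Union>{I W |W. W \<in> zopens (variety_of X) \<and> x \<in> W}" using W by blast
  show "germ_eq X x g (\<lambda>y. \<Sum>k<(1::nat). 1 * g y)"
    unfolding germ_eq_def by (rule exI[of _ X]) (simp add: openin_manifold_whole[OF X(1)] X(2))
qed

section \<open>Estimates for the Weil functions of one subscheme\<close>

locale weil_pair = directed_linear_system X V L S M \<sigma>
  for X :: "('n::finite) pt set" and V and L :: "('i, 'n) line_bundle" and S M \<sigma> +
  fixes I :: "'n pt set \<Rightarrow> ('n pt \<Rightarrow> complex) set" and lam :: "'n pt \<Rightarrow> real" and lam1 :: "'n pt \<times> 'n tv set \<Rightarrow> real"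
    and m :: nat and \<tau> :: "nat \<Rightarrow> ('i, 'n) sect"
  assumes subscheme: "closed_subscheme (variety_of X) I"
    and weil: "weil_function (variety_of X) I lam"
    and weil1: "weil_function (projectivization X V) (prolongation X V I) lam1"
    and base: "is_base_ideal_through X L S I"
    and \<tau>_mem: "\<forall>k<m. \<tau> k \<in> sections_through X L S I"
    and \<tau>_span: "\<forall>s\<in>sections_through X L S I. \<exists>c. s = (\<lambda>i x. \<Sum>k<m. c k * \<tau> k i x)"
begin

definition HH :: "'i \<Rightarrow> 'n pt \<Rightarrow> real" where
  "HH i x = tH {..<M} {..<m} (\<lambda>k. \<sigma> k i x) (\<lambda>k. \<tau> k i x)"

definition RR :: "'i \<Rightarrow> 'n pt \<Rightarrow> 'n tv \<Rightarrow> real" where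
  "RR i x D = tR {..<M} {..<m} (\<lambda>k. \<sigma> k i x) (\<lambda>k. D (\<sigma> k i)) (\<lambda>k. \<tau> k i x) (\<lambda>k. D (\<tau> k i))"

lemma \<tau>_S: "k < m \<Longrightarrow> \<tau> k \<in> S"
  using \<tau>_mem unfolding sections_through_def by blast

lemma \<tau>_stalk: "k < m \<Longrightarrow> x \<in> triv_dom L i \<Longrightarrow> \<tau> k i \<in> an_stalk X I x"
  using \<tau>_mem unfolding sections_through_def by blast

lemma RR_change: "x \<in> triv_dom L i \<Longrightarrow> x \<in> triv_dom L j \<Longrightarrow> D \<in> tangent_space X x \<Longrightarrow> RR i x D = RR j x D"
  unfolding RR_def by (rule tuple_change(1)) (simp_all add: \<tau>_S)

lemma zero_tangent: "(\<lambda>_. 0) \<in> tangent_space X x" by (simp add: tangent_space_def)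

lemma HH_change: "x \<in> triv_dom L i \<Longrightarrow> x \<in> triv_dom L j \<Longrightarrow> HH i x = HH j x"
  unfolding HH_def by (rule tuple_change(2)[OF _ _ _ zero_tangent]) (simp_all add: \<tau>_S)

lemma base_stalk: "x \<in> triv_dom L i \<Longrightarrow> g \<in> an_stalk X I x \<Longrightarrow> g \<in> germ_ideal X x {s i |s. s \<in> sections_through X L S I}"
  using base unfolding is_base_ideal_through_def base_ideal_def by blast

text \<open>Used in contraposition: points with positive \<open>HH\<close> lie off the support,
  where the Weil functions are under control.\<close>

lemma Supp_imp_HH_0:
  assumes "x \<in> Supp (variety_of X) I" "x \<in> triv_dom L i" shows "HH i x = 0"
proof -
  have "\<tau> k i x = 0" if k: "k < m" for k
  proof -
    obtain n :: nat and a b where ab: "\<And>k. k < n \<Longrightarrow> holo_at X x (a k)"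
      "\<And>k. k < n \<Longrightarrow> b k \<in> \<Union>{I W |W. W \<in> zopens (variety_of X) \<and> x \<in> W}" "germ_eq X x (\<tau> k i) (\<lambda>y. \<Sum>k<n. a k y * b k y)"
      by (rule germ_idealE[OF \<tau>_stalk[OF k assms(2), unfolded an_stalk_def]]) (rule that)
    have "b l x = 0" if "l < n" for l
      using ab(2)[OF that] assms(1) unfolding Supp_def by blast
    moreover have "\<tau> k i x = (\<Sum>k<n. a k x * b k x)" using ab(3) unfolding germ_eq_def by auto
    ultimately show ?thesis by simp
  qed
  then show ?thesis by (simp add: HH_def tH_def tN_def)
qed

text \<open>A local section of the ideal that is nonzero at \<open>x\<close> lies in the base ideal,
  so it is a combination of sections through the subscheme, and these are combinations of the
  \<open>\<tau> k\<close>.\<close>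

lemma not_Supp_imp_section:
  assumes "x \<notin> Supp (variety_of X) I" "x \<in> triv_dom L i" shows "\<exists>k<m. \<tau> k i x \<noteq> 0"
proof (rule ccontr)
  assume neg: "\<not> ?thesis"
  note x = triv_subset[OF assms(2)]
  obtain W g where W: "W \<in> zopens (variety_of X)" "x \<in> W" "g \<in> I W" "g x \<noteq> 0"
    using assms(1) x zopens_Union[OF XP] unfolding Supp_def by blast
  obtain n :: nat and a b where ab: "\<And>k. k < n \<Longrightarrow> holo_at X x (a k)"
      "\<And>k. k < n \<Longrightarrow> b k \<in> {s i |s. s \<in> sections_through X L S I}" "germ_eq X x g (\<lambda>y. \<Sum>k<n. a k y * b k y)"
    by (rule germ_idealE[OF base_stalk[OF assms(2) an_stalkI[of X x W g I]]])
      (rule XP x W(1-3) that | assumption)+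
  have "b l x = 0" if l: "l < n" for l
  proof -
    obtain s where s: "b l = s i" "s \<in> sections_through X L S I" using ab(2)[OF l] by blast
    obtain c where "s = (\<lambda>i x. \<Sum>k<m. c k * \<tau> k i x)" using bspec[OF \<tau>_span s(2)] by (elim exE)
    then show ?thesis using s(1) neg by simp
  qed
  moreover have "g x = (\<Sum>k<n. a k x * b k x)" using ab(3) unfolding germ_eq_def by auto
  ultimately show False using W(4) by simp
qed

text \<open>Affine open sets with finitely many generators of the ideal are part of the data of a
  Weil function.\<close>

lemma variety_cover: "x \<in> X \<Longrightarrow> \<exists>U s \<zeta>. affine_open (variety_of X) U \<and> x \<in> U \<and> generates (variety_of X) I U s \<zeta>"
proof -
  assume "x \<in> X"
  then have x: "x \<in> \<Union>(zopens (variety_of X))" using zopens_Union[OF XP] by simp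
  obtain U r g C where "affine_open (variety_of X) U" "x \<in> U" "0 < (r::nat)" "generates (variety_of X) I U r g"
    "continuous_map (subtopology (complex_topology (variety_of X)) U) euclideanreal C"
    "\<And>u. u \<in> U \<Longrightarrow> u \<notin> Supp (variety_of X) I \<Longrightarrow> \<bar>lam u + ln (max_cmod r g u)\<bar> \<le> C u"
    by (rule weil_function_local[OF weil x]) (rule that)
  then show ?thesis by blast
qed

text \<open>Near a point \<open>lam\<close> is at most a bounded function minus \<open>ln\<close> of
  the largest generator, and each \<open>\<tau> k\<close> is bounded by a multiple of that generator
  because it lies in the ideal.\<close>

lemma weil_upper_bound: "\<exists>K. \<forall>x\<in>X. x \<notin> Supp (variety_of X) I \<longrightarrow> exp (2 * lam x) * HH (tr x) x \<le> K"
proof (rule bounded_by_compactness[OF proj])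
  fix xs x assume c: "cconv X xs x" and ns: "\<And>n. xs n \<notin> Supp (variety_of X) I"
  have x: "x \<in> X" and xsX: "\<And>n. xs n \<in> X" using c by (auto simp: cconv_def)
  note t = tr_mem[OF x]
  define i where "i = tr x"
  have t: "x \<in> triv_dom L i" using t by (simp add: i_def)
  have xz: "x \<in> \<Union>(zopens (variety_of X))" using zopens_Union[OF XP] x by simp
  obtain U r g C where U: "affine_open (variety_of X) U" "x \<in> U" "0 < r" "generates (variety_of X) I U r g"
    "continuous_map (subtopology (complex_topology (variety_of X)) U) euclideanreal C"
    "\<And>u. u \<in> U \<Longrightarrow> u \<notin> Supp (variety_of X) I \<Longrightarrow> \<bar>lam u + ln (max_cmod r g u)\<bar> \<le> C u"
    by (rule weil_function_local[OF weil xz]) (rule that)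
  note Uz = affine_open_zopens[OF U(1)]
  note mx0 = max_cmod_nonneg[OF U(3)]
  have dom: "dominated (\<lambda>n. \<tau> k i (xs n)) (\<lambda>n. max_cmod r g (xs n))" if k: "k < m" for k
  proof -
    obtain n :: nat and a b where ab: "\<And>k. k < n \<Longrightarrow> holo_at X x (a k)"
      "\<And>k. k < n \<Longrightarrow> b k \<in> \<Union>{I W |W. W \<in> zopens (variety_of X) \<and> x \<in> W}" "germ_eq X x (\<tau> k i) (\<lambda>y. \<Sum>k<n. a k y * b k y)"
      by (rule germ_idealE[OF \<tau>_stalk[OF k t, unfolded an_stalk_def]]) (rule that)
    have "dominated (\<lambda>n. b l (xs n)) (\<lambda>n. max_cmod r g (xs n))" if l: "l < n" for l
    proof -
      obtain W where W: "W \<in> zopens (variety_of X)" "x \<in> W" "b l \<in> I W" using ab(2)[OF l] by blast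
      show ?thesis by (rule ideal_element_dominated[OF XP subscheme U(1,2,4,3) W c])
    qed
    then have "dominated (\<lambda>p. \<Sum>l<n. a l (xs p) * b l (xs p)) (\<lambda>n. max_cmod r g (xs n))"
      by (intro dominated_sum dominated_mult[OF holo_at_cconv(1)[OF XP ab(1) c]] mx0) auto
    moreover have "eventually (\<lambda>p. \<tau> k i (xs p) = (\<Sum>l<n. a l (xs p) * b l (xs p))) sequentially"
      using germ_eq_cconv[OF XP ab(3) c] by eventually_elim simp
    ultimately show ?thesis by (rule dominated_cong)
  qed
  obtain K where K: "K \<ge> 0" "eventually (\<lambda>n. tN {..<m} (\<lambda>k. \<tau> k i (xs n)) \<le> K * (max_cmod r g (xs n))\<^sup>2) sequentially"
    using dominated_tN[of "{..<m}" "\<lambda>k n. \<tau> k i (xs n)" "\<lambda>n. max_cmod r g (xs n)", OF finite_lessThan _ mx0] dom by auto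
  let ?N0 = "tN {..<M} (\<lambda>k. \<sigma> k i x)"
  have N0: "0 < ?N0" by (rule N_pos[OF t])
  have evN: "eventually (\<lambda>n. tN {..<M} (\<lambda>k. \<sigma> k i (xs n)) > ?N0 / 2) sequentially"
    by (rule order_tendstoD(1)[OF N_cconv[OF c t]]) (use N0 in simp)
  have evC: "eventually (\<lambda>n. C (xs n) < C x + 1) sequentially"
    by (rule order_tendstoD(2)[OF cconv_real_function[OF XP c U(5) zopens_openin[OF Uz regs_const] U(2)]]) simp
  define K' where "K' = exp (2 * (C x + 1)) * (K * 2 / ?N0)"
  have "eventually (\<lambda>n. exp (2 * lam (xs n)) * HH (tr (xs n)) (xs n) \<le> K') sequentially"
    using K(2) evN evC zopens_cconv[OF XP Uz U(2) c] triv_eventually[OF c t]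
  proof eventually_elim
    case (elim n)
    let ?mx = "max_cmod r g (xs n)"
    have "HH (tr (xs n)) (xs n) = HH i (xs n)" by (rule HH_change[OF tr_mem[OF xsX] elim(5)])
    also have "\<dots> \<le> K * ?mx\<^sup>2 / (?N0 / 2)"
      unfolding HH_def tH_def using elim(1,2) N0 K(1) by (intro frac_le) (auto simp: tN_nonneg)
    finally have h: "HH (tr (xs n)) (xs n) \<le> (K * 2 / ?N0) * ?mx\<^sup>2" by (simp add: field_simps)
    have "exp (2 * lam (xs n)) * HH (tr (xs n)) (xs n) \<le> exp (2 * lam (xs n)) * ((K * 2 / ?N0) * ?mx\<^sup>2)"
      by (rule mult_left_mono[OF h]) simp
    also have "\<dots> = (K * 2 / ?N0) * (exp (2 * lam (xs n)) * ?mx\<^sup>2)" by simp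
    also have "\<dots> \<le> (K * 2 / ?N0) * exp (2 * (C x + 1))"
    proof (intro mult_left_mono)
      show "exp (2 * lam (xs n)) * ?mx\<^sup>2 \<le> exp (2 * (C x + 1))"
      \<comment> \<open>If all generators vanish, the left side is zero; otherwise
        \<open>ln ?mx\<close> is a true logarithm and the Weil estimate can be
        exponentiated.\<close>
      proof (cases "?mx = 0")
        case False
        then have mx: "?mx > 0" using mx0[of g "xs n"] by simp
        have "exp (2 * lam (xs n)) * ?mx\<^sup>2 = exp (2 * lam (xs n) + 2 * ln ?mx)"
          using mx by (simp add: exp_add exp_double)
        also have "\<dots> \<le> exp (2 * (C x + 1))"
          using U(6)[OF elim(4) ns] elim(3) by simp
        finally show ?thesis .
      qed simp
      show "0 \<le> K * 2 / ?N0" using K(1) N0 by simp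
    qed
    finally show ?case by (simp add: K'_def mult.commute)
  qed
  then show "\<exists>K. eventually (\<lambda>n. exp (2 * lam (xs n)) * HH (tr (xs n)) (xs n) \<le> K) sequentially" by blast
qed

text \<open>Since the ideal is the base ideal, the germ of \<open>\<zeta>\<close> is a combination
  of sections through the subscheme with holomorphic coefficients, and Leibniz' rule gives its
  differential. \<open>G\<close> contains covariant derivatives of the \<open>\<tau> k\<close>; the
  plain ones differ from them by \<open>\<kappa> * \<tau> k\<close>, which \<open>G\<close> also
  dominates since \<open>\<kappa>\<close> converges.\<close>

lemma jet_ideal_dominated:
  assumes c: "tconv X V xs Ds x D" and t: "x \<in> triv_dom L i"
    and U: "U \<in> zopens (variety_of X)" "x \<in> U" and \<zeta>: "\<zeta> \<in> I U"
  defines "G \<equiv> \<lambda>n. \<Sum>k<m. cmod (\<tau> k i (xs n)) +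
     cmod (Ds n (\<tau> k i) - tK {..<M} (\<lambda>k. \<sigma> k i (xs n)) (\<lambda>k. Ds n (\<sigma> k i)) * \<tau> k i (xs n))"
  shows "dominated (\<lambda>n. \<zeta> (xs n)) G" "dominated (\<lambda>n. Ds n \<zeta>) G"
proof -
  note T = tconvD[OF c]
  have G0: "0 \<le> G n" for n unfolding G_def by (intro sum_nonneg) auto
  define \<kappa> where "\<kappa> n = tK {..<M} (\<lambda>k. \<sigma> k i (xs n)) (\<lambda>k. Ds n (\<sigma> k i))" for n
  have \<kappa>: "\<kappa> \<longlonglongrightarrow> tK {..<M} (\<lambda>k. \<sigma> k i x) (\<lambda>k. D (\<sigma> k i))" unfolding \<kappa>_def by (rule K_tconv[OF c t])
  have Gk: "cmod (\<tau> k i (xs n)) \<le> G n" "cmod (Ds n (\<tau> k i) - \<kappa> n * \<tau> k i (xs n)) \<le> G n" if k: "k < m" for k n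
  proof -
    have "cmod (\<tau> k i (xs n)) + cmod (Ds n (\<tau> k i) - \<kappa> n * \<tau> k i (xs n)) \<le> G n"
      unfolding G_def \<kappa>_def using k
      by (intro member_le_sum[of k "{..<m}" "\<lambda>k. cmod (\<tau> k i (xs n)) +
     cmod (Ds n (\<tau> k i) - tK {..<M} (\<lambda>k. \<sigma> k i (xs n)) (\<lambda>k. Ds n (\<sigma> k i)) * \<tau> k i (xs n))"]) auto
    then show "cmod (\<tau> k i (xs n)) \<le> G n" "cmod (Ds n (\<tau> k i) - \<kappa> n * \<tau> k i (xs n)) \<le> G n"
      using norm_ge_zero[of "\<tau> k i (xs n)"] norm_ge_zero[of "Ds n (\<tau> k i) - \<kappa> n * \<tau> k i (xs n)"] by linarith+
  qed
  have d1: "dominated (\<lambda>n. \<tau> k i (xs n)) G" "dominated (\<lambda>n. Ds n (\<tau> k i) - \<kappa> n * \<tau> k i (xs n)) G" if "k < m" for k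
    by (rule dominatedI[of 1]; use Gk[OF that] in simp)+
  have sec: "dominated (\<lambda>n. s i (xs n)) G \<and> dominated (\<lambda>n. Ds n (s i)) G" if s: "s \<in> sections_through X L S I" for s
  proof -
    obtain d where d: "s = (\<lambda>i x. \<Sum>k<m. d k * \<tau> k i x)" using bspec[OF \<tau>_span s] by (elim exE)
    have 1: "dominated (\<lambda>n. s i (xs n)) G"
      unfolding d by (intro dominated_sum dominated_mult[OF tendsto_const] d1 G0) auto
    \<comment> \<open>The differential of \<open>s i\<close> is split into covariant derivatives of
      the \<open>\<tau> k\<close> and the connection coefficient times \<open>s i\<close>, which was
      estimated just before.\<close>
    have "dominated (\<lambda>n. (\<Sum>k<m. d k * (Ds n (\<tau> k i) - \<kappa> n * \<tau> k i (xs n))) + \<kappa> n * s i (xs n)) G"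
      by (intro dominated_add dominated_sum dominated_mult[OF tendsto_const] dominated_mult[OF \<kappa>] d1 1 G0) auto
    moreover have "eventually (\<lambda>n. Ds n (s i) = (\<Sum>k<m. d k * (Ds n (\<tau> k i) - \<kappa> n * \<tau> k i (xs n))) + \<kappa> n * s i (xs n)) sequentially"
      using triv_eventually[OF T(1) t]
    proof eventually_elim
      case (elim n)
      have h: "holo_at X (xs n) (\<tau> k i)" if "k < m" for k by (rule section_holo[OF \<tau>_S[OF that] elim])
      have hc: "holo_at X (xs n) (\<lambda>_. d k)" for k by (rule holo_at_const[OF XP T(3)])
      have "Ds n (s i) = (\<Sum>k<m. Ds n (\<lambda>y. d k * \<tau> k i y))"
        unfolding d using holo_at_mult[OF XP T(3) hc h] by (intro tangent_sum[OF XP T(3) T(8)]) auto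
      also have "\<dots> = (\<Sum>k<m. d k * Ds n (\<tau> k i))"
        using tangent_mult[OF T(8) hc h] tangent_const[OF XP T(3) T(8)] by (intro sum.cong refl) simp
      finally show ?case
        unfolding d by (simp add: sum_distrib_left sum_subtractf right_diff_distrib mult.left_commute)
    qed
    ultimately have "dominated (\<lambda>n. Ds n (s i)) G" by (rule dominated_cong)
    then show ?thesis using 1 by blast
  qed
  obtain p :: nat and a b where ab: "\<And>k. k < p \<Longrightarrow> holo_at X x (a k)"
      "\<And>k. k < p \<Longrightarrow> b k \<in> {s i |s. s \<in> sections_through X L S I}" "germ_eq X x \<zeta> (\<lambda>y. \<Sum>k<p. a k y * b k y)"
    by (rule germ_idealE[OF base_stalk[OF t an_stalkI[of X x U \<zeta> I]]])
      (rule XP T(2) U \<zeta> that | assumption)+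
  have bs: "\<exists>s. b l = s i \<and> s \<in> sections_through X L S I" if "l < p" for l using ab(2)[OF that] by blast
  have db: "dominated (\<lambda>n. b l (xs n)) G" "dominated (\<lambda>n. Ds n (b l)) G" if l: "l < p" for l
    using bs[OF l] sec by auto
  have hb: "holo_at X x' (b l)" if l: "l < p" "x' \<in> triv_dom L i" for l x'
  proof -
    obtain s where s: "b l = s i" "s \<in> sections_through X L S I" using bs[OF l(1)] by blast
    then have "s \<in> S" unfolding sections_through_def by blast
    then show ?thesis using section_holo[of s x' i] l(2) s(1) by simp
  qed
  have ca: "(\<lambda>n. a l (xs n)) \<longlonglongrightarrow> a l x" if "l < p" for l by (rule holo_at_cconv(1)[OF XP ab(1)[OF that] T(1)])
  have "dominated (\<lambda>n. \<Sum>l<p. a l (xs n) * b l (xs n)) G"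
    by (intro dominated_sum dominated_mult[OF ca] db G0) auto
  moreover have "eventually (\<lambda>n. \<zeta> (xs n) = (\<Sum>l<p. a l (xs n) * b l (xs n))) sequentially"
    using germ_eq_cconv[OF XP ab(3) T(1)] by eventually_elim simp
  ultimately show "dominated (\<lambda>n. \<zeta> (xs n)) G" by (rule dominated_cong)
  have "dominated (\<lambda>n. \<Sum>l<p. (a l (xs n) * Ds n (b l) + Ds n (a l) * b l (xs n))) G"
    by (intro dominated_sum dominated_add dominated_mult[OF ca] dominated_mult[OF T(7)[OF ab(1)]] db G0) auto
  moreover have "eventually (\<lambda>n. \<forall>l\<in>{..<p}. holo_at X (xs n) (a l)) sequentially"
    using holo_at_cconv(2)[OF XP ab(1) T(1)] by (simp add: eventually_ball_finite)
  then have "eventually (\<lambda>n. Ds n \<zeta> = (\<Sum>l<p. (a l (xs n) * Ds n (b l) + Ds n (a l) * b l (xs n)))) sequentially"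
    using germ_eq_cconv[OF XP ab(3) T(1)] triv_eventually[OF T(1) t] zopens_cconv[OF XP U T(1)]
  proof eventually_elim
    case (elim n)
    have ha: "holo_at X (xs n) (a l)" and hbl: "holo_at X (xs n) (b l)" if "l < p" for l
      using elim(1) that hb[OF that elim(3)] by auto
    have hm: "holo_at X (xs n) (\<lambda>y. a l y * b l y)" if "l < p" for l
      by (rule holo_at_mult[OF XP T(3) ha[OF that] hbl[OF that]])
    have h\<zeta>: "holo_at X (xs n) \<zeta>"
      by (rule regs_holo_at[OF XP U(1) elim(4)]) (use closed_subscheme_ideal(1)[OF subscheme U(1)] \<zeta> in blast)
    have hs: "holo_at X (xs n) (\<lambda>y. \<Sum>l<p. a l y * b l y)" by (rule holo_at_sum[OF XP T(3)]) (use hm in auto)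
    have "Ds n \<zeta> = Ds n (\<lambda>y. \<Sum>l<p. a l y * b l y)"
      by (rule tangent_germ[OF T(8) h\<zeta> hs]) (use elim(2) in blast)
    also have "\<dots> = (\<Sum>l<p. Ds n (\<lambda>y. a l y * b l y))" by (rule tangent_sum[OF XP T(3) T(8)]) (use hm in auto)
    also have "\<dots> = (\<Sum>l<p. (a l (xs n) * Ds n (b l) + Ds n (a l) * b l (xs n)))"
      using tangent_mult[OF T(8) ha hbl] by (intro sum.cong refl) (simp add: mult.commute)
    finally show ?case .
  qed
  ultimately show "dominated (\<lambda>n. Ds n \<zeta>) G" by (rule dominated_cong)
qed

end

context weil_pair
begin

lemma EE_homogeneous: "EE i x (\<lambda>g. c * D g) = (cmod c)\<^sup>2 * EE i x D"
  unfolding EE_def by (rule tR_homogeneous)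

lemma RR_homogeneous: "RR i x (\<lambda>g. c * D g) = (cmod c)\<^sup>2 * RR i x D"
  unfolding RR_def by (rule tR_homogeneous)

lemma HH_nonneg: "0 \<le> HH i x" unfolding HH_def by (rule tH_nonneg)
lemma RR_nonneg: "0 \<le> RR i x D" unfolding RR_def by (rule tR_nonneg)

text \<open>A section is locally \<open>P / Q\<close> with \<open>P\<close> in the jet ideal. The
  coefficients in \<open>P\<close> converge and \<open>Q\<close> has a nonzero limit, so the
  estimate reduces to the generators and their differentials.\<close>

lemma prolongation_dominated:
  assumes c: "tconv X V xs Ds x D" and t: "x \<in> triv_dom L i"
    and U': "U' \<in> zopens (projectivization X V)" "(x, tline D) \<in> U'" and g: "g \<in> prolongation X V I U'"
  defines "G \<equiv> \<lambda>n. \<Sum>k<m. cmod (\<tau> k i (xs n)) +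
     cmod (Ds n (\<tau> k i) - tK {..<M} (\<lambda>k. \<sigma> k i (xs n)) (\<lambda>k. Ds n (\<sigma> k i)) * \<tau> k i (xs n))"
  shows "dominated (\<lambda>n. g (xs n, tline (Ds n))) G"
proof -
  note T = tconvD[OF c]
  have G0: "0 \<le> G n" for n unfolding G_def by (intro sum_nonneg) auto
  have "\<forall>w\<in>U'. \<exists>U s \<zeta> m P Q. affine_open (variety_of X) U \<and> generates (variety_of X) I U s \<zeta> \<and>
        P \<in> jet_ideal X U s \<zeta> m \<and> fibre_poly X U m Q \<and>
        w \<in> basic_open X V U Q \<and> is_fraction_on (U' \<inter> basic_open X V U Q) g P Q"
    using g unfolding prolongation_def by blast
  from bspec[OF this U'(2)] obtain U s \<zeta> d P Q where U: "affine_open (variety_of X) U" "generates (variety_of X) I U s \<zeta>"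
    "P \<in> jet_ideal X U s \<zeta> d" "fibre_poly X U d Q" "(x, tline D) \<in> basic_open X V U Q" "is_fraction_on (U' \<inter> basic_open X V U Q) g P Q"
    by (elim exE conjE)
  note Uz = affine_open_zopens[OF U(1)]
  note b = basic_open_tconv[OF XP Uz c U(4,5)]
  obtain A B where AB: "\<forall>i<s. fibre_poly X U d (A i)" "\<forall>i<s. if d = 0 then B i = (\<lambda>_. 0) else fibre_poly X U (d - 1) (B i)"
     "P = (\<lambda>(x, D). (\<Sum>i<s. A i (x, D) * \<zeta> i x) + (\<Sum>i<s. B i (x, D) * D (\<zeta> i)))"
    using U(3) unfolding jet_ideal_def mem_Collect_eq by (elim exE conjE)
  have \<zeta>: "\<zeta> l \<in> I U" if "l < s" for l using conjunct1[OF U(2)[unfolded generates_def]] that by blast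
  have jd: "dominated (\<lambda>n. \<zeta> l (xs n)) G" "dominated (\<lambda>n. Ds n (\<zeta> l)) G" if "l < s" for l
    unfolding G_def using jet_ideal_dominated[OF c t Uz b(3) \<zeta>[OF that]] by auto
  have cA: "(\<lambda>n. A l (xs n, Ds n)) \<longlonglongrightarrow> A l (x, D)" if "l < s" for l
    by (rule fibre_poly_tconv[OF XP Uz b(3) c]) (use AB(1) that in blast)
  have cB: "(\<lambda>n. B l (xs n, Ds n)) \<longlonglongrightarrow> B l (x, D)" if l: "l < s" for l
  proof (cases "d = 0")
    case True
    then have "B l = (\<lambda>_. 0)" using AB(2) l by auto
    then show ?thesis by simp
  next
    case False
    then have "fibre_poly X U (d - 1) (B l)" using AB(2) l by auto
    then show ?thesis by (rule fibre_poly_tconv[OF XP Uz b(3) c])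
  qed
  have "dominated (\<lambda>n. (\<Sum>l<s. A l (xs n, Ds n) * \<zeta> l (xs n)) + (\<Sum>l<s. B l (xs n, Ds n) * Ds n (\<zeta> l))) G"
    by (intro dominated_add dominated_sum dominated_mult[OF cA] dominated_mult[OF cB] jd G0) auto
  then have dP: "dominated (\<lambda>n. P (xs n, Ds n)) G" unfolding AB(3) by simp
  have "(\<lambda>n. inverse (Q (xs n, Ds n))) \<longlonglongrightarrow> inverse (Q (x, D))"
    by (intro tendsto_inverse fibre_poly_tconv[OF XP Uz b(3) c U(4)] b(2))
  then have "dominated (\<lambda>n. inverse (Q (xs n, Ds n)) * P (xs n, Ds n)) G"
    by (rule dominated_mult[OF _ dP G0])
  moreover have "eventually (\<lambda>n. g (xs n, tline (Ds n)) = inverse (Q (xs n, Ds n)) * P (xs n, Ds n)) sequentially"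
    using b(1) zopens_tconv[OF XP c U']
  proof eventually_elim
    case (elim n)
    then show ?case using is_fraction_on_tline[OF U(6) _ T(5)] by (simp add: divide_inverse mult.commute)
  qed
  ultimately show ?thesis by (rule dominated_cong)
qed

text \<open>Locally \<open>exp (- 2 * lam1)\<close> is at most a constant times the square of the
  largest generator of the prolongation, hence times \<open>HH + RR\<close>. The factor
  \<open>EE\<close> turns this into an inequality homogeneous of degree 2 in the tangent vector, as
  the compactness argument demands.\<close>

lemma weil1_lower_bound:
  "\<exists>K\<ge>0. \<forall>x\<in>X. \<forall>D\<in>V x. x \<notin> Supp (variety_of X) I \<longrightarrow> D \<noteq> (\<lambda>_. 0) \<longrightarrow>
     exp (- 2 * lam1 (x, tline D)) * EE (tr x) x D \<le> K * (HH (tr x) x * EE (tr x) x D + RR (tr x) x D)"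
proof -
  let ?F = "\<lambda>x D. exp (- 2 * lam1 (x, tline D)) * EE (tr x) x D"
  let ?G = "\<lambda>x D. HH (tr x) x * EE (tr x) x D + RR (tr x) x D"
  have "\<exists>K\<ge>0. \<forall>x\<in>X. \<forall>D\<in>V x. x \<notin> Supp (variety_of X) I \<longrightarrow> D \<noteq> (\<lambda>_. 0) \<longrightarrow> ?F x D \<le> K * ?G x D"
  proof (rule tangent_bounded_by_compactness[OF manifold])
    show "?F x (\<lambda>g. c * D g) = (cmod c)\<^sup>2 * ?F x D" for x D c
    proof (cases "c = 0")
      case False
      show ?thesis by (simp only: tline_eq_scale[OF False] EE_homogeneous) simp
    qed (simp only: EE_homogeneous, simp)
    show "?G x (\<lambda>g. c * D g) = (cmod c)\<^sup>2 * ?G x D" for x D c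
      by (simp only: EE_homogeneous RR_homogeneous) (simp add: algebra_simps)
    show "0 \<le> ?G x D" for x D
      by (intro add_nonneg_nonneg mult_nonneg_nonneg HH_nonneg EE_nonneg RR_nonneg)
    fix xs Ds x D assume c: "tconv X V xs Ds x D" and ns: "\<And>n. xs n \<notin> Supp (variety_of X) I"
    note T = tconvD[OF c]
    define i where "i = tr x"
    have t: "x \<in> triv_dom L i" using tr_mem[OF T(2)] by (simp add: i_def)
    have "D \<in> V x" using c by (simp add: tconv_def)
    then have li: "(x, tline D) \<in> lines_in X V" using T(2,6) by (intro lines_inI)
    have "(x, tline D) \<in> \<Union>(zopens (projectivization X V))"
    proof -
      obtain U s \<zeta> where U: "affine_open (variety_of X) U" "x \<in> U" using variety_cover[OF T(2)] by blast
      \<comment> \<open>A constant of fibre degree 0 shows that all of \<open>P(V)\<close> over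
        \<open>U\<close> is open, so the limit line lies in some open set.\<close>
      define Q :: "'n pt \<times> 'n tv \<Rightarrow> complex" where "Q = (\<lambda>(x, D). 1)"
      have Q: "fibre_poly X U 0 Q" unfolding Q_def by (rule fibre_poly.base[OF regs_const])
      have "basic_open X V U Q \<in> zopens (projectivization X V)"
        unfolding projectivization_zopens_iff using U(1) Q by (auto simp: basic_open_def)
      moreover have "(x, tline D) \<in> basic_open X V U Q"
        unfolding basic_open_tline_iff[OF Q T(6)] using li U(2) by (simp add: Q_def)
      ultimately show ?thesis by blast
    qed
    then obtain U' r g C where U': "affine_open (projectivization X V) U'" "(x, tline D) \<in> U'" "0 < r"
      "generates (projectivization X V) (prolongation X V I) U' r g"
      "continuous_map (subtopology (complex_topology (projectivization X V)) U') euclideanreal C"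
      "\<And>u. u \<in> U' \<Longrightarrow> u \<notin> Supp (projectivization X V) (prolongation X V I) \<Longrightarrow> \<bar>lam1 u + ln (max_cmod r g u)\<bar> \<le> C u"
      by (rule weil_function_local[OF weil1]) (rule that)
    note Uz = affine_open_zopens[OF U'(1)]
    define G where "G n = (\<Sum>k<m. cmod (\<tau> k i (xs n)) +
     cmod (Ds n (\<tau> k i) - tK {..<M} (\<lambda>k. \<sigma> k i (xs n)) (\<lambda>k. Ds n (\<sigma> k i)) * \<tau> k i (xs n)))" for n
    have G0: "0 \<le> G n" for n unfolding G_def by (intro sum_nonneg) auto
    have "dominated (\<lambda>n. g j (xs n, tline (Ds n))) G" if "j < r" for j
      unfolding G_def
    proof (rule prolongation_dominated[OF c t Uz U'(2)])
      show "g j \<in> prolongation X V I U'" using conjunct1[OF U'(4)[unfolded generates_def]] that by blast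
    qed
    then obtain K where K: "K \<ge> 0" "eventually (\<lambda>n. tN {..<r} (\<lambda>j. g j (xs n, tline (Ds n))) \<le> K * (G n)\<^sup>2) sequentially"
      using dominated_tN[of "{..<r}" "\<lambda>j n. g j (xs n, tline (Ds n))" G, OF finite_lessThan _ G0] by auto
    have lim: "limitin (complex_topology (projectivization X V)) (\<lambda>n. (xs n, tline (Ds n))) (x, tline D) sequentially"
      by (rule tconv_limitin[OF XP c Uz U'(2)])
    have evU: "eventually (\<lambda>n. (xs n, tline (Ds n)) \<in> U') sequentially" by (rule zopens_tconv[OF XP c Uz U'(2)])
    have limC: "(\<lambda>n. C (xs n, tline (Ds n))) \<longlonglongrightarrow> C (x, tline D)"
    proof -
      have "limitin (subtopology (complex_topology (projectivization X V)) U') (\<lambda>n. (xs n, tline (Ds n))) (x, tline D) sequentially"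
        unfolding limitin_subtopology using lim evU U'(2) by simp
      from continuous_map_limit[OF U'(5) this] show ?thesis by (simp add: o_def)
    qed
    define C0 where "C0 = C (x, tline D) + 1"
    have evC: "eventually (\<lambda>n. C (xs n, tline (Ds n)) < C0) sequentially"
      by (rule order_tendstoD(2)[OF limC]) (simp add: C0_def)
    let ?limN = "tN {..<M} (\<lambda>k. \<sigma> k i x)"
    have N0: "0 < ?limN" by (rule N_pos[OF t])
    have evN: "eventually (\<lambda>n. tN {..<M} (\<lambda>k. \<sigma> k i (xs n)) < ?limN + 1) sequentially"
      by (rule order_tendstoD(2)[OF N_cconv[OF T(1) t]]) simp
    \<comment> \<open>\<open>E0\<close> bounds \<open>EE\<close> in the product with
      \<open>RR\<close>; being at least 1, it may also be inserted as a factor of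
      \<open>HH * EE\<close>.\<close>
    define E0 where "E0 = EE i x D + 1"
    have evE: "eventually (\<lambda>n. EE i (xs n) (Ds n) < E0) sequentially"
      by (rule order_tendstoD(2)[OF E_tconv[OF c t]]) (simp add: E0_def)
    have E0: "1 \<le> E0" using EE_nonneg[of i x D] by (simp add: E0_def)
    define K1 where "K1 = exp (2 * C0) * K * (2 * real m * 2) * (?limN + 1)"
    have K1: "0 \<le> K1" unfolding K1_def using K(1) N0 by (intro mult_nonneg_nonneg) auto
    have "eventually (\<lambda>n. ?F (xs n) (Ds n) \<le> (K1 * E0) * ?G (xs n) (Ds n)) sequentially"
      using K(2) evU evC evN evE triv_eventually[OF T(1) t]
    proof eventually_elim
      case (elim n)
      let ?u = "(xs n, tline (Ds n))"
      let ?\<kappa> = "tK {..<M} (\<lambda>k. \<sigma> k i (xs n)) (\<lambda>k. Ds n (\<sigma> k i))"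
      let ?curN = "tN {..<M} (\<lambda>k. \<sigma> k i (xs n))"
      have N: "0 < ?curN" by (rule N_pos[OF elim(6)])
      note tn = tr_mem[OF T(3)[of n]]
      have eq: "EE (tr (xs n)) (xs n) (Ds n) = EE i (xs n) (Ds n)" "RR (tr (xs n)) (xs n) (Ds n) = RR i (xs n) (Ds n)"
        "HH (tr (xs n)) (xs n) = HH i (xs n)"
        using EE_change[OF tn elim(6) T(8)] RR_change[OF tn elim(6) T(8)] HH_change[OF tn elim(6)] by auto
      \<comment> \<open>As \<open>ln 0\<close> is \<open>0\<close>, the Weil estimate gives nothing
        where all generators vanish. A section over \<open>U'\<close> that is nonzero at
        \<open>?u\<close> keeps this point off the support of the prolongation and forces a
        generator to be nonzero there.\<close>
      obtain h where h: "h \<in> prolongation X V I U'" "h ?u \<noteq> 0"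
        by (rule prolongation_nonvanishing[OF proj subscheme variety_cover U'(1) elim(2) ns]) (assumption, rule that)
      have nsu: "?u \<notin> Supp (projectivization X V) (prolongation X V I)"
        using h Uz elim(2) unfolding Supp_def by blast
      obtain \<alpha> where \<alpha>: "\<forall>u\<in>U'. h u = (\<Sum>j<r. \<alpha> j u * g j u)"
        using bspec[OF conjunct2[OF U'(4)[unfolded generates_def]] h(1)] by (elim exE conjE)
      have "\<exists>j<r. g j ?u \<noteq> 0"
      proof (rule ccontr)
        assume "\<not> ?thesis"
        then have "h ?u = 0" using bspec[OF \<alpha> elim(2)] by simp
        then show False using h(2) by simp
      qed
      then obtain j where j: "j < r" "g j ?u \<noteq> 0" by blast
      have mx: "max_cmod r g ?u > 0" by (rule less_le_trans[OF _ max_cmod_ge[OF j(1)]]) (use j(2) in simp)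
      obtain l where l: "l < r" "max_cmod r g ?u = cmod (g l ?u)" using max_cmod_attained[OF U'(3), of g ?u] by (elim exE conjE)
      have mx2: "(max_cmod r g ?u)\<^sup>2 \<le> K * (G n)\<^sup>2"
      proof -
        have "(cmod (g l ?u))\<^sup>2 \<le> tN {..<r} (\<lambda>j. g j ?u)"
          unfolding tN_def by (rule member_le_sum[of l "{..<r}" "\<lambda>j. (cmod (g j ?u))\<^sup>2"]) (use l in auto)
        then show ?thesis using elim(1) l(2) by simp
      qed
      \<comment> \<open>\<open>real m\<close> stems from Cauchy-Schwarz for \<open>m\<close>
        summands, a factor 2 from the square of \<open>?a k + ?b k\<close>, and
        \<open>?limN + 1\<close> bounds the denominator common to \<open>HH\<close> and
        \<open>RR\<close>.\<close>
      have G2: "(G n)\<^sup>2 \<le> (2 * real m * 2) * (?limN + 1) * (HH i (xs n) + RR i (xs n) (Ds n))"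
      proof -
        let ?a = "\<lambda>k. cmod (\<tau> k i (xs n))" and ?b = "\<lambda>k. cmod (Ds n (\<tau> k i) - ?\<kappa> * \<tau> k i (xs n))"
        have "(\<Sum>k<m. 1 * (?a k + ?b k))\<^sup>2 \<le> (\<Sum>k<m. 1\<^sup>2) * (\<Sum>k<m. (?a k + ?b k)\<^sup>2)" by (rule Cauchy_Schwarz_ineq_sum)
        then have "(G n)\<^sup>2 \<le> real m * (\<Sum>k<m. (?a k + ?b k)\<^sup>2)" by (simp add: G_def)
        also have "\<dots> \<le> real m * (\<Sum>k<m. 2 * ((?a k)\<^sup>2 + (?b k)\<^sup>2))"
        proof (intro mult_left_mono sum_mono)
          fix k
          have "2 * ((?a k)\<^sup>2 + (?b k)\<^sup>2) - (?a k + ?b k)\<^sup>2 = (?a k - ?b k)\<^sup>2" by (simp add: power2_eq_square algebra_simps)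
          then show "(?a k + ?b k)\<^sup>2 \<le> 2 * ((?a k)\<^sup>2 + (?b k)\<^sup>2)" using zero_le_power2[of "?a k - ?b k"] by linarith
        qed simp
        also have "\<dots> = (2 * real m) * (?curN * (HH i (xs n) + RR i (xs n) (Ds n)))"
          using N by (simp add: HH_def RR_def tH_def tR_def tN_def[of "{..<m}"] sum.distrib distrib_left flip: sum_distrib_left)
        also have "\<dots> \<le> (2 * real m * 2) * ((?limN + 1) * (HH i (xs n) + RR i (xs n) (Ds n)))"
        proof (rule mult_mono[of "2 * real m" "2 * real m * 2"])
          show "?curN * (HH i (xs n) + RR i (xs n) (Ds n)) \<le> (?limN + 1) * (HH i (xs n) + RR i (xs n) (Ds n))"
            using elim(4) by (intro mult_right_mono add_nonneg_nonneg HH_nonneg RR_nonneg) simp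
          show "0 \<le> ?curN * (HH i (xs n) + RR i (xs n) (Ds n))"
            by (intro mult_nonneg_nonneg add_nonneg_nonneg HH_nonneg RR_nonneg tN_nonneg)
        qed simp_all
        finally show ?thesis by (simp only: mult.assoc)
      qed
      have "- 2 * lam1 ?u \<le> 2 * C0 + 2 * ln (max_cmod r g ?u)" using U'(6)[OF elim(2) nsu] elim(3) by linarith
      then have "exp (- 2 * lam1 ?u) \<le> exp (2 * C0 + 2 * ln (max_cmod r g ?u))" by simp
      also have "\<dots> = exp (2 * C0) * (max_cmod r g ?u)\<^sup>2" using mx by (simp add: exp_add exp_double)
      also have "\<dots> \<le> exp (2 * C0) * (K * ((2 * real m * 2) * (?limN + 1) * (HH i (xs n) + RR i (xs n) (Ds n))))"
        by (intro mult_left_mono order_trans[OF mx2] G2 K(1)) auto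
      finally have ex: "exp (- 2 * lam1 ?u) \<le> K1 * (HH i (xs n) + RR i (xs n) (Ds n))" by (simp only: K1_def mult.assoc)
      have "?F (xs n) (Ds n) \<le> K1 * (HH i (xs n) + RR i (xs n) (Ds n)) * EE i (xs n) (Ds n)"
        unfolding eq by (rule mult_right_mono[OF ex EE_nonneg])
      also have "\<dots> = K1 * (HH i (xs n) * EE i (xs n) (Ds n) + RR i (xs n) (Ds n) * EE i (xs n) (Ds n))"
        by (simp add: algebra_simps)
      also have "\<dots> \<le> K1 * (E0 * (HH i (xs n) * EE i (xs n) (Ds n)) + RR i (xs n) (Ds n) * E0)"
      proof (intro mult_left_mono add_mono K1)
        show "HH i (xs n) * EE i (xs n) (Ds n) \<le> E0 * (HH i (xs n) * EE i (xs n) (Ds n))"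
          using mult_right_mono[OF E0, of "HH i (xs n) * EE i (xs n) (Ds n)"] HH_nonneg[of i "xs n"] EE_nonneg[of i "xs n" "Ds n"] by simp
        show "EE i (xs n) (Ds n) \<le> E0" using elim(5) by simp
      qed (rule RR_nonneg)
      also have "\<dots> = (K1 * E0) * ?G (xs n) (Ds n)" unfolding eq by (simp add: algebra_simps)
      finally show ?case .
    qed
    then show "\<exists>K. eventually (\<lambda>n. ?F (xs n) (Ds n) \<le> K * ?G (xs n) (Ds n)) sequentially" by blast
  qed
  then show ?thesis by blast
qed

end

section \<open>From tuples on patches to global functions on the plane\<close>

context holomorphic_tuples
begin

lemma N_eq_tN: "N z = tN I (\<lambda>k. a k z)" by (simp add: N_def tN_def)

lemma E_eq_tR: "E z = tR I I (\<lambda>k. a k z) (\<lambda>k. deriv (a k) z) (\<lambda>k. a k z) (\<lambda>k. deriv (a k) z)"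
  by (simp add: E_def tR_def tK_def \<kappa>_def N_eq_tN)

lemma R_eq_tR: "R z = tR I J (\<lambda>k. a k z) (\<lambda>k. deriv (a k) z) (\<lambda>k. b k z) (\<lambda>k. deriv (b k) z)"
  by (simp add: R_def tR_def tK_def \<kappa>_def N_eq_tN)

lemma BN_eq_tH: "B z / N z = tH I J (\<lambda>k. a k z) (\<lambda>k. b k z)"
  by (simp add: B_def tH_def N_eq_tN tN_def[of J])

lemma continuous_N: "continuous_on A N"
  unfolding N_def using hol_a by (intro continuous_intros) (auto intro: holomorphic_on_imp_continuous_on)

lemma continuous_R: "continuous_on A R"
  unfolding R_def \<kappa>_def
proof -
  have ca: "continuous_on A (a k)" "continuous_on A (deriv (a k))" if "k \<in> I" for k
    using hol_a[OF that] A by (auto intro!: holomorphic_on_imp_continuous_on holomorphic_deriv)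
  have cb: "continuous_on A (b k)" "continuous_on A (deriv (b k))" if "k \<in> J" for k
    using hol_b[OF that] A by (auto intro!: holomorphic_on_imp_continuous_on holomorphic_deriv)
  have nz: "\<forall>z\<in>A. N z \<noteq> 0" using N_pos by force
  have ck: "continuous_on A (\<lambda>z. (\<Sum>k\<in>I. cnj (a k z) * deriv (a k) z) / of_real (N z))"
    using nz by (intro continuous_on_divide continuous_on_sum continuous_on_mult continuous_on_cnj continuous_on_of_real continuous_N ca) auto
  show "continuous_on A (\<lambda>z. (\<Sum>k\<in>J. (cmod (deriv (b k) z - (\<Sum>k\<in>I. cnj (a k z) * deriv (a k) z) / of_real (N z) * b k z))\<^sup>2) / N z)"
    using nz by (intro continuous_on_divide[OF _ continuous_N] continuous_on_sum continuous_on_power continuous_on_norm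
       continuous_on_diff continuous_on_mult ck cb)
qed

lemma continuous_BN: "continuous_on A (\<lambda>z. B z / N z)"
proof -
  have "continuous_on A B"
    unfolding B_def using hol_b by (intro continuous_intros) (auto intro: holomorphic_on_imp_continuous_on)
  moreover have "\<forall>z\<in>A. N z \<noteq> 0" using N_pos by force
  ultimately show ?thesis by (intro continuous_on_divide continuous_N)
qed

end

lemma continuous_on_UNIV_local:
  fixes u :: "complex \<Rightarrow> real"
  assumes "\<And>z. \<exists>S v. open S \<and> z \<in> S \<and> continuous_on S v \<and> (\<forall>w\<in>S. v w = u w)"
  shows "continuous_on UNIV u"
proof (rule continuous_at_imp_continuous_on, rule ballI)
  fix z
  obtain S v where S: "open S" "z \<in> S" "continuous_on S v" "\<forall>w\<in>S. v w = u w" using assms[of z] by blast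
  then have "continuous_on S u" by (metis (no_types, lifting) continuous_on_cong)
  then show "isCont u z" using S(1,2) by (simp add: continuous_on_eq_continuous_at)
qed

lemma C2_on_ddc_diff:
  assumes "C2_on A u" "C2_on A v" "open A"
  shows "C2_on A (\<lambda>z. u z - v z)" "z \<in> A \<Longrightarrow> ddc (\<lambda>z. u z - v z) z = ddc u z - ddc v z"
proof -
  have ex: "\<exists>g l. C2_grad_lap A u g l" if h: "C2_on A u" for u
  proof -
    obtain p q pp pq qp qq where "C2d A u p q pp pq qp qq" using h unfolding C2_on_iff by (elim exE)
    then show ?thesis unfolding C2_grad_lap_def
      by - (rule exI[of _ "\<lambda>z. Complex (p z) (q z)"], rule exI[of _ "\<lambda>z. pp z + qq z"], intro exI conjI, assumption, simp)
  qed
  obtain g l where u: "C2_grad_lap A u g l" using ex[OF assms(1)] by (elim exE)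
  obtain h k where v: "C2_grad_lap A v h k" using ex[OF assms(2)] by (elim exE)
  note d = C2_grad_lap_diff[OF u v]
  show "C2_on A (\<lambda>z. u z - v z)" by (rule C2_grad_lap_imp_C2_on[OF d])
  show "ddc (\<lambda>z. u z - v z) z = ddc u z - ddc v z" if "z \<in> A"
    using C2_grad_lap_ddc[OF d assms(3) that] C2_grad_lap_ddc[OF u assms(3) that] C2_grad_lap_ddc[OF v assms(3) that]
    by (simp add: diff_divide_distrib)
qed

lemma C2_on_continuous_ddc:
  assumes "C2_on A u" "open A" shows "continuous_on A (ddc u)"
proof -
  obtain p q pp pq qp qq where C: "C2d A u p q pp pq qp qq" using assms(1) unfolding C2_on_iff by (elim exE)
  have "continuous_on A (\<lambda>z. (pp z + qq z) / (4 * pi))"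
    using C2d_isCont(4,7)[OF C] by (intro continuous_intros continuous_at_imp_continuous_on) auto
  then show ?thesis by (rule continuous_on_eq) (simp add: ddc_C2d[OF C assms(2)])
qed

subsection \<open>Curves in a directed manifold\<close>

locale curve_in_system = directed_linear_system X V L S M \<sigma>
  for X :: "('n::finite) pt set" and V and L :: "('i, 'n) line_bundle" and S M \<sigma> +
  fixes f :: "complex \<Rightarrow> 'n pt"
  assumes curve: "directed_curve X V f"
begin

lemma fX: "f z \<in> X"
  and f_open: "open_in_manifold X \<Omega> \<Longrightarrow> open (f -` \<Omega>)"
  and f_analytic: "holo_at X (f z) g \<Longrightarrow> (\<lambda>w. g (f w)) analytic_on {z}"
  using curve by (auto simp: directed_curve_def holomorphic_map_to_def)

abbreviation "vel z \<equiv> velocity X f z"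
abbreviation "patch i \<equiv> f -` triv_dom L i"

lemma vel_V: "vel z \<in> V (f z)" using curve by (simp add: directed_curve_def)

lemma vel_tangent: "vel z \<in> tangent_space X (f z)" by (rule tangent_V[OF fX vel_V])

lemma patch_open: "open (patch i)" by (rule f_open[OF triv_open])

lemma patch_tr: "z \<in> patch (tr (f z))" using tr_mem[OF fX] by simp

lemma section_holomorphic:
  assumes "s \<in> S" shows "(\<lambda>w. s i (f w)) holomorphic_on patch i"
proof -
  have "(\<lambda>w. s i (f w)) analytic_on {z}" if "z \<in> patch i" for z
    by (rule f_analytic[OF section_holo[OF assms]]) (use that in simp)
  then have "(\<lambda>w. s i (f w)) analytic_on patch i" using analytic_on_analytic_at by blast
  then show ?thesis by (rule analytic_imp_holomorphic)
qed

lemma section_deriv: "s \<in> S \<Longrightarrow> z \<in> patch i \<Longrightarrow> deriv (\<lambda>w. s i (f w)) z = vel z (s i)"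
  using section_holo[of s "f z" i] by (simp add: velocity_def)

lemma tuples:
  assumes "finite J" "\<And>k. k \<in> J \<Longrightarrow> \<tau> k \<in> S"
  shows "holomorphic_tuples (patch i) {..<M} J (\<lambda>k w. \<sigma> k i (f w)) (\<lambda>k w. \<tau> k i (f w))"
proof
  show "\<exists>k\<in>{..<M}. \<sigma> k i (f z) \<noteq> 0" if "z \<in> patch i" for z using basis_nonzero[of "f z" i] that by auto
qed (use assms patch_open section_holomorphic basis_mem in auto)

lemma tR_deriv:
  assumes "\<And>k. k \<in> J \<Longrightarrow> \<tau> k \<in> S" "z \<in> patch i"
  shows "tR {..<M} J (\<lambda>k. \<sigma> k i (f z)) (\<lambda>k. deriv (\<lambda>w. \<sigma> k i (f w)) z) (\<lambda>k. \<tau> k i (f z)) (\<lambda>k. deriv (\<lambda>w. \<tau> k i (f w)) z)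
    = tR {..<M} J (\<lambda>k. \<sigma> k i (f z)) (\<lambda>k. vel z (\<sigma> k i)) (\<lambda>k. \<tau> k i (f z)) (\<lambda>k. vel z (\<tau> k i))"
proof -
  have "tK {..<M} (\<lambda>k. \<sigma> k i (f z)) (\<lambda>k. deriv (\<lambda>w. \<sigma> k i (f w)) z) = tK {..<M} (\<lambda>k. \<sigma> k i (f z)) (\<lambda>k. vel z (\<sigma> k i))"
    unfolding tK_def using section_deriv[OF basis_mem assms(2)] by simp
  then show ?thesis
    unfolding tR_def using section_deriv[OF assms(1) assms(2)] by simp
qed

text \<open>\<open>pi\<close> times the density of the pulled back form, by
  \<open>pullback_system_weight\<close>; the scale avoids carrying \<open>1 / pi\<close> through the
  estimates.\<close>

definition Ez :: "complex \<Rightarrow> real" where "Ez z = EE (tr (f z)) (f z) (vel z)"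

lemma Ez_nonneg: "0 \<le> Ez z" unfolding Ez_def by (rule EE_nonneg)

lemma Ez_local: "z \<in> patch i \<Longrightarrow> Ez z = EE i (f z) (vel z)"
  unfolding Ez_def by (rule EE_change[OF tr_mem[OF fX] _ vel_tangent]) simp

lemma Ez_ddc:
  assumes "z \<in> patch i"
  shows "ddc (\<lambda>w. system_weight M \<sigma> i (f w)) z = Ez z / pi" "C2_on (patch i) (\<lambda>w. system_weight M \<sigma> i (f w))"
proof -
  interpret T: holomorphic_tuples "patch i" "{..<M}" "{..<M}" "\<lambda>k w. \<sigma> k i (f w)" "\<lambda>k w. \<sigma> k i (f w)"
    by (rule tuples) (auto simp: basis_mem)
  have eq: "(\<lambda>w. system_weight M \<sigma> i (f w)) = (\<lambda>w. ln (T.N w))" by (simp add: system_weight_def T.N_def fun_eq_iff)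
  have "T.E z = Ez z"
    unfolding T.E_eq_tR Ez_local[OF assms] EE_def by (rule tR_deriv) (use assms basis_mem in auto)
  then show "ddc (\<lambda>w. system_weight M \<sigma> i (f w)) z = Ez z / pi" unfolding eq using T.ddc_ln_N[OF assms] by simp
  show "C2_on (patch i) (\<lambda>w. system_weight M \<sigma> i (f w))" unfolding eq by (rule T.C2_ln_N)
qed

lemma pullback_system_weight: "pullback_ddc L f (system_weight M \<sigma>) z = Ez z / pi"
  unfolding pullback_ddc_def tr_def[symmetric] by (rule Ez_ddc(1)[OF patch_tr])

lemma Ez_continuous: "continuous_on UNIV Ez"
proof (rule continuous_on_UNIV_local)
  fix z
  let ?i = "tr (f z)"
  have "continuous_on (patch ?i) (\<lambda>w. pi * ddc (\<lambda>w. system_weight M \<sigma> ?i (f w)) w)"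
    by (intro continuous_intros C2_on_continuous_ddc[OF Ez_ddc(2)[OF patch_tr] patch_open])
  moreover have "\<forall>w\<in>patch ?i. pi * ddc (\<lambda>w. system_weight M \<sigma> ?i (f w)) w = Ez w"
    using Ez_ddc(1) by simp
  ultimately show "\<exists>S v. open S \<and> z \<in> S \<and> continuous_on S v \<and> (\<forall>w\<in>S. v w = Ez w)"
    by - (rule exI[of _ "patch ?i"], rule exI[of _ "\<lambda>w. pi * ddc (\<lambda>w. system_weight M \<sigma> ?i (f w)) w"],
      intro conjI patch_open patch_tr, assumption, assumption)
qed

text \<open>Both weights change by the same logarithm under a change of trivialization, so their
  difference \<open>u\<close> is a function on all of \<open>X\<close>, bounded by compactness.
  Jensen's formula then bounds the contribution of \<open>ddc\<close> of \<open>u\<close> along the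
  curve.\<close>

lemma characteristic_bound:
  assumes "characteristic_function X L f T"
  shows "\<exists>K\<ge>0. \<forall>r\<ge>0. nev Ez r \<le> pi * (T r + K)"
proof -
  obtain \<phi> K where \<phi>: "hermitian_weight X L \<phi>" "\<forall>i. C2_on (patch i) (\<lambda>z. \<phi> i (f z))"
    and K: "\<forall>r\<ge>0. \<bar>nevanlinna (pullback_ddc L f \<phi>) r - ereal (T r)\<bar> \<le> ereal K"
    using assms unfolding characteristic_function_def by (elim exE conjE)
  define u where "u x = system_weight M \<sigma> (tr x) x - \<phi> (tr x) x" for x
  have sw: "system_weight M \<sigma> i x = ln (tN {..<M} (\<lambda>k. \<sigma> k i x))" for i x by (simp add: system_weight_def tN_def)
  have u_local: "u x = system_weight M \<sigma> i x - \<phi> i x" if x: "x \<in> triv_dom L i" for x i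
  proof -
    let ?j = "tr x"
    note xj = tr_mem[OF triv_subset[OF x]]
    have g: "transition L ?j i x \<noteq> 0" using transition xj x by blast
    have "tN {..<M} (\<lambda>k. \<sigma> k ?j x) = (cmod (transition L ?j i x))\<^sup>2 * tN {..<M} (\<lambda>k. \<sigma> k i x)"
    proof -
      have "tN {..<M} (\<lambda>k. \<sigma> k ?j x) = tN {..<M} (\<lambda>k. transition L ?j i x * \<sigma> k i x)"
        unfolding tN_def
      proof (intro sum.cong refl)
        fix k assume "k \<in> {..<M}"
        then have "\<sigma> k ?j x = transition L ?j i x * \<sigma> k i x" using section_transition[OF basis_mem xj x] by simp
        then show "(cmod (\<sigma> k ?j x))\<^sup>2 = (cmod (transition L ?j i x * \<sigma> k i x))\<^sup>2" by (rule arg_cong)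
      qed
      then show ?thesis unfolding tN_scale .
    qed
    then have "system_weight M \<sigma> ?j x = ln ((cmod (transition L ?j i x))\<^sup>2) + system_weight M \<sigma> i x"
      unfolding sw using g N_pos[OF x] by (simp add: ln_mult)
    moreover have "\<phi> ?j x = \<phi> i x + ln ((cmod (transition L ?j i x))\<^sup>2)"
      using \<phi>(1) xj x unfolding hermitian_weight_def by blast
    ultimately show ?thesis unfolding u_def by simp
  qed
  have "\<exists>B. \<forall>x\<in>X. True \<longrightarrow> \<bar>u x\<bar> \<le> B"
  proof (rule bounded_by_compactness[OF proj])
    fix xs x assume c: "cconv X xs x"
    then have x: "x \<in> X" by (simp add: cconv_def)
    note t = tr_mem[OF x]
    have "(\<lambda>n. \<phi> (tr x) (xs n)) \<longlonglongrightarrow> \<phi> (tr x) x"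
      by (rule cconv_real_function[OF XP c _ triv_open t]) (use \<phi>(1) in \<open>simp add: hermitian_weight_def\<close>)
    moreover have "(\<lambda>n. ln (tN {..<M} (\<lambda>k. \<sigma> k (tr x) (xs n)))) \<longlonglongrightarrow> ln (tN {..<M} (\<lambda>k. \<sigma> k (tr x) x))"
      by (rule tendsto_ln[OF N_cconv[OF c t]]) (use N_pos[OF t] in simp)
    ultimately have "(\<lambda>n. \<bar>system_weight M \<sigma> (tr x) (xs n) - \<phi> (tr x) (xs n)\<bar>) \<longlonglongrightarrow> \<bar>system_weight M \<sigma> (tr x) x - \<phi> (tr x) x\<bar>"
      unfolding sw by (intro tendsto_rabs tendsto_diff)
    then have "eventually (\<lambda>n. \<bar>system_weight M \<sigma> (tr x) (xs n) - \<phi> (tr x) (xs n)\<bar> < \<bar>system_weight M \<sigma> (tr x) x - \<phi> (tr x) x\<bar> + 1) sequentially"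
      by (rule order_tendstoD(2)) simp
    then have "eventually (\<lambda>n. \<bar>u (xs n)\<bar> \<le> \<bar>system_weight M \<sigma> (tr x) x - \<phi> (tr x) x\<bar> + 1) sequentially"
      using triv_eventually[OF c t] by eventually_elim (simp add: u_local)
    then show "\<exists>K. eventually (\<lambda>n. \<bar>u (xs n)\<bar> \<le> K) sequentially" by blast
  qed
  then obtain B where B: "\<And>z. \<bar>u (f z)\<bar> \<le> B" using fX by blast
  have loc: "C2_on (patch i) (\<lambda>z. system_weight M \<sigma> i (f z) - \<phi> i (f z))"
    "\<And>z. z \<in> patch i \<Longrightarrow> ddc (\<lambda>z. system_weight M \<sigma> i (f z) - \<phi> i (f z)) z = ddc (\<lambda>z. system_weight M \<sigma> i (f z)) z - ddc (\<lambda>z. \<phi> i (f z)) z" if "z0 \<in> patch i" for i z0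
    using C2_on_ddc_diff[OF Ez_ddc(2)[OF that] spec[OF \<phi>(2)] patch_open] by auto
  have C2u: "C2_on UNIV (\<lambda>z. u (f z))"
  proof (rule C2_on_UNIV_local)
    fix z
    show "\<exists>S v. open S \<and> z \<in> S \<and> C2_on S v \<and> (\<forall>w\<in>S. v w = u (f w))"
      by (rule exI[of _ "patch (tr (f z))"], rule exI[of _ "\<lambda>w. system_weight M \<sigma> (tr (f z)) (f w) - \<phi> (tr (f z)) (f w)"])
        (intro conjI patch_open patch_tr loc(1)[OF patch_tr] ballI, simp add: u_local)
  qed
  have ddcu: "ddc (\<lambda>z. u (f z)) z = Ez z / pi - pullback_ddc L f \<phi> z" for z
  proof -
    let ?i = "tr (f z)"
    have "ddc (\<lambda>z. u (f z)) z = ddc (\<lambda>w. system_weight M \<sigma> ?i (f w) - \<phi> ?i (f w)) z"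
      by (rule ddc_cong, rule eventually_mono[OF eventually_nhds_in_open[OF patch_open patch_tr]]) (simp add: u_local)
    also have "\<dots> = Ez z / pi - ddc (\<lambda>w. \<phi> ?i (f w)) z" using loc(2)[OF patch_tr patch_tr, of z] Ez_ddc(1)[OF patch_tr] by simp
    finally show ?thesis by (simp add: pullback_ddc_def tr_def)
  qed
  note nd = nev_ddc_bound[OF C2u B]
  have pe: "pullback_ddc L f \<phi> = (\<lambda>z. 1 / pi * Ez z + (- 1) * ddc (\<lambda>z. u (f z)) z)" using ddcu by (auto simp: fun_eq_iff)
  have c1: "continuous_on UNIV (\<lambda>z. 1 / pi * Ez z)" and c2: "continuous_on UNIV (\<lambda>z. (- 1) * ddc (\<lambda>z. u (f z)) z)"
    by (intro continuous_on_mult continuous_on_const Ez_continuous nd(1))+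
  have cp: "continuous_on UNIV (pullback_ddc L f \<phi>)" unfolding pe by (intro continuous_on_add c1 c2)
  have "nev Ez r \<le> pi * (T r + (\<bar>K\<bar> + B))" if r: "r \<ge> 0" for r
  proof -
    have "nev (pullback_ddc L f \<phi>) r \<le> T r + K"
      using K[rule_format, OF r] unfolding nevanlinna_eq_nev[OF cp] by simp
    moreover have "nev (pullback_ddc L f \<phi>) r = 1 / pi * nev Ez r + (- 1) * nev (ddc (\<lambda>z. u (f z))) r"
      unfolding pe nev_add[OF c1 c2] nev_cmult ..
    moreover have "\<bar>nev (ddc (\<lambda>z. u (f z))) r\<bar> \<le> B" by (rule nd(2)[OF r])
    ultimately have "1 / pi * nev Ez r \<le> T r + (\<bar>K\<bar> + B)" by linarith
    then show ?thesis by (simp add: field_simps)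
  qed
  moreover have "0 \<le> \<bar>K\<bar> + B" using B[of 0] by linarith
  ultimately show ?thesis by blast
qed

text \<open>The interior \<open>P\<close> of the zero set is closed by the identity theorem. It
  misses \<open>z0\<close> and the plane is connected, so it is empty and the zeros are
  isolated.\<close>

lemma section_zeros_negligible:
  assumes s: "s \<in> S" and z0: "s (tr (f z0)) (f z0) \<noteq> 0"
  shows "negligible {z. s (tr (f z)) (f z) = 0}" (is "negligible ?Z")
proof -
  have loc: "z \<in> ?Z \<longleftrightarrow> s i (f z) = 0" if "z \<in> patch i" for z i
  proof -
    have x: "f z \<in> triv_dom L i" using that by simp
    note y = tr_mem[OF fX[of z]]
    have "s i (f z) = transition L i (tr (f z)) (f z) * s (tr (f z)) (f z)" by (rule section_transition[OF s x y])
    moreover have "transition L i (tr (f z)) (f z) \<noteq> 0" using transition[OF x y] by blast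
    ultimately show ?thesis by simp
  qed
  have ballD: "\<exists>e>0. ball z e \<subseteq> patch (tr (f z))" for z using patch_open patch_tr open_contains_ball by blast
  define P where "P = {z. \<exists>e>0. ball z e \<subseteq> ?Z}"
  have oP: "open P"
    unfolding open_contains_ball
  proof
    fix z assume "z \<in> P"
    then obtain e where e: "e > 0" "ball z e \<subseteq> ?Z" unfolding P_def by blast
    have "ball z e \<subseteq> P"
    proof
      fix w assume "w \<in> ball z e"
      then obtain d where "d > 0" "ball w d \<subseteq> ball z e" using open_ball open_contains_ball by metis
      then show "w \<in> P" using e(2) unfolding P_def by blast
    qed
    then show "\<exists>e>0. ball z e \<subseteq> P" using e(1) by blast
  qed
  \<comment> \<open>A disc inside a single patch that meets \<open>P\<close> carries a holomorphic
    function vanishing on an open subset, hence everywhere on the disc.\<close>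
  have step: "z \<in> P" if e: "e > 0" "ball z e \<subseteq> patch (tr (f z))" and w: "w \<in> P" "w \<in> ball z e" for z w e
  proof -
    let ?g = "\<lambda>y. s (tr (f z)) (f y)"
    have hol: "?g holomorphic_on ball z e" by (rule holomorphic_on_subset[OF section_holomorphic[OF s] e(2)])
    obtain d where d: "d > 0" "ball w d \<subseteq> ?Z" using w(1) unfolding P_def by blast
    have "?g y = 0" if y: "y \<in> ball z e" for y
    proof (rule analytic_continuation_open[of "ball w d \<inter> ball z e" "ball z e" ?g "\<lambda>_. 0"])
      show "ball w d \<inter> ball z e \<noteq> {}" using w(2) centre_in_ball[THEN iffD2, OF d(1)] by blast
      show "?g x = 0" if "x \<in> ball w d \<inter> ball z e" for x
      proof -
        have "x \<in> ?Z" "x \<in> patch (tr (f z))" using that d(2) e(2) by blast+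
        then show ?thesis using loc by blast
      qed
    qed (use hol y in \<open>auto intro: open_Int\<close>)
    then have "ball z e \<subseteq> ?Z" using loc e(2) by blast
    then show ?thesis using e(1) unfolding P_def by blast
  qed
  have cP: "closed P"
    unfolding closed_def open_contains_ball
  proof
    fix z assume z: "z \<in> - P"
    obtain e where e: "e > 0" "ball z e \<subseteq> patch (tr (f z))" using ballD[of z] by (elim exE conjE)
    then have "ball z e \<subseteq> - P" using step z by blast
    then show "\<exists>e>0. ball z e \<subseteq> - P" using e(1) by blast
  qed
  have "z0 \<notin> P"
  proof
    assume "z0 \<in> P"
    then obtain e where "e > 0" "ball z0 e \<subseteq> ?Z" unfolding P_def by blast
    then have "z0 \<in> ?Z" by (auto simp: subset_eq)
    then show False using z0 by simp
  qed
  then have P: "P = {}" using iffD1[OF clopen conjI[OF cP oP]] by (elim disjE) simp_all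
  show ?thesis
  proof (rule locally_negligible_alt[THEN iffD2], rule ballI)
    fix z assume z: "z \<in> ?Z"
    obtain e where e: "e > 0" "ball z e \<subseteq> patch (tr (f z))" using ballD[of z] by (elim exE conjE)
    let ?g = "\<lambda>y. s (tr (f z)) (f y)"
    have hol: "?g holomorphic_on ball z e" by (rule holomorphic_on_subset[OF section_holomorphic[OF s] e(2)])
    have "z \<notin> P" unfolding P by simp
    then have "\<not> ball z e \<subseteq> ?Z" unfolding P_def mem_Collect_eq using e(1) by (metis (no_types))
    then obtain y where y0: "y \<in> ball z e" "y \<notin> ?Z" unfolding subset_eq by auto
    have "y \<in> patch (tr (f z))" using y0(1) e(2) by (rule rev_subsetD)
    then have y: "y \<in> ball z e" "?g y \<noteq> 0" using loc y0 by simp_all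
    have gz: "?g z = 0" using z by simp
    obtain d where d: "d > 0" "ball z d \<subseteq> ball z e" "\<And>w. w \<in> ball z d - {z} \<Longrightarrow> ?g w \<noteq> 0"
      by (rule isolated_zeros[OF hol open_ball connected_ball centre_in_ball[THEN iffD2, OF e(1)] gz y]) (rule that)
    have "?Z \<inter> ball z d \<subseteq> {z}"
    proof
      fix w assume w: "w \<in> ?Z \<inter> ball z d"
      then have "w \<in> patch (tr (f z))" using d(2) e(2) by blast
      then have "?g w = 0" using loc w by blast
      then show "w \<in> {z}" using d(3) w by blast
    qed
    then have "negligible (?Z \<inter> ball z d)" using negligible_subset[OF negligible_sing] by blast
    moreover have "openin (top_of_set ?Z) (?Z \<inter> ball z d)" by (rule openin_open_Int) simp
    ultimately show "\<exists>U. openin (top_of_set ?Z) U \<and> z \<in> U \<and> negligible U"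
      using z d(1) by (intro exI[of _ "?Z \<inter> ball z d"]) auto
  qed
qed

end

section \<open>One subscheme along the curve\<close>

locale weil_pair_on_curve =
  curve_in_system X V L S M \<sigma> f + weil_pair X V L S M \<sigma> I lam lam1 m \<tau>
  for X :: "('n::finite) pt set" and V and L :: "('i, 'n) line_bundle" and S M \<sigma> f I lam lam1 m \<tau> +
  fixes C :: real
  assumes span_bound: "\<forall>i x. tN {..<m} (\<lambda>k. \<tau> k i x) \<le> C * tN {..<M} (\<lambda>k. \<sigma> k i x)"
    and C_nonneg: "0 \<le> C"
    and curve_not_in_Supp: "\<exists>z. f z \<notin> Supp (variety_of X) I"
begin

definition h :: "complex \<Rightarrow> real" where "h z = HH (tr (f z)) (f z)"
definition \<rho> :: "complex \<Rightarrow> real" where "\<rho> z = RR (tr (f z)) (f z) (vel z)"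

lemma h_local: "z \<in> patch i \<Longrightarrow> h z = HH i (f z)"
  unfolding h_def by (rule HH_change[OF tr_mem[OF fX]]) simp

lemma \<rho>_local: "z \<in> patch i \<Longrightarrow> \<rho> z = RR i (f z) (vel z)"
  unfolding \<rho>_def by (rule RR_change[OF tr_mem[OF fX] _ vel_tangent]) simp

lemma h_nonneg: "0 \<le> h z" unfolding h_def by (rule HH_nonneg)
lemma \<rho>_nonneg: "0 \<le> \<rho> z" unfolding \<rho>_def by (rule RR_nonneg)

lemma h_le: "h z \<le> C"
  unfolding h_def HH_def tH_def using span_bound N_pos[OF tr_mem[OF fX]] by (simp add: divide_le_eq)

text \<open>On a patch a single trivialization serves all points, so the sections become holomorphic
  functions of one variable and the results on tuples apply.\<close>

lemma h_\<rho>_in_patch: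
  fixes i \<delta> \<epsilon>
  defines "u \<equiv> \<lambda>w. (HH i (f w) + \<delta>) powr \<epsilon>"
  shows "continuous_on (patch i) (\<lambda>w. HH i (f w))"
    and "continuous_on (patch i) \<rho>"
    and "0 < \<delta> \<Longrightarrow> C2_on (patch i) u"
    and "z \<in> patch i \<Longrightarrow> 0 < \<delta> \<Longrightarrow> 0 < \<epsilon> \<Longrightarrow> \<epsilon> \<le> 1 \<Longrightarrow>
      \<epsilon> * (h z + \<delta>) powr (\<epsilon> - 1) * \<rho> z \<le> (h z + \<delta>) powr \<epsilon> * Ez z + pi / \<epsilon> * ddc u z"
proof -
  interpret T: holomorphic_tuples "patch i" "{..<M}" "{..<m}" "\<lambda>k w. \<sigma> k i (f w)" "\<lambda>k w. \<tau> k i (f w)"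
    by (rule tuples) (auto simp: \<tau>_S)
  have BN: "T.B w / T.N w = HH i (f w)" for w unfolding T.BN_eq_tH HH_def ..
  have R: "T.R w = \<rho> w" if w: "w \<in> patch i" for w
    unfolding T.R_eq_tR \<rho>_local[OF w] RR_def by (rule tR_deriv) (use w \<tau>_S in auto)
  have E: "T.E w = Ez w" if w: "w \<in> patch i" for w
    unfolding T.E_eq_tR Ez_local[OF w] EE_def by (rule tR_deriv) (use w basis_mem in auto)
  show "continuous_on (patch i) (\<lambda>w. HH i (f w))" using T.continuous_BN unfolding BN .
  show "continuous_on (patch i) \<rho>" by (rule continuous_on_eq[OF T.continuous_R R])
  show "C2_on (patch i) u" if "0 < \<delta>" unfolding u_def using T.powr_C2_on[OF that, of \<epsilon>] unfolding BN .
  show "\<epsilon> * (h z + \<delta>) powr (\<epsilon> - 1) * \<rho> z \<le> (h z + \<delta>) powr \<epsilon> * Ez z + pi / \<epsilon> * ddc u z"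
    if "z \<in> patch i" "0 < \<delta>" "0 < \<epsilon>" "\<epsilon> \<le> 1"
    using T.curvature_inequality[OF that] unfolding BN R[OF that(1)] E[OF that(1)] u_def h_local[OF that(1)] .
qed

lemma continuous_h: "continuous_on UNIV h"
proof (rule continuous_on_UNIV_local)
  fix z
  show "\<exists>S v. open S \<and> z \<in> S \<and> continuous_on S v \<and> (\<forall>w\<in>S. v w = h w)"
    by (rule exI[of _ "patch (tr (f z))"], rule exI[of _ "\<lambda>w. HH (tr (f z)) (f w)"])
      (intro conjI patch_open patch_tr h_\<rho>_in_patch(1) ballI, simp add: h_local)
qed

lemma continuous_\<rho>: "continuous_on UNIV \<rho>"
proof (rule continuous_on_UNIV_local)
  fix z
  show "\<exists>S v. open S \<and> z \<in> S \<and> continuous_on S v \<and> (\<forall>w\<in>S. v w = \<rho> w)"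
    by (rule exI[of _ "patch (tr (f z))"], rule exI[of _ \<rho>])
      (intro conjI patch_open patch_tr h_\<rho>_in_patch(2) ballI refl)
qed

text \<open>The curve leaves the support, so some \<open>\<tau> k\<close> does not vanish
  identically along it, and every zero of \<open>h\<close> is a zero of that section.\<close>

lemma h_pos_AE: "AE z in lborel. 0 < h z"
proof -
  obtain z0 where z0: "f z0 \<notin> Supp (variety_of X) I" using curve_not_in_Supp by blast
  obtain k where k: "k < m" "\<tau> k (tr (f z0)) (f z0) \<noteq> 0" using not_Supp_imp_section[OF z0 tr_mem[OF fX]] by blast
  let ?Z = "{z. \<tau> k (tr (f z)) (f z) = 0}"
  have "negligible ?Z" by (rule section_zeros_negligible[OF \<tau>_S[OF k(1)] k(2)])
  then have "negligible {z. h z = 0}"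
  proof (rule negligible_subset)
    show "{z. h z = 0} \<subseteq> ?Z"
    proof clarify
      fix z assume "h z = 0"
      then have "tN {..<m} (\<lambda>k. \<tau> k (tr (f z)) (f z)) = 0"
        using N_pos[OF tr_mem[OF fX], of z] by (simp add: h_def HH_def tH_def)
      then show "\<tau> k (tr (f z)) (f z) = 0" using k(1) by (simp add: tN_def sum_nonneg_eq_0_iff)
    qed
  qed
  \<comment> \<open>A negligible set is null only for the completed measure; closedness makes it a
    Borel set and hence null for \<open>lborel\<close>.\<close>
  moreover have "closed {z. h z = 0}"
    by (rule closed_Collect_eq[OF continuous_h continuous_on_const])
  ultimately have "{z. h z = 0} \<in> null_sets lborel"
    by (simp add: negligible_iff_null_sets null_sets_completion_iff borel_closed)
  then have "AE z in lborel. z \<notin> {z. h z = 0}" by (rule AE_not_in)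
  then show ?thesis
  proof eventually_elim
    fix z assume "z \<notin> {z. h z = 0}"
    then show "0 < h z" using h_nonneg[of z] by (auto simp: order_less_le)
  qed
qed

text \<open>The bound for \<open>exp (2 * lam)\<close> is raised to the power
  \<open>1 - \<epsilon>\<close> and multiplied with the bound for \<open>lam1\<close>. The constant
  must be chosen before \<open>\<epsilon>\<close>.\<close>

lemma weil_integrand_bound:
  "\<exists>c\<ge>0. \<forall>z \<epsilon>. 0 < h z \<longrightarrow> vel z \<noteq> (\<lambda>_. 0) \<longrightarrow> 0 < \<epsilon> \<longrightarrow> \<epsilon> < 1 \<longrightarrow>
     exp (2 * (1 - \<epsilon>) * lam (f z) - 2 * lam1 (f z, tline (vel z))) * Ez z
      \<le> c * ((C + 1) * Ez z + h z powr (\<epsilon> - 1) * \<rho> z)"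
proof -
  obtain K where K: "\<forall>x\<in>X. x \<notin> Supp (variety_of X) I \<longrightarrow> exp (2 * lam x) * HH (tr x) x \<le> K"
    using weil_upper_bound by blast
  obtain K1 where K1: "K1 \<ge> 0" "\<forall>x\<in>X. \<forall>D\<in>V x. x \<notin> Supp (variety_of X) I \<longrightarrow> D \<noteq> (\<lambda>_. 0) \<longrightarrow>
     exp (- 2 * lam1 (x, tline D)) * EE (tr x) x D \<le> K1 * (HH (tr x) x * EE (tr x) x D + RR (tr x) x D)"
    using weil1_lower_bound by blast
  \<comment> \<open>At least 1, so that \<open>K0 powr (1 - \<epsilon>) \<le> K0\<close> for every
    \<open>\<epsilon>\<close>.\<close>
  define K0 where "K0 = max 1 K"
  have "exp (2 * (1 - \<epsilon>) * lam (f z) - 2 * lam1 (f z, tline (vel z))) * Ez z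
      \<le> K0 * K1 * ((C + 1) * Ez z + h z powr (\<epsilon> - 1) * \<rho> z)"
    if h: "0 < h z" and v: "vel z \<noteq> (\<lambda>_. 0)" and \<epsilon>: "0 < \<epsilon>" "\<epsilon> < 1" for z \<epsilon>
  proof -
    have nS: "f z \<notin> Supp (variety_of X) I"
      using h Supp_imp_HH_0[OF _ tr_mem[OF fX]] unfolding h_def by fastforce
    have "exp (2 * lam (f z)) * h z \<le> K" using K fX nS unfolding h_def by blast
    then have "exp (2 * lam (f z)) * h z \<le> K0" unfolding K0_def by simp
    then have "exp (2 * lam (f z)) \<le> K0 / h z" using h by (simp add: field_simps)
    then have "exp (2 * lam (f z)) powr (1 - \<epsilon>) \<le> (K0 / h z) powr (1 - \<epsilon>)" using \<epsilon> by (intro powr_mono2) auto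
    also have "\<dots> = K0 powr (1 - \<epsilon>) * h z powr (\<epsilon> - 1)"
    proof -
      have "(K0 / h z) powr (1 - \<epsilon>) = K0 powr (1 - \<epsilon>) / h z powr (1 - \<epsilon>)"
        by (rule powr_divide)
      moreover have "h z powr (\<epsilon> - 1) = inverse (h z powr (1 - \<epsilon>))" using powr_minus[of "h z" "1 - \<epsilon>"] by simp
      ultimately show ?thesis by (simp add: divide_inverse)
    qed
    also have "\<dots> \<le> K0 * h z powr (\<epsilon> - 1)"
      using powr_mono[of "1 - \<epsilon>" 1 K0] \<epsilon> by (intro mult_right_mono) (auto simp: K0_def)
    finally have a0: "exp (2 * lam (f z)) powr (1 - \<epsilon>) \<le> K0 * h z powr (\<epsilon> - 1)" .
    have a: "exp (2 * (1 - \<epsilon>) * lam (f z)) \<le> K0 * h z powr (\<epsilon> - 1)"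
    proof -
      have "exp (2 * (1 - \<epsilon>) * lam (f z)) = exp (2 * lam (f z)) powr (1 - \<epsilon>)" by (simp add: powr_def algebra_simps)
      then show ?thesis using a0 by simp
    qed
    have b: "exp (- 2 * lam1 (f z, tline (vel z))) * Ez z \<le> K1 * (h z * Ez z + \<rho> z)"
      using K1(2)[rule_format, OF fX[of z] vel_V[of z] nS v] unfolding h_def \<rho>_def Ez_def .
    have "exp (2 * (1 - \<epsilon>) * lam (f z) - 2 * lam1 (f z, tline (vel z))) * Ez z
       = exp (2 * (1 - \<epsilon>) * lam (f z)) * (exp (- 2 * lam1 (f z, tline (vel z))) * Ez z)"
      by (simp add: exp_diff exp_minus divide_inverse mult.assoc)
    also have "\<dots> \<le> (K0 * h z powr (\<epsilon> - 1)) * (K1 * (h z * Ez z + \<rho> z))"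
      by (intro mult_mono a b mult_nonneg_nonneg Ez_nonneg) (auto simp: K0_def)
    also have "\<dots> = K0 * K1 * (h z powr (\<epsilon> - 1) * h z * Ez z + h z powr (\<epsilon> - 1) * \<rho> z)" by (simp add: algebra_simps)
    also have "h z powr (\<epsilon> - 1) * h z = h z powr \<epsilon>" using h by (simp add: powr_mult_base mult.commute)
    also have "K0 * K1 * (h z powr \<epsilon> * Ez z + h z powr (\<epsilon> - 1) * \<rho> z) \<le> K0 * K1 * ((C + 1) * Ez z + h z powr (\<epsilon> - 1) * \<rho> z)"
    proof -
      \<comment> \<open>The summand 1 brings the base to at least 1, so that raising the exponent
        from \<open>\<epsilon>\<close> to 1 increases the power.\<close>
      have "h z powr \<epsilon> \<le> (C + 1) powr \<epsilon>" using h_le[of z] h \<epsilon> by (intro powr_mono2) auto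
      also have "\<dots> \<le> (C + 1) powr 1" using C_nonneg \<epsilon> by (intro powr_mono) auto
      finally have "h z powr \<epsilon> \<le> C + 1" using C_nonneg by simp
      then show ?thesis using K1(1) by (intro mult_left_mono add_right_mono mult_right_mono Ez_nonneg) (auto simp: K0_def)
    qed
    finally show ?thesis .
  qed
  moreover have "0 \<le> K0 * K1" using K1(1) by (simp add: K0_def)
  ultimately show ?thesis by blast
qed

text \<open>As \<open>\<delta> \<le> 1\<close> and \<open>\<epsilon> < 1\<close>, the function
  \<open>(h + \<delta>) powr \<epsilon>\<close> is at most \<open>C + 1\<close> for all parameters.
  This bounds the coefficient of \<open>Ez\<close> and, through Jensen's formula,
  \<open>nev D\<close>; independence of \<open>\<delta>\<close> is what the limit requires.\<close>

lemma curvature_bound: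
  assumes \<epsilon>: "0 < \<epsilon>" "\<epsilon> < 1" and \<delta>: "0 < \<delta>" "\<delta> \<le> 1"
  defines "D \<equiv> ddc (\<lambda>z. (h z + \<delta>) powr \<epsilon>)"
  shows "continuous_on UNIV D" "r \<ge> 0 \<Longrightarrow> \<bar>nev D r\<bar> \<le> C + 1"
    and "(h z + \<delta>) powr (\<epsilon> - 1) * \<rho> z \<le> 1 / \<epsilon> * ((C + 1) * Ez z + pi / \<epsilon> * D z)"
proof -
  have le: "(h z + \<delta>) powr \<epsilon> \<le> C + 1" for z
  proof -
    have "(h z + \<delta>) powr \<epsilon> \<le> (C + 1) powr \<epsilon>" using h_le[of z] h_nonneg[of z] \<epsilon> \<delta> by (intro powr_mono2) auto
    also have "\<dots> \<le> (C + 1) powr 1" using C_nonneg \<epsilon> by (intro powr_mono) auto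
    finally show ?thesis using C_nonneg by simp
  qed
  have C2: "C2_on UNIV (\<lambda>z. (h z + \<delta>) powr \<epsilon>)"
  proof (rule C2_on_UNIV_local)
    fix z
    show "\<exists>S v. open S \<and> z \<in> S \<and> C2_on S v \<and> (\<forall>w\<in>S. v w = (h w + \<delta>) powr \<epsilon>)"
      by (rule exI[of _ "patch (tr (f z))"], rule exI[of _ "\<lambda>w. (HH (tr (f z)) (f w) + \<delta>) powr \<epsilon>"])
        (intro conjI patch_open patch_tr h_\<rho>_in_patch(3) \<delta>(1) ballI, simp add: h_local)
  qed
  have "\<bar>(h z + \<delta>) powr \<epsilon>\<bar> \<le> C + 1" for z using le by simp
  note nb = nev_ddc_bound[OF C2 this]
  show "continuous_on UNIV D" unfolding D_def by (rule nb(1))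
  show "\<bar>nev D r\<bar> \<le> C + 1" if "r \<ge> 0" unfolding D_def by (rule nb(2)[OF that])
  have Dz: "ddc (\<lambda>w. (HH (tr (f z)) (f w) + \<delta>) powr \<epsilon>) z = D z"
    unfolding D_def by (rule ddc_cong, rule eventually_mono[OF eventually_nhds_in_open[OF patch_open patch_tr]]) (simp add: h_local)
  have "\<epsilon> * (h z + \<delta>) powr (\<epsilon> - 1) * \<rho> z \<le> (h z + \<delta>) powr \<epsilon> * Ez z + pi / \<epsilon> * D z"
    using h_\<rho>_in_patch(4)[OF patch_tr[of z] \<delta>(1) \<epsilon>(1) less_imp_le[OF \<epsilon>(2)]] unfolding Dz .
  also have "\<dots> \<le> (C + 1) * Ez z + pi / \<epsilon> * D z" by (intro add_right_mono mult_right_mono le Ez_nonneg)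
  finally show "(h z + \<delta>) powr (\<epsilon> - 1) * \<rho> z \<le> 1 / \<epsilon> * ((C + 1) * Ez z + pi / \<epsilon> * D z)"
    using \<epsilon>(1) by (simp add: field_simps)
qed

end

section \<open>Combination of several subschemes\<close>

lemma Supp_subscheme_sum:
  "i \<in> {1..q} \<Longrightarrow> Supp S (Z i) \<subseteq> Supp S (subscheme_sum S Z q)"
proof (induction q)
  case (Suc q)
  show ?case
  proof
    fix x assume x: "x \<in> Supp S (Z i)"
    have "g x = 0" if W: "W \<in> zopens S" "x \<in> W" "g \<in> ideal_product S (subscheme_sum S Z q) (Z (Suc q)) W" for W g
    proof -
      have "\<forall>w\<in>W. \<exists>W'\<in>zopens S. w \<in> W' \<and> W' \<subseteq> W \<and>
         (\<exists>(n::nat) a b. (\<forall>k<n. a k \<in> subscheme_sum S Z q W' \<and> b k \<in> Z (Suc q) W') \<and> (\<forall>u\<in>W'. g u = (\<Sum>k<n. a k u * b k u)))"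
        using W(3) unfolding ideal_product_def by blast
      from bspec[OF this W(2)] obtain W' and n :: nat and a b where W': "W' \<in> zopens S" "x \<in> W'"
        and ab: "\<forall>k<n. a k \<in> subscheme_sum S Z q W' \<and> b k \<in> Z (Suc q) W'" and g: "\<forall>u\<in>W'. g u = (\<Sum>k<n. a k u * b k u)"
        by (elim bexE exE conjE)
      have "a k x * b k x = 0" if k: "k < n" for k
      proof (cases "i = Suc q")
        case True
        then show ?thesis using x W' ab k unfolding Supp_def by auto
      next
        case False
        then have "x \<in> Supp S (subscheme_sum S Z q)" using Suc x by auto
        then show ?thesis using W' ab k unfolding Supp_def by auto
      qed
      then have "(\<Sum>k<n. a k x * b k x) = 0" by (intro sum.neutral) auto
      then show ?thesis using g W'(2) by simp
    qed
    moreover have "x \<in> \<Union>(zopens S)" using x unfolding Supp_def by blast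
    ultimately show "x \<in> Supp S (subscheme_sum S Z (Suc q))" unfolding Supp_def by simp
  qed
qed simp

text \<open>A nonzero velocity means that the vanishing order \<open>m\<close> is 0. At the other
  points the integrand vanishes together with \<open>Ez\<close>.\<close>

lemma is_lift_at_regular_point:
  assumes "is_lift X V f f1" "velocity X f z \<noteq> (\<lambda>_. 0)"
  shows "f1 z = (f z, tline (velocity X f z))"
proof -
  obtain m :: nat and u e where "e > 0" and u: "\<forall>w\<in>ball z e. u w \<in> V (f w) \<and> velocity X f w = (\<lambda>g. (w - z) ^ m * u w g)"
    and f1: "f1 z = (f z, tline (u z))"
    using spec[OF assms(1)[unfolded is_lift_def], of z] by (elim exE conjE)
  then have v: "velocity X f z = (\<lambda>g. (z - z) ^ m * u z g)" by simp
  have "m = 0" using v assms(2) by (cases m) auto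
  then show ?thesis using v f1 by simp
qed

lemma nevanlinna_nn_mono_AE:
  assumes "AE z in lborel. u z \<le> v z"
  shows "nevanlinna_nn u r \<le> nevanlinna_nn v r"
proof -
  have le: "(\<integral>\<^sup>+ z\<in>ball 0 t. ennreal (u z) \<partial>lborel) \<le> (\<integral>\<^sup>+ z\<in>ball 0 t. ennreal (v z) \<partial>lborel)" for t
    by (rule nn_integral_mono_AE) (use assms in eventually_elim, auto intro!: mult_right_mono ennreal_leI)
  show ?thesis unfolding nevanlinna_nn_def
    by (rule nn_integral_mono, rule mult_right_mono, rule mult_left_mono[OF le]) simp_all
qed

context curve_in_system
begin

lemma Ez_eq_0: "vel z = (\<lambda>_. 0) \<Longrightarrow> Ez z = 0"
  unfolding Ez_def EE_def by (simp add: tR_def tK_def)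

text \<open>An interface to one subscheme that hides the sections \<open>\<tau>\<close> and their
  number, so that the data of all subschemes can be chosen and summed. \<open>D\<close> may depend
  on \<open>\<epsilon>\<close> and \<open>\<delta>\<close>, but its bound \<open>C\<close> may
  not.\<close>

definition majorized ::
    "('n pt \<Rightarrow> real) \<Rightarrow> ('n pt \<times> 'n tv set \<Rightarrow> real) \<Rightarrow> real \<Rightarrow> real \<Rightarrow> (complex \<Rightarrow> real) \<Rightarrow> (complex \<Rightarrow> real) \<Rightarrow> bool" where
  "majorized lam lam1 c C h \<rho> \<longleftrightarrow> 0 \<le> c \<and> 0 \<le> C \<and> continuous_on UNIV h \<and> continuous_on UNIV \<rho> \<and>
     (\<forall>z. 0 \<le> h z) \<and> (\<forall>z. 0 \<le> \<rho> z) \<and> (AE z in lborel. 0 < h z) \<and>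
     (\<forall>z \<epsilon>. 0 < h z \<longrightarrow> vel z \<noteq> (\<lambda>_. 0) \<longrightarrow> 0 < \<epsilon> \<longrightarrow> \<epsilon> < 1 \<longrightarrow>
        exp (2 * (1 - \<epsilon>) * lam (f z) - 2 * lam1 (f z, tline (vel z))) * Ez z \<le> c * (C * Ez z + h z powr (\<epsilon> - 1) * \<rho> z)) \<and>
     (\<forall>\<epsilon> \<delta>. 0 < \<epsilon> \<longrightarrow> \<epsilon> < 1 \<longrightarrow> 0 < \<delta> \<longrightarrow> \<delta> \<le> 1 \<longrightarrow>
        (\<exists>D. continuous_on UNIV D \<and> (\<forall>r\<ge>0. \<bar>nev D r\<bar> \<le> C) \<and>
          (\<forall>z. (h z + \<delta>) powr (\<epsilon> - 1) * \<rho> z \<le> 1 / \<epsilon> * (C * Ez z + pi / \<epsilon> * D z))))"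

lemma ex_majorized:
  assumes I: "closed_subscheme (variety_of X) I" and w: "weil_function (variety_of X) I lam"
    and w1: "weil_function (projectivization X V) (prolongation X V I) lam1"
    and base: "is_base_ideal_through X L S I" and z0: "\<exists>z. f z \<notin> Supp (variety_of X) I"
  shows "\<exists>c C h \<rho>. majorized lam lam1 c C h \<rho>"
proof -
  have "sections_through X L S I \<subseteq> S" unfolding sections_through_def by blast
  from finite_spanning_sections[OF this] obtain m :: nat and \<tau> B where
    t: "\<forall>k<m. \<tau> k \<in> sections_through X L S I" "\<forall>s\<in>sections_through X L S I. \<exists>c. s = (\<lambda>i x. \<Sum>k<m. c k * \<tau> k i x)"
    "\<forall>i x. tN {..<m} (\<lambda>k. \<tau> k i x) \<le> B * tN {..<M} (\<lambda>k. \<sigma> k i x)" "0 \<le> B"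
    by (elim exE conjE)
  interpret W: weil_pair_on_curve X V L S M \<sigma> f I lam lam1 m \<tau> B
    by unfold_locales (fact I w w1 base t z0)+
  obtain c where c: "c \<ge> 0" "\<forall>z \<epsilon>. 0 < W.h z \<longrightarrow> vel z \<noteq> (\<lambda>_. 0) \<longrightarrow> 0 < \<epsilon> \<longrightarrow> \<epsilon> < 1 \<longrightarrow>
     exp (2 * (1 - \<epsilon>) * lam (f z) - 2 * lam1 (f z, tline (vel z))) * Ez z
      \<le> c * ((B + 1) * Ez z + W.h z powr (\<epsilon> - 1) * W.\<rho> z)"
    using W.weil_integrand_bound by (elim exE conjE)
  have "majorized lam lam1 c (B + 1) W.h W.\<rho>"
    unfolding majorized_def
  proof (intro conjI allI impI)
    fix \<epsilon> \<delta> :: real assume as: "0 < \<epsilon>" "\<epsilon> < 1" "0 < \<delta>" "\<delta> \<le> 1"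
    show "\<exists>D. continuous_on UNIV D \<and> (\<forall>r\<ge>0. \<bar>nev D r\<bar> \<le> B + 1) \<and>
          (\<forall>z. (W.h z + \<delta>) powr (\<epsilon> - 1) * W.\<rho> z \<le> 1 / \<epsilon> * ((B + 1) * Ez z + pi / \<epsilon> * D z))"
      by (rule exI[of _ "ddc (\<lambda>z. (W.h z + \<delta>) powr \<epsilon>)"]) (intro conjI allI impI W.curvature_bound[OF as])
  next
    fix z and \<epsilon> :: real assume "0 < W.h z" "vel z \<noteq> (\<lambda>_. 0)" "0 < \<epsilon>" "\<epsilon> < 1"
    then show "exp (2 * (1 - \<epsilon>) * lam (f z) - 2 * lam1 (f z, tline (vel z))) * Ez z
      \<le> c * ((B + 1) * Ez z + W.h z powr (\<epsilon> - 1) * W.\<rho> z)" using c(2) by simp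
  qed (use c(1) t(4) W.continuous_h W.continuous_\<rho> W.h_nonneg W.\<rho>_nonneg W.h_pos_AE in simp_all)
  then show ?thesis by - (rule exI, rule exI, rule exI, rule exI)
qed

text \<open>\<open>G 0\<close> is the majorant of the integrand and \<open>G \<delta>\<close> its
  regularisation. At zeros of some \<open>h i\<close> the convention
  \<open>0 powr (\<epsilon> - 1) = 0\<close> spoils both the majorization and the convergence as
  \<open>\<delta>\<close> tends to 0, so these null sets are excluded throughout.\<close>

lemma nevanlinna_bound_of_majorized:
  fixes q :: nat
  assumes q: "1 \<le> q" and W: "\<forall>i\<in>{1..q}. majorized (lam i) (lam1 i) (c i) (C i) (h i) (\<rho> i)"
    and lift: "is_lift X V f f1" and \<epsilon>: "0 < \<epsilon>" "\<epsilon> < 1" and r: "0 \<le> r"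
  defines "s \<equiv> \<Sum>i\<in>{1..q}. c i * C i"
  shows "ereal \<epsilon> * nevanlinna
           (\<lambda>z. exp (2 * (1 - \<epsilon>) * (MAX i\<in>{1..q}. lam i (f z)) - 2 * (MAX i\<in>{1..q}. lam1 i (f1 z)))
                * pullback_ddc L f (system_weight M \<sigma>) z) r \<le> ereal (2 * s * nev Ez r + s * pi / \<epsilon>)"
proof -
  let ?A = "{1..q}"
  define F where "F = (\<lambda>z. exp (2 * (1 - \<epsilon>) * (MAX i\<in>?A. lam i (f z)) - 2 * (MAX i\<in>?A. lam1 i (f1 z)))
                * pullback_ddc L f (system_weight M \<sigma>) z)"
  have c0: "0 \<le> c i" and C0: "0 \<le> C i" and ch: "continuous_on UNIV (h i)" and c\<rho>: "continuous_on UNIV (\<rho> i)"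
    and h0: "0 \<le> h i z" and \<rho>0: "0 \<le> \<rho> i z" and ae: "AE z in lborel. 0 < h i z" if "i \<in> ?A" for i z
    using bspec[OF W that] unfolding majorized_def by simp_all
  have bound: "exp (2 * (1 - \<epsilon>) * lam i (f z) - 2 * lam1 i (f z, tline (vel z))) * Ez z
     \<le> c i * (C i * Ez z + h i z powr (\<epsilon> - 1) * \<rho> i z)" if "i \<in> ?A" "0 < h i z" "vel z \<noteq> (\<lambda>_. 0)" for i z
    using bspec[OF W that(1)] that(2,3) \<epsilon> unfolding majorized_def by simp
  define G where "G = (\<lambda>\<delta> z. \<Sum>i\<in>?A. c i * (C i * Ez z + (h i z + \<delta>) powr (\<epsilon> - 1) * \<rho> i z))"
  define \<delta> where "\<delta> = (\<lambda>n. inverse (real (Suc n)))"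
  have \<delta>: "0 < \<delta> n" "\<delta> n \<le> 1" for n by (auto simp: \<delta>_def field_simps)
  have \<delta>_lim: "\<delta> \<longlonglongrightarrow> 0" unfolding \<delta>_def by (rule LIMSEQ_inverse_real_of_nat)
  have G0: "0 \<le> G d z" for d z
    unfolding G_def by (intro sum_nonneg mult_nonneg_nonneg add_nonneg_nonneg c0 C0 Ez_nonneg \<rho>0 powr_ge_zero)
  have all_pos: "AE z in lborel. \<forall>i\<in>?A. 0 < h i z"
    by (rule AE_finite_allI) (auto intro: ae)
  have F_le: "F z \<le> G 0 z" if z: "\<forall>i\<in>?A. 0 < h i z" for z
  proof (cases "vel z = (\<lambda>_. 0)")
    case True
    then show ?thesis using G0 by (simp add: F_def pullback_system_weight Ez_eq_0)
  next
    case False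
    note f1 = is_lift_at_regular_point[OF lift False]
    \<comment> \<open>The index \<open>j\<close> attains the maximum of the \<open>lam i\<close>.
      The \<open>lam1 i\<close> enter with a negative sign, so their maximum may be replaced by the
      smaller \<open>lam1 j\<close>.\<close>
    have "(MAX i\<in>?A. lam i (f z)) \<in> (\<lambda>i. lam i (f z)) ` ?A" by (rule Max_in) (use q in auto)
    then obtain j where j: "j \<in> ?A" "(MAX i\<in>?A. lam i (f z)) = lam j (f z)" by (elim imageE)
    have "lam1 j (f1 z) \<le> (MAX i\<in>?A. lam1 i (f1 z))" using j(1) by (intro Max_ge) auto
    then have "F z \<le> exp (2 * (1 - \<epsilon>) * lam j (f z) - 2 * lam1 j (f z, tline (vel z))) * (Ez z / pi)"
      unfolding F_def pullback_system_weight j(2) f1 by (intro mult_right_mono) (auto simp: Ez_nonneg)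
    also have "\<dots> \<le> exp (2 * (1 - \<epsilon>) * lam j (f z) - 2 * lam1 j (f z, tline (vel z))) * Ez z"
    proof -
      have "Ez z * 1 \<le> Ez z * pi" using Ez_nonneg[of z] pi_gt3 by (intro mult_left_mono) auto
      then show ?thesis by (intro mult_left_mono) (simp_all add: divide_le_eq)
    qed
    also have "\<dots> \<le> c j * (C j * Ez z + (h j z + 0) powr (\<epsilon> - 1) * \<rho> j z)"
      using bound[OF j(1) _ False] z j(1) by simp
    also have "\<dots> \<le> G 0 z" unfolding G_def
      by (rule member_le_sum[OF j(1)])
        (auto intro!: mult_nonneg_nonneg add_nonneg_nonneg c0 C0 Ez_nonneg \<rho>0)
    finally show ?thesis .
  qed
  have G_bound: "nevanlinna_nn (G (\<delta> n)) r \<le> ennreal (s * (1 + 1 / \<epsilon>) * nev Ez r + s * pi / \<epsilon>\<^sup>2)" for n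
  proof -
    have "\<forall>i\<in>?A. \<exists>D. continuous_on UNIV D \<and> (\<forall>r\<ge>0. \<bar>nev D r\<bar> \<le> C i) \<and>
          (\<forall>z. (h i z + \<delta> n) powr (\<epsilon> - 1) * \<rho> i z \<le> 1 / \<epsilon> * (C i * Ez z + pi / \<epsilon> * D z))"
    proof
      fix i assume "i \<in> ?A"
      then show "\<exists>D. continuous_on UNIV D \<and> (\<forall>r\<ge>0. \<bar>nev D r\<bar> \<le> C i) \<and>
          (\<forall>z. (h i z + \<delta> n) powr (\<epsilon> - 1) * \<rho> i z \<le> 1 / \<epsilon> * (C i * Ez z + pi / \<epsilon> * D z))"
        using bspec[OF W] \<epsilon> \<delta>[of n] unfolding majorized_def by simp
    qed
    from bchoice[OF this] obtain D where D: "\<forall>i\<in>?A. continuous_on UNIV (D i) \<and> (\<forall>r\<ge>0. \<bar>nev (D i) r\<bar> \<le> C i) \<and>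
          (\<forall>z. (h i z + \<delta> n) powr (\<epsilon> - 1) * \<rho> i z \<le> 1 / \<epsilon> * (C i * Ez z + pi / \<epsilon> * D i z))"
      by (elim exE)
    \<comment> \<open>\<open>P i\<close> results from inserting the curvature inequality. It is a
      linear combination of the continuous functions \<open>Ez\<close> and \<open>D i\<close>, so
      \<open>nev\<close> can be evaluated termwise although \<open>D i\<close> has no sign.\<close>
    define P where "P = (\<lambda>i z. (c i * C i * (1 + 1 / \<epsilon>)) * Ez z + (c i * (pi / \<epsilon>\<^sup>2)) * D i z)"
    have cE: "continuous_on UNIV (\<lambda>z. k * Ez z)" for k by (intro continuous_on_mult continuous_on_const Ez_continuous)
    have cD: "continuous_on UNIV (\<lambda>z. k * D i z)" if "i \<in> ?A" for k i
      using D that by (intro continuous_on_mult continuous_on_const) auto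
    have cP: "continuous_on UNIV (P i)" if "i \<in> ?A" for i
      unfolding P_def by (intro continuous_on_add cE cD that)
    have le: "G (\<delta> n) z \<le> (\<Sum>i\<in>?A. P i z)" for z
      unfolding G_def
    proof (rule sum_mono)
      fix i assume i: "i \<in> ?A"
      then have "(h i z + \<delta> n) powr (\<epsilon> - 1) * \<rho> i z \<le> 1 / \<epsilon> * (C i * Ez z + pi / \<epsilon> * D i z)" using D by blast
      then have "c i * (C i * Ez z + (h i z + \<delta> n) powr (\<epsilon> - 1) * \<rho> i z)
         \<le> c i * (C i * Ez z + 1 / \<epsilon> * (C i * Ez z + pi / \<epsilon> * D i z))" by (intro mult_left_mono add_left_mono c0 i)
      also have "\<dots> = P i z" using \<epsilon> by (simp add: P_def field_simps power2_eq_square)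
      finally show "c i * (C i * Ez z + (h i z + \<delta> n) powr (\<epsilon> - 1) * \<rho> i z) \<le> P i z" .
    qed
    have "nevanlinna_nn (G (\<delta> n)) r \<le> nevanlinna_nn (\<lambda>z. \<Sum>i\<in>?A. P i z) r"
      by (rule nevanlinna_nn_mono_AE, rule AE_I2, rule le)
    also have "\<dots> = ennreal (nev (\<lambda>z. \<Sum>i\<in>?A. P i z) r)"
      by (rule nevanlinna_nn_eq_nev) (use cP order_trans[OF G0 le] in \<open>auto intro!: continuous_on_sum\<close>)
    also have "nev (\<lambda>z. \<Sum>i\<in>?A. P i z) r = (\<Sum>i\<in>?A. nev (P i) r)" by (rule nev_sum) (use cP in auto)
    also have "ennreal (\<Sum>i\<in>?A. nev (P i) r) \<le> ennreal (s * (1 + 1 / \<epsilon>) * nev Ez r + s * pi / \<epsilon>\<^sup>2)"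
    proof (rule ennreal_leI)
      have "nev (P i) r \<le> c i * C i * ((1 + 1 / \<epsilon>) * nev Ez r + pi / \<epsilon>\<^sup>2)" if i: "i \<in> ?A" for i
      proof -
        have "nev (P i) r = (c i * C i * (1 + 1 / \<epsilon>)) * nev Ez r + (c i * (pi / \<epsilon>\<^sup>2)) * nev (D i) r"
          unfolding P_def nev_add[OF cE cD[OF i]] nev_cmult ..
        also have "\<dots> \<le> (c i * C i * (1 + 1 / \<epsilon>)) * nev Ez r + (c i * (pi / \<epsilon>\<^sup>2)) * C i"
        proof (intro add_left_mono mult_left_mono mult_nonneg_nonneg c0 i)
          have "\<bar>nev (D i) r\<bar> \<le> C i" using D i r by blast
          then show "nev (D i) r \<le> C i" by linarith
        qed simp
        finally show ?thesis by (simp add: algebra_simps)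
      qed
      then have "(\<Sum>i\<in>?A. nev (P i) r) \<le> (\<Sum>i\<in>?A. c i * C i * ((1 + 1 / \<epsilon>) * nev Ez r + pi / \<epsilon>\<^sup>2))" by (rule sum_mono)
      also have "\<dots> = s * ((1 + 1 / \<epsilon>) * nev Ez r + pi / \<epsilon>\<^sup>2)" unfolding s_def sum_distrib_right ..
      finally show "(\<Sum>i\<in>?A. nev (P i) r) \<le> s * (1 + 1 / \<epsilon>) * nev Ez r + s * pi / \<epsilon>\<^sup>2" by (simp add: algebra_simps)
    qed
    finally show ?thesis .
  qed
  have G_meas: "G d \<in> borel_measurable borel" for d
  proof -
    have [measurable]: "Ez \<in> borel_measurable borel" by (rule borel_measurable_continuous_onI[OF Ez_continuous])
    have hm: "h i \<in> borel_measurable borel" and \<rho>m: "\<rho> i \<in> borel_measurable borel" if "i \<in> ?A" for i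
      using ch[OF that] c\<rho>[OF that] by (auto intro: borel_measurable_continuous_onI)
    show ?thesis unfolding G_def
    proof (rule borel_measurable_sum)
      fix i assume i: "i \<in> ?A"
      note [measurable] = hm[OF i] \<rho>m[OF i]
      show "(\<lambda>z. c i * (C i * Ez z + (h i z + d) powr (\<epsilon> - 1) * \<rho> i z)) \<in> borel_measurable borel" by measurable
    qed
  qed
  have s0: "0 \<le> s" unfolding s_def by (intro sum_nonneg mult_nonneg_nonneg c0 C0)
  have E0: "0 \<le> nev Ez r" by (rule nev_nonneg[OF Ez_continuous Ez_nonneg])
  have "nevanlinna_nn F r \<le> nevanlinna_nn (G 0) r"
    by (rule nevanlinna_nn_mono_AE) (use all_pos in eventually_elim, rule F_le)
  also have "\<dots> \<le> ennreal (s * (1 + 1 / \<epsilon>) * nev Ez r + s * pi / \<epsilon>\<^sup>2)"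
  proof (rule nevanlinna_nn_le_liminf[of "\<lambda>n. G (\<delta> n)"])
    show "AE z in lborel. (\<lambda>n. G (\<delta> n) z) \<longlonglongrightarrow> G 0 z"
      using all_pos
    proof eventually_elim
      fix z assume z: "\<forall>i\<in>?A. 0 < h i z"
      show "(\<lambda>n. G (\<delta> n) z) \<longlonglongrightarrow> G 0 z" unfolding G_def
      proof (rule tendsto_sum)
        fix i assume i: "i \<in> ?A"
        have "h i z + 0 \<noteq> 0" using z i by force
        then have "(\<lambda>n. (h i z + \<delta> n) powr (\<epsilon> - 1)) \<longlonglongrightarrow> (h i z + 0) powr (\<epsilon> - 1)"
          by (intro tendsto_powr tendsto_add tendsto_const \<delta>_lim)
        then show "(\<lambda>n. c i * (C i * Ez z + (h i z + \<delta> n) powr (\<epsilon> - 1) * \<rho> i z)) \<longlonglongrightarrow>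
            c i * (C i * Ez z + (h i z + 0) powr (\<epsilon> - 1) * \<rho> i z)"
          by (intro tendsto_mult tendsto_add tendsto_const)
      qed
    qed
  qed (fact G_meas G_bound)+
  finally have nnF: "nevanlinna_nn F r \<le> ennreal (s * (1 + 1 / \<epsilon>) * nev Ez r + s * pi / \<epsilon>\<^sup>2)" .
  \<comment> \<open>The subtracted negative part is nonnegative, so the positive part alone gives an
    upper bound.\<close>
  have "nevanlinna F r \<le> enn2ereal (nevanlinna_nn F r)"
    unfolding nevanlinna_def by (rule ereal_diff_le_self) simp
  also have "\<dots> \<le> ereal (s * (1 + 1 / \<epsilon>) * nev Ez r + s * pi / \<epsilon>\<^sup>2)"
  proof -
    have "0 \<le> s * (1 + 1 / \<epsilon>) * nev Ez r + s * pi / \<epsilon>\<^sup>2" using s0 E0 \<epsilon> by simp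
    from enn2ereal_ennreal[OF this] show ?thesis using nnF[unfolded less_eq_ennreal.rep_eq] by (simp only:)
  qed
  finally have "ereal \<epsilon> * nevanlinna F r \<le> ereal \<epsilon> * ereal (s * (1 + 1 / \<epsilon>) * nev Ez r + s * pi / \<epsilon>\<^sup>2)"
    using \<epsilon> by (intro ereal_mult_left_mono) auto
  \<comment> \<open>Here the factor \<open>\<epsilon>\<close> of the claim is spent:
    \<open>\<epsilon> * (1 + 1 / \<epsilon>)\<close> equals \<open>\<epsilon> + 1\<close>, at most 2
    for all \<open>\<epsilon>\<close>. The other summand \<open>s * pi / \<epsilon>\<close> depends
    on \<open>\<epsilon>\<close> but not on \<open>r\<close>.\<close>
  also have "\<dots> = ereal ((\<epsilon> + 1) * (s * nev Ez r) + s * pi / \<epsilon>)"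
    using \<epsilon> by (simp add: field_simps power2_eq_square)
  also have "\<dots> \<le> ereal (2 * s * nev Ez r + s * pi / \<epsilon>)"
    using mult_right_mono[of "\<epsilon> + 1" 2 "s * nev Ez r"] \<epsilon> s0 E0 by (simp add: mult.assoc)
  finally show ?thesis unfolding F_def .
qed

end

theorem lemma0p9:
  fixes X :: "('n::finite) pt set" and V :: "'n pt \<Rightarrow> 'n tv set"
    and q :: nat and Z :: "nat \<Rightarrow> 'n pt set \<Rightarrow> ('n pt \<Rightarrow> complex) set"
    and f :: "complex \<Rightarrow> 'n pt" and f1 :: "complex \<Rightarrow> 'n pt \<times> 'n tv set"
    and lam :: "nat \<Rightarrow> 'n pt \<Rightarrow> real" and lam1 :: "nat \<Rightarrow> 'n pt \<times> 'n tv set \<Rightarrow> real"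
    and L :: "('i, 'n) line_bundle" and S :: "('i, 'n) sect set"
    and M :: nat and \<sigma> :: "nat \<Rightarrow> ('i, 'n) sect"
    and T :: "real \<Rightarrow> real"
  assumes "directed_projective_manifold X V"
    and "1 \<le> q"
    and "\<forall>i\<in>{1..q}. closed_subscheme (variety_of X) (Z i)"
    and "directed_curve X V f"
    and "\<not> f constant_on UNIV"
    and "is_lift X V f f1"
    and "\<not> range f \<subseteq> Supp (variety_of X) (subscheme_sum (variety_of X) Z q)"
    and "\<forall>i\<in>{1..q}. weil_function (variety_of X) (Z i) (lam i)"
    and "\<forall>i\<in>{1..q}. weil_function (projectivization X V) (prolongation X V (Z i)) (lam1 i)"
    and "holomorphic_line_bundle X L"
    and "linear_system X L S"
    and "is_basis S M \<sigma>"
    and "\<forall>x\<in>X. separates_1jets X L S x"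
    and "\<forall>i\<in>{1..q}. is_base_ideal_through X L S (Z i)"
    and "characteristic_function X L f T"
  shows "\<exists>c>0. \<forall>\<epsilon>. 0 < \<epsilon> \<and> \<epsilon> < 1 \<longrightarrow>
    (\<exists>b :: real \<Rightarrow> real. (\<exists>K. \<forall>r\<ge>0. \<bar>b r\<bar> \<le> K) \<and>
      (\<forall>r\<ge>0. ereal \<epsilon> * nevanlinna
           (\<lambda>z. exp (2 * (1 - \<epsilon>) * (MAX i\<in>{1..q}. lam i (f z)) - 2 * (MAX i\<in>{1..q}. lam1 i (f1 z)))
                * pullback_ddc L f (system_weight M \<sigma>) z) r
         \<le> ereal (c * T r + b r)))"
proof -
  interpret curve_in_system X V L S M \<sigma> f
    by unfold_locales (use assms in auto)
  obtain z0 where z0: "f z0 \<notin> Supp (variety_of X) (subscheme_sum (variety_of X) Z q)" using assms(7) by blast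
  have "\<forall>i\<in>{1..q}. \<exists>c C h \<rho>. majorized (lam i) (lam1 i) c C h \<rho>"
  proof
    fix i assume i: "i \<in> {1..q}"
    have "\<exists>z. f z \<notin> Supp (variety_of X) (Z i)" using z0 Supp_subscheme_sum[where S = "variety_of X" and Z = Z, OF i] by blast
    then show "\<exists>c C h \<rho>. majorized (lam i) (lam1 i) c C h \<rho>"
      by (rule ex_majorized[OF bspec[OF assms(3) i] bspec[OF assms(8) i] bspec[OF assms(9) i] bspec[OF assms(14) i]])
  qed
  from bchoice[OF this] obtain c where "\<forall>i\<in>{1..q}. \<exists>C h \<rho>. majorized (lam i) (lam1 i) (c i) C h \<rho>" by (elim exE)
  from bchoice[OF this] obtain C where "\<forall>i\<in>{1..q}. \<exists>h \<rho>. majorized (lam i) (lam1 i) (c i) (C i) h \<rho>" by (elim exE)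
  from bchoice[OF this] obtain h where "\<forall>i\<in>{1..q}. \<exists>\<rho>. majorized (lam i) (lam1 i) (c i) (C i) (h i) \<rho>" by (elim exE)
  from bchoice[OF this] obtain \<rho> where W: "\<forall>i\<in>{1..q}. majorized (lam i) (lam1 i) (c i) (C i) (h i) (\<rho> i)" by (elim exE)
  obtain K where K: "K \<ge> 0" "\<forall>r\<ge>0. nev Ez r \<le> pi * (T r + K)" using characteristic_bound[OF assms(15)] by blast
  define s where "s = (\<Sum>i\<in>{1..q}. c i * C i)"
  \<comment> \<open>The factor 2 is the coefficient of \<open>s * nev Ez r\<close> in the bound,
    \<open>pi\<close> comes from the comparison of \<open>nev Ez\<close> with \<open>T\<close>, and
    the summand 1 makes \<open>c'\<close> positive.\<close>
  define c' where "c' = 2 * pi * s + 1"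
  have s0: "0 \<le> s" unfolding s_def by (intro sum_nonneg mult_nonneg_nonneg) (use W in \<open>auto simp: majorized_def\<close>)
  have main: "ereal \<epsilon> * nevanlinna
           (\<lambda>z. exp (2 * (1 - \<epsilon>) * (MAX i\<in>{1..q}. lam i (f z)) - 2 * (MAX i\<in>{1..q}. lam1 i (f1 z)))
                * pullback_ddc L f (system_weight M \<sigma>) z) r
         \<le> ereal (c' * T r + (c' * K + s * pi / \<epsilon>))" if \<epsilon>: "0 < \<epsilon>" "\<epsilon> < 1" and r: "0 \<le> r" for \<epsilon> r
  proof -
    have E: "nev Ez r \<le> pi * (T r + K)" using K(2) r by blast
    moreover have "0 \<le> nev Ez r" by (rule nev_nonneg[OF Ez_continuous Ez_nonneg])
    ultimately have "0 \<le> pi * (T r + K)" by linarith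
    \<comment> \<open>\<open>T\<close> is determined only up to bounded functions and may be
      negative. \<open>T r + K\<close> is not, which permits enlarging its coefficient to
      \<open>c'\<close>.\<close>
    then have TK: "0 \<le> T r + K" using zero_le_mult_iff[of pi] pi_gt_zero by (simp add: not_le)
    have "2 * s * nev Ez r \<le> 2 * s * (pi * (T r + K))" using E s0 by (intro mult_left_mono) auto
    also have "\<dots> \<le> c' * (T r + K)" using TK by (simp add: c'_def algebra_simps)
    finally have "2 * s * nev Ez r + s * pi / \<epsilon> \<le> c' * T r + (c' * K + s * pi / \<epsilon>)" by (simp add: algebra_simps)
    then show ?thesis
      using nevanlinna_bound_of_majorized[OF assms(2) W assms(6) \<epsilon> r] unfolding s_def[symmetric]
      by (meson ereal_less_eq(3) order_trans)
  qed
  show ?thesis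
  proof (rule exI[of _ c'], intro conjI allI impI)
    show "0 < c'" using s0 by (simp add: c'_def add_nonneg_pos)
    fix \<epsilon> :: real assume \<epsilon>: "0 < \<epsilon> \<and> \<epsilon> < 1"
    show "\<exists>b :: real \<Rightarrow> real. (\<exists>K. \<forall>r\<ge>0. \<bar>b r\<bar> \<le> K) \<and>
      (\<forall>r\<ge>0. ereal \<epsilon> * nevanlinna
           (\<lambda>z. exp (2 * (1 - \<epsilon>) * (MAX i\<in>{1..q}. lam i (f z)) - 2 * (MAX i\<in>{1..q}. lam1 i (f1 z)))
                * pullback_ddc L f (system_weight M \<sigma>) z) r
         \<le> ereal (c' * T r + b r))"
      by (rule exI[of _ "\<lambda>_. c' * K + s * pi / \<epsilon>"], intro conjI allI impI main conjunct1[OF \<epsilon>] conjunct2[OF \<epsilon>])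
        (rule exI[of _ "\<bar>c' * K + s * pi / \<epsilon>\<bar>"], simp)
  qed
qed

end
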